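(* Let $\alpha\colon G\curvearrowright B$ be a continuous action of a totally disconnected locally compact group on a $\sigma$-finite diffuse factor $B$. Assume that $\alpha$ is properly outer relative to a compact open subgroup $K_0\le G$ and that the restricted action $\alpha|_{K_0}$ is minimal. Then every subfactor between $B$ and $B\rtimes_\alpha G$ is of the form $B\rtimes_\alpha H$ for some closed subgroup $H\le G$.
   Context: An action $\alpha\colon G\curvearrowright B$ of a totally disconnected (locally compact) group on a diffuse factor is *properly outer relative to* a compact open subgroup $K_0\le G$ if for every $g\in G$: whenever there is a nonzero $b\in B$ with $\alpha_g(x)b=bx$ for all $x\in B^{K_0}$ (the fixed point algebra of $\alpha|_{K_0}$), then $g\in K_0$. The action of the compact group $K_0$ on the factor $B$ is *minimal* if it is faithful and $(B^{K_0})'\cap B=\mathbb C1$. For closed $H\le G$, $B\rtimes_\alpha H$ is identified with the von Neumann subalgebra of $B\rtimes_\alpha G$ generated by $B$ and $\{\lambda_h\mid h\in H\}$. A subfactor between $B$ and $B\rtimes G$ is a factor $N$ with $B\subset N\subset B\rtimes G$. *)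

theory Defs
  imports "HOL-Analysis.Analysis"
begin

section \<open>Complex Hilbert spaces\<close>

text \<open>The form \<open>cinner\<close> is linear in the first argument.  In \<open>complex_semi_inner\<close> it may be
  degenerate.\<close>

class complex_semi_inner = real_vector +
  fixes scaleC :: "complex \<Rightarrow> 'a \<Rightarrow> 'a"  (infixr \<open>*\<^sub>C\<close> 75)
    and cinner :: "'a \<Rightarrow> 'a \<Rightarrow> complex"
  assumes scaleC_add_right: "c *\<^sub>C (x + y) = c *\<^sub>C x + c *\<^sub>C y"
    and scaleC_add_left: "(c + d) *\<^sub>C x = c *\<^sub>C x + d *\<^sub>C x"
    and scaleC_scaleC: "c *\<^sub>C (d *\<^sub>C x) = (c * d) *\<^sub>C x"
    and scaleC_of_real: "complex_of_real r *\<^sub>C x = r *\<^sub>R x"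
    and cinner_commute: "cinner x y = cnj (cinner y x)"
    and cinner_add_left: "cinner (x + y) z = cinner x z + cinner y z"
    and cinner_scaleC_left: "cinner (c *\<^sub>C x) y = c * cinner x y"
    and cinner_ge_zero: "0 \<le> Re (cinner x x)"

class complex_hilbert_space = complex_semi_inner + real_inner + complete_space +
  assumes inner_eq_Re_cinner: "inner x y = Re (cinner x y)"

definition snorm :: "'a::complex_semi_inner \<Rightarrow> real" where
  "snorm x = sqrt (Re (cinner x x))"

lemma cinner_scaleR_left: "cinner (r *\<^sub>R x) y = of_real r * cinner x y"
  by (metis cinner_scaleC_left scaleC_of_real)

lemma cinner_minus_left: "cinner (- x) y = - cinner x y"
  using cinner_scaleR_left[of "-1" x y] by simp

lemma cinner_diff_left: "cinner (x - y) z = cinner x z - cinner y z"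
  using cinner_add_left[of x "- y" z] by (simp add: cinner_minus_left)

lemma cinner_zero_left: "cinner 0 y = 0"
  using cinner_scaleR_left[of 0 0 y] by simp

lemma cinner_zero_right: "cinner y 0 = 0"
  by (metis cinner_zero_left cinner_commute complex_cnj_zero)

lemma cinner_add_right: "cinner z (x + y) = cinner z x + cinner z y"
  by (metis cinner_add_left cinner_commute complex_cnj_add)

lemma cinner_scaleC_right: "cinner x (c *\<^sub>C y) = cnj c * cinner x y"
  by (metis cinner_scaleC_left cinner_commute complex_cnj_mult)

lemma cinner_scaleR_right: "cinner x (r *\<^sub>R y) = of_real r * cinner x y"
  by (metis cinner_scaleC_right complex_cnj_complex_of_real scaleC_of_real)

lemma cinner_diff_right: "cinner z (x - y) = cinner z x - cinner z y"
  by (metis cinner_diff_left cinner_commute complex_cnj_diff)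

lemma scaleC_diff_right: "c *\<^sub>C (x - y) = c *\<^sub>C x - c *\<^sub>C (y::'a::complex_semi_inner)"
  using scaleC_add_right[of c "x - y" y] by simp

lemma snorm_ge_zero: "0 \<le> snorm x"
  by (simp add: snorm_def cinner_ge_zero)

lemma snorm_sq: "(snorm x)\<^sup>2 = Re (cinner x x)"
  by (simp add: snorm_def cinner_ge_zero)

lemma snorm_scaleC: "snorm (c *\<^sub>C x) = norm c * snorm x"
proof -
  have "cinner (c *\<^sub>C x) (c *\<^sub>C x) = (c * cnj c) * cinner x x"
    by (simp add: cinner_scaleC_left cinner_scaleC_right)
  also have "c * cnj c = of_real ((norm c)\<^sup>2)"
    by (rule complex_norm_square[symmetric])
  finally show ?thesis
    by (simp add: snorm_def real_sqrt_mult)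
qed

lemma snorm_minus_commute: "snorm (x - y) = snorm (y - x)"
proof -
  have "cinner (x - y) (x - y) = cinner (y - x) (y - x)"
    by (simp add: cinner_diff_left cinner_diff_right)
  then show ?thesis by (simp add: snorm_def)
qed

lemma Re_cinner_le: "\<bar>Re (cinner x y)\<bar> \<le> snorm x * snorm y"
proof -
  define A b C where "A = Re (cinner x x)" and "b = Re (cinner x y)" and "C = Re (cinner y y)"
  have C0: "0 \<le> C" and A0: "0 \<le> A" by (simp_all add: A_def C_def cinner_ge_zero)
  have q: "0 \<le> A + 2 * r * b + r\<^sup>2 * C" for r
  proof -
    have "Re (cinner y x) = b" by (subst cinner_commute) (simp add: b_def)
    then have "Re (cinner (x + r *\<^sub>R y) (x + r *\<^sub>R y)) = A + 2 * r * b + r\<^sup>2 * C"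
      by (simp add: cinner_add_left cinner_add_right cinner_scaleR_left cinner_scaleR_right
          A_def C_def power2_eq_square algebra_simps) (simp add: b_def)
    then show ?thesis using cinner_ge_zero[of "x + r *\<^sub>R y"] by simp
  qed
  have "b\<^sup>2 \<le> A * C"
  proof (cases "C = 0")
    case True
    have "b = 0"
    proof (rule ccontr)
      assume "b \<noteq> 0"
      with q[of "- (A + 1) / (2 * b)"] True show False by (simp add: field_simps)
    qed
    with True show ?thesis by simp
  next
    case False
    with C0 have Cp: "0 < C" by simp
    with q[of "- b / C"] show ?thesis by (simp add: field_simps power2_eq_square)
  qed
  then have "sqrt (b\<^sup>2) \<le> sqrt (A * C)" by (rule real_sqrt_le_mono)
  then show ?thesis by (simp add: snorm_def A_def b_def C_def real_sqrt_mult)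
qed

lemma semi_cauchy_schwarz: "norm (cinner x y) \<le> snorm x * snorm y"
proof (cases "cinner x y = 0")
  case True
  then show ?thesis by (simp add: snorm_ge_zero)
next
  case False
  define c where "c = cnj (cinner x y) / of_real (norm (cinner x y))"
  have nc: "norm c = 1" using False by (simp add: c_def norm_divide)
  have "c * cinner x y = of_real (norm (cinner x y))"
    using False
    by (simp add: c_def mult.commute[of "cnj _"] complex_norm_square[symmetric] power2_eq_square)
  then have "Re (cinner (c *\<^sub>C x) y) = norm (cinner x y)"
    by (simp add: cinner_scaleC_left)
  with Re_cinner_le[of "c *\<^sub>C x" y] show ?thesis by (simp add: snorm_scaleC nc)
qed

lemma snorm_triangle: "snorm (x + y) \<le> snorm x + snorm y"
proof (rule power2_le_imp_le)
  have "Re (cinner y x) = Re (cinner x y)" by (subst cinner_commute) simp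
  then have "(snorm (x + y))\<^sup>2 = (snorm x)\<^sup>2 + 2 * Re (cinner x y) + (snorm y)\<^sup>2"
    by (simp add: snorm_sq cinner_add_left cinner_add_right)
  also have "\<dots> \<le> (snorm x)\<^sup>2 + 2 * (snorm x * snorm y) + (snorm y)\<^sup>2"
    using Re_cinner_le[of x y] by simp
  also have "\<dots> = (snorm x + snorm y)\<^sup>2" by (simp add: power2_sum)
  finally show "(snorm (x + y))\<^sup>2 \<le> (snorm x + snorm y)\<^sup>2" .
qed (simp add: snorm_ge_zero)

lemma snorm_triangle_diff: "snorm (x - z) \<le> snorm (x - y) + snorm (y - z)"
  using snorm_triangle[of "x - y" "y - z"] by simp

lemma snorm_zero: "snorm 0 = 0"
  by (simp add: snorm_def cinner_zero_left)

lemma snorm_scaleR: "snorm (r *\<^sub>R x) = \<bar>r\<bar> * snorm x"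
  by (metis snorm_scaleC scaleC_of_real norm_of_real)

lemma snorm_diff_abs: "\<bar>snorm x - snorm y\<bar> \<le> snorm (x - y)"
  using snorm_triangle[of "x - y" y] snorm_triangle[of "y - x" x] snorm_minus_commute[of x y]
  by simp

section \<open>Completion of a semi-inner product space\<close>

definition scauchy :: "(nat \<Rightarrow> 'v::complex_semi_inner) \<Rightarrow> bool" where
  "scauchy X \<longleftrightarrow> (\<forall>e>0. \<exists>M. \<forall>m\<ge>M. \<forall>n\<ge>M. snorm (X m - X n) < e)"

definition sequiv :: "(nat \<Rightarrow> 'v::complex_semi_inner) \<Rightarrow> (nat \<Rightarrow> 'v) \<Rightarrow> bool" where
  "sequiv X Y \<longleftrightarrow> scauchy X \<and> scauchy Y \<and> (\<lambda>n. snorm (X n - Y n)) \<longlonglongrightarrow> 0"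

lemma scauchy_const: "scauchy (\<lambda>_. x)"
  by (simp add: scauchy_def snorm_zero)

lemma scauchy_add:
  assumes "scauchy X" "scauchy Y" shows "scauchy (\<lambda>n. X n + Y n)"
  unfolding scauchy_def
proof (intro allI impI)
  fix e :: real assume "e > 0"
  with assms obtain M N where M: "\<And>m n. m \<ge> M \<Longrightarrow> n \<ge> M \<Longrightarrow> snorm (X m - X n) < e/2"
    and N: "\<And>m n. m \<ge> N \<Longrightarrow> n \<ge> N \<Longrightarrow> snorm (Y m - Y n) < e/2"
    unfolding scauchy_def by (metis half_gt_zero)
  have "snorm ((X m + Y m) - (X n + Y n)) < e" if "m \<ge> max M N" "n \<ge> max M N" for m n
  proof -
    have eq: "(X m + Y m) - (X n + Y n) = (X m - X n) + (Y m - Y n)" by simp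
    have "snorm (X m - X n) < e/2" "snorm (Y m - Y n) < e/2" using M N that by auto
    with snorm_triangle[of "X m - X n" "Y m - Y n"] show ?thesis
      unfolding eq by linarith
  qed
  then show "\<exists>M. \<forall>m\<ge>M. \<forall>n\<ge>M. snorm ((X m + Y m) - (X n + Y n)) < e" by blast
qed

lemma scauchy_scaleC:
  assumes "scauchy X" shows "scauchy (\<lambda>n. c *\<^sub>C X n)"
  unfolding scauchy_def
proof (intro allI impI)
  fix e :: real assume e: "e > 0"
  have p: "norm c + 1 > 0" by (simp add: add_nonneg_pos)
  with e assms obtain M where M: "\<And>m n. m \<ge> M \<Longrightarrow> n \<ge> M \<Longrightarrow> snorm (X m - X n) < e / (norm c + 1)"
    unfolding scauchy_def by (metis divide_pos_pos)
  have "snorm (c *\<^sub>C X m - c *\<^sub>C X n) < e" if "m \<ge> M" "n \<ge> M" for m n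
  proof -
    have "snorm (c *\<^sub>C X m - c *\<^sub>C X n) = norm c * snorm (X m - X n)"
      by (simp add: snorm_scaleC flip: scaleC_diff_right)
    also have "\<dots> \<le> (norm c + 1) * snorm (X m - X n)"
      by (simp add: mult_right_mono snorm_ge_zero)
    also have "\<dots> < e" using M[OF that] p by (simp add: field_simps)
    finally show ?thesis .
  qed
  then show "\<exists>M. \<forall>m\<ge>M. \<forall>n\<ge>M. snorm (c *\<^sub>C X m - c *\<^sub>C X n) < e" by blast
qed

lemma scauchy_scaleR: "scauchy X \<Longrightarrow> scauchy (\<lambda>n. r *\<^sub>R X n)"
  using scauchy_scaleC[of X "of_real r"] by (simp add: scaleC_of_real)

lemma scauchy_bounded:
  assumes "scauchy X" obtains C where "0 \<le> C" "\<And>n. snorm (X n) \<le> C"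
proof -
  have "Cauchy (\<lambda>n. snorm (X n))"
    unfolding Cauchy_def dist_real_def
  proof (intro allI impI)
    fix e :: real assume "0 < e"
    then obtain M where "\<And>m n. m \<ge> M \<Longrightarrow> n \<ge> M \<Longrightarrow> snorm (X m - X n) < e"
      using assms unfolding scauchy_def by metis
    then show "\<exists>M. \<forall>m\<ge>M. \<forall>n\<ge>M. \<bar>snorm (X m) - snorm (X n)\<bar> < e"
      using snorm_diff_abs le_less_trans by metis
  qed
  then have "Bseq (\<lambda>n. snorm (X n))" by (rule Cauchy_Bseq)
  then obtain C where "C > 0" "\<And>n. norm (snorm (X n)) \<le> C" unfolding Bseq_def by blast
  then show ?thesis using that[of C] by (simp add: snorm_ge_zero)
qed

lemma null_squeeze:
  fixes f g :: "nat \<Rightarrow> real"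
  assumes "g \<longlonglongrightarrow> 0" "\<And>n. 0 \<le> f n" "\<And>n. f n \<le> g n" shows "f \<longlonglongrightarrow> 0"
  using assms by (intro tendsto_sandwich[OF _ _ tendsto_const[of 0] assms(1)] always_eventually allI)

lemma sequiv_refl: "scauchy X \<Longrightarrow> sequiv X X"
  by (simp add: sequiv_def snorm_zero)

lemma sequiv_eqI:
  assumes "sequiv X X" and eq: "\<And>n. X n = Y n" shows "sequiv X Y"
proof -
  have "X = Y" using eq by (rule ext)
  with assms(1) show ?thesis by simp
qed

lemma sequiv_sym: "sequiv X Y \<Longrightarrow> sequiv Y X"
  by (simp add: sequiv_def snorm_minus_commute)

lemma sequiv_trans:
  assumes "sequiv X Y" "sequiv Y Z" shows "sequiv X Z"
proof -
  have "(\<lambda>n. snorm (X n - Y n) + snorm (Y n - Z n)) \<longlonglongrightarrow> 0 + 0"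
    using assms unfolding sequiv_def by (intro tendsto_add) auto
  then have "(\<lambda>n. snorm (X n - Y n) + snorm (Y n - Z n)) \<longlonglongrightarrow> 0" by simp
  then have "(\<lambda>n. snorm (X n - Z n)) \<longlonglongrightarrow> 0"
    by (rule null_squeeze) (rule snorm_ge_zero snorm_triangle_diff)+
  with assms show ?thesis by (simp add: sequiv_def)
qed

lemma sequiv_add:
  assumes "sequiv X X'" "sequiv Y Y'"
  shows "sequiv (\<lambda>n. X n + Y n) (\<lambda>n. X' n + Y' n)"
proof -
  have "(\<lambda>n. snorm (X n - X' n) + snorm (Y n - Y' n)) \<longlonglongrightarrow> 0 + 0"
    using assms unfolding sequiv_def by (intro tendsto_add) auto
  then have L: "(\<lambda>n. snorm (X n - X' n) + snorm (Y n - Y' n)) \<longlonglongrightarrow> 0" by simp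
  have le: "snorm ((X n + Y n) - (X' n + Y' n)) \<le> snorm (X n - X' n) + snorm (Y n - Y' n)" for n
    using snorm_triangle[of "X n - X' n" "Y n - Y' n"] by (simp add: algebra_simps)
  have "(\<lambda>n. snorm ((X n + Y n) - (X' n + Y' n))) \<longlonglongrightarrow> 0"
    by (rule null_squeeze[OF L snorm_ge_zero le])
  with assms show ?thesis by (simp add: sequiv_def scauchy_add)
qed

lemma sequiv_scaleC:
  assumes "sequiv X Y" shows "sequiv (\<lambda>n. c *\<^sub>C X n) (\<lambda>n. c *\<^sub>C Y n)"
proof -
  have "(\<lambda>n. norm c * snorm (X n - Y n)) \<longlonglongrightarrow> norm c * 0"
    using assms unfolding sequiv_def by (intro tendsto_mult tendsto_const) auto
  with assms show ?thesis
    by (simp add: sequiv_def scauchy_scaleC snorm_scaleC flip: scaleC_diff_right)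
qed

lemma sequiv_scaleR: "sequiv X Y \<Longrightarrow> sequiv (\<lambda>n. r *\<^sub>R X n) (\<lambda>n. r *\<^sub>R Y n)"
  using sequiv_scaleC[of X Y "of_real r"] by (simp add: scaleC_of_real)

lemma norm_cinner_diff_le:
  "norm (cinner x y - cinner x' y') \<le> snorm (x - x') * snorm y + snorm x' * snorm (y - y')"
proof -
  have "cinner x y - cinner x' y' = cinner (x - x') y + cinner x' (y - y')"
    by (simp add: cinner_diff_left cinner_diff_right)
  then show ?thesis
    by (metis norm_triangle_mono semi_cauchy_schwarz)
qed

lemma convergent_cinner:
  assumes "scauchy X" "scauchy Y" shows "convergent (\<lambda>n. cinner (X n) (Y n))"
proof -
  obtain C where C: "0 \<le> C" "\<And>n. snorm (X n) \<le> C" using scauchy_bounded[OF assms(1)] by blast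
  obtain D where D: "0 \<le> D" "\<And>n. snorm (Y n) \<le> D" using scauchy_bounded[OF assms(2)] by blast
  have "Cauchy (\<lambda>n. cinner (X n) (Y n))"
    unfolding Cauchy_def
  proof (intro allI impI)
    fix e :: real assume e: "0 < e"
    define d where "d = e / (C + D + 1)"
    have p: "C + D + 1 > 0" using C D by simp
    then have "d > 0" using e by (simp add: d_def)
    with assms obtain M N where M: "\<And>m n. m \<ge> M \<Longrightarrow> n \<ge> M \<Longrightarrow> snorm (X m - X n) < d"
      and N: "\<And>m n. m \<ge> N \<Longrightarrow> n \<ge> N \<Longrightarrow> snorm (Y m - Y n) < d"
      unfolding scauchy_def by metis
    have "dist (cinner (X m) (Y m)) (cinner (X n) (Y n)) < e"
      if "m \<ge> max M N" "n \<ge> max M N" for m n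
    proof -
      have "dist (cinner (X m) (Y m)) (cinner (X n) (Y n))
          \<le> snorm (X m - X n) * snorm (Y m) + snorm (X n) * snorm (Y m - Y n)"
        unfolding dist_norm by (rule norm_cinner_diff_le)
      also have "\<dots> \<le> d * D + C * d"
        using M[of m n] N[of m n] that C D \<open>0 < d\<close>
        by (intro add_mono mult_mono) (auto simp: snorm_ge_zero intro: less_imp_le)
      also have "\<dots> < d * (C + D + 1)" using \<open>d > 0\<close> by (simp add: algebra_simps)
      also have "\<dots> = e" using p by (simp add: d_def)
      finally show ?thesis .
    qed
    then show "\<exists>M. \<forall>m\<ge>M. \<forall>n\<ge>M. dist (cinner (X m) (Y m)) (cinner (X n) (Y n)) < e" by blast
  qed
  then show ?thesis by (rule Cauchy_convergent)
qed

lemma sequiv_cinner_lim: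
  assumes "sequiv X X'" "sequiv Y Y'"
  shows "lim (\<lambda>n. cinner (X n) (Y n)) = lim (\<lambda>n. cinner (X' n) (Y' n))"
proof -
  have sc: "scauchy X" "scauchy X'" "scauchy Y" "scauchy Y'" using assms by (auto simp: sequiv_def)
  obtain C where C: "0 \<le> C" "\<And>n. snorm (X' n) \<le> C" using scauchy_bounded[OF sc(2)] by blast
  obtain D where D: "0 \<le> D" "\<And>n. snorm (Y n) \<le> D" using scauchy_bounded[OF sc(3)] by blast
  have "(\<lambda>n. snorm (X n - X' n) * D + C * snorm (Y n - Y' n)) \<longlonglongrightarrow> 0 * D + C * 0"
    using assms unfolding sequiv_def by (intro tendsto_intros) auto
  then have L: "(\<lambda>n. snorm (X n - X' n) * D + C * snorm (Y n - Y' n)) \<longlonglongrightarrow> 0" by simp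
  have le: "norm (cinner (X n) (Y n) - cinner (X' n) (Y' n))
      \<le> snorm (X n - X' n) * D + C * snorm (Y n - Y' n)" for n
    by (rule order_trans[OF norm_cinner_diff_le])
      (intro add_mono mult_mono C D order_refl snorm_ge_zero)
  have "(\<lambda>n. cinner (X n) (Y n) - cinner (X' n) (Y' n)) \<longlonglongrightarrow> 0"
    by (rule Lim_null_comparison[OF _ L]) (simp add: le)
  moreover have "(\<lambda>n. cinner (X' n) (Y' n)) \<longlonglongrightarrow> lim (\<lambda>n. cinner (X' n) (Y' n))"
    using convergent_cinner sc convergent_LIMSEQ_iff by blast
  ultimately have "(\<lambda>n. cinner (X n) (Y n)) \<longlonglongrightarrow> lim (\<lambda>n. cinner (X' n) (Y' n))"
    using Lim_transform by fastforce
  then show ?thesis by (rule limI)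
qed

lemma sequiv_diff:
  assumes "sequiv X X'" "sequiv Y Y'"
  shows "sequiv (\<lambda>n. X n - Y n) (\<lambda>n. X' n - Y' n)"
  using sequiv_add[OF assms(1) sequiv_scaleR[OF assms(2), of "-1"]] by simp

quotient_type (overloaded) 'v completion = "nat \<Rightarrow> 'v::complex_semi_inner" / partial: sequiv
proof (rule part_equivpI)
  show "\<exists>X. sequiv X X" using sequiv_refl[OF scauchy_const] by blast
  show "symp sequiv" using sequiv_sym by (rule sympI)
  show "transp sequiv" using sequiv_trans by (rule transpI)
qed

instantiation completion :: (complex_semi_inner) real_vector
begin

lift_definition zero_completion :: "'a completion" is "\<lambda>_. 0"
  by (rule sequiv_refl[OF scauchy_const])

lift_definition plus_completion :: "'a completion \<Rightarrow> 'a completion \<Rightarrow> 'a completion"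
  is "\<lambda>X Y n. X n + Y n"
  by (rule sequiv_add)

lift_definition uminus_completion :: "'a completion \<Rightarrow> 'a completion" is "\<lambda>X n. - X n"
  using sequiv_scaleR[of _ _ "-1"] by simp

lift_definition minus_completion :: "'a completion \<Rightarrow> 'a completion \<Rightarrow> 'a completion"
  is "\<lambda>X Y n. X n - Y n"
  by (rule sequiv_diff)

lift_definition scaleR_completion :: "real \<Rightarrow> 'a completion \<Rightarrow> 'a completion"
  is "\<lambda>r X n. r *\<^sub>R X n"
  by (rule sequiv_scaleR)

instance
proof
  fix a b c :: "'a completion" and r s :: real
  show "a + b + c = a + (b + c)"
    by transfer (rule sequiv_eqI, intro sequiv_add; simp add: add.assoc)
  show "a + b = b + a"
    by transfer (rule sequiv_eqI, intro sequiv_add; simp add: add.commute)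
  show "0 + a = a" by transfer simp
  show "- a + a = 0" by transfer (simp add: sequiv_refl scauchy_const)
  show "a - b = a + - b"
    by transfer (rule sequiv_eqI, intro sequiv_diff; simp)
  show "r *\<^sub>R (a + b) = r *\<^sub>R a + r *\<^sub>R b"
    by transfer (rule sequiv_eqI, intro sequiv_scaleR sequiv_add; simp add: scaleR_right_distrib)
  show "(r + s) *\<^sub>R a = r *\<^sub>R a + s *\<^sub>R a"
    by transfer (rule sequiv_eqI; simp add: sequiv_add sequiv_scaleR scaleR_left_distrib)
  show "r *\<^sub>R s *\<^sub>R a = (r * s) *\<^sub>R a"
    by transfer (rule sequiv_eqI; simp add: sequiv_scaleR)
  show "1 *\<^sub>R a = a" by transfer simp
qed

end

instantiation completion :: (complex_semi_inner) complex_semi_inner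
begin

lift_definition scaleC_completion :: "complex \<Rightarrow> 'a completion \<Rightarrow> 'a completion"
  is "\<lambda>c X n. c *\<^sub>C X n"
  by (rule sequiv_scaleC)

lift_definition cinner_completion :: "'a completion \<Rightarrow> 'a completion \<Rightarrow> complex"
  is "\<lambda>X Y. lim (\<lambda>n. cinner (X n) (Y n))"
  by (rule sequiv_cinner_lim)

instance
proof
  fix x y z :: "'a completion" and c d :: complex and r :: real
  show "c *\<^sub>C (x + y) = c *\<^sub>C x + c *\<^sub>C y"
    by transfer (rule sequiv_eqI, intro sequiv_scaleC sequiv_add; simp add: scaleC_add_right)
  show "(c + d) *\<^sub>C x = c *\<^sub>C x + d *\<^sub>C x"
    by transfer (rule sequiv_eqI; simp add: sequiv_add sequiv_scaleC scaleC_add_left)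
  show "c *\<^sub>C (d *\<^sub>C x) = (c * d) *\<^sub>C x"
    by transfer (rule sequiv_eqI; simp add: sequiv_scaleC scaleC_scaleC)
  show "complex_of_real r *\<^sub>C x = r *\<^sub>R x"
    by transfer (rule sequiv_eqI; simp add: sequiv_scaleR sequiv_scaleC scaleC_of_real)
  have L: "(\<lambda>n. cinner (X n) (Y n)) \<longlonglongrightarrow> lim (\<lambda>n. cinner (X n) (Y n))"
    if "sequiv X X" "sequiv Y Y" for X Y :: "nat \<Rightarrow> 'a"
    using that convergent_cinner convergent_LIMSEQ_iff by (auto simp: sequiv_def)
  show "cinner x y = cnj (cinner y x)"
  proof transfer
    fix X Y :: "nat \<Rightarrow> 'a" assume "sequiv X X" "sequiv Y Y"
    then have "(\<lambda>n. cnj (cinner (Y n) (X n))) \<longlonglongrightarrow> cnj (lim (\<lambda>n. cinner (Y n) (X n)))"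
      by (intro tendsto_cnj L)
    then show "lim (\<lambda>n. cinner (X n) (Y n)) = cnj (lim (\<lambda>n. cinner (Y n) (X n)))"
      by (intro limI) (simp flip: cinner_commute)
  qed
  show "cinner (x + y) z = cinner x z + cinner y z"
  proof transfer
    fix X Y Z :: "nat \<Rightarrow> 'a" assume "sequiv X X" "sequiv Y Y" "sequiv Z Z"
    then have "(\<lambda>n. cinner (X n) (Z n) + cinner (Y n) (Z n))
        \<longlonglongrightarrow> lim (\<lambda>n. cinner (X n) (Z n)) + lim (\<lambda>n. cinner (Y n) (Z n))"
      by (intro tendsto_add L)
    then show "lim (\<lambda>n. cinner (X n + Y n) (Z n))
        = lim (\<lambda>n. cinner (X n) (Z n)) + lim (\<lambda>n. cinner (Y n) (Z n))"
      by (intro limI) (simp add: cinner_add_left)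
  qed
  show "cinner (c *\<^sub>C x) y = c * cinner x y"
  proof transfer
    fix c and X Y :: "nat \<Rightarrow> 'a" assume "sequiv X X" "sequiv Y Y"
    then have "(\<lambda>n. c * cinner (X n) (Y n)) \<longlonglongrightarrow> c * lim (\<lambda>n. cinner (X n) (Y n))"
      by (intro tendsto_mult tendsto_const L)
    then show "lim (\<lambda>n. cinner (c *\<^sub>C X n) (Y n)) = c * lim (\<lambda>n. cinner (X n) (Y n))"
      by (intro limI) (simp add: cinner_scaleC_left)
  qed
  show "0 \<le> Re (cinner x x)"
  proof transfer
    fix X :: "nat \<Rightarrow> 'a" assume "sequiv X X"
    then have "(\<lambda>n. Re (cinner (X n) (X n))) \<longlonglongrightarrow> Re (lim (\<lambda>n. cinner (X n) (X n)))"
      by (intro tendsto_Re L)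
    then show "0 \<le> Re (lim (\<lambda>n. cinner (X n) (X n)))"
      by (rule LIMSEQ_le_const) (auto simp: cinner_ge_zero)
  qed
qed

end

instantiation completion :: (complex_semi_inner) real_inner
begin

definition inner_completion :: "'a completion \<Rightarrow> 'a completion \<Rightarrow> real" where
  "inner_completion x y = Re (cinner x y)"
definition norm_completion :: "'a completion \<Rightarrow> real" where
  "norm_completion x = sqrt (inner x x)"
definition sgn_completion :: "'a completion \<Rightarrow> 'a completion" where
  "sgn_completion x = inverse (norm x) *\<^sub>R x"
definition dist_completion :: "'a completion \<Rightarrow> 'a completion \<Rightarrow> real" where
  "dist_completion x y = norm (x - y)"
definition uniformity_completion :: "('a completion \<times> 'a completion) filter" where
  "uniformity_completion = (INF e\<in>{0 <..}. principal {(x, y). dist x y < e})"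
definition open_completion :: "'a completion set \<Rightarrow> bool" where
  "open_completion U \<longleftrightarrow> (\<forall>x\<in>U. eventually (\<lambda>(x', y). x' = x \<longrightarrow> y \<in> U) uniformity)"

instance
proof
  fix x y z :: "'a completion" and r :: real and U :: "'a completion set"
  show "dist x y = norm (x - y)" by (rule dist_completion_def)
  show "sgn x = x /\<^sub>R norm x" by (rule sgn_completion_def)
  show "uniformity = (INF e\<in>{0 <..}. principal {(x::'a completion, y). dist x y < e})"
    by (rule uniformity_completion_def)
  show "open U \<longleftrightarrow> (\<forall>x\<in>U. \<forall>\<^sub>F (x', y) in uniformity. x' = x \<longrightarrow> y \<in> U)"
    by (rule open_completion_def)
  show "inner x y = inner y x"
    unfolding inner_completion_def by (subst cinner_commute) simp
  show "inner (x + y) z = inner x z + inner y z"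
    by (simp add: inner_completion_def cinner_add_left)
  show "inner (r *\<^sub>R x) y = r * inner x y"
    by (simp add: inner_completion_def cinner_scaleR_left)
  show "0 \<le> inner x x" by (simp add: inner_completion_def cinner_ge_zero)
  show "norm x = sqrt (inner x x)" by (rule norm_completion_def)
  show "inner x x = 0 \<longleftrightarrow> x = 0"
    unfolding inner_completion_def
  proof transfer
    fix X :: "nat \<Rightarrow> 'a" assume X: "sequiv X X"
    then have L: "(\<lambda>n. cinner (X n) (X n)) \<longlonglongrightarrow> lim (\<lambda>n. cinner (X n) (X n))"
      using convergent_cinner convergent_LIMSEQ_iff by (auto simp: sequiv_def)
    have sn: "(\<lambda>n. snorm (X n)) \<longlonglongrightarrow> sqrt (Re (lim (\<lambda>n. cinner (X n) (X n))))"
      unfolding snorm_def by (intro tendsto_real_sqrt tendsto_Re L)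
    have "sequiv X (\<lambda>_. 0) \<longleftrightarrow> (\<lambda>n. snorm (X n)) \<longlonglongrightarrow> 0"
      using X by (simp add: sequiv_def scauchy_const)
    also have "\<dots> \<longleftrightarrow> sqrt (Re (lim (\<lambda>n. cinner (X n) (X n)))) = 0"
      using sn LIMSEQ_unique by fastforce
    finally show "Re (lim (\<lambda>n. cinner (X n) (X n))) = 0 \<longleftrightarrow> sequiv X (\<lambda>_. 0)" by simp
  qed
qed

end

lift_definition embed :: "'v::complex_semi_inner \<Rightarrow> 'v completion" is "\<lambda>v _. v"
  by (rule sequiv_refl[OF scauchy_const])

lemma embed_diff: "embed (v - w) = embed v - embed w"
  by transfer (rule sequiv_refl[OF scauchy_const])

lemma cinner_embed: "cinner (embed v) (embed w) = cinner v w"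
  by transfer simp

lemma norm_embed: "norm (embed v) = snorm v"
  by (simp add: norm_completion_def inner_completion_def cinner_embed snorm_def)

lemma embed_tendsto:
  assumes "scauchy X" shows "(\<lambda>k. embed (X k)) \<longlonglongrightarrow> abs_completion X"
proof (rule LIMSEQ_I)
  fix e :: real assume e: "0 < e"
  then obtain M where M: "\<And>m n. m \<ge> M \<Longrightarrow> n \<ge> M \<Longrightarrow> snorm (X m - X n) < e/2"
    using assms unfolding scauchy_def by (metis half_gt_zero)
  have "norm (embed (X k) - abs_completion X) < e" if k: "k \<ge> M" for k
  proof -
    have ref: "sequiv X X" and refk: "sequiv (\<lambda>_. X k) (\<lambda>_. X k)"
      using assms by (auto intro: sequiv_refl scauchy_const)
    have sc: "scauchy (\<lambda>n. X k - X n)"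
      using scauchy_add[OF scauchy_const[of "X k"] scauchy_scaleR[OF assms, of "-1"]] by simp
    have eq: "embed (X k) - abs_completion X = abs_completion (\<lambda>n. X k - X n)"
      using ref refk by (simp add: embed.abs_eq minus_completion.abs_eq)
    have "cinner (abs_completion (\<lambda>n. X k - X n)) (abs_completion (\<lambda>n. X k - X n))
        = lim (\<lambda>n. cinner (X k - X n) (X k - X n))"
      using sc by (intro cinner_completion.abs_eq sequiv_refl)
    moreover have "(\<lambda>n. cinner (X k - X n) (X k - X n)) \<longlonglongrightarrow> lim (\<lambda>n. cinner (X k - X n) (X k - X n))"
      using convergent_cinner[OF sc sc] convergent_LIMSEQ_iff by blast
    ultimately have "(\<lambda>n. snorm (X k - X n)) \<longlonglongrightarrow> norm (embed (X k) - abs_completion X)"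
      unfolding snorm_def eq norm_completion_def inner_completion_def
      by (intro tendsto_real_sqrt tendsto_Re) simp
    then have "norm (embed (X k) - abs_completion X) \<le> e/2"
      by (rule LIMSEQ_le_const2) (use M k in \<open>auto intro!: exI[of _ M] less_imp_le\<close>)
    with e show ?thesis by simp
  qed
  then show "\<exists>M. \<forall>k\<ge>M. norm (embed (X k) - abs_completion X) < e" by blast
qed

lemma embed_dense:
  assumes "0 < e" shows "\<exists>v. norm (embed v - x) < e"
proof -
  obtain X where X: "sequiv X X" "x = abs_completion X"
    by (metis Quotient_completion Quotient_abs_rep Quotient_rep_reflp)
  then have "(\<lambda>k. embed (X k)) \<longlonglongrightarrow> x" using embed_tendsto[of X] by (simp add: sequiv_def)
  then show ?thesis using assms LIMSEQ_D by blast
qed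

instance completion :: (complex_semi_inner) complex_hilbert_space
proof
  fix x y :: "'a completion"
  show "inner x y = Re (cinner x y)" by (rule inner_completion_def)
next
  fix F :: "nat \<Rightarrow> 'a completion" assume F: "Cauchy F"
  have "\<forall>k. \<exists>v. norm (embed v - F k) < inverse (real (Suc k))"
    by (intro allI embed_dense) simp
  then obtain v where v: "\<And>k. norm (embed (v k) - F k) < inverse (real (Suc k))"
    using choice[of "\<lambda>k v. norm (embed v - F k) < inverse (real (Suc k))"] by auto
  have z: "(\<lambda>k. embed (v k) - F k) \<longlonglongrightarrow> 0"
    by (rule Lim_null_comparison[OF _ LIMSEQ_inverse_real_of_nat])
      (use v in \<open>auto intro!: always_eventually less_imp_le\<close>)
  have cauchy_iff: "Cauchy X \<longleftrightarrow> scauchy X" for X :: "nat \<Rightarrow> 'a completion"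
    by (simp add: Cauchy_def scauchy_def dist_norm snorm_def norm_completion_def
        inner_completion_def)
  have "Cauchy (\<lambda>k. (embed (v k) - F k) + F k)"
    using LIMSEQ_imp_Cauchy[OF z] F unfolding cauchy_iff by (rule scauchy_add)
  then have C: "Cauchy (\<lambda>k. embed (v k))" by simp
  have "scauchy v"
    using C unfolding Cauchy_def scauchy_def dist_norm
    by (simp add: norm_embed flip: embed_diff)
  then have "(\<lambda>k. embed (v k)) \<longlonglongrightarrow> abs_completion v" by (rule embed_tendsto)
  then have "(\<lambda>k. embed (v k) - (embed (v k) - F k)) \<longlonglongrightarrow> abs_completion v - 0"
    by (intro tendsto_diff z)
  then show "convergent F" by (auto simp: convergent_def)
qed

section \<open>The Hilbert space of square-integrable functions on a locally compact group\<close>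

text \<open>Topological groups are written additively, following the library class
  \<open>topological_group_add\<close>, which does not assume commutativity: \<open>g + t\<close> is the product, \<open>- t\<close> the
  inverse and \<open>0\<close> the neutral element.\<close>

definition left_haar_measure :: "'g::topological_group_add measure \<Rightarrow> bool" where
  "left_haar_measure \<mu> \<longleftrightarrow>
     sets \<mu> = sets borel \<and>
     (\<forall>K. compact K \<longrightarrow> emeasure \<mu> K < \<infinity>) \<and>
     (\<forall>U. open U \<and> U \<noteq> {} \<longrightarrow> 0 < emeasure \<mu> U) \<and>
     (\<forall>g. \<forall>A\<in>sets \<mu>. emeasure \<mu> ((\<lambda>t. g + t) ` A) = emeasure \<mu> A) \<and>
     (\<forall>A\<in>sets \<mu>. emeasure \<mu> A = (INF U\<in>{U. open U \<and> A \<subseteq> U}. emeasure \<mu> U)) \<and>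
     (\<forall>U. open U \<longrightarrow> emeasure \<mu> U = (SUP K\<in>{K. compact K \<and> K \<subseteq> U}. emeasure \<mu> K))"

text \<open>On a locally compact group a left Haar measure exists and is unique up to a positive factor,
  so the second branch is never taken there; it only makes the definition total.\<close>

definition haar :: "'g::topological_group_add measure" where
  "haar = (if \<exists>\<mu>::'g measure. left_haar_measure \<mu> then SOME \<mu>. left_haar_measure \<mu>
           else null_measure borel)"

lemma sets_haar: "sets (haar :: 'a::topological_group_add measure) = sets borel"
  and emeasure_haar_compact: "compact (K :: 'a::topological_group_add set) \<Longrightarrow> emeasure haar K < \<infinity>"
proof -
  have *: "sets (haar :: 'a measure) = sets borel \<and>
      (\<forall>K::'a set. compact K \<longrightarrow> emeasure haar K < \<infinity>)"
  proof (cases "\<exists>\<mu>::'a measure. left_haar_measure \<mu>")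
    case True
    then have "left_haar_measure (haar :: 'a measure)"
      unfolding haar_def by (simp add: someI_ex)
    then show ?thesis by (simp add: left_haar_measure_def)
  next
    case False
    then show ?thesis by (simp add: haar_def)
  qed
  show "sets (haar :: 'a measure) = sets borel" using * by blast
  show "compact K \<Longrightarrow> emeasure haar K < \<infinity>" using * by blast
qed

lemma snorm_eq_norm: "snorm (x::'a::complex_hilbert_space) = norm x"
  by (simp add: snorm_def norm_eq_sqrt_inner inner_eq_Re_cinner)

lemma bounded_bilinear_cinner:
  "bounded_bilinear (cinner :: 'a::complex_hilbert_space \<Rightarrow> 'a \<Rightarrow> complex)"
proof
  show "\<exists>K. \<forall>x y::'a. norm (cinner x y) \<le> norm x * norm y * K"
    using semi_cauchy_schwarz by (intro exI[of _ 1]) (auto simp flip: snorm_eq_norm)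
qed (simp_all add: cinner_add_left cinner_add_right cinner_scaleR_left cinner_scaleR_right
    scaleR_conv_of_real)

lemma bounded_linear_scaleC: "bounded_linear (\<lambda>x::'a::complex_hilbert_space. c *\<^sub>C x)"
proof
  fix r and x :: 'a
  show "c *\<^sub>C (r *\<^sub>R x) = r *\<^sub>R (c *\<^sub>C x)"
    by (simp add: scaleC_scaleC mult.commute flip: scaleC_of_real)
  show "\<exists>K. \<forall>x::'a. norm (c *\<^sub>C x) \<le> norm x * K"
    by (intro exI[of _ "norm c"]) (simp add: mult.commute snorm_scaleC flip: snorm_eq_norm)
qed (rule scaleC_add_right)

typedef (overloaded) ('g, 'h) cc =
    "{f :: 'g::topological_space \<Rightarrow> 'h::complex_hilbert_space.
       continuous_on UNIV f \<and> (\<exists>K. compact K \<and> (\<forall>t. t \<notin> K \<longrightarrow> f t = 0))}"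
  morphisms cc_apply Abs_cc
  by (rule exI[of _ "\<lambda>_. 0"]) auto

setup_lifting type_definition_cc

lemma integrable_cinner_cc:
  fixes f g :: "('g::{topological_group_add,t2_space}, 'h::complex_hilbert_space) cc"
  shows "integrable haar (\<lambda>t. cinner (cc_apply f t) (cc_apply g t))"
proof -
  have cf: "continuous_on UNIV (cc_apply f)" and cg: "continuous_on UNIV (cc_apply g)"
    using cc_apply[of f] cc_apply[of g] by auto
  obtain K where K: "compact K" "\<And>t. t \<notin> K \<Longrightarrow> cc_apply f t = 0"
    using cc_apply[of f] by auto
  let ?h = "\<lambda>t. cinner (cc_apply f t) (cc_apply g t)"
  have ch: "continuous_on UNIV ?h"
    by (rule bounded_bilinear.continuous_on[OF bounded_bilinear_cinner cf cg])
  then have m: "?h \<in> borel_measurable haar"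
    using borel_measurable_continuous_onI measurable_cong_sets[OF sets_haar refl] by blast
  have "compact (?h ` K)"
    by (rule compact_continuous_image[OF continuous_on_subset[OF ch] K(1)]) simp
  then have "bounded (?h ` K)" by (rule compact_imp_bounded)
  then obtain B where B: "\<And>t. t \<in> K \<Longrightarrow> norm (?h t) \<le> B"
    unfolding bounded_iff by auto
  show ?thesis
  proof (rule integrableI_bounded_set[of K])
    show "K \<in> sets haar" using K(1) by (simp add: sets_haar compact_imp_closed borel_closed)
    show "emeasure haar K < \<infinity>" by (rule emeasure_haar_compact[OF K(1)])
    show "AE t in haar. t \<in> K \<longrightarrow> norm (?h t) \<le> B" using B by simp
    show "AE t in haar. t \<notin> K \<longrightarrow> ?h t = 0" using K(2) by (simp add: cinner_zero_left)
  qed (rule m)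
qed

lemma cc_closed_binary:
  fixes f g :: "'g::topological_space \<Rightarrow> 'h::complex_hilbert_space"
  assumes "continuous_on UNIV f \<and> (\<exists>K. compact K \<and> (\<forall>t. t \<notin> K \<longrightarrow> f t = 0))"
    and "continuous_on UNIV g \<and> (\<exists>K. compact K \<and> (\<forall>t. t \<notin> K \<longrightarrow> g t = 0))"
    and "continuous_on UNIV (\<lambda>t. F (f t) (g t))" and "F 0 0 = 0"
  shows "continuous_on UNIV (\<lambda>t. F (f t) (g t)) \<and>
    (\<exists>K. compact K \<and> (\<forall>t. t \<notin> K \<longrightarrow> F (f t) (g t) = 0))"
proof -
  obtain K L where "compact K" "\<And>t. t \<notin> K \<Longrightarrow> f t = 0" "compact L" "\<And>t. t \<notin> L \<Longrightarrow> g t = 0"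
    using assms by blast
  then have "compact (K \<union> L) \<and> (\<forall>t. t \<notin> K \<union> L \<longrightarrow> F (f t) (g t) = 0)"
    using assms(4) by auto
  with assms(3) show ?thesis by blast
qed

instantiation cc :: (topological_space, complex_hilbert_space) real_vector
begin

lift_definition zero_cc :: "('a, 'b) cc" is "\<lambda>_. 0" by auto

lift_definition plus_cc :: "('a, 'b) cc \<Rightarrow> ('a, 'b) cc \<Rightarrow> ('a, 'b) cc" is "\<lambda>f g t. f t + g t"
  by (rule cc_closed_binary) (auto intro: continuous_on_add)

lift_definition minus_cc :: "('a, 'b) cc \<Rightarrow> ('a, 'b) cc \<Rightarrow> ('a, 'b) cc" is "\<lambda>f g t. f t - g t"
  by (rule cc_closed_binary) (auto intro: continuous_on_diff)

lift_definition uminus_cc :: "('a, 'b) cc \<Rightarrow> ('a, 'b) cc" is "\<lambda>f t. - f t"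
  by (auto intro: continuous_on_minus)

lift_definition scaleR_cc :: "real \<Rightarrow> ('a, 'b) cc \<Rightarrow> ('a, 'b) cc" is "\<lambda>r f t. r *\<^sub>R f t"
  by (auto intro: continuous_on_scaleR continuous_on_const)

instance
  by standard (transfer; simp add: fun_eq_iff algebra_simps)+

end

instantiation cc :: ("{topological_group_add,t2_space}", complex_hilbert_space) complex_semi_inner
begin

lift_definition scaleC_cc :: "complex \<Rightarrow> ('a, 'b) cc \<Rightarrow> ('a, 'b) cc" is "\<lambda>c f t. c *\<^sub>C f t"
  using bounded_linear.continuous_on[OF bounded_linear_scaleC]
    linear_simps(3)[OF bounded_linear_scaleC] by fastforce

definition cinner_cc :: "('a, 'b) cc \<Rightarrow> ('a, 'b) cc \<Rightarrow> complex" where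
  "cinner_cc f g = (\<integral>t. cinner (cc_apply f t) (cc_apply g t) \<partial>haar)"

instance
proof
  fix f g h :: "('a, 'b) cc" and c d :: complex and r :: real
  show "c *\<^sub>C (f + g) = c *\<^sub>C f + c *\<^sub>C g" by transfer (simp add: scaleC_add_right)
  show "(c + d) *\<^sub>C f = c *\<^sub>C f + d *\<^sub>C f" by transfer (simp add: scaleC_add_left)
  show "c *\<^sub>C (d *\<^sub>C f) = (c * d) *\<^sub>C f" by transfer (simp add: scaleC_scaleC)
  show "complex_of_real r *\<^sub>C f = r *\<^sub>R f" by transfer (simp add: scaleC_of_real)
  show "cinner f g = cnj (cinner g f)"
    unfolding cinner_cc_def by (subst cinner_commute) simp
  show "cinner (f + g) h = cinner f h + cinner g h"
    by (simp add: cinner_cc_def plus_cc.rep_eq cinner_add_left integrable_cinner_cc)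
  show "cinner (c *\<^sub>C f) g = c * cinner f g"
    by (simp add: cinner_cc_def scaleC_cc.rep_eq cinner_scaleC_left)
  have "Re (cinner f f) = (\<integral>t. Re (cinner (cc_apply f t) (cc_apply f t)) \<partial>haar)"
    unfolding cinner_cc_def by (rule integral_Re[symmetric, OF integrable_cinner_cc])
  then show "0 \<le> Re (cinner f f)"
    by (simp add: cinner_ge_zero)
qed

end

type_synonym ('g, 'h) l2 = "('g, 'h) cc completion"

section \<open>Von Neumann algebras\<close>

text \<open>Operators are elements of the library type of bounded real-linear maps; complex linearity is
  imposed by \<open>clinear_ops\<close>, which contains every commutant.\<close>

definition clinear_ops :: "('h::complex_hilbert_space \<Rightarrow>\<^sub>L 'h) set" where
  "clinear_ops = {T. \<forall>c x. blinfun_apply T (c *\<^sub>C x) = c *\<^sub>C blinfun_apply T x}"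

definition adj :: "('h::complex_hilbert_space \<Rightarrow>\<^sub>L 'h) \<Rightarrow> ('h \<Rightarrow>\<^sub>L 'h)" where
  "adj T = (THE S. \<forall>x y. cinner (blinfun_apply T x) y = cinner x (blinfun_apply S y))"

definition scalar_op :: "complex \<Rightarrow> ('h::complex_hilbert_space \<Rightarrow>\<^sub>L 'h)" where
  "scalar_op c = Blinfun (\<lambda>x. c *\<^sub>C x)"

definition commutant :: "('h::complex_hilbert_space \<Rightarrow>\<^sub>L 'h) set \<Rightarrow> ('h \<Rightarrow>\<^sub>L 'h) set" where
  "commutant S = {T \<in> clinear_ops. \<forall>A\<in>S. T o\<^sub>L A = A o\<^sub>L T}"

definition von_neumann_algebra :: "('h::complex_hilbert_space \<Rightarrow>\<^sub>L 'h) set \<Rightarrow> bool" where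
  "von_neumann_algebra M \<longleftrightarrow> (\<forall>T\<in>M. adj T \<in> M) \<and> commutant (commutant M) = M"

definition vn_generated :: "('h::complex_hilbert_space \<Rightarrow>\<^sub>L 'h) set \<Rightarrow> ('h \<Rightarrow>\<^sub>L 'h) set" where
  "vn_generated S = commutant (commutant (S \<union> adj ` S))"

definition vn_factor :: "('h::complex_hilbert_space \<Rightarrow>\<^sub>L 'h) set \<Rightarrow> bool" where
  "vn_factor M \<longleftrightarrow> von_neumann_algebra M \<and> M \<noteq> {0} \<and> M \<inter> commutant M = range scalar_op"

definition projections :: "('h::complex_hilbert_space \<Rightarrow>\<^sub>L 'h) set \<Rightarrow> ('h \<Rightarrow>\<^sub>L 'h) set" where
  "projections M = {p \<in> M. adj p = p \<and> p o\<^sub>L p = p}"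

definition vn_sigma_finite :: "('h::complex_hilbert_space \<Rightarrow>\<^sub>L 'h) set \<Rightarrow> bool" where
  "vn_sigma_finite M \<longleftrightarrow>
     (\<forall>P \<subseteq> projections M - {0}. (\<forall>p\<in>P. \<forall>q\<in>P. p \<noteq> q \<longrightarrow> p o\<^sub>L q = 0) \<longrightarrow> countable P)"

definition minimal_projection :: "('h::complex_hilbert_space \<Rightarrow>\<^sub>L 'h) set \<Rightarrow> ('h \<Rightarrow>\<^sub>L 'h) \<Rightarrow> bool" where
  "minimal_projection M p \<longleftrightarrow>
     p \<in> projections M \<and> p \<noteq> 0 \<and> (\<forall>q\<in>projections M. p o\<^sub>L q = q \<longrightarrow> q = 0 \<or> q = p)"

definition vn_diffuse :: "('h::complex_hilbert_space \<Rightarrow>\<^sub>L 'h) set \<Rightarrow> bool" where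
  "vn_diffuse M \<longleftrightarrow> (\<nexists>p. minimal_projection M p)"

definition star_automorphism ::
    "('h::complex_hilbert_space \<Rightarrow>\<^sub>L 'h) set \<Rightarrow> (('h \<Rightarrow>\<^sub>L 'h) \<Rightarrow> ('h \<Rightarrow>\<^sub>L 'h)) \<Rightarrow> bool" where
  "star_automorphism M \<phi> \<longleftrightarrow>
     bij_betw \<phi> M M \<and>
     (\<forall>x\<in>M. \<forall>y\<in>M. \<phi> (x + y) = \<phi> x + \<phi> y \<and> \<phi> (x o\<^sub>L y) = \<phi> x o\<^sub>L \<phi> y) \<and>
     (\<forall>x\<in>M. \<phi> (adj x) = adj (\<phi> x) \<and> (\<forall>c. \<phi> (scalar_op c o\<^sub>L x) = scalar_op c o\<^sub>L \<phi> x))"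

section \<open>Group actions and crossed products\<close>

definition totally_disconnected :: "'a::topological_space set \<Rightarrow> bool" where
  "totally_disconnected S \<longleftrightarrow> (\<forall>C \<subseteq> S. connected C \<longrightarrow> (\<forall>x\<in>C. \<forall>y\<in>C. x = y))"

definition additive_subgroup :: "'g::group_add set \<Rightarrow> bool" where
  "additive_subgroup H \<longleftrightarrow> 0 \<in> H \<and> (\<forall>g\<in>H. \<forall>h\<in>H. g + h \<in> H) \<and> (\<forall>g\<in>H. - g \<in> H)"

text \<open>Continuity is pointwise strong continuity.  For actions by \<open>*\<close>-automorphisms it is equivalent
  to pointwise \<open>\<sigma>\<close>-weak continuity, and to norm continuity of the orbit maps on the predual.
  Only the values of \<open>\<alpha> g\<close> on \<open>B\<close> matter.\<close>

definition continuous_action ::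
    "('g::topological_group_add \<Rightarrow> ('h::complex_hilbert_space \<Rightarrow>\<^sub>L 'h) \<Rightarrow> ('h \<Rightarrow>\<^sub>L 'h))
      \<Rightarrow> ('h \<Rightarrow>\<^sub>L 'h) set \<Rightarrow> bool" where
  "continuous_action \<alpha> B \<longleftrightarrow>
     (\<forall>g. star_automorphism B (\<alpha> g)) \<and>
     (\<forall>x\<in>B. \<alpha> 0 x = x) \<and>
     (\<forall>g h. \<forall>x\<in>B. \<alpha> (g + h) x = \<alpha> g (\<alpha> h x)) \<and>
     (\<forall>x\<in>B. \<forall>\<xi>. continuous_on UNIV (\<lambda>g. blinfun_apply (\<alpha> g x) \<xi>))"

definition fixed_algebra ::
    "('g \<Rightarrow> ('h::complex_hilbert_space \<Rightarrow>\<^sub>L 'h) \<Rightarrow> ('h \<Rightarrow>\<^sub>L 'h)) \<Rightarrow> 'g set \<Rightarrow> ('h \<Rightarrow>\<^sub>L 'h) set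
      \<Rightarrow> ('h \<Rightarrow>\<^sub>L 'h) set" where
  "fixed_algebra \<alpha> K B = {x \<in> B. \<forall>k\<in>K. \<alpha> k x = x}"

definition properly_outer_relative ::
    "('g \<Rightarrow> ('h::complex_hilbert_space \<Rightarrow>\<^sub>L 'h) \<Rightarrow> ('h \<Rightarrow>\<^sub>L 'h)) \<Rightarrow> ('h \<Rightarrow>\<^sub>L 'h) set \<Rightarrow> 'g set
      \<Rightarrow> bool" where
  "properly_outer_relative \<alpha> B K \<longleftrightarrow>
     (\<forall>g. (\<exists>b\<in>B. b \<noteq> 0 \<and> (\<forall>x\<in>fixed_algebra \<alpha> K B. \<alpha> g x o\<^sub>L b = b o\<^sub>L x)) \<longrightarrow> g \<in> K)"

definition minimal_action ::
    "('g::group_add \<Rightarrow> ('h::complex_hilbert_space \<Rightarrow>\<^sub>L 'h) \<Rightarrow> ('h \<Rightarrow>\<^sub>L 'h)) \<Rightarrow> ('h \<Rightarrow>\<^sub>L 'h) set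
      \<Rightarrow> 'g set \<Rightarrow> bool" where
  "minimal_action \<alpha> B K \<longleftrightarrow>
     (\<forall>k\<in>K. (\<forall>x\<in>B. \<alpha> k x = x) \<longrightarrow> k = 0) \<and>
     commutant (fixed_algebra \<alpha> K B) \<inter> B = range scalar_op"

text \<open>The operators \<open>(\<pi>(x)\<xi>)(t) = \<alpha>\<^bsub>t\<^sup>-\<^sup>1\<^esub>(x) \<xi>(t)\<close> and \<open>(\<lambda>\<^bsub>g\<^esub>\<xi>)(t) = \<xi>(g\<^sup>-\<^sup>1 t)\<close> on \<open>L\<^sup>2(G, H)\<close>,
  determined by their action on the dense subspace of continuous compactly supported functions.\<close>

definition pi_op ::
    "('g::{topological_group_add,t2_space} \<Rightarrow> ('h::complex_hilbert_space \<Rightarrow>\<^sub>L 'h) \<Rightarrow> ('h \<Rightarrow>\<^sub>L 'h))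
      \<Rightarrow> ('h \<Rightarrow>\<^sub>L 'h) \<Rightarrow> (('g, 'h) l2 \<Rightarrow>\<^sub>L ('g, 'h) l2)" where
  "pi_op \<alpha> x = (THE T. \<forall>f. blinfun_apply T (embed f) = embed (Abs_cc (\<lambda>t. blinfun_apply (\<alpha> (- t) x) (cc_apply f t))))"

definition lambda_op ::
    "'g::{topological_group_add,t2_space} \<Rightarrow> (('g, 'h::complex_hilbert_space) l2 \<Rightarrow>\<^sub>L ('g, 'h) l2)"
  where
  "lambda_op g = (THE T. \<forall>f. blinfun_apply T (embed f) = embed (Abs_cc (\<lambda>t. cc_apply f (- g + t))))"

definition crossed_product ::
    "('g::{topological_group_add,t2_space} \<Rightarrow> ('h::complex_hilbert_space \<Rightarrow>\<^sub>L 'h) \<Rightarrow> ('h \<Rightarrow>\<^sub>L 'h))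
      \<Rightarrow> ('h \<Rightarrow>\<^sub>L 'h) set \<Rightarrow> 'g set \<Rightarrow> (('g, 'h) l2 \<Rightarrow>\<^sub>L ('g, 'h) l2) set" where
  "crossed_product \<alpha> B H = vn_generated (pi_op \<alpha> ` B \<union> lambda_op ` H)"

end

theory Submission
 imports Defs
begin

text \<open>For every \<open>t\<close> there is an intertwiner of \<open>id\<close> and \<open>\<alpha>\<^bsub>-t\<^esub>\<close>; combined with right translation it
 commutes with \<open>B \<rtimes> G\<close>, which makes the matrix coefficients of \<open>x \<in> N\<close> covariant.  Let
 \<open>H = {s. \<lambda>\<^bsub>s\<^esub> \<in> N}\<close>.  If for every small open normal subgroup \<open>V\<close> of \<open>K\<^sub>0\<close> some \<open>1\<^bsub>sV\<^esub> x 1\<^sub>V\<close> with \<open>x \<in> N\<close> is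
 nonzero, then \<open>s \<in> H\<close>: among the normalised \<open>y \<in> \<lambda>\<^bsub>s\<^esub>\<^sup>* N\<close> minimise \<open>\<parallel>y 1\<^sub>V\<parallel>\<^sup>2 + \<parallel>y\<^sup>* 1\<^sub>V\<parallel>\<^sup>2\<close>; the minimiser
 commutes on \<open>1\<^sub>V\<close> with \<open>B\<^sup>V\<close>, so it fixes \<open>1\<^sub>V\<close> by minimality and relative proper outerness, and \<open>V\<close> shrinks
 to \<open>0\<close>.  Thus \<open>N\<close> is supported on \<open>H\<close>, and averaging over small \<open>V\<close> shows that it commutes with
 \<open>(B \<union> \<lambda>\<^bsub>H\<^esub>)'\<close>.\<close>

section \<open>Hilbert space preliminaries\<close>

text \<open>The Hilbert space of \<open>B\<close> is arbitrary, so \<open>\<alpha> t\<close> need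
  not be implemented by a unitary. Bounded intertwiners are enough: covariance can be tested on
  their ranges, whose closed span reduces both \<open>B\<close> and its commutant and is therefore
  everything when \<open>B\<close> is a factor. For a non-discrete group an element of
  \<open>N\<close> has no Fourier coefficients, and multiplying by \<open>1_V\<close> leaves
  \<open>N\<close>. What remains are the compressions between vectors
  \<open>1_A \<otimes> u\<close>, which take values in \<open>B\<close>. The quantity minimised is
  the best constant \<open>k\<close> with \<open>D y u \<le> k * (norm u)^2\<close> for all
  \<open>u\<close>. A unitary of \<open>Q V\<close> that moves the minimiser yields only a nonzero
  positive form \<open>h\<close> as gain, possibly zero at some \<open>u\<close>. Irreducibility of
  \<open>Q V\<close> in \<open>B\<close> is what turns this into a uniform gain: averaging over a
  family in \<open>Q V\<close> spreads \<open>h\<close> over the whole space. An operator commuting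
  with \<open>\<pi>\<close> and with the translations by \<open>H\<close> need not commute with
  those of any open subgroup. It is averaged over \<open>V\<close> first; only then do its corners
  extend to the commutant of the full crossed product, with which \<open>N\<close> commutes.\<close>

type_synonym 'h op = "'h \<Rightarrow>\<^sub>L 'h"

abbreviation ap :: "('a::real_normed_vector \<Rightarrow>\<^sub>L 'b::real_normed_vector) => 'a => 'b" where "ap \<equiv> blinfun_apply"
abbreviation op_comp :: "('b::real_normed_vector \<Rightarrow>\<^sub>L 'c::real_normed_vector) => ('a::real_normed_vector \<Rightarrow>\<^sub>L 'b) => 'a \<Rightarrow>\<^sub>L 'c"  (infixl "oL" 55)
 where "op_comp \<equiv> blinfun_compose"
abbreviation fm :: "('a::real_normed_vector \<Rightarrow>\<^sub>L 'h::complex_hilbert_space) => 'a => 'h => complex" where "fm T x y \<equiv> cinner (ap T x) y"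
abbreviation Id1 :: "'h::real_normed_vector \<Rightarrow>\<^sub>L 'h" where "Id1 \<equiv> id_blinfun"
abbreviation CL :: "('h::complex_hilbert_space \<Rightarrow>\<^sub>L 'h) set"  ("\<L>") where "\<L> \<equiv> clinear_ops"

lemma cinner_self: "cinner x x = of_real ((norm (x::'a::complex_hilbert_space))^2)"
proof -
 have "Im (cinner x x) = 0"
  using arg_cong[OF cinner_commute[of x x], of Im] by simp
 moreover have "Re (cinner x x) = (norm x)^2"
  by (simp add: power2_norm_eq_inner inner_eq_Re_cinner)
 ultimately show ?thesis by (simp add: complex_eq_iff)
qed

lemma Re_cinner_self: "Re (cinner x x) = (norm (x::'a::complex_hilbert_space))^2"
 by (simp add: cinner_self)

lemma norm_cinner_le: "norm (cinner x y) \<le> norm x * norm (y::'a::complex_hilbert_space)"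
 using semi_cauchy_schwarz[of x y] by (simp add: snorm_eq_norm)

lemma cinner_ext:
 assumes "!!z. cinner x z = cinner (y::'a::complex_hilbert_space) z" shows "x = y"
proof -
 have "cinner (x - y) (x - y) = 0" using assms by (simp add: cinner_diff_left)
 then show ?thesis by (simp add: cinner_self)
qed

lemma cinner_minus_right: "cinner x (- y) = - cinner x y"
 by (metis cinner_commute cinner_minus_left complex_cnj_minus)

lemma cinner_sum_left: "cinner (\<Sum>i\<in>I. f i) y = (\<Sum>i\<in>I. cinner (f i) y)"
 by (induction I rule: infinite_finite_induct) (simp_all add: cinner_zero_left cinner_add_left)

lemma cinner_sum_right: "cinner y (\<Sum>i\<in>I. f i) = (\<Sum>i\<in>I. cinner y (f i))"
 by (induction I rule: infinite_finite_induct) (simp_all add: cinner_zero_right cinner_add_right)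

lemmas cinner_simps = cinner_add_left cinner_add_right cinner_diff_left cinner_diff_right
 cinner_scaleC_left cinner_scaleC_right cinner_scaleR_left cinner_scaleR_right
 cinner_zero_left cinner_zero_right cinner_minus_left cinner_minus_right

lemmas tendsto_cinner = bounded_bilinear.tendsto[OF bounded_bilinear_cinner]
lemmas continuous_on_cinner = bounded_bilinear.continuous_on[OF bounded_bilinear_cinner]

lemma norm_scaleC: "norm (c *\<^sub>C (x::'a::complex_hilbert_space)) = norm c * norm x"
 using snorm_scaleC[of c x] by (simp add: snorm_eq_norm)

lemma continuous_on_scaleC: "continuous_on S f ==> continuous_on S (\<lambda>t. c *\<^sub>C (f t::'a::complex_hilbert_space))"
 by (rule bounded_linear.continuous_on[OF bounded_linear_scaleC])

lemma scaleC_minus1: "(-1) *\<^sub>C (x::'a::complex_semi_inner) = - x"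
 using scaleC_of_real[of "-1" x] by simp

lemma scaleC_one: "1 *\<^sub>C (x::'a::complex_semi_inner) = x"
 using scaleC_of_real[of 1 x] by simp

lemma scaleC_zero_left: "0 *\<^sub>C (x::'a::complex_semi_inner) = 0"
 using scaleC_of_real[of 0 x] by simp

lemma scaleC_zero_right: "c *\<^sub>C (0::'a::complex_semi_inner) = 0"
 using scaleC_diff_right[of c 0 0] by simp

section \<open>Closed complex subspaces: nearest points and the Riesz representation\<close>

definition csubspace :: "'a::complex_semi_inner set => bool" where
 "csubspace S \<longleftrightarrow> 0 \<in> S & (\<forall>x\<in>S. \<forall>y\<in>S. x + y \<in> S) & (\<forall>c. \<forall>x\<in>S. c *\<^sub>C x \<in> S)"

lemma csubspaceD:
 assumes "csubspace S"
 shows "0 \<in> S" "!!x y. x \<in> S ==> y \<in> S ==> x + y \<in> S" "!!c x. x \<in> S ==> c *\<^sub>C x \<in> S"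
  "!!r x. x \<in> S ==> r *\<^sub>R x \<in> S" "!!x y. x \<in> S ==> y \<in> S ==> x - y \<in> S"
  "!!x. x \<in> S ==> - x \<in> S"
proof -
 show "0 \<in> S" and a: "!!x y. x \<in> S ==> y \<in> S ==> x + y \<in> S"
  and b: "!!c x. x \<in> S ==> c *\<^sub>C x \<in> S"
  using assms by (auto simp: csubspace_def)
 show "r *\<^sub>R x \<in> S" if "x \<in> S" for r x using b[OF that, of "of_real r"] by (simp add: scaleC_of_real)
 show m: "- x \<in> S" if "x \<in> S" for x using b[OF that, of "-1"] by (simp add: scaleC_minus1)
 show "x - y \<in> S" if "x \<in> S" "y \<in> S" for x y using a[OF that(1) m[OF that(2)]] by simp
qed

text \<open>A minimising sequence is Cauchy by the parallelogram law. Varying its limit along real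
  multiples of \<open>y\<close> gives orthogonality for the real inner product; inserting
  \<open>\<i> *\<^sub>C y\<close> handles the imaginary part.\<close>

lemma closest_point_subspace:
 fixes x :: "'a::complex_hilbert_space"
 assumes cl: "closed S" and S: "csubspace S"
 shows "\<exists>z\<in>S. \<forall>y\<in>S. cinner (x - z) y = 0"
proof -
 define D where "D = (\<lambda>y. (norm (x - y))^2) ` S"
 define d where "d = Inf D"
 have bdd: "bdd_below D" unfolding D_def by (rule bdd_belowI[of _ 0]) auto
 have ne: "D \<noteq> {}" using csubspaceD(1)[OF S] by (auto simp: D_def)
 have dle: "d \<le> (norm (x - y))^2" if "y \<in> S" for y
  unfolding d_def using that by (intro cInf_lower[OF _ bdd]) (auto simp: D_def)
 have "\<exists>y. y \<in> S & (norm (x - y))^2 < d + inverse (real (Suc n))" for n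
 proof (rule ccontr)
  assume "\<not> ?thesis"
  then have "d + inverse (real (Suc n)) \<le> t" if "t \<in> D" for t
   using that unfolding D_def by force
  then have "d + inverse (real (Suc n)) \<le> d" unfolding d_def by (intro cInf_greatest ne)
  then show False by (simp add: not_less[symmetric] del: not_less)
 qed
 then have "\<exists>f. \<forall>n. f n \<in> S & (norm (x - f n))^2 < d + inverse (real (Suc n))" by (intro choice allI)
 then obtain f where f: "!!n. f n \<in> S" "!!n. (norm (x - f n))^2 < d + inverse (real (Suc n))" by blast
 have par: "(norm (f m - f n))^2 \<le> 2 * inverse (real (Suc m)) + 2 * inverse (real (Suc n))" for m n
 proof -
  have "(1/2) *\<^sub>R (f m + f n) \<in> S" by (intro csubspaceD(4)[OF S] csubspaceD(2)[OF S] f(1))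
  then have "d \<le> (norm (x - (1/2) *\<^sub>R (f m + f n)))^2" by (rule dle)
  moreover have "x - (1/2) *\<^sub>R (f m + f n) = (1/2) *\<^sub>R ((x - f m) + (x - f n))"
  proof -
   have "x = (1/2) *\<^sub>R x + (1/2) *\<^sub>R x" by (simp flip: scaleR_add_left)
   then show ?thesis by (simp add: scaleR_right_distrib scaleR_right_diff_distrib)
  qed
  ultimately have "4 * d \<le> (norm ((x - f m) + (x - f n)))^2" by (simp add: power_divide)
  moreover have "(norm ((x - f m) + (x - f n)))^2 + (norm (f m - f n))^2
    = 2 * (norm (x - f m))^2 + 2 * (norm (x - f n))^2"
   by (simp add: power2_norm_eq_inner algebra_simps inner_commute)
  ultimately show ?thesis using f(2)[of m] f(2)[of n] by linarith
 qed
 have "Cauchy f"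
 proof (rule metric_CauchyI)
  fix e :: real assume e: "0 < e"
  obtain N where N: "inverse (real (Suc N)) < e^2 / 4"
   using reals_Archimedean[of "e^2/4"] e by auto
  have "dist (f m) (f n) < e" if "m \<ge> N" "n \<ge> N" for m n
  proof -
   have "inverse (real (Suc m)) \<le> inverse (real (Suc N))" "inverse (real (Suc n)) \<le> inverse (real (Suc N))"
    using that by (auto intro!: le_imp_inverse_le)
   then have "(norm (f m - f n))^2 < e^2" using par[of m n] N by linarith
   then show ?thesis using e by (simp add: dist_norm power2_less_imp_less)
  qed
  then show "\<exists>M. \<forall>m\<ge>M. \<forall>n\<ge>M. dist (f m) (f n) < e" by blast
 qed
 then obtain z where z: "f \<longlonglongrightarrow> z" using Cauchy_convergent convergent_def by metis
 have zS: "z \<in> S" using closed_sequentially[OF cl _ z] f(1) by blast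
 have "(\<lambda>n. (norm (x - f n))^2) \<longlonglongrightarrow> (norm (x - z))^2"
  by (intro tendsto_intros z)
 moreover have "(\<lambda>n. d + inverse (real (Suc n))) \<longlonglongrightarrow> d + 0"
  by (intro tendsto_intros LIMSEQ_inverse_real_of_nat)
 ultimately have nz: "(norm (x - z))^2 \<le> d + 0"
  by (rule LIMSEQ_le) (use f(2) in \<open>auto intro: less_imp_le\<close>)
 have re: "inner (x - z) y = 0" if y: "y \<in> S" for y
 proof (rule ccontr)
  assume ne0: "inner (x - z) y \<noteq> 0"
  define b where "b = inner (x - z) y"
  have "2 * t * b \<le> t^2 * (norm y)^2" for t
  proof -
   have "z + t *\<^sub>R y \<in> S" by (intro csubspaceD(4)[OF S] csubspaceD(2)[OF S] zS y)
   then have "(norm (x - z))^2 \<le> (norm (x - (z + t *\<^sub>R y)))^2" using dle[of "z + t *\<^sub>R y"] nz by linarith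
   also have "... = (norm (x - z))^2 - 2 * t * b + t^2 * (norm y)^2"
    unfolding diff_diff_add[symmetric] power2_norm_eq_inner
    by (simp add: inner_diff_left inner_diff_right inner_commute b_def power2_eq_square algebra_simps)
   finally show ?thesis by simp
  qed
  \<comment> \<open>The optimal parameter would be \<open>b / (norm y)^2\<close>; the added 1 avoids
    a case distinction on \<open>y = 0\<close>.\<close>
  from this[of "b / ((norm y)^2 + 1)"]
  have "2 * b^2 / ((norm y)^2 + 1) \<le> b^2 * (norm y)^2 / ((norm y)^2 + 1)^2"
   by (simp add: power2_eq_square)
  moreover have "b^2 * (norm y)^2 / ((norm y)^2 + 1)^2 \<le> b^2 / ((norm y)^2 + 1)"
  proof -
   have p: "(norm y)^2 + 1 > 0" by (simp add: add_nonneg_pos)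
   have "b^2 * (norm y)^2 / ((norm y)^2 + 1)^2 \<le> b^2 * ((norm y)^2 + 1) / ((norm y)^2 + 1)^2"
    by (intro divide_right_mono mult_left_mono) auto
   also have "... = b^2 / ((norm y)^2 + 1)" using p by (simp add: power2_eq_square)
   finally show ?thesis .
  qed
  moreover have "0 < b^2 / ((norm y)^2 + 1)" using ne0 by (simp add: b_def add_nonneg_pos)
  ultimately show False by simp
 qed
 have "cinner (x - z) y = 0" if y: "y \<in> S" for y
 proof -
  have "Re (cinner (x - z) y) = 0" using re[OF y] by (simp add: inner_eq_Re_cinner)
  moreover have "Re (cinner (x - z) (\<i> *\<^sub>C y)) = 0"
   using re[OF csubspaceD(3)[OF S y]] by (simp add: inner_eq_Re_cinner)
  then have "Im (cinner (x - z) y) = 0" by (simp add: cinner_scaleC_right)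
  ultimately show ?thesis by (simp add: complex_eq_iff)
 qed
 then show ?thesis using zS by blast
qed

lemma riesz:
 fixes \<phi> :: "'a::complex_hilbert_space => complex"
 assumes add: "!!x y. \<phi> (x + y) = \<phi> x + \<phi> y" and sc: "!!c x. \<phi> (c *\<^sub>C x) = c * \<phi> x"
  and bd: "!!x. norm (\<phi> x) \<le> C * norm x"
 shows "\<exists>z. \<forall>x. \<phi> x = cinner x z"
proof (cases "\<forall>x. \<phi> x = 0")
 case True
 then show ?thesis by (intro exI[of _ 0]) (simp add: cinner_zero_right)
next
 case False
 then obtain x0 where x0: "\<phi> x0 \<noteq> 0" by blast
 define S where "S = {x. \<phi> x = 0}"
 have z0: "\<phi> 0 = 0" using sc[of 0 0] by (simp add: scaleC_zero_left)
 have dif: "\<phi> (x - y) = \<phi> x - \<phi> y" for x y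
  using add[of x "- y"] sc[of "-1" y] by (simp add: scaleC_minus1)
 have S: "csubspace S" by (auto simp: csubspace_def S_def z0 add sc)
 have bl: "bounded_linear \<phi>"
  by (rule bounded_linear_intro[of _ C])
   (use add sc[of "of_real _"] bd in \<open>auto simp: scaleC_of_real scaleR_conv_of_real mult.commute\<close>)
 have "closed S"
  unfolding S_def by (intro closed_Collect_eq linear_continuous_on[OF bl] continuous_on_const)
 then obtain z where z: "z \<in> S" "!!y. y \<in> S ==> cinner (x0 - z) y = 0"
  using closest_point_subspace[OF _ S] by blast
 define w where "w = x0 - z"
 have pw: "\<phi> w = \<phi> x0" using z(1) by (simp add: w_def dif S_def)
 then have w0: "w \<noteq> 0" using x0 z0 by auto
 have "\<phi> x = cinner x (cnj (\<phi> w / of_real ((norm w)^2)) *\<^sub>C w)" for x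
 proof -
  have "x - (\<phi> x / \<phi> w) *\<^sub>C w \<in> S" using x0 by (simp add: S_def dif sc pw)
  then have "cinner w (x - (\<phi> x / \<phi> w) *\<^sub>C w) = 0" using z(2) by (simp add: w_def)
  then have "cinner (x - (\<phi> x / \<phi> w) *\<^sub>C w) w = 0" by (metis cinner_commute complex_cnj_zero)
  then have "cinner x w = \<phi> x / \<phi> w * of_real ((norm w)^2)"
   by (simp add: cinner_simps cinner_self)
  then show ?thesis using x0 pw w0 by (simp add: cinner_scaleC_right field_simps)
 qed
 then show ?thesis by blast
qed

section \<open>Bounded complex-linear operators\<close>

lemma clinear_scaleC: "T \<in> \<L> ==> ap T (c *\<^sub>C x) = c *\<^sub>C ap T x"
 by (simp add: clinear_ops_def)

lemma op_ext:
 fixes S T :: "'a::real_normed_vector \<Rightarrow>\<^sub>L 'h::complex_hilbert_space"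
 assumes "!!x y. fm S x y = fm T x y" shows "S = T"
 using assms by (intro blinfun_eqI cinner_ext)

lemma ex_op:
 fixes f :: "'h::complex_hilbert_space => 'k::complex_hilbert_space"
 assumes "!!x y. f (x + y) = f x + f y" "!!c x. f (c *\<^sub>C x) = c *\<^sub>C f x" "!!x. norm (f x) \<le> C * norm x" "0 \<le> C"
 shows "\<exists>T. (\<forall>x. ap T x = f x) & norm T \<le> C"
proof -
 have "bounded_linear f"
  by (rule bounded_linear_intro[of _ C]) (use assms(1,3) assms(2)[of "of_real _"] in \<open>auto simp: scaleC_of_real mult.commute\<close>)
 then have "\<forall>x. ap (Blinfun f) x = f x" by (simp add: bounded_linear_Blinfun_apply)
 moreover from this have "norm (Blinfun f) \<le> C"
  by (intro norm_blinfun_bound assms(4)) (simp add: assms(3))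
 ultimately show ?thesis by blast
qed

lemma ex_clinear_op:
 fixes f :: "'h::complex_hilbert_space => 'h"
 assumes "!!x y. f (x + y) = f x + f y" "!!c x. f (c *\<^sub>C x) = c *\<^sub>C f x" "!!x. norm (f x) \<le> C * norm x" "0 \<le> C"
 shows "\<exists>T\<in>\<L>. (\<forall>x. ap T x = f x) & norm T \<le> C"
 using ex_op[of f C, OF assms] assms(2) by (fastforce simp: clinear_ops_def)

lemma norm_le_cinner:
 fixes v :: "'h::complex_hilbert_space"
 assumes "!!y. norm (cinner v y) \<le> C * norm y" "0 \<le> C" shows "norm v \<le> C"
proof (cases "v = 0")
 case False
 have "norm v * norm v \<le> C * norm v"
  using assms(1)[of v] by (simp only: cinner_self norm_of_real) (simp add: power2_eq_square)
 with False show ?thesis by simp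
qed (use assms in simp)

text \<open>Riesz representation in the second variable. Adjoints, weak limits, coefficients and
  averages are all obtained from their sesquilinear forms through this lemma.\<close>

lemma form_op:
 fixes B :: "'h::complex_hilbert_space => 'h => complex"
 assumes al: "!!x y z. B (x + y) z = B x z + B y z" and ar: "!!x y z. B x (y + z) = B x y + B x z"
  and sl: "!!c x y. B (c *\<^sub>C x) y = c * B x y" and sr: "!!c x y. B x (c *\<^sub>C y) = cnj c * B x y"
  and bd: "!!x y. norm (B x y) \<le> C * norm x * norm y" and C: "0 \<le> C"
 shows "\<exists>T\<in>\<L>. norm T \<le> C & (\<forall>x y. fm T x y = B x y)"
proof -
 have "\<exists>z. \<forall>y. cnj (B x y) = cinner y z" for x
  by (rule riesz[of _ "C * norm x"]) (simp_all add: ar sr bd)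
 then obtain f where f: "!!x y. cnj (B x y) = cinner y (f x)" by metis
 have fB: "cinner (f x) y = B x y" for x y
  using f[of x y] by (metis cinner_commute complex_cnj_cnj)
 have "norm (f x) \<le> C * norm x" for x
  by (rule norm_le_cinner) (use bd C in \<open>auto simp: fB\<close>)
 moreover have "f (x + y) = f x + f y" for x y
  by (rule cinner_ext) (simp add: fB al cinner_add_left)
 moreover have "f (c *\<^sub>C x) = c *\<^sub>C f x" for c x
  by (rule cinner_ext) (simp add: fB sl cinner_scaleC_left)
 ultimately obtain T where "T \<in> \<L>" "\<forall>x. ap T x = f x" "norm T \<le> C"
  using ex_clinear_op[of f C] C by blast
 then show ?thesis using fB by auto
qed

lemma ex_adj:
 assumes "T \<in> \<L>"
 shows "\<exists>S\<in>\<L>. (\<forall>x y. fm T x y = cinner x (ap S y)) & norm S \<le> norm T"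
proof -
 have "\<exists>S\<in>\<L>. norm S \<le> norm T & (\<forall>x y. fm S x y = cinner x (ap T y))"
 proof (rule form_op)
  fix x y
  show "norm (cinner x (ap T y)) \<le> norm T * norm x * norm y"
   by (rule order_trans[OF norm_cinner_le])
    (use mult_left_mono[OF norm_blinfun[of T y], of "norm x"] in \<open>simp add: mult.assoc mult.left_commute\<close>)
 qed (simp_all add: cinner_simps clinear_scaleC[OF assms] blinfun.add_right)
 then show ?thesis by (metis cinner_commute)
qed

lemma adj_works:
 assumes "T \<in> \<L>"
 shows "fm T x y = cinner x (ap (adj T) y)" "adj T \<in> \<L>" "norm (adj T) \<le> norm T"
proof -
 obtain S where S: "S \<in> \<L>" "\<forall>x y. fm T x y = cinner x (ap S y)" "norm S \<le> norm T"
  using ex_adj[OF assms] by blast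
 have "adj T = S"
  unfolding adj_def
 proof (rule the_equality)
  fix S' assume "\<forall>x y. fm T x y = cinner x (ap S' y)"
  then have "cinner x (ap S' y) = cinner x (ap S y)" for x y using S by metis
  then show "S' = S" by (intro op_ext) (metis cinner_commute)
 qed (use S in blast)
 with S show "fm T x y = cinner x (ap (adj T) y)" "adj T \<in> \<L>" "norm (adj T) \<le> norm T"
  by auto
qed

lemma adj_works_right:
 assumes "T \<in> \<L>"
 shows "cinner x (ap T y) = fm (adj T) x y"
 by (metis adj_works(1)[OF assms] cinner_commute)

lemma adj_unique:
 assumes "S \<in> \<L>" "!!x y. fm T x y = cinner x (ap S y)" "T \<in> \<L>"
 shows "adj T = S"
proof (rule op_ext)
 fix x y
 have "cinner y (ap (adj T) x) = cinner y (ap S x)"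
  using assms(2) adj_works(1)[OF assms(3)] by metis
 then show "fm (adj T) x y = fm S x y" by (metis cinner_commute)
qed

lemma adj_adj: "T \<in> \<L> ==> adj (adj T) = T"
 by (rule adj_unique) (auto simp: adj_works(2) adj_works_right)

lemma clinear_compose: "S \<in> \<L> ==> T \<in> \<L> ==> S oL T \<in> \<L>"
 by (simp add: clinear_ops_def)
lemma clinear_add: "S \<in> \<L> ==> T \<in> \<L> ==> S + T \<in> \<L>"
 by (simp add: clinear_ops_def blinfun.add_left scaleC_add_right)
lemma clinear_diff: "S \<in> \<L> ==> T \<in> \<L> ==> S - T \<in> \<L>"
 by (simp add: clinear_ops_def blinfun.diff_left scaleC_diff_right)
lemma clinear_id: "Id1 \<in> \<L>"
 by (simp add: clinear_ops_def)
lemma clinear_zero: "0 \<in> \<L>"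
 by (simp add: clinear_ops_def scaleC_zero_right)
lemma clinear_scaleR: "T \<in> \<L> ==> r *\<^sub>R T \<in> \<L>"
 by (simp add: clinear_ops_def blinfun.scaleR_left scaleC_scaleC mult.commute flip: scaleC_of_real)
lemma scalar_op_apply: "ap (scalar_op c) x = c *\<^sub>C x"
 by (simp add: scalar_op_def bounded_linear_Blinfun_apply[OF bounded_linear_scaleC])
lemma clinear_scalar: "scalar_op c \<in> \<L>"
 by (simp add: clinear_ops_def scalar_op_apply scaleC_scaleC mult.commute)
lemma clinear_sum: "(!!i. i \<in> I ==> f i \<in> \<L>) ==> (\<Sum>i\<in>I. f i) \<in> \<L>"
 by (induction I rule: infinite_finite_induct) (auto simp: clinear_zero clinear_add)

lemmas clinear_intros = clinear_compose clinear_add clinear_diff clinear_id clinear_zero clinear_scaleR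
 clinear_scalar clinear_sum adj_works(2)

lemma closed_clinear: "closed (\<L> :: 'h::complex_hilbert_space op set)"
proof -
 have "\<L> = (\<Inter>c. \<Inter>x. {T::'h op. ap T (c *\<^sub>C x) = c *\<^sub>C ap T x})"
  by (auto simp: clinear_ops_def)
 moreover have "closed {T::'h op. ap T (c *\<^sub>C x) = c *\<^sub>C ap T x}" for c x
  by (intro closed_Collect_eq continuous_intros continuous_on_scaleC)
 ultimately show ?thesis by (metis (no_types, lifting) closed_INT)
qed

lemma adj_compose:
 assumes "S \<in> \<L>" "T \<in> \<L>" shows "adj (S oL T) = adj T oL adj S"
 by (rule adj_unique) (auto intro: clinear_intros assms simp: adj_works(1)[OF assms(1)] adj_works(1)[OF assms(2)])

lemma adj_add:
 assumes "S \<in> \<L>" "T \<in> \<L>" shows "adj (S + T) = adj S + adj T"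
 by (rule adj_unique) (auto intro: clinear_intros assms simp: adj_works(1)[OF assms(1)] adj_works(1)[OF assms(2)] blinfun.add_left cinner_simps)

lemma adj_diff:
 assumes "S \<in> \<L>" "T \<in> \<L>" shows "adj (S - T) = adj S - adj T"
 by (rule adj_unique) (auto intro: clinear_intros assms simp: adj_works(1)[OF assms(1)] adj_works(1)[OF assms(2)] blinfun.diff_left cinner_simps)

lemma adj_scaleR: "T \<in> \<L> ==> adj (r *\<^sub>R T) = r *\<^sub>R adj T"
 by (rule adj_unique) (auto intro: clinear_intros simp: adj_works(1) blinfun.scaleR_left cinner_simps)

lemma adj_id: "adj Id1 = Id1"
 by (rule adj_unique) (auto intro: clinear_intros)
lemma adj_zero: "adj 0 = 0"
 by (rule adj_unique) (auto intro: clinear_intros simp: cinner_simps)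
lemma adj_scalar: "adj (scalar_op c) = scalar_op (cnj c)"
 by (rule adj_unique) (auto intro: clinear_intros simp: scalar_op_apply cinner_simps)

lemma adj_sum:
 "(!!i. i \<in> I ==> f i \<in> \<L>) ==> adj (\<Sum>i\<in>I. f i) = (\<Sum>i\<in>I. adj (f i))"
 by (induction I rule: infinite_finite_induct) (auto simp: adj_zero adj_add clinear_sum)

lemma norm_blinfun_apply_le: "norm T \<le> R ==> norm (ap T x) \<le> R * norm x"
 by (rule order_trans[OF norm_blinfun mult_right_mono]) auto

lemma compose_assoc: "(A oL B) oL C = A oL (B oL C)"
 by (rule blinfun_eqI) simp

lemma compose_add_left: "(A + B) oL C = (A oL C) + (B oL C)"
 and compose_add_right: "D oL (A + B) = (D oL A) + (D oL B)"
 and compose_diff_left: "(A - B) oL C = (A oL C) - (B oL C)"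
 and compose_diff_right: "D oL (A - B) = (D oL A) - (D oL B)"
 and compose_scaleR_left: "(r *\<^sub>R A) oL C = r *\<^sub>R (A oL C)"
 and compose_scaleR_right: "D oL (r *\<^sub>R A) = r *\<^sub>R (D oL A)"
 and compose_id_left: "Id1 oL A = A" and compose_id_right: "A oL Id1 = A"
 and compose_zero_left: "0 oL C = 0" and compose_zero_right: "D oL 0 = 0"
 by (auto intro!: blinfun_eqI simp: blinfun.bilinear_simps)

lemmas compose_simps = compose_assoc compose_add_left compose_add_right compose_diff_left compose_diff_right
 compose_scaleR_left compose_scaleR_right compose_id_left compose_id_right compose_zero_left compose_zero_right

lemma compose_sum_left: "(\<Sum>i\<in>I. f i) oL C = (\<Sum>i\<in>I. f i oL C)"
 by (induction I rule: infinite_finite_induct) (simp_all add: compose_zero_left compose_add_left)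
lemma compose_sum_right: "C oL (\<Sum>i\<in>I. f i) = (\<Sum>i\<in>I. C oL f i)"
 by (induction I rule: infinite_finite_induct) (simp_all add: compose_zero_right compose_add_right)

section \<open>Commutants\<close>

lemma commutantI: "T \<in> \<L> ==> (!!A. A \<in> S ==> T oL A = A oL T) ==> T \<in> commutant S"
 by (simp add: commutant_def)
lemma commutantD: "T \<in> commutant S ==> A \<in> S ==> T oL A = A oL T"
 by (simp add: commutant_def)
lemma commutantD_apply: "T \<in> commutant S ==> A \<in> S ==> ap T (ap A x) = ap A (ap T x)"
 by (metis commutantD blinfun_apply_blinfun_compose)
lemma commutant_clinear: "T \<in> commutant S ==> T \<in> \<L>"
 by (simp add: commutant_def)
lemma commutant_antimono: "S <= S' ==> commutant S' <= commutant S"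
 by (auto simp: commutant_def)

text \<open>Real scalars and no adjoints: this is what the commutant of an arbitrary set of
  real-linear operators satisfies, and it is enough to contain norm limits of real polynomials,
  hence positive square roots.\<close>

definition op_algebra :: "'h::complex_hilbert_space op set => bool" where
 "op_algebra A \<longleftrightarrow> closed A & A <= \<L> & Id1 \<in> A & (\<forall>S\<in>A. \<forall>T\<in>A. S + T \<in> A & S oL T \<in> A) &
  (\<forall>r. \<forall>T\<in>A. r *\<^sub>R T \<in> A)"

lemma op_algebraD:
 assumes "op_algebra A"
 shows "closed A" "!!T. T \<in> A ==> T \<in> \<L>" "Id1 \<in> A" "!!S T. S \<in> A ==> T \<in> A ==> S + T \<in> A"
  "!!S T. S \<in> A ==> T \<in> A ==> S oL T \<in> A" "!!r T. T \<in> A ==> r *\<^sub>R T \<in> A"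
  "!!S T. S \<in> A ==> T \<in> A ==> S - T \<in> A" "0 \<in> A"
  "!!I f. (!!i. i \<in> I ==> f i \<in> A) ==> (\<Sum>i\<in>I. f i) \<in> A"
proof -
 show 1: "closed A" "!!T. T \<in> A ==> T \<in> \<L>" "Id1 \<in> A" "!!S T. S \<in> A ==> T \<in> A ==> S + T \<in> A"
  "!!S T. S \<in> A ==> T \<in> A ==> S oL T \<in> A" "!!r T. T \<in> A ==> r *\<^sub>R T \<in> A"
  using assms unfolding op_algebra_def by blast+
 show "S - T \<in> A" if "S \<in> A" "T \<in> A" for S T
  using 1(4)[OF that(1) 1(6)[OF that(2), of "-1"]] by simp
 show z: "0 \<in> A" using 1(6)[OF 1(3), of 0] by simp
 show "(\<Sum>i\<in>I. f i) \<in> A" if "!!i. i \<in> I ==> f i \<in> A" for f and I :: "'b set"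
  using that by (induction I rule: infinite_finite_induct) (auto simp: z 1(4))
qed

lemma op_algebra_commutant: "op_algebra (commutant S)"
proof -
 have eq: "commutant S = \<L> \<inter> (\<Inter>A\<in>S. {T. T oL A = A oL T})"
  by (auto simp: commutant_def)
 have "closed {T. T oL A = A oL T}" for A :: "'a op"
  by (intro closed_Collect_eq continuous_intros)
 then have "closed (commutant S)" unfolding eq by (auto intro!: closed_Int closed_clinear)
 moreover have "S1 oL S2 \<in> commutant S" if "S1 \<in> commutant S" "S2 \<in> commutant S" for S1 S2
  using that by (auto simp: commutant_def clinear_compose) (metis compose_assoc)
 ultimately show ?thesis
  unfolding op_algebra_def by (auto simp: commutant_def clinear_intros compose_simps)
qed

lemma commutant_scalar: "scalar_op c \<in> commutant S" if "S <= \<L>"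
 using that by (intro commutantI clinear_scalar blinfun_eqI) (auto simp: scalar_op_apply clinear_ops_def)

lemma commutant_adj:
 assumes T: "T \<in> commutant S" and S: "!!A. A \<in> S ==> A \<in> \<L>" "!!A. A \<in> S ==> adj A \<in> S"
 shows "adj T \<in> commutant S"
proof (rule commutantI)
 show "adj T \<in> \<L>" using T by (simp add: commutant_clinear adj_works(2))
 fix A assume A: "A \<in> S"
 have "adj (T oL adj A) = adj (adj A oL T)" using commutantD[OF T S(2)[OF A]] by simp
 then show "adj T oL A = A oL adj T"
  using A S T by (simp add: adj_compose commutant_clinear adj_adj)
qed

section \<open>Projections\<close>

definition ccspan :: "'h::complex_hilbert_space set => 'h set" where
 "ccspan X = \<Inter>{S. closed S & csubspace S & X <= S}"

lemma ccspan_closed: "closed (ccspan X)" by (auto simp: ccspan_def)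
lemma ccspan_csubspace: "csubspace (ccspan X)" by (auto simp: ccspan_def csubspace_def)
lemma ccspan_superset: "X <= ccspan X" by (auto simp: ccspan_def)
lemma ccspan_inc: "x \<in> X ==> x \<in> ccspan X" using ccspan_superset by blast
lemma ccspan_minimal: "closed S ==> csubspace S ==> X <= S ==> ccspan X <= S" by (auto simp: ccspan_def)

lemma orth_closed_csubspace:
 "closed {x. \<forall>y\<in>Y. cinner x y = 0}" "csubspace {x::'h::complex_hilbert_space. \<forall>y\<in>Y. cinner x y = 0}"
proof -
 have "{x. \<forall>y\<in>Y. cinner x y = 0} = (\<Inter>y\<in>Y. {x. cinner x y = 0})" by auto
 moreover have "closed {x. cinner x y = 0}" for y :: 'h
  by (intro closed_Collect_eq continuous_on_cinner continuous_intros)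
 ultimately show "closed {x. \<forall>y\<in>Y. cinner x y = 0}" by auto
qed (auto simp: csubspace_def cinner_simps)

lemma ccspan_orth:
 assumes "!!x. x \<in> X ==> cinner x y = 0" "x \<in> ccspan X" shows "cinner x y = 0"
 using ccspan_minimal[OF orth_closed_csubspace(1)[of "{y}"] orth_closed_csubspace(2)[of "{y}"], of X] assms by auto

lemma preimage_closed_csubspace:
 assumes "closed S" "csubspace S" "!!c x. ap T (c *\<^sub>C x) = c *\<^sub>C ap T x"
 shows "closed (ap T -` S)" "csubspace (ap T -` S)"
proof -
 show "closed (ap T -` S)"
  using assms(1) by (intro closed_vimage) (auto intro: continuous_intros)
 show "csubspace (ap T -` S)"
  using assms(2,3) by (auto simp: csubspace_def blinfun.bilinear_simps)
qed

lemma ccspan_image: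
 assumes "T \<in> \<L>" "!!x. x \<in> X ==> ap T x \<in> ccspan Y" "x \<in> ccspan X"
 shows "ap T x \<in> ccspan Y"
 using ccspan_minimal[of "ap T -` ccspan Y" X] assms
  preimage_closed_csubspace[OF ccspan_closed ccspan_csubspace clinear_scaleC[OF assms(1)], where X2=Y]
 by auto

lemma ex_projection:
 fixes S :: "'h::complex_hilbert_space set"
 assumes cl: "closed S" and S: "csubspace S"
 shows "\<exists>P\<in>\<L>. norm P \<le> 1 & adj P = P & P oL P = P & (\<forall>x. ap P x \<in> S) & (\<forall>x\<in>S. ap P x = x) &
  (\<forall>x. \<forall>y\<in>S. cinner (x - ap P x) y = 0)"
proof -
 obtain p where p: "!!x. p x \<in> S" "!!x y. y \<in> S ==> cinner (x - p x) y = 0"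
  using closest_point_subspace[OF cl S] by metis
 have uniq: "p x = z" if "z \<in> S" "!!y. y \<in> S ==> cinner (x - z) y = 0" for x z
 proof -
  have "p x - z \<in> S" by (intro csubspaceD(5)[OF S] p that)
  then have "cinner (x - z) (p x - z) - cinner (x - p x) (p x - z) = 0" using p that by simp
  then have "cinner (p x - z) (p x - z) = 0" by (simp add: cinner_simps algebra_simps)
  then show ?thesis by (simp add: cinner_self)
 qed
 have z: "cinner x y = cinner (p x) y" if "y \<in> S" for x y using p(2)[OF that, of x] by (simp add: cinner_simps)
 have n: "norm (p x) \<le> 1 * norm x" for x
 proof -
  have "(norm (p x))^2 = Re (cinner x (p x))" using z[OF p(1), of x x] by (simp add: cinner_self)
  also have "... \<le> norm x * norm (p x)" using norm_cinner_le[of x "p x"] complex_Re_le_cmod order_trans by blast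
  finally show ?thesis by (cases "p x = 0") (auto simp: power2_eq_square)
 qed
 have pa: "p (x + y) = p x + p y" for x y
 proof (rule uniq)
  show "p x + p y \<in> S" by (intro csubspaceD(2)[OF S] p(1))
  show "cinner (x + y - (p x + p y)) w = 0" if "w \<in> S" for w
   using z[OF that, of x] z[OF that, of y] by (simp add: cinner_simps)
 qed
 have pc: "p (c *\<^sub>C x) = c *\<^sub>C p x" for c x
 proof (rule uniq)
  show "c *\<^sub>C p x \<in> S" by (intro csubspaceD(3)[OF S] p(1))
  show "cinner (c *\<^sub>C x - c *\<^sub>C p x) w = 0" if "w \<in> S" for w
   using z[OF that, of x] by (simp add: cinner_simps)
 qed
 obtain P where P: "P \<in> \<L>" "!!x. ap P x = p x" "norm P \<le> 1"
  using ex_clinear_op[of p 1, OF pa pc n] by auto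
 have PP: "P oL P = P" by (rule blinfun_eqI) (simp add: P(2) uniq[OF p(1)] cinner_simps)
 have aP: "adj P = P"
  by (rule adj_unique[OF P(1) _ P(1)]) (metis P(2) cinner_commute p(1) z)
 have "\<forall>x\<in>S. ap P x = x" by (auto simp: P(2) intro!: uniq) (simp add: cinner_zero_left)
 then show ?thesis
  using P(1,3) aP PP p unfolding P(2)[symmetric] by (intro bexI[of _ P] conjI allI ballI) simp_all
qed

lemma ccspan_UNIV:
 assumes "!!y. (!!x. x \<in> X ==> cinner y x = 0) ==> y = 0" shows "ccspan X = UNIV"
proof -
 have "y \<in> ccspan X" for y
 proof -
  obtain z where z: "z \<in> ccspan X" "!!x. x \<in> ccspan X ==> cinner (y - z) x = 0"
   using closest_point_subspace[OF ccspan_closed ccspan_csubspace] by metis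
  then have "y - z = 0" using assms ccspan_superset by blast
  with z show ?thesis by simp
 qed
 then show ?thesis by blast
qed

text \<open>Here \<open>P\<close> is the orthogonal projection onto \<open>S\<close>. Invariance
  under \<open>A\<close> and under \<open>adj A\<close> gives \<open>P A P = A P\<close> and
  \<open>P (adj A) P = (adj A) P\<close>; the adjoint of the second is
  \<open>P A P = P A\<close>.\<close>

lemma proj_commute:
 assumes P: "P \<in> \<L>" "adj P = P" "!!x. ap P x \<in> S" "!!x. x \<in> S ==> ap P x = x"
  and A: "A \<in> \<L>" "!!x. x \<in> S ==> ap A x \<in> S" "!!x. x \<in> S ==> ap (adj A) x \<in> S"
 shows "P oL A = A oL P"
proof -
 have 1: "P oL B oL P = B oL P" if "!!x. x \<in> S ==> ap B x \<in> S" for B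
  by (rule blinfun_eqI) (simp add: P that)
 have "adj (P oL adj A oL P) = adj (adj A oL P)" using 1[of "adj A"] A by simp
 then have "P oL A oL P = P oL A"
  using P(1,2) A(1) by (simp add: adj_compose clinear_intros adj_adj compose_assoc)
 then show ?thesis using 1[OF A(2)] by simp
qed

lemma eq_on_ccspan:
 fixes S T :: "'h::complex_hilbert_space op"
 assumes "S \<in> \<L>" "T \<in> \<L>" "!!x. x \<in> X ==> ap S x = ap T x" "x \<in> ccspan X"
 shows "ap S x = ap T x"
proof -
 have "ccspan X <= ap (S - T) -` {0}"
  using assms(1-3) preimage_closed_csubspace[of "{0}" "S - T", OF _ _ clinear_scaleC]
  by (intro ccspan_minimal) (auto simp: csubspace_def scaleC_zero_right clinear_diff blinfun.bilinear_simps)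
 with assms(4) show ?thesis by (auto simp: blinfun.bilinear_simps)
qed

instance complex_hilbert_space \<subseteq> banach ..

section \<open>Positive operators\<close>

definition pos_op :: "'h::complex_hilbert_space op => bool" where
 "pos_op T \<longleftrightarrow> T \<in> \<L> & adj T = T & (\<forall>x. 0 \<le> Re (fm T x x))"

lemma pos_opD:
 assumes "pos_op T"
 shows "T \<in> \<L>" "adj T = T" "0 \<le> Re (fm T x x)"
 using assms by (auto simp: pos_op_def)

lemma selfadj_cinner:
 assumes "T \<in> \<L>" "adj T = T"
 shows "fm T x y = cinner x (ap T y)"
 using adj_works(1)[OF assms(1), of x y] assms(2) by simp

lemma pos_op_cauchy_schwarz:
 assumes T: "pos_op T"
 shows "(Re (fm T x y))^2 \<le> Re (fm T x x) * Re (fm T y y)"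
proof -
 define a b c where "a = Re (fm T x x)" and "b = Re (fm T x y)"
  and "c = Re (fm T y y)"
 have a0: "0 \<le> a" and c0: "0 \<le> c" using pos_opD(3)[OF T] by (auto simp: a_def c_def)
 have sym: "Re (fm T y x) = b"
  unfolding b_def selfadj_cinner[OF pos_opD(1,2)[OF T], of y x] by (subst cinner_commute) simp
 have q: "0 \<le> a + 2 * r * b + r^2 * c" for r
 proof -
  have "0 \<le> Re (fm T (x + r *\<^sub>R y) (x + r *\<^sub>R y))" by (rule pos_opD(3)[OF T])
  also have "... = a + 2 * r * b + r^2 * c"
   by (simp add: blinfun.bilinear_simps cinner_simps sym a_def c_def power2_eq_square algebra_simps)
    (simp add: b_def)
  finally show ?thesis .
 qed
 have "b^2 \<le> a * c"
 proof (cases "c = 0")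
  case True
  have "b = 0"
  proof (rule ccontr)
   assume "b \<noteq> 0"
   with q[of "- (a + 1) / (2 * b)"] True show False by (simp add: field_simps)
  qed
  with True show ?thesis by simp
 next
  case False
  with c0 q[of "- b / c"] show ?thesis by (simp add: field_simps power2_eq_square)
 qed
 then show ?thesis by (simp add: a_def b_def c_def)
qed

text \<open>Cauchy-Schwarz for the form of \<open>T\<close> at \<open>x\<close> and
  \<open>ap T x\<close>: its left side is the fourth power of \<open>norm (ap T x)\<close>, and one
  square cancels.\<close>

lemma pos_op_norm_le:
 assumes T: "pos_op T" and c: "0 \<le> c" "!!x. Re (fm T x x) \<le> c * (norm x)^2"
 shows "norm T \<le> c"
proof (rule norm_blinfun_bound[OF c(1)])
 fix x
 let ?n = "norm (ap T x)"
 have "(?n^2)^2 \<le> Re (fm T x x) * Re (fm T (ap T x) (ap T x))"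
  using pos_op_cauchy_schwarz[OF T, of x "ap T x"] by (simp add: cinner_self)
 also have "... \<le> (c * (norm x)^2) * (c * ?n^2)"
  by (intro mult_mono c pos_opD(3)[OF T]) (use c in auto)
 finally have "?n^2 * ?n^2 \<le> (c * norm x)^2 * ?n^2" by (simp add: power2_eq_square mult_ac)
 then have "?n^2 \<le> (c * norm x)^2"
 proof (cases "?n = 0")
  case False
  then have "0 < ?n^2" by simp
  with \<open>?n^2 * ?n^2 \<le> (c * norm x)^2 * ?n^2\<close> show ?thesis by (rule mult_right_le_imp_le)
 qed simp
 then show "?n \<le> c * norm x" by (rule power2_le_imp_le) (use c in auto)
qed

lemma Re_cinner_op_le: "Re (fm T x x) \<le> norm T * (norm (x::'h::complex_hilbert_space))^2"
proof -
 have "Re (fm T x x) \<le> norm (ap T x) * norm x"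
  using norm_cinner_le complex_Re_le_cmod order_trans by blast
 also have "... \<le> norm T * norm x * norm x" by (intro mult_right_mono norm_blinfun) auto
 finally show ?thesis by (simp add: power2_eq_square mult_ac)
qed

lemma pos_op_adj_comp:
 assumes "T \<in> \<L>" shows "pos_op (adj T oL T)" "pos_op (T oL adj T)"
proof -
 have *: "pos_op (adj T oL T)" if "T \<in> \<L>" for T :: "'a op"
  unfolding pos_op_def using that
  by (auto intro: clinear_intros simp: adj_compose adj_works(2) adj_adj)
    (metis adj_works_right adj_adj adj_works(2) Re_cinner_self zero_le_power2)
 show "pos_op (adj T oL T)" by (rule *[OF assms])
 show "pos_op (T oL adj T)" using *[OF adj_works(2)[OF assms]] by (simp add: adj_adj[OF assms])
qed

lemma Re_cinner_adj_comp:
 assumes "T \<in> \<L>"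
 shows "Re (fm (adj T oL T) x x) = (norm (ap T x))^2"
 using adj_works_right[OF assms, of "ap T x" x] Re_cinner_self[of "ap T x"] by simp

lemma pos_op_add: "pos_op S ==> pos_op T ==> pos_op (S + T)"
 by (auto simp: pos_op_def clinear_add adj_add blinfun.add_left cinner_add_left)
lemma pos_op_zero: "pos_op 0"
 by (auto simp: pos_op_def clinear_zero adj_zero cinner_zero_left)
lemma pos_op_scaleR: "pos_op T ==> 0 \<le> r ==> pos_op (r *\<^sub>R T)"
 by (auto simp: pos_op_def clinear_scaleR adj_scaleR blinfun.scaleR_left cinner_scaleR_left)
lemma pos_op_id: "pos_op Id1"
 by (auto simp: pos_op_def clinear_id adj_id cinner_self)
lemma pos_op_sum: "(!!i. i \<in> I ==> pos_op (f i)) ==> pos_op (\<Sum>i\<in>I. f i)"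
 by (induction I rule: infinite_finite_induct) (auto simp: pos_op_zero pos_op_add)
lemma selfadj_eq_zero:
 assumes "T \<in> \<L>" "adj T = T" "!!x. Re (fm T x x) = 0" shows "T = 0"
proof -
 have "pos_op T" using assms by (simp add: pos_op_def)
 then have "norm T \<le> 0" by (rule pos_op_norm_le) (use assms in auto)
 then show ?thesis by simp
qed

lemma pos_op_antisym:
 assumes "pos_op (S - T)" "pos_op (T - S)" shows "S = T"
proof -
 have "Re (fm (S - T) x x) = 0" for x
  using pos_opD(3)[OF assms(1), of x] pos_opD(3)[OF assms(2), of x]
  by (simp add: blinfun.diff_left cinner_diff_left)
 then have "S - T = 0" using assms(1) by (intro selfadj_eq_zero) (auto simp: pos_op_def)
 then show ?thesis by simp
qed

lemma closed_selfadj: "closed {T. T \<in> \<L> & adj T = (T::'h::complex_hilbert_space op)}"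
proof -
 have "{T. T \<in> \<L> & adj T = T} = \<L> \<inter>
  (\<Inter>x. \<Inter>y. {T::'h op. fm T x y = cinner x (ap T y)})"
  by (intro set_eqI iffI) (auto simp: selfadj_cinner intro: adj_unique)
 moreover have "closed {T::'h op. fm T x y = cinner x (ap T y)}" for x y
  by (intro closed_Collect_eq continuous_intros continuous_on_cinner)
 ultimately show ?thesis by (metis (no_types, lifting) closed_INT closed_Int closed_clinear)
qed

text \<open>The square root of \<open>1 - x\<close> is \<open>1 - y\<close> with \<open>y = (x + y\<^sup>2) / 2\<close>; the iterates are dominated in
 norm by the increments of the scalar iteration started at \<open>0\<close> with \<open>x = 1\<close>.\<close>

lemma ex_sqrt_contraction:
 fixes x :: "'h::complex_hilbert_space op"
 assumes x: "norm x \<le> 1" "x \<in> \<L>" "adj x = x"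
 shows "\<exists>y. norm y \<le> 1 & y \<in> \<L> & adj y = y & 2 *\<^sub>R y = x + (y oL y) & (\<forall>A. op_algebra A --> x \<in> A --> y \<in> A)"
proof -
 define y where "y = rec_nat 0 (\<lambda>_ z. (1/2) *\<^sub>R (x + (z oL z)))"
 define t :: "nat => real" where "t = rec_nat 0 (\<lambda>_ s. (1 + s^2) / 2)"
 have y0: "y 0 = 0" and yS: "y (Suc n) = (1/2) *\<^sub>R (x + (y n oL y n))" for n by (simp_all add: y_def)
 have t0: "t 0 = 0" and tS: "t (Suc n) = (1 + (t n)^2) / 2" for n by (simp_all add: t_def)
 have tb: "0 \<le> t n & t n \<le> 1" for n
 proof (induction n)
  case (Suc n) then show ?case using power_le_one[of "t n" 2] by (simp add: tS)
 qed (simp add: t0)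
 have ty: "norm (y n) \<le> t n" for n
 proof (induction n)
  case (Suc n)
  have "norm (y n oL y n) \<le> norm (y n) * norm (y n)" by (rule norm_blinfun_compose)
  also have "... \<le> (t n)^2" using Suc tb[of n] by (auto simp: power2_eq_square intro: mult_mono)
  finally have "norm (x + (y n oL y n)) \<le> 1 + (t n)^2" using x(1) norm_triangle_ineq[of x "y n oL y n"] by linarith
  then show ?case by (simp add: yS tS)
 qed (simp add: y0 t0)
 have step: "norm (y (Suc n) - y n) \<le> t (Suc n) - t n" for n
 proof (induction n)
  case 0 then show ?case using x(1) by (simp add: y0 yS tS t0 compose_zero_left)
 next
  case (Suc n)
  let ?a = "y (Suc n)" and ?b = "y n"
  have "y (Suc (Suc n)) - ?a = (1/2) *\<^sub>R ((?a oL ?a) - (?b oL ?b))"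
   unfolding yS[of "Suc n"] by (subst yS[of n]) (simp flip: scaleR_right_diff_distrib)
  also have "(?a oL ?a) - (?b oL ?b) = (?a oL (?a - ?b)) + ((?a - ?b) oL ?b)"
   by (simp add: compose_simps)
  finally have "norm (y (Suc (Suc n)) - ?a) = norm ((?a oL (?a - ?b)) + ((?a - ?b) oL ?b)) / 2" by simp
  also have "... \<le> (norm ?a * norm (?a - ?b) + norm (?a - ?b) * norm ?b) / 2"
   by (intro divide_right_mono order_trans[OF norm_triangle_ineq] add_mono norm_blinfun_compose) simp
  also have "... \<le> (t (Suc n) * (t (Suc n) - t n) + (t (Suc n) - t n) * t n) / 2"
   by (intro divide_right_mono add_mono mult_mono ty Suc order_trans[OF norm_ge_zero Suc] norm_ge_zero conjunct1[OF tb]) simp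
  also have "... = t (Suc (Suc n)) - t (Suc n)"
   unfolding tS[of "Suc n"] by (subst (5) tS[of n]) (simp add: field_simps power2_eq_square)
  finally show ?case .
 qed
 have inc: "incseq t" using order_trans[OF norm_ge_zero step] by (intro incseq_SucI) simp
 have dif: "norm (y (n + k) - y n) \<le> t (n + k) - t n" for n k
 proof (induction k)
  case (Suc k)
  have "norm (y (n + Suc k) - y n) \<le> norm (y (Suc (n + k)) - y (n + k)) + norm (y (n + k) - y n)"
   by (metis add_Suc_right dist_norm dist_triangle)
  with step[of "n + k"] Suc show ?case by simp
 qed simp
 have "Cauchy t"
  using inc tb by (intro convergent_Cauchy Bseq_mono_convergent) (auto intro!: BseqI'[of _ 1] simp: incseq_def)
 have "Cauchy y"
 proof (rule metric_CauchyI)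
  fix e :: real assume "0 < e"
  then obtain M where M: "!!m n. m \<ge> M ==> n \<ge> M ==> dist (t m) (t n) < e"
   using metric_CauchyD[OF \<open>Cauchy t\<close>] by blast
  have 1: "dist (y m) (y n) < e" if "m \<ge> n" "n \<ge> M" for m n
   using dif[of n "m - n"] M[of m n] that by (simp add: dist_norm)
  have "dist (y m) (y n) < e" if "m \<ge> M" "n \<ge> M" for m n
   using 1[of m n] 1[of n m] that by (cases "m \<ge> n") (auto simp: dist_commute)
  then show "\<exists>M. \<forall>m\<ge>M. \<forall>n\<ge>M. dist (y m) (y n) < e" by blast
 qed
 then obtain Y where Y: "y \<longlonglongrightarrow> Y" using Cauchy_convergent convergent_def by metis
 have inA: "Y \<in> A" if A: "closed A" "!!n. y n \<in> A" for A using closed_sequentially[OF A(1) _ Y] A(2) by blast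
 have alg: "y n \<in> A" if "op_algebra A" "x \<in> A" for A n
 proof (induction n)
  case (Suc n) then show ?case unfolding yS by (intro op_algebraD[OF that(1)] that(2))
 qed (simp add: y0 op_algebraD(8)[OF that(1)])
 have sa: "y n \<in> \<L> & adj (y n) = y n" for n
 proof (induction n)
  case (Suc n) then show ?case unfolding yS
   by (simp add: adj_scaleR adj_add adj_compose clinear_intros x)
 qed (simp add: y0 adj_zero clinear_zero)
 have "Y \<in> {T. T \<in> \<L> & adj T = T}" by (rule inA[OF closed_selfadj]) (use sa in auto)
 moreover have "Y \<in> cball 0 1" by (rule inA) (use ty tb order_trans in \<open>auto, blast\<close>)
 moreover have "2 *\<^sub>R Y = x + (Y oL Y)"
 proof -
  have "(\<lambda>n. 2 *\<^sub>R y (Suc n)) \<longlonglongrightarrow> 2 *\<^sub>R Y" by (intro tendsto_intros LIMSEQ_Suc Y)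
  moreover have "(\<lambda>n. 2 *\<^sub>R y (Suc n)) = (\<lambda>n. x + (y n oL y n))" by (simp add: yS)
  moreover have "(\<lambda>n. x + (y n oL y n)) \<longlonglongrightarrow> x + (Y oL Y)" by (intro tendsto_intros Y)
  ultimately show ?thesis using LIMSEQ_unique by metis
 qed
 moreover have "Y \<in> A" if "op_algebra A" "x \<in> A" for A
  by (rule inA[OF op_algebraD(1)[OF that(1)] alg[OF that]])
 ultimately show ?thesis by (intro exI[of _ Y]) auto
qed

text \<open>The last conjunct stands in for functional calculus: every algebra containing
  \<open>T\<close>, whether a commutant or a fixed-point algebra, contains this same root.\<close>

lemma ex_sqrt:
 assumes T: "pos_op T"
 shows "\<exists>S. pos_op S & S oL S = T & (\<forall>A. op_algebra A --> T \<in> A --> S \<in> A)"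
proof -
 \<comment> \<open>The added 1 keeps \<open>M\<close> positive even for \<open>T = 0\<close>;
   \<open>1 - T / M\<close> is then a positive contraction.\<close>
 define M where "M = norm T + 1"
 have M: "M > 0" by (simp add: M_def add_nonneg_pos)
 define x where "x = Id1 - (1 / M) *\<^sub>R T"
 have Rx: "Re (fm x v v) = (norm v)^2 - Re (fm T v v) / M" for v
  by (simp add: x_def blinfun.bilinear_simps cinner_simps cinner_self)
 have le: "Re (fm T v v) / M \<le> (norm v)^2" for v
 proof -
  have "Re (fm T v v) \<le> M * (norm v)^2"
   using Re_cinner_op_le[of T v] by (simp add: M_def distrib_right add_increasing2)
  then show ?thesis using M by (simp add: field_simps)
 qed
 have xc: "x \<in> \<L>" "adj x = x"
  using pos_opD[OF T] by (simp_all add: x_def clinear_intros adj_diff adj_id adj_scaleR)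
 have px: "pos_op x" using xc le by (simp add: pos_op_def Rx)
 have "norm x \<le> 1"
  by (rule pos_op_norm_le[OF px]) (use pos_opD(3)[OF T] M in \<open>simp_all add: Rx\<close>)
 then obtain y where y: "norm y \<le> 1" "y \<in> \<L>" "adj y = y" "2 *\<^sub>R y = x + (y oL y)"
  "!!A. op_algebra A ==> x \<in> A ==> y \<in> A"
  using ex_sqrt_contraction[OF _ xc] by blast
 define S where "S = sqrt M *\<^sub>R (Id1 - y)"
 have "(Id1 - y) oL (Id1 - y) = Id1 - 2 *\<^sub>R y + (y oL y)"
  by (simp add: compose_simps scaleR_2)
 also have "... = (1 / M) *\<^sub>R T" by (simp add: y(4) x_def)
 finally have e: "(Id1 - y) oL (Id1 - y) = (1 / M) *\<^sub>R T" .
 have "S oL S = (sqrt M * sqrt M) *\<^sub>R ((Id1 - y) oL (Id1 - y))"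
  by (simp only: S_def compose_scaleR_left compose_scaleR_right scaleR_scaleR)
 also have "... = T" unfolding e using M by simp
 finally have "S oL S = T" .
 moreover have "Re (fm (Id1 - y) v v) \<ge> 0" for v
 proof -
  have "Re (fm y v v) \<le> 1 * (norm v)^2"
   using Re_cinner_op_le[of y v] mult_right_mono[OF y(1), of "(norm v)^2"] by simp
  then show ?thesis by (simp add: blinfun.bilinear_simps cinner_simps cinner_self)
 qed
 then have "pos_op (Id1 - y)" using y by (simp add: pos_op_def clinear_intros adj_diff adj_id)
 then have "pos_op S" unfolding S_def by (rule pos_op_scaleR) (use M in simp)
 moreover have "S \<in> A" if A: "op_algebra A" "T \<in> A" for A
 proof -
  have "x \<in> A" unfolding x_def by (intro op_algebraD[OF A(1)] A(2))
  then show ?thesis unfolding S_def by (intro op_algebraD[OF A(1)] y(5) A(1))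
 qed
 ultimately show ?thesis by blast
qed

text \<open>The lower bound makes \<open>T\<close> injective with closed range. A vector orthogonal
  to the range has vanishing quadratic form, so it is zero and \<open>T\<close> is onto.\<close>

lemma ex_inverse:
 assumes T: "pos_op T" and c: "0 < c" "!!x. c * (norm x)^2 \<le> Re (fm T x x)"
 shows "\<exists>X. pos_op X & T oL X = Id1 & X oL T = Id1 & norm X \<le> 1 / c & (\<forall>S. T \<in> commutant S --> X \<in> commutant S)"
proof -
 have lin: "ap T (a *\<^sub>C x) = a *\<^sub>C ap T x" for a x
  by (rule clinear_scaleC[OF pos_opD(1)[OF T]])
 have lb: "c * norm x \<le> norm (ap T x)" for x
 proof (cases "x = 0")
  case False
  have "c * norm x * norm x \<le> norm (ap T x) * norm x"
   using c(2)[of x] norm_cinner_le[of "ap T x" x] complex_Re_le_cmod[of "fm T x x"]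
   by (simp add: power2_eq_square mult.assoc)
  with False show ?thesis by simp
 qed simp
 have sub: "csubspace (range (ap T))"
  unfolding csubspace_def
 proof (intro conjI ballI allI)
  show "0 \<in> range (ap T)" by (metis blinfun.zero_right rangeI)
  show "x + y \<in> range (ap T)" if "x \<in> range (ap T)" "y \<in> range (ap T)" for x y
   using that by (auto simp flip: blinfun.add_right)
  show "a *\<^sub>C x \<in> range (ap T)" if "x \<in> range (ap T)" for a x
   using that by (auto simp flip: lin)
 qed
 have "closed (range (ap T))"
  unfolding closed_sequential_limits
 proof (intro allI impI, elim conjE)
  fix f l assume f: "\<forall>n. f n \<in> range (ap T)" and l: "f \<longlonglongrightarrow> l"
  from f have "\<forall>n. \<exists>x. f n = ap T x" by auto
  then obtain g where g: "!!n. f n = ap T (g n)" by metis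
  have "Cauchy g"
  proof (rule metric_CauchyI)
   fix e :: real assume "0 < e"
   then obtain M where M: "!!m n. m \<ge> M ==> n \<ge> M ==> dist (f m) (f n) < c * e"
    using metric_CauchyD[OF LIMSEQ_imp_Cauchy[OF l], of "c * e"] c(1) by auto
   have "dist (g m) (g n) < e" if "m \<ge> M" "n \<ge> M" for m n
   proof -
    have "c * norm (g m - g n) < c * e"
     using lb[of "g m - g n"] M[OF that] by (simp add: g dist_norm blinfun.diff_right)
    then show ?thesis using c(1) by (simp add: dist_norm)
   qed
   then show "\<exists>M. \<forall>m\<ge>M. \<forall>n\<ge>M. dist (g m) (g n) < e" by blast
  qed
  then obtain x where "g \<longlonglongrightarrow> x" using Cauchy_convergent convergent_def by metis
  then have "f \<longlonglongrightarrow> ap T x" unfolding g by (intro tendsto_intros)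
  then show "l \<in> range (ap T)" using LIMSEQ_unique[OF l] by simp
 qed
 then have surj: "\<exists>x. ap T x = y" for y
 proof -
  obtain z where z: "z \<in> range (ap T)" "!!w. w \<in> range (ap T) ==> cinner (y - z) w = 0"
   using closest_point_subspace[OF \<open>closed _\<close> sub, of y] by blast
  have "cinner (y - z) (ap T (y - z)) = 0" by (rule z(2)) simp
  then have "fm T (y - z) (y - z) = 0" by (metis cinner_commute complex_cnj_zero)
  then have "c * (norm (y - z))^2 \<le> 0" using c(2)[of "y - z"] by simp
  then have "y = z" using c(1) by (simp add: mult_le_0_iff)
  with z(1) show ?thesis by auto
 qed
 then obtain g where g: "!!y. ap T (g y) = y" by metis
 have inj: "x = y" if "ap T x = ap T y" for x y
  using lb[of "x - y"] that c(1) by (simp add: blinfun.diff_right mult_le_0_iff)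
 have "g (x + y) = g x + g y" for x y by (rule inj) (simp add: g blinfun.add_right)
 moreover have "g (a *\<^sub>C x) = a *\<^sub>C g x" for a x by (rule inj) (simp add: g lin)
 moreover have "norm (g y) \<le> 1 / c * norm y" for y using lb[of "g y"] c(1) by (simp add: g field_simps)
 ultimately obtain X where X: "X \<in> \<L>" "!!x. ap X x = g x" "norm X \<le> 1 / c"
  using ex_clinear_op[of g "1 / c"] c(1) by auto
 have 1: "T oL X = Id1" by (rule blinfun_eqI) (simp add: X g)
 have 2: "X oL T = Id1" by (rule blinfun_eqI, rule inj) (simp add: X g)
 have "adj X oL T = Id1"
  using arg_cong[OF 1, of adj] by (simp add: adj_compose X pos_opD[OF T] adj_id)
 then have aX: "adj X = X" by (metis 1 compose_assoc compose_id_left compose_id_right)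
 have "0 \<le> Re (fm X x x)" for x
 proof -
  have "fm X x x = fm X x (ap T (ap X x))"
   by (simp add: X g)
  then show ?thesis using pos_opD(3)[OF T, of "ap X x"] selfadj_cinner[OF pos_opD(1,2)[OF T]] by metis
 qed
 then have "pos_op X" using X aX by (simp add: pos_op_def)
 moreover have "X \<in> commutant S" if "T \<in> commutant S" for S
 proof (rule commutantI[OF X(1)])
  fix A assume A: "A \<in> S"
  have "X oL A = X oL ((A oL T) oL X)" by (simp add: 1 compose_simps)
  also have "... = X oL ((T oL A) oL X)" using commutantD[OF that A] by simp
  also have "... = (X oL T) oL (A oL X)" by (simp only: compose_assoc)
  finally show "X oL A = A oL X" by (simp add: 2 compose_simps)
 qed
 ultimately show ?thesis using 1 2 X(3) by blast
qed

section \<open>Compactness in the weak operator topology\<close>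

text \<open>The closure in the weak operator topology, phrased by basic neighbourhoods so that the
  operator type keeps its norm topology.\<close>

definition wot_closure :: "'h::complex_hilbert_space op set => 'h op set" where
 "wot_closure S = {T. \<forall>E e. finite E --> 0 < e -->
   (\<exists>T'\<in>S. \<forall>(x, y)\<in>E. norm (fm T' x y - fm T x y) < e)}"

lemma wot_closureD:
 assumes "T \<in> wot_closure S" "finite E" "0 < e"
 shows "\<exists>T'\<in>S. \<forall>(x, y)\<in>E. norm (fm T' x y - fm T x y) < e"
 using assms unfolding wot_closure_def by blast

lemma wot_closure_mono: "S <= S' ==> wot_closure S <= wot_closure S'"
 unfolding wot_closure_def by (auto, blast)

lemma norm_le_all_eps: "(!!e::real. 0 < e ==> norm (a::'a::real_normed_vector) \<le> C * e) ==> a = 0"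
proof (rule ccontr)
 assume h: "!!e. 0 < e ==> norm a \<le> C * e" and "a \<noteq> 0"
 then have n: "norm a > 0" by simp
 have "norm a \<le> C" using h[of 1] by simp
 with n have C: "C > 0" by linarith
 with h[of "norm a / (2 * C)"] n show False by (simp add: field_simps)
qed

lemma norm_three_le:
 fixes a b c :: "'a::real_normed_vector"
 shows "norm a < e ==> norm b < e ==> norm c < e ==> norm (- a + b + c) \<le> 3 * e"
 using norm_triangle_ineq[of "- a + b" c] norm_triangle_ineq[of "- a" b] by simp

text \<open>Weak compactness of balls, by Tychonoff for the product of the discs that contain the
  matrix coefficients; sesquilinearity survives in the limit. Downward directed families of sets
  play the role of nets.\<close>

lemma wot_compact:
 fixes F :: "'h::complex_hilbert_space op set set"
 assumes ne: "F \<noteq> {}" "!!S. S \<in> F ==> S \<noteq> {}"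
  and bd: "!!S T. S \<in> F ==> T \<in> S ==> T \<in> \<L> & norm T \<le> R"
  and dir: "!!S S'. S \<in> F ==> S' \<in> F ==> \<exists>S''\<in>F. S'' <= S \<inter> S'"
 shows "\<exists>T\<in>\<L>. norm T \<le> R & (\<forall>S\<in>F. T \<in> wot_closure S)"
proof -
 define form where "form = (\<lambda>(T::'h op) (x, y). fm T x y)"
 define X where "X = PiE UNIV (\<lambda>(x::'h, y::'h). cball (0::complex) (R * norm x * norm y))"
 obtain S0 T0 where S0: "S0 \<in> F" "T0 \<in> S0" using ne by blast
 have R: "0 \<le> R" using bd[OF S0] norm_ge_zero order_trans by blast
 have "compactin (product_topology (\<lambda>_. euclidean) UNIV) X"
  unfolding X_def by (subst compactin_PiE) (auto split: prod.split)
 then have cX: "compact X" by (simp add: euclidean_product_topology)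
 have fX: "form T \<in> X" if "S \<in> F" "T \<in> S" for S T
 proof -
  have "norm (fm T x y) \<le> R * norm x * norm y" for x y
   by (rule order_trans[OF norm_cinner_le]) (intro mult_right_mono norm_blinfun_apply_le, use bd[OF that] in auto)
  then show ?thesis by (auto simp: X_def form_def PiE_def extensional_def)
 qed
 define C where "C = (\<lambda>S. closure (form ` S)) ` F"
 have "X \<inter> \<Inter>C \<noteq> {}"
 proof (rule compact_imp_fip[OF cX])
  show "closed T" if "T \<in> C" for T using that by (auto simp: C_def)
  fix C' assume C': "finite C'" "C' <= C"
  then obtain F' where F': "F' <= F" "finite F'" "C' = (\<lambda>S. closure (form ` S)) ` F'"
   unfolding C_def using finite_subset_image by meson
  have "\<exists>S''\<in>F. \<forall>S\<in>F'. S'' <= S"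
   using F'(2,1)
  proof (induction F' rule: finite_induct)
   case empty then show ?case using ne by blast
  next
   case (insert S F')
   then obtain S1 where S1: "S1 \<in> F" "\<forall>S\<in>F'. S1 <= S" by auto
   obtain S2 where "S2 \<in> F" "S2 <= S \<inter> S1" using dir[of S S1] insert.prems S1 by auto
   with S1 show ?case by (intro bexI[of _ S2]) auto
  qed
  then obtain S'' where S'': "S'' \<in> F" "!!S. S \<in> F' ==> S'' <= S" by blast
  obtain T where T: "T \<in> S''" using ne S''(1) by blast
  have "form T \<in> X \<inter> \<Inter>C'"
   using fX[OF S''(1) T] S''(2) T closure_subset by (fastforce simp: F'(3))
  then show "X \<inter> \<Inter>C' \<noteq> {}" by blast
 qed
 then obtain f where f: "f \<in> X" "!!S. S \<in> F ==> f \<in> closure (form ` S)" by (auto simp: C_def)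
 have app: "\<exists>T\<in>S. \<forall>p\<in>E. norm (form T p - f p) < e" if "S \<in> F" "finite E" "0 < e" for S E e
 proof -
  have "open (\<Inter>p\<in>E. {g. norm (g p - f p) < e})"
   using that(2) by (intro open_INT ballI open_Collect_less continuous_intros) auto
  moreover have "f \<in> (\<Inter>p\<in>E. {g. norm (g p - f p) < e})" using that by simp
  ultimately have "form ` S \<inter> (\<Inter>p\<in>E. {g. norm (g p - f p) < e}) \<noteq> {}"
   using f(2)[OF that(1)] unfolding closure_iff_nhds_not_empty by blast
  then show ?thesis by auto
 qed
 have fb: "norm (f (x, y)) \<le> R * norm x * norm y" for x y
  using f(1) by (auto simp: X_def PiE_def Pi_def dest!: spec[of _ "(x, y)"])
 have app': "\<exists>T\<in>\<L>. \<forall>(x, y)\<in>E. norm (fm T x y - f (x, y)) < e" if "finite E" "0 < e" for E e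
  using app[OF S0(1) that] bd[OF S0(1)] by (fastforce simp: form_def)
 have "\<exists>T\<in>\<L>. norm T \<le> R & (\<forall>x y. fm T x y = f (x, y))"
 proof (rule form_op[of "\<lambda>x y. f (x, y)"])
  fix x y z :: 'h and c :: complex
  have "f (x + y, z) - f (x, z) - f (y, z) = 0"
  proof (rule norm_le_all_eps[of _ 3])
   fix e :: real assume "0 < e"
   then obtain T where T: "T \<in> \<L>" "\<forall>(u, v)\<in>{(x + y, z), (x, z), (y, z)}. norm (fm T u v - f (u, v)) < e"
    using app'[of "{(x + y, z), (x, z), (y, z)}" e] by blast
   have "f (x + y, z) - f (x, z) - f (y, z) = - (fm T (x + y) z - f (x + y, z))
    + (fm T x z - f (x, z)) + (fm T y z - f (y, z))"
    by (simp add: blinfun.add_right cinner_add_left)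
   then show "norm (f (x + y, z) - f (x, z) - f (y, z)) \<le> 3 * e"
    using T(2) by (simp only:) (intro norm_three_le, auto)
  qed
  then show "f (x + y, z) = f (x, z) + f (y, z)" by (simp add: algebra_simps)
  have "f (x, y + z) - f (x, y) - f (x, z) = 0"
  proof (rule norm_le_all_eps[of _ 3])
   fix e :: real assume "0 < e"
   then obtain T where T: "T \<in> \<L>" "\<forall>(u, v)\<in>{(x, y + z), (x, y), (x, z)}. norm (fm T u v - f (u, v)) < e"
    using app'[of "{(x, y + z), (x, y), (x, z)}" e] by blast
   have "f (x, y + z) - f (x, y) - f (x, z) = - (fm T x (y + z) - f (x, y + z))
    + (fm T x y - f (x, y)) + (fm T x z - f (x, z))"
    by (simp add: cinner_add_right)
   then show "norm (f (x, y + z) - f (x, y) - f (x, z)) \<le> 3 * e"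
    using T(2) by (simp only:) (intro norm_three_le, auto)
  qed
  then show "f (x, y + z) = f (x, y) + f (x, z)" by (simp add: algebra_simps)
  have "f (c *\<^sub>C x, y) - c * f (x, y) = 0"
  proof (rule norm_le_all_eps[of _ "1 + norm c"])
   fix e :: real assume "0 < e"
   then obtain T where T: "T \<in> \<L>" "\<forall>(u, v)\<in>{(c *\<^sub>C x, y), (x, y)}. norm (fm T u v - f (u, v)) < e"
    using app'[of "{(c *\<^sub>C x, y), (x, y)}" e] by blast
   have "f (c *\<^sub>C x, y) - c * f (x, y) = - (fm T (c *\<^sub>C x) y - f (c *\<^sub>C x, y))
    + c * (fm T x y - f (x, y))"
    by (simp add: clinear_scaleC[OF T(1)] cinner_scaleC_left algebra_simps)
   also have "norm ... \<le> e + norm c * e"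
    using T(2) by (intro norm_triangle_mono) (auto simp: norm_mult norm_minus_commute intro!: mult_left_mono)
   finally show "norm (f (c *\<^sub>C x, y) - c * f (x, y)) \<le> (1 + norm c) * e" by (simp add: algebra_simps)
  qed
  then show "f (c *\<^sub>C x, y) = c * f (x, y)" by simp
  have "f (x, c *\<^sub>C y) - cnj c * f (x, y) = 0"
  proof (rule norm_le_all_eps[of _ "1 + norm c"])
   fix e :: real assume "0 < e"
   then obtain T where T: "T \<in> \<L>" "\<forall>(u, v)\<in>{(x, c *\<^sub>C y), (x, y)}. norm (fm T u v - f (u, v)) < e"
    using app'[of "{(x, c *\<^sub>C y), (x, y)}" e] by blast
   have "f (x, c *\<^sub>C y) - cnj c * f (x, y) = - (fm T x (c *\<^sub>C y) - f (x, c *\<^sub>C y))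
    + cnj c * (fm T x y - f (x, y))"
    by (simp add: cinner_scaleC_right algebra_simps)
   also have "norm ... \<le> e + norm c * e"
    using T(2) by (intro norm_triangle_mono) (auto simp: norm_mult norm_minus_commute intro!: mult_left_mono)
   finally show "norm (f (x, c *\<^sub>C y) - cnj c * f (x, y)) \<le> (1 + norm c) * e" by (simp add: algebra_simps)
  qed
  then show "f (x, c *\<^sub>C y) = cnj c * f (x, y)" by simp
 qed (use fb R in auto)
 then obtain T where T: "T \<in> \<L>" "norm T \<le> R" "!!x y. fm T x y = f (x, y)" by blast
 have "T \<in> wot_closure S" if "S \<in> F" for S
  unfolding wot_closure_def using app[OF that] by (fastforce simp: T(3) form_def)
 with T(1,2) show ?thesis by blast
qed

lemma wot_closure_commutant:
 assumes "T \<in> wot_closure S" "T \<in> \<L>" "S <= commutant C" "C <= \<L>"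
 shows "T \<in> commutant C"
proof (rule commutantI[OF assms(2)])
 fix A assume A: "A \<in> C"
 then have Ac: "A \<in> \<L>" using assms(4) by blast
 show "T oL A = A oL T"
 proof (rule op_ext)
  fix x y
  have "fm T (ap A x) y - fm T x (ap (adj A) y) = 0"
  proof (rule norm_le_all_eps[of _ 2])
   fix e :: real assume "0 < e"
   then obtain T' where T': "T' \<in> S" "\<forall>(u, v)\<in>{(ap A x, y), (x, ap (adj A) y)}.
     norm (fm T' u v - fm T u v) < e"
    using wot_closureD[OF assms(1), of "{(ap A x, y), (x, ap (adj A) y)}" e] by blast
   have "T' \<in> commutant C" using T'(1) assms(3) by blast
   then have "fm T' (ap A x) y = fm T' x (ap (adj A) y)"
    using commutantD_apply[OF _ A] adj_works(1)[OF Ac] by metis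
   then have "fm T (ap A x) y - fm T x (ap (adj A) y)
    = - (fm T' (ap A x) y - fm T (ap A x) y)
     + (fm T' x (ap (adj A) y) - fm T x (ap (adj A) y))"
    by simp
   also have "norm ... \<le> e + e"
    using T'(2) by (intro norm_triangle_mono) (auto simp: norm_minus_commute)
   finally show "norm (fm T (ap A x) y - fm T x (ap (adj A) y)) \<le> 2 * e"
    by simp
  qed
  then show "fm (T oL A) x y = fm (A oL T) x y"
   using adj_works(1)[OF Ac] by simp
 qed
qed

lemma wot_closure_selfadj:
 assumes "T \<in> wot_closure S" "T \<in> \<L>" "!!A. A \<in> S ==> A \<in> \<L> & adj A = A"
 shows "adj T = T"
proof (rule adj_unique[OF assms(2) _ assms(2)])
 fix x y
 have "fm T x y - cnj (fm T y x) = 0"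
 proof (rule norm_le_all_eps[of _ 2])
  fix e :: real assume "0 < e"
  then obtain T' where T': "T' \<in> S" "\<forall>(u, v)\<in>{(x, y), (y, x)}.
    norm (fm T' u v - fm T u v) < e"
   using wot_closureD[OF assms(1), of "{(x, y), (y, x)}" e] by blast
  have "fm T' x y = cnj (fm T' y x)"
   using selfadj_cinner assms(3)[OF T'(1)] cinner_commute by metis
  then have "fm T x y - cnj (fm T y x)
   = - (fm T' x y - fm T x y)
    + cnj (fm T' y x - fm T y x)" by simp
  also have "norm ... \<le> e + e"
   unfolding complex_mod_cnj using T'(2) by (intro norm_triangle_mono) (auto simp: norm_minus_commute complex_mod_cnj simp del: complex_cnj_diff)
  finally show "norm (fm T x y - cnj (fm T y x)) \<le> 2 * e" by simp
 qed
 then show "fm T x y = cinner x (ap T y)" by (metis cinner_commute eq_iff_diff_eq_0)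
qed

text \<open>The tails of the sequence have a common weak cluster point. Since the quadratic forms
  increase, such a point is an upper bound and the forms converge to its form.\<close>

lemma increasing_op_limit:
 fixes e :: "nat => 'h::complex_hilbert_space op"
 assumes pos: "!!n. pos_op (e n)" and inc: "!!n. pos_op (e (Suc n) - e n)" and bd: "!!n. norm (e n) \<le> R"
 shows "\<exists>T. pos_op T & T \<in> wot_closure (range e) & (\<forall>n. pos_op (T - e n)) &
  (\<forall>x. (\<lambda>n. Re (fm (e n) x x)) \<longlonglongrightarrow> Re (fm T x x))"
proof -
 have mono: "Re (fm (e m) x x) \<le> Re (fm (e n) x x)" if "m \<le> n" for m n x
  using that
 proof (induction n rule: dec_induct)
  case (step n)
  then show ?case using pos_opD(3)[OF inc[of n], of x] by (simp add: blinfun.diff_left cinner_diff_left)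
 qed simp
 define F where "F = range (\<lambda>n. e ` {n..})"
 have "\<exists>T\<in>\<L>. norm T \<le> R & (\<forall>S\<in>F. T \<in> wot_closure S)"
 proof (rule wot_compact)
  show "\<exists>S''\<in>F. S'' <= S \<inter> S'" if SS: "S \<in> F" "S' \<in> F" for S S'
  proof -
   obtain n m where "S = e ` {n..}" "S' = e ` {m..}" using SS by (auto simp: F_def)
   then have "e ` {max n m..} <= S \<inter> S'" by auto
   then show ?thesis unfolding F_def by blast
  qed
 qed (auto simp: F_def pos_opD(1)[OF pos] bd)
 then obtain T where T: "T \<in> \<L>" "!!n. T \<in> wot_closure (e ` {n..})" by (auto simp: F_def)
 have T0: "T \<in> wot_closure (range e)" using T(2)[of 0] wot_closure_mono[of "e ` {0..}" "range e"] by auto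
 have adT: "adj T = T" by (rule wot_closure_selfadj[OF T0 T(1)]) (use pos_opD[OF pos] in auto)
 have near: "\<exists>m\<ge>n. \<bar>Re (fm (e m) x x) - Re (fm T x x)\<bar> < d" if "0 < d" for n x d
 proof -
  have "\<exists>T'\<in>e ` {n..}. \<forall>(u, v)\<in>{(x, x)}. norm (fm T' u v - fm T u v) < d"
   using wot_closureD[OF T(2)[of n], of "{(x, x)}" d] that by simp
  then obtain T' where "T' \<in> e ` {n..}" "norm (fm T' x x - fm T x x) < d"
   by auto
  then show ?thesis using abs_Re_le_cmod[of "fm T' x x - fm T x x"]
   by fastforce
 qed
 have le: "Re (fm (e n) x x) \<le> Re (fm T x x)" for n x
 proof (rule field_le_epsilon)
  fix d :: real assume "0 < d"
  then obtain m where m: "m \<ge> n" "\<bar>Re (fm (e m) x x) - Re (fm T x x)\<bar> < d"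
   using near by blast
  with mono[OF m(1), of x] show "Re (fm (e n) x x) \<le> Re (fm T x x) + d" by linarith
 qed
 have p: "pos_op (T - e n)" for n
  using le[of n] pos_opD[OF pos[of n]] T(1) adT
  by (simp add: pos_op_def clinear_diff adj_diff blinfun.diff_left cinner_diff_left)
 have "(\<lambda>n. Re (fm (e n) x x)) \<longlonglongrightarrow> Re (fm T x x)" for x
 proof (rule LIMSEQ_I)
  fix d :: real assume "0 < d"
  then obtain m where m: "\<bar>Re (fm (e m) x x) - Re (fm T x x)\<bar> < d"
   using near by blast
  have "norm (Re (fm (e n) x x) - Re (fm T x x)) < d" if "n \<ge> m" for n
   using m mono[OF that, of x] le[of n x] by simp
  then show "\<exists>no. \<forall>n\<ge>no. norm (Re (fm (e n) x x) - Re (fm T x x)) < d" by blast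
 qed
 moreover have "pos_op T" using pos_op_add[OF p[of 0] pos[of 0]] by simp
 ultimately show ?thesis using p T0 by blast
qed

section \<open>Factors and automorphisms\<close>

lemma vn_double: "von_neumann_algebra B ==> commutant (commutant B) = B"
 by (simp add: von_neumann_algebra_def)
lemma vn_adj: "von_neumann_algebra B ==> T \<in> B ==> adj T \<in> B"
 by (simp add: von_neumann_algebra_def)
lemma vn_op_algebra: "von_neumann_algebra B ==> op_algebra B"
 by (metis vn_double op_algebra_commutant)
lemma vn_clinear: "von_neumann_algebra B ==> T \<in> B ==> T \<in> \<L>"
 by (metis vn_double commutant_clinear)
lemma vn_scalar: "von_neumann_algebra B ==> scalar_op c \<in> B"
 by (metis vn_double commutant_scalar commutant_clinear subsetI)
lemma vn_commutant_adj: "von_neumann_algebra B ==> T \<in> commutant B ==> adj T \<in> commutant B"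
 by (rule commutant_adj) (auto simp: vn_clinear vn_adj)
lemma vn_wot_closure:
 assumes "von_neumann_algebra B" "S <= B" "T \<in> wot_closure S" "T \<in> \<L>" shows "T \<in> B"
proof -
 have "T \<in> commutant (commutant B)"
  by (rule wot_closure_commutant[OF assms(3,4)]) (use assms(2) vn_double[OF assms(1)] commutant_clinear in auto)
 then show ?thesis by (simp add: vn_double[OF assms(1)])
qed
lemma vn_memI:
 assumes "von_neumann_algebra B" "T \<in> \<L>" "!!S. S \<in> commutant B ==> T oL S = S oL T" shows "T \<in> B"
 using commutantI[of T "commutant B"] assms by (simp add: vn_double)

lemma scalar_op_of_real: "scalar_op (of_real r) oL T = r *\<^sub>R T"
 by (rule blinfun_eqI) (simp add: scalar_op_apply scaleC_of_real blinfun.scaleR_left)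

lemma vn_inverse:
 assumes B: "von_neumann_algebra B" "T \<in> B" and X: "X \<in> \<L>" "T oL X = Id1" "X oL T = Id1"
 shows "X \<in> B"
proof (rule vn_memI[OF B(1) X(1)])
 fix S assume S: "S \<in> commutant B"
 have "X oL S = X oL ((S oL T) oL X)" by (simp add: X compose_simps)
 also have "... = X oL ((T oL S) oL X)" using commutantD[OF S B(2)] by simp
 also have "... = (X oL T) oL (S oL X)" by (simp only: compose_assoc)
 finally show "X oL S = S oL X" by (simp add: X compose_simps)
qed

lemma star_autD:
 assumes "star_automorphism B \<phi>"
 shows "!!x. x \<in> B ==> \<phi> x \<in> B" "!!x y. x \<in> B ==> y \<in> B ==> \<phi> (x + y) = \<phi> x + \<phi> y"
  "!!x y. x \<in> B ==> y \<in> B ==> \<phi> (x oL y) = \<phi> x oL \<phi> y" "!!x. x \<in> B ==> \<phi> (adj x) = adj (\<phi> x)"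
  "!!x c. x \<in> B ==> \<phi> (scalar_op c oL x) = scalar_op c oL \<phi> x" "inj_on \<phi> B" "\<phi> ` B = B"
 using assms unfolding star_automorphism_def bij_betw_def by blast+

text \<open>An automorphism is given only algebraically. It preserves positivity because square
  roots stay in \<open>B\<close>, and it is contractive because positivity applies to
  \<open>(norm x)^2 - adj x oL x\<close>.\<close>

lemma star_aut_more:
 assumes B: "von_neumann_algebra B" and \<phi>: "star_automorphism B \<phi>"
 shows "\<phi> Id1 = Id1" "!!r x. x \<in> B ==> \<phi> (r *\<^sub>R x) = r *\<^sub>R \<phi> x"
  "!!x y. x \<in> B ==> y \<in> B ==> \<phi> (x - y) = \<phi> x - \<phi> y" "\<phi> 0 = 0"
  "!!x. x \<in> B ==> pos_op x ==> pos_op (\<phi> x)" "!!x. x \<in> B ==> norm (\<phi> x) \<le> norm x"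
  "!!x. x \<in> B ==> \<phi> x = 0 ==> x = 0"
proof -
 note alg = op_algebraD[OF vn_op_algebra[OF B]]
 have idB: "Id1 \<in> B" by (rule alg(3))
 then obtain u where u: "u \<in> B" "\<phi> u = Id1" using star_autD(7)[OF \<phi>] by (metis imageE)
 have "\<phi> (Id1 oL u) = \<phi> Id1 oL Id1" using star_autD(3)[OF \<phi> idB u(1)] u(2) by simp
 then show 1: "\<phi> Id1 = Id1" by (simp add: u compose_simps)
 show r: "\<phi> (r *\<^sub>R x) = r *\<^sub>R \<phi> x" if "x \<in> B" for r x
  using star_autD(5)[OF \<phi> that, of "of_real r"] by (simp add: scalar_op_of_real)
 show d: "\<phi> (x - y) = \<phi> x - \<phi> y" if "x \<in> B" "y \<in> B" for x y
  using star_autD(2)[OF \<phi> that(1) alg(6)[OF that(2), of "-1"]] r[OF that(2), of "-1"] by simp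
 show z: "\<phi> 0 = 0" using d[OF idB idB] by simp
 show p: "pos_op (\<phi> x)" if x: "x \<in> B" "pos_op x" for x
 proof -
  obtain s where s: "pos_op s" "s oL s = x" "s \<in> B" using ex_sqrt[OF x(2)] vn_op_algebra[OF B] x(1) by blast
  have "\<phi> x = adj (\<phi> s) oL \<phi> s" using star_autD(3)[OF \<phi> s(3,3)] star_autD(4)[OF \<phi> s(3)] pos_opD(2)[OF s(1)] s(2) by simp
  then show ?thesis using pos_op_adj_comp(1)[OF vn_clinear[OF B star_autD(1)[OF \<phi> s(3)]]] by simp
 qed
 show "norm (\<phi> x) \<le> norm x" if x: "x \<in> B" for x
 proof (rule norm_blinfun_bound)
  fix v
  let ?d = "(norm x)^2 *\<^sub>R Id1 - (adj x oL x)"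
  have xc: "x \<in> \<L>" "\<phi> x \<in> \<L>" using vn_clinear[OF B] x star_autD(1)[OF \<phi> x] by auto
  have ax: "adj x \<in> B" by (rule vn_adj[OF B x])
  have dB: "?d \<in> B" by (intro alg ax x)
  have "pos_op ?d"
   unfolding pos_op_def
  proof (intro conjI allI)
   show "?d \<in> \<L>" using dB vn_clinear[OF B] by blast
   show "adj ?d = ?d" using xc by (simp add: adj_diff clinear_intros adj_scaleR adj_id adj_compose adj_adj)
   fix w
   have "(norm (ap x w))^2 \<le> (norm x * norm w)^2" by (intro power_mono norm_blinfun) simp
   then show "0 \<le> Re (fm ?d w w)"
    using Re_cinner_adj_comp[OF xc(1), of w]
    by (simp add: blinfun.bilinear_simps cinner_simps cinner_self power_mult_distrib)
  qed
  then have "pos_op (\<phi> ?d)" by (rule p[OF dB])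
  moreover have "\<phi> ?d = (norm x)^2 *\<^sub>R Id1 - (adj (\<phi> x) oL \<phi> x)"
   by (simp add: d r alg idB ax x 1 star_autD(3)[OF \<phi> ax x] star_autD(4)[OF \<phi> x])
  ultimately have "0 \<le> Re (fm ((norm x)^2 *\<^sub>R Id1 - (adj (\<phi> x) oL \<phi> x)) v v)"
   using pos_opD(3) by metis
  then have "(norm (ap (\<phi> x) v))^2 \<le> (norm x * norm v)^2"
   using Re_cinner_adj_comp[OF xc(2), of v]
   by (simp add: blinfun.bilinear_simps cinner_simps cinner_self power_mult_distrib)
  then show "norm (ap (\<phi> x) v) \<le> norm x * norm v" by (rule power2_le_imp_le) simp
 qed simp
 show "x = 0" if "x \<in> B" "\<phi> x = 0" for x
  using inj_onD[OF star_autD(6)[OF \<phi>], of x 0] z that alg(8) by simp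
qed

section \<open>Extension of densely defined bounded maps\<close>

text \<open>Uniform continuity extends \<open>f\<close> to the closure of \<open>D\<close>;
  composing with the projection onto that closure makes the extension vanish on the orthogonal
  complement.\<close>

lemma extend_bounded:
 fixes f :: "'h::complex_hilbert_space => 'k::complex_hilbert_space"
 assumes D: "csubspace D" and add: "!!x y. x \<in> D ==> y \<in> D ==> f (x + y) = f x + f y"
  and sc: "!!c x. x \<in> D ==> f (c *\<^sub>C x) = c *\<^sub>C f x" and bd: "!!x. x \<in> D ==> norm (f x) \<le> C * norm x" and C: "0 \<le> C"
 shows "\<exists>T. norm T \<le> C & (\<forall>c x. ap T (c *\<^sub>C x) = c *\<^sub>C ap T x) & (\<forall>x\<in>D. ap T x = f x) &
  (\<forall>x. (\<forall>y\<in>D. cinner x y = 0) --> ap T x = 0)"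
proof -
 have f_diff: "f (x - y) = f x - f y" if "x \<in> D" "y \<in> D" for x y
  using add[OF csubspaceD(5)[OF D that] that(2)] by simp
 have "uniformly_continuous_on D f"
  unfolding uniformly_continuous_on_def
 proof (intro allI impI)
  fix e :: real assume e: "0 < e"
  have "dist (f x') (f x) < e" if "x \<in> D" "x' \<in> D" "dist x' x < e / (C + 1)" for x x'
  proof -
   have "dist (f x') (f x) \<le> C * norm (x' - x)"
    using bd[OF csubspaceD(5)[OF D that(2,1)]] f_diff[OF that(2,1)] by (simp add: dist_norm)
   also have "... \<le> (C + 1) * norm (x' - x)" by (simp add: distrib_right)
   also have "... < e" using that(3) C by (simp add: dist_norm field_simps)
   finally show ?thesis .
  qed
  then show "\<exists>d>0. \<forall>x\<in>D. \<forall>x'\<in>D. dist x' x < d --> dist (f x') (f x) < e"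
   using e C by (intro exI[of _ "e / (C + 1)"]) auto
 qed
 then obtain g where g: "uniformly_continuous_on (closure D) g" "!!x. x \<in> D ==> f x = g x"
  using uniformly_continuous_on_extension_on_closure by metis
 have cg: "continuous_on (closure D) g" by (rule uniformly_continuous_imp_continuous[OF g(1)])
 have lim: "(\<lambda>n. g (s n)) \<longlonglongrightarrow> g x" if "!!n. s n \<in> D" "s \<longlonglongrightarrow> x" for s x
 proof -
  have "x \<in> closure D" using that closure_sequential by blast
  then show ?thesis
   using cg that closure_subset unfolding continuous_on_sequentially by (metis (no_types, lifting) comp_apply ext subsetD)
 qed
 have seq: "\<exists>s. (\<forall>n. s n \<in> D) & s \<longlonglongrightarrow> x" if "x \<in> closure D" for x using that closure_sequential by blast
 have g_add: "g (x + y) = g x + g y" and cl_add: "x + y \<in> closure D" if xy: "x \<in> closure D" "y \<in> closure D" for x y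
 proof -
  obtain s t where st: "!!n. s n \<in> D" "s \<longlonglongrightarrow> x" "!!n. t n \<in> D" "t \<longlonglongrightarrow> y" using seq xy by metis
  have stD: "s n + t n \<in> D" for n by (intro csubspaceD(2)[OF D] st)
  have l: "(\<lambda>n. s n + t n) \<longlonglongrightarrow> x + y" by (intro tendsto_intros st)
  have "(\<lambda>n. g (s n + t n)) \<longlonglongrightarrow> g (x + y)" by (rule lim[OF stD l])
  moreover have "g (s n + t n) = g (s n) + g (t n)" for n using add[OF st(1)[of n] st(3)[of n]] g(2) stD st by simp
  moreover have "(\<lambda>n. g (s n) + g (t n)) \<longlonglongrightarrow> g x + g y" by (intro tendsto_add lim st)
  ultimately show "g (x + y) = g x + g y" using LIMSEQ_unique by simp
  show "x + y \<in> closure D" using stD l unfolding closure_sequential by (intro exI[of _ "\<lambda>n. s n + t n"]) simp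
 qed
 have g_sc: "g (c *\<^sub>C x) = c *\<^sub>C g x" and cl_sc: "c *\<^sub>C x \<in> closure D" if x: "x \<in> closure D" for c x
 proof -
  obtain s where s: "!!n. s n \<in> D" "s \<longlonglongrightarrow> x" using seq x by metis
  have sD: "c *\<^sub>C s n \<in> D" for n by (intro csubspaceD(3)[OF D] s)
  have l: "(\<lambda>n. c *\<^sub>C s n) \<longlonglongrightarrow> c *\<^sub>C x" by (rule bounded_linear.tendsto[OF bounded_linear_scaleC s(2)])
  have "(\<lambda>n. g (c *\<^sub>C s n)) \<longlonglongrightarrow> g (c *\<^sub>C x)" by (rule lim[OF sD l])
  moreover have "g (c *\<^sub>C s n) = c *\<^sub>C g (s n)" for n using sc[OF s(1)[of n], of c] g(2)[OF sD[of n]] g(2)[OF s(1)[of n]] by simp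
  moreover have "(\<lambda>n. c *\<^sub>C g (s n)) \<longlonglongrightarrow> c *\<^sub>C g x" by (rule bounded_linear.tendsto[OF bounded_linear_scaleC lim[OF s]])
  ultimately show "g (c *\<^sub>C x) = c *\<^sub>C g x" using LIMSEQ_unique by simp
  show "c *\<^sub>C x \<in> closure D" using sD l unfolding closure_sequential by (intro exI[of _ "\<lambda>n. c *\<^sub>C s n"]) simp
 qed
 have g_bd: "norm (g x) \<le> C * norm x" if x: "x \<in> closure D" for x
 proof -
  obtain s where s: "!!n. s n \<in> D" "s \<longlonglongrightarrow> x" using seq x by metis
  have "(\<lambda>n. norm (g (s n))) \<longlonglongrightarrow> norm (g x)" by (intro tendsto_norm lim s)
  moreover have "(\<lambda>n. C * norm (s n)) \<longlonglongrightarrow> C * norm x" by (intro tendsto_intros s)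
  ultimately show ?thesis by (rule LIMSEQ_le) (use bd s g(2) in auto)
 qed
 have "0 \<in> closure D" using csubspaceD(1)[OF D] closure_subset by (rule rev_subsetD)
 then have sub: "csubspace (closure D)"
  unfolding csubspace_def using cl_add cl_sc by simp
 obtain P where P': "P \<in> \<L>" "norm P \<le> 1" "\<forall>x. ap P x \<in> closure D"
  "\<forall>x\<in>closure D. ap P x = x" "\<forall>x. \<forall>y\<in>closure D. cinner (x - ap P x) y = 0"
  using ex_projection[OF closed_closure sub] by (elim bexE conjE)
 have P: "P \<in> \<L>" "norm P \<le> 1" "!!x. ap P x \<in> closure D"
  "!!x. x \<in> closure D ==> ap P x = x" "!!x y. y \<in> closure D ==> cinner (x - ap P x) y = 0"
  using P' by simp_all
 have gP: "norm (g (ap P x)) \<le> C * norm x" for x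
  using g_bd[OF P(3), of x] mult_left_mono[OF norm_blinfun_apply_le[OF P(2), of x] C] by simp
 obtain T where T: "!!x. ap T x = g (ap P x)" "norm T \<le> C"
  using ex_op[of "\<lambda>x. g (ap P x)" C, OF _ _ gP C]
  by (metis (no_types, lifting) blinfun.add_right g_add g_sc P(1,3) clinear_scaleC)
 have g0: "g 0 = 0" using g_sc[of 0 0] csubspaceD(1)[OF sub] by (simp add: scaleC_zero_left)
 show ?thesis
 proof (intro exI[of _ T] conjI allI ballI impI)
  show "ap T (c *\<^sub>C x) = c *\<^sub>C ap T x" for c x
   by (simp add: T clinear_scaleC[OF P(1)] g_sc[OF P(3)])
  show "ap T x = f x" if "x \<in> D" for x
  proof -
   have "x \<in> closure D" using that closure_subset by blast
   then show ?thesis using P(4)[of x] g(2)[OF that] by (simp add: T)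
  qed
  show "ap T x = 0" if x: "\<forall>y\<in>D. cinner x y = 0" for x
  proof -
   have "cinner x (ap P x) = 0"
   proof -
    obtain s where s: "!!n. s n \<in> D" "s \<longlonglongrightarrow> ap P x" using seq[OF P(3), of x] by metis
    have "(\<lambda>n. cinner x (s n)) \<longlonglongrightarrow> cinner x (ap P x)" by (intro tendsto_cinner tendsto_const s)
    moreover have "(\<lambda>n. cinner x (s n)) = (\<lambda>_. 0)" using x s(1) by simp
    ultimately show ?thesis by (simp add: LIMSEQ_const_iff)
   qed
   then have "fm P x (ap P x) = 0"
    using P(5)[OF P(3), of x x] by (simp add: cinner_diff_left)
   then show ?thesis by (simp add: T cinner_self g0)
  qed
 qed (rule T)
qed

section \<open>Intertwiners\<close>

text \<open>The supremum need not be attained. A greedy exhaustion works as long as each choice is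
  within a fixed factor of the best one.\<close>

lemma almost_max:
 fixes S :: "real set"
 assumes "bdd_above S" "0 \<in> S" shows "\<exists>m\<in>S. \<forall>s\<in>S. s \<le> 2 * m"
proof (cases "Sup S \<le> 0")
 case True
 then have "s \<le> 2 * 0" if "s \<in> S" for s using cSup_upper[OF that assms(1)] by simp
 then show ?thesis using assms(2) by blast
next
 case False
 then have "Sup S / 2 < Sup S" by simp
 then obtain m where m: "m \<in> S" "Sup S / 2 < m" using less_cSup_iff[OF _ assms(1)] assms(2) by blast
 have "s \<le> 2 * m" if "s \<in> S" for s using cSup_upper[OF that assms(1)] m(2) by simp
 with m(1) show ?thesis by blast
qed

text \<open>With \<open>p\<close> the support projection of the vector state of \<open>u\<close> and \<open>q = \<psi> p\<close>, exhausting the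
 part of \<open>q\<close> where \<open>\<phi>\<close> followed by the state exceeds the vector functional of a long vector leaves a
 nonzero remainder \<open>s\<close> on which the former is dominated by the latter.\<close>

lemma ex_intertwiner:
 fixes B :: "'h::complex_hilbert_space op set"
 assumes B: "von_neumann_algebra B" and ne: "Id1 \<noteq> (0::'h op)"
  and \<phi>: "star_automorphism B \<phi>" and \<psi>: "star_automorphism B \<psi>"
  and \<phi>\<psi>: "!!x. x \<in> B ==> \<phi> (\<psi> x) = x" and \<psi>\<phi>: "!!x. x \<in> B ==> \<psi> (\<phi> x) = x"
 shows "\<exists>T\<in>\<L>. T \<noteq> 0 & (\<forall>b\<in>B. T oL b = \<phi> b oL T)"
proof -
 note alg = op_algebraD[OF vn_op_algebra[OF B]]
 note fD = star_autD[OF \<phi>] and pD = star_autD[OF \<psi>]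
 note fM = star_aut_more[OF B \<phi>] and pM = star_aut_more[OF B \<psi>]
 obtain u :: 'h where u: "u \<noteq> 0"
 proof -
  have "\<not> (\<forall>x::'h. x = 0)" using ne by (auto intro!: blinfun_eqI)
  then show ?thesis using that by blast
 qed
 define Y where "Y = ccspan {ap S u | S. S \<in> commutant B}"
 have Y: "closed Y" "csubspace Y" by (simp_all add: Y_def ccspan_closed ccspan_csubspace)
 obtain p where p: "p \<in> \<L>" "adj p = p" "p oL p = p" "!!x. ap p x \<in> Y" "!!x. x \<in> Y ==> ap p x = x" "norm p \<le> 1"
  using ex_projection[OF Y] by blast
 have SY: "ap S x \<in> Y" if "S \<in> commutant B" "x \<in> Y" for S x
  unfolding Y_def
 proof (rule ccspan_image[OF commutant_clinear[OF that(1)]])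
  show "x \<in> ccspan {ap S u | S. S \<in> commutant B}" using that(2) by (simp add: Y_def)
  fix y assume "y \<in> {ap S u | S. S \<in> commutant B}"
  then obtain S' where S': "S' \<in> commutant B" "y = ap S' u" by blast
  have "S oL S' \<in> commutant B" using op_algebraD(5)[OF op_algebra_commutant] that(1) S'(1) by blast
  then show "ap S y \<in> ccspan {ap S u | S. S \<in> commutant B}"
   unfolding S'(2) blinfun_apply_blinfun_compose[symmetric] by (intro ccspan_inc) blast
 qed
 have pB: "p \<in> B"
  by (rule vn_memI[OF B p(1)], rule proj_commute[OF p(1,2,4,5)])
   (auto simp: commutant_clinear SY vn_commutant_adj[OF B])
 have "u \<in> Y"
 proof -
  have "Id1 \<in> commutant B" by (rule op_algebraD(3)[OF op_algebra_commutant])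
  then have "ap Id1 u \<in> {ap S u | S. S \<in> commutant B}" by blast
  then have "u \<in> {ap S u | S. S \<in> commutant B}" by simp
  then show ?thesis unfolding Y_def by (rule ccspan_inc)
 qed
 then have p\<eta>: "ap p u = u" by (rule p(5))
 define q where "q = \<psi> p"
 have qB: "q \<in> B" unfolding q_def by (rule pD(1)[OF pB])
 have q: "q oL q = q" "adj q = q" unfolding q_def using pD(3)[OF pB pB] pD(4)[OF pB] p by simp_all
 have qc: "q \<in> \<L>" by (rule vn_clinear[OF B qB])
 have fq: "\<phi> q = p" unfolding q_def by (rule \<phi>\<psi>[OF pB])
 have posq: "pos_op q" using pos_op_adj_comp(1)[OF qc] q by simp
 have nq: "norm q \<le> 1" unfolding q_def using pM(6)[OF pB] p(6) by simp
 have "q \<noteq> 0" using fq fM(4) p\<eta> u by auto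
 then obtain v where v: "ap q v \<noteq> 0" by (metis blinfun_eqI zero_blinfun.rep_eq)
 \<comment> \<open>The factor 2 makes \<open>W q = 4 * (norm u)^2\<close> exceed
   \<open>F q = (norm u)^2\<close>, so \<open>g q\<close> is negative and the exhaustion, along
   which \<open>g\<close> is nonnegative, cannot use up all of \<open>q\<close>.\<close>
 define w where "w = (2 * norm u / norm (ap q v)) *\<^sub>R ap q v"
 have q\<zeta>: "ap q w = w"
  unfolding w_def blinfun.scaleR_right blinfun_apply_blinfun_compose[symmetric] q(1) ..
 have n\<zeta>: "norm w = 2 * norm u" using v by (simp add: w_def)
 define F where "F = (\<lambda>b. Re (fm (\<phi> b) u u))"
 define W where "W = (\<lambda>b. Re (fm b w w))"
 define g where "g = (\<lambda>b. F b - W b)"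
 have g_add: "g (a + b) = g a + g b" if "a \<in> B" "b \<in> B" for a b
  by (simp add: g_def F_def W_def fD(2)[OF that] blinfun.add_left cinner_add_left)
 have F_mono: "F a \<le> F b" if "a \<in> B" "b \<in> B" "pos_op (b - a)" for a b
  using pos_opD(3)[OF fM(5)[OF alg(7)[OF that(2,1)] that(3)], of u]
  by (simp add: F_def fM(3) that blinfun.diff_left cinner_diff_left)
 have W_mono: "W a \<le> W b" if "pos_op (b - a)" for a b
  using pos_opD(3)[OF that, of w] by (simp add: W_def blinfun.diff_left cinner_diff_left)
 have W0: "W 0 = 0" and F0: "F 0 = 0" by (simp_all add: W_def F_def fM(4) cinner_zero_left)
 have Fq: "F q = (norm u)^2" by (simp add: F_def fq p\<eta> cinner_self)
 define I where "I = (\<lambda>c. {b \<in> B. pos_op b & pos_op (c - b)})"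
 have zI: "0 \<in> I c" if "pos_op c" for c using that by (simp add: I_def alg(8) pos_op_zero)
 have g_le: "g b \<le> (norm u)^2" if "b \<in> I c" "pos_op (q - c)" for b c
 proof -
  have "pos_op (q - b)" using pos_op_add[of "q - c" "c - b"] that by (simp add: I_def)
  then have "F b \<le> F q" using that by (intro F_mono qB) (auto simp: I_def)
  moreover have "0 \<le> W b" using W_mono[of b 0] that W0 by (simp add: I_def)
  ultimately show ?thesis by (simp add: g_def Fq)
 qed
 have ex: "\<exists>b. b \<in> I c & (\<forall>b'\<in>I c. g b' \<le> 2 * g b)" if "pos_op c" "pos_op (q - c)" for c
 proof -
  have "bdd_above (g ` I c)" using g_le[OF _ that(2)] by (intro bdd_aboveI[of _ "(norm u)^2"]) auto
  moreover have "g 0 = 0" by (simp add: g_def W0 F0)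
  then have "0 \<in> g ` I c" using zI[OF that(1)] by (metis imageI)
  ultimately show ?thesis using almost_max[of "g ` I c"] by blast
 qed
 define nxt where "nxt = (\<lambda>c. SOME b. b \<in> I c & (\<forall>b'\<in>I c. g b' \<le> 2 * g b))"
 have nxt: "nxt c \<in> I c" "!!b'. b' \<in> I c ==> g b' \<le> 2 * g (nxt c)" if "pos_op c" "pos_op (q - c)" for c
  using someI_ex[OF ex[OF that]] unfolding nxt_def by blast+
 define e where "e = rec_nat 0 (\<lambda>_ z. z + nxt (q - z))"
 have e0: "e 0 = 0" and eS: "e (Suc n) = e n + nxt (q - e n)" for n by (simp_all add: e_def)
 have e: "e n \<in> B & pos_op (e n) & pos_op (q - e n)" for n
 proof (induction n)
  case 0 then show ?case by (simp add: e0 alg(8) pos_op_zero posq)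
 next
  case (Suc n)
  then have "nxt (q - e n) \<in> I (q - e n)" by (intro nxt) auto
  then have "nxt (q - e n) \<in> B" "pos_op (nxt (q - e n))" "pos_op (q - e n - nxt (q - e n))" by (auto simp: I_def)
  with Suc show ?case by (simp add: eS alg(4) pos_op_add diff_diff_add)
 qed
 have ni: "nxt (q - e n) \<in> I (q - e n)" and nm: "!!b'. b' \<in> I (q - e n) ==> g b' \<le> 2 * g (nxt (q - e n))" for n
  using nxt[of "q - e n"] e[of n] by auto
 have bound1: "norm a \<le> 1" if "pos_op a" "pos_op (q - a)" for a
 proof (rule pos_op_norm_le[OF that(1)])
  fix x
  have "Re (fm a x x) \<le> Re (fm q x x)"
   using pos_opD(3)[OF that(2), of x] by (simp add: blinfun.diff_left cinner_diff_left)
  also have "... \<le> 1 * (norm x)^2" using Re_cinner_op_le[of q x] mult_right_mono[OF nq, of "(norm x)^2"] by simp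
  finally show "Re (fm a x x) \<le> 1 * (norm x)^2" .
 qed simp
 have incr: "pos_op (e (Suc n) - e n)" for n using ni[of n] by (simp add: eS I_def)
 obtain E where E: "pos_op E" "E \<in> wot_closure (range e)" "!!n. pos_op (E - e n)"
  "!!x. (\<lambda>n. Re (fm (e n) x x)) \<longlonglongrightarrow> Re (fm E x x)"
  using increasing_op_limit[of e 1] e incr bound1 by blast
 have EB: "E \<in> B" by (rule vn_wot_closure[OF B _ E(2) pos_opD(1)[OF E(1)]]) (use e in auto)
 have qE: "pos_op (q - E)"
 proof -
  have "Re (fm E x x) \<le> Re (fm q x x)" for x
  proof (rule LIMSEQ_le_const2[OF E(4)], intro exI allI impI)
   show "Re (fm (e n) x x) \<le> Re (fm q x x)" for n
    using pos_opD(3)[of "q - e n" x] e by (simp add: blinfun.diff_left cinner_diff_left)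
  qed
  then show ?thesis
   using pos_opD[OF E(1)] qc q by (simp add: pos_op_def clinear_diff adj_diff blinfun.diff_left cinner_diff_left)
 qed
 have fe: "pos_op (\<phi> (e n))" "pos_op (\<phi> (e (Suc n)) - \<phi> (e n))" "norm (\<phi> (e n)) \<le> 1" "\<phi> (e n) \<in> B" for n
 proof -
  show "pos_op (\<phi> (e n))" "\<phi> (e n) \<in> B" using e fM(5) fD(1) by auto
  show "pos_op (\<phi> (e (Suc n)) - \<phi> (e n))" using fM(5)[OF alg(7) incr, of n] e fM(3) by simp
  show "norm (\<phi> (e n)) \<le> 1" using fM(6)[of "e n"] e[of n] bound1[of "e n"] by simp
 qed
 obtain E' where E': "pos_op E'" "E' \<in> wot_closure (range (\<lambda>n. \<phi> (e n)))" "!!n. pos_op (E' - \<phi> (e n))"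
  "!!x. (\<lambda>n. Re (fm (\<phi> (e n)) x x)) \<longlonglongrightarrow> Re (fm E' x x)"
  using increasing_op_limit[of "\<lambda>n. \<phi> (e n)" 1] fe by blast
 have EB': "E' \<in> B" by (rule vn_wot_closure[OF B _ E'(2) pos_opD(1)[OF E'(1)]]) (use fe in auto)
 have le_lim: "pos_op (S - L)" if "S \<in> \<L>" "adj S = S" "pos_op L" "!!n. pos_op (S - s n)"
  "!!x. (\<lambda>n. Re (fm (s n) x x)) \<longlonglongrightarrow> Re (fm L x x)" for S L and s :: "nat => 'h op"
 proof -
  have "Re (fm L x x) \<le> Re (fm S x x)" for x
  proof (rule LIMSEQ_le_const2[OF that(5)], intro exI allI impI)
   show "Re (fm (s n) x x) \<le> Re (fm S x x)" for n
    using pos_opD(3)[OF that(4), of n x] by (simp add: blinfun.diff_left cinner_diff_left)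
  qed
  then show ?thesis
   using pos_opD[OF that(3)] that(1,2) by (simp add: pos_op_def clinear_diff adj_diff blinfun.diff_left cinner_diff_left)
 qed
 \<comment> \<open>Normality along the sequence: \<open>\<phi>\<close> and \<open>\<psi>\<close>
   both preserve order, so the supremum of the \<open>e n\<close> goes to the supremum of their
   images.\<close>
 have "\<phi> E = E'"
 proof (rule pos_op_antisym)
  have "pos_op (\<phi> E)" by (rule fM(5)[OF EB E(1)])
  moreover have "pos_op (\<phi> E - \<phi> (e n))" for n using fM(5)[OF alg(7) E(3), of n] EB e fM(3) by simp
  ultimately show "pos_op (\<phi> E - E')" by (intro le_lim[OF _ _ E'(1) _ E'(4)]) (auto simp: pos_opD)
  have "pos_op (\<psi> E')" by (rule pM(5)[OF EB' E'(1)])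
  moreover have "pos_op (\<psi> E' - e n)" for n using pM(5)[OF alg(7) E'(3), of n] EB' fe(4) pM(3) e \<psi>\<phi> by simp
  ultimately have "pos_op (\<psi> E' - E)" by (intro le_lim[OF _ _ E(1) _ E(4)]) (auto simp: pos_opD)
  then have "pos_op (\<phi> (\<psi> E' - E))" by (rule fM(5)[OF alg(7)[OF pD(1)[OF EB'] EB]])
  then show "pos_op (E' - \<phi> E)" using fM(3)[OF pD(1)[OF EB'] EB] \<phi>\<psi>[OF EB'] by simp
 qed
 then have g_lim: "(\<lambda>n. g (e n)) \<longlonglongrightarrow> g E"
  unfolding g_def F_def W_def using E'(4) E(4) by (auto intro!: tendsto_diff)
 have ginc: "g (e n) \<le> g (e (Suc n))" for n
 proof -
  have "0 \<le> g (nxt (q - e n))" using nm[OF zI, of n] e[of n] by (simp add: g_def W0 F0)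
  moreover have "g (e (Suc n)) = g (e n) + g (nxt (q - e n))" unfolding eS by (rule g_add) (use e ni in \<open>auto simp: I_def\<close>)
  ultimately show ?thesis by simp
 qed
 have gE: "0 \<le> g E"
 proof (rule LIMSEQ_le_const[OF g_lim], intro exI allI impI)
  have "incseq (\<lambda>n. g (e n))" using ginc by (rule incseq_SucI)
  then show "0 \<le> g (e n)" for n using incseqD[of "\<lambda>n. g (e n)" 0 n] by (simp add: e0 g_def W0 F0)
 qed
 define s where "s = q - E"
 have sB: "s \<in> B" unfolding s_def by (intro alg qB EB)
 have sp: "pos_op s" using qE by (simp add: s_def)
 \<comment> \<open>Anything below the remainder \<open>s\<close> was an admissible choice at every
   stage, so \<open>g b\<close> is at most twice each increment, and the increments of a convergent
   sequence tend to 0.\<close>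
 have dom: "g b \<le> 0" if "b \<in> I s" for b
 proof -
  have "b \<in> I (q - e n)" for n
  proof -
   have "q - e n - b = (s - b) + (E - e n)" by (simp add: s_def)
   moreover have "pos_op (s - b + (E - e n))" using that pos_op_add[OF _ E(3)[of n], of "s - b"] by (simp add: I_def)
   ultimately show ?thesis using that by (simp only: I_def mem_Collect_eq)
  qed
  then have "g b \<le> 2 * g (nxt (q - e n))" for n by (rule nm)
  moreover have "(\<lambda>n. 2 * g (nxt (q - e n))) \<longlonglongrightarrow> 2 * (g E - g E)"
  proof -
   have "g (nxt (q - e n)) = g (e (Suc n)) - g (e n)" for n
   proof -
    have "g (e (Suc n)) = g (e n) + g (nxt (q - e n))" unfolding eS by (rule g_add) (use e ni in \<open>auto simp: I_def\<close>)
    then show ?thesis by simp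
   qed
   then show ?thesis by (simp only:) (intro tendsto_intros LIMSEQ_Suc g_lim)
  qed
  ultimately show ?thesis using LIMSEQ_le_const[of "\<lambda>n. 2 * g (nxt (q - e n))" 0 "g b"] by simp
 qed
 have "s \<noteq> 0"
 proof
  assume "s = 0"
  then have "E = q" by (simp add: s_def)
  then have "(norm w)^2 \<le> (norm u)^2" using gE by (simp add: g_def Fq W_def q\<zeta> cinner_self)
  then show False using u by (simp add: n\<zeta> power_mult_distrib)
 qed
 have sc: "s \<in> \<L>" "adj s = s" using pos_opD[OF sp] by auto
 have sE: "pos_op (q - s)" using E(1) by (simp add: s_def)
 have sq: "s oL q = s"
 proof -
  have "ap s x = 0" if "ap q x = 0" for x
  proof -
   have "Re (fm s x x) \<le> 0" using pos_opD(3)[OF sE, of x] that by (simp add: blinfun.diff_left cinner_simps)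
   then have "(Re (fm s x (ap s x)))^2 \<le> 0"
    using pos_op_cauchy_schwarz[OF sp, of x "ap s x"] pos_opD(3)[OF sp, of x] by simp
   then show ?thesis by (simp add: cinner_self)
  qed
  then have "ap s (x - ap q x) = 0" for x
   using q(1) by (metis blinfun.diff_right blinfun_apply_blinfun_compose right_minus_eq)
  then show ?thesis by (intro blinfun_eqI) (simp add: blinfun.diff_right)
 qed
 define \<eta>' \<zeta>' where "\<eta>' = ap (\<phi> s) u" and "\<zeta>' = ap s w"
 \<comment> \<open>If \<open>\<phi> s\<close> killed \<open>u\<close>, it would kill the closed span
   \<open>Y\<close> of the orbit of \<open>u\<close> under the commutant, hence
   \<open>\<phi> s oL p = 0\<close>. But \<open>s oL q = s\<close> gives
   \<open>\<phi> s oL p = \<phi> s\<close>.\<close>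
 have "\<eta>' \<noteq> 0"
 proof
  assume z: "\<eta>' = 0"
  have fsB: "\<phi> s \<in> B" by (rule fD(1)[OF sB])
  have "ap (\<phi> s) x = ap 0 x" if "x \<in> Y" for x
   using that unfolding Y_def
  proof (rule eq_on_ccspan[OF vn_clinear[OF B fsB] clinear_zero, rotated])
   fix y assume "y \<in> {ap S u | S. S \<in> commutant B}"
   then obtain S where S: "S \<in> commutant B" "y = ap S u" by blast
   then show "ap (\<phi> s) y = ap 0 y"
    using commutantD_apply[OF S(1) fsB, of u] z by (simp add: \<eta>'_def)
  qed
  then have "\<phi> s oL p = 0" by (intro blinfun_eqI) (simp add: p(4))
  then have "\<phi> s = 0" using fD(3)[OF sB qB] fq sq by simp
  then show False using fM(7)[OF sB] \<open>s \<noteq> 0\<close> by blast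
 qed
 have ss: "(norm (ap s x))^2 \<le> Re (fm s x x)" for x
 proof (cases "ap s x = 0")
  case False
  let ?n = "norm (ap s x)"
  have n0: "0 < ?n^2" using False by simp
  have "(?n^2)^2 \<le> Re (fm s x x) * Re (fm s (ap s x) (ap s x))"
   using pos_op_cauchy_schwarz[OF sp, of x "ap s x"] by (simp add: cinner_self)
  also have "... \<le> Re (fm s x x) * ?n^2"
   using Re_cinner_op_le[of s "ap s x"] mult_right_mono[OF bound1[OF sp sE], of "?n^2"]
   by (intro mult_left_mono pos_opD(3)[OF sp]) simp
  finally have "?n^2 * ?n^2 \<le> Re (fm s x x) * ?n^2" by (simp add: power2_eq_square)
  then show ?thesis using n0 by (rule mult_right_le_imp_le)
 qed (use pos_opD(3)[OF sp] in \<open>simp add: cinner_zero_left\<close>)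
 have key: "norm (ap (\<phi> x) \<eta>') \<le> 1 * norm (ap x \<zeta>')" if x: "x \<in> B" for x
 proof -
  \<comment> \<open>Since \<open>s\<close> is a contraction, \<open>s oL s\<close> lies below
    \<open>s\<close>; the factor \<open>c\<close> then puts \<open>c (x s)\<^sup>* (x s)\<close>
    below \<open>s\<close>, where the domination \<open>dom\<close> applies.\<close>
  define c where "c = 1 / ((norm x)^2 + 1)"
  have c: "0 < c" "c * (norm x)^2 \<le> 1" by (simp_all add: c_def add_nonneg_pos)
  have xc: "x \<in> \<L>" by (rule vn_clinear[OF B x])
  have xsB: "x oL s \<in> B" by (intro alg x sB)
  have xsc: "x oL s \<in> \<L>" by (rule vn_clinear[OF B xsB])
  define b where "b = c *\<^sub>R (adj (x oL s) oL (x oL s))"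
  have b0: "adj (x oL s) oL (x oL s) \<in> B" by (intro alg vn_adj[OF B] xsB)
  have bB: "b \<in> B" unfolding b_def by (intro alg b0)
  have bp: "pos_op b" unfolding b_def using c by (intro pos_op_scaleR pos_op_adj_comp xsc) auto
  have Rb: "Re (fm b y y) = c * (norm (ap x (ap s y)))^2" for y
   using Re_cinner_adj_comp[OF xsc, of y] by (simp add: b_def blinfun.scaleR_left cinner_scaleR_left)
  have "pos_op (s - b)"
   unfolding pos_op_def
  proof (intro conjI allI)
   show "s - b \<in> \<L>" "adj (s - b) = s - b"
    using sc pos_opD[OF bp] by (auto simp: clinear_diff adj_diff)
   fix y
   have "c * (norm (ap x (ap s y)))^2 \<le> c * (norm x * norm (ap s y))^2"
    using c by (intro mult_left_mono power_mono norm_blinfun) auto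
   also have "... = (c * (norm x)^2) * (norm (ap s y))^2" by (simp add: power_mult_distrib)
   also have "... \<le> 1 * (norm (ap s y))^2" by (intro mult_right_mono c) simp
   also have "... \<le> Re (fm s y y)" using ss by simp
   finally show "0 \<le> Re (fm (s - b) y y)" by (simp add: blinfun.diff_left cinner_diff_left Rb)
  qed
  then have "g b \<le> 0" using bB bp by (intro dom) (simp add: I_def)
  moreover have "F b = c * (norm (ap (\<phi> x) \<eta>'))^2"
  proof -
   have "\<phi> b = c *\<^sub>R (adj (\<phi> (x oL s)) oL \<phi> (x oL s))"
    unfolding b_def by (simp add: fM(2)[OF b0] fD(3)[OF vn_adj[OF B xsB] xsB] fD(4)[OF xsB])
   then show ?thesis
    using Re_cinner_adj_comp[OF vn_clinear[OF B fD(1)[OF xsB]], of u] fD(3)[OF x sB]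
    by (simp add: F_def blinfun.scaleR_left cinner_scaleR_left \<eta>'_def)
  qed
  ultimately have "c * (norm (ap (\<phi> x) \<eta>'))^2 \<le> c * (norm (ap x \<zeta>'))^2"
   by (simp add: g_def W_def Rb \<zeta>'_def)
  then have "(norm (ap (\<phi> x) \<eta>'))^2 \<le> (norm (ap x \<zeta>'))^2" using c(1) by simp
  then show ?thesis by (simp add: power2_le_iff_abs_le)
 qed
 \<comment> \<open>The intertwiner sends \<open>ap x \<zeta>'\<close> to
   \<open>ap (\<phi> x) \<eta>'\<close>; \<open>key\<close> makes this well defined and
   contractive.\<close>
 define D where "D = {ap x \<zeta>' | x. x \<in> B}"
 define f where "f = (\<lambda>v. ap (\<phi> (SOME x. x \<in> B & v = ap x \<zeta>')) \<eta>')"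
 have f: "f (ap x \<zeta>') = ap (\<phi> x) \<eta>'" if x: "x \<in> B" for x
 proof -
  define y where "y = (SOME y. y \<in> B & ap x \<zeta>' = ap y \<zeta>')"
  have y: "y \<in> B" "ap x \<zeta>' = ap y \<zeta>'"
   using someI[of "\<lambda>y. y \<in> B & ap x \<zeta>' = ap y \<zeta>'" x] x by (auto simp: y_def)
  have "norm (ap (\<phi> (x - y)) \<eta>') \<le> 0"
   using key[OF alg(7)[OF x y(1)]] y(2) by (simp add: blinfun.diff_left)
  then show ?thesis using fM(3)[OF x y(1)] by (simp add: f_def y_def[symmetric] blinfun.diff_left)
 qed
 have Dsub: "csubspace D"
  unfolding csubspace_def
 proof (intro conjI ballI allI)
  show "0 \<in> D" unfolding D_def using alg(8) by (force simp: blinfun.zero_left)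
  show "x + y \<in> D" if "x \<in> D" "y \<in> D" for x y
   using that unfolding D_def by (auto simp flip: blinfun.add_left intro!: alg(4))
  show "c *\<^sub>C x \<in> D" if x: "x \<in> D" for c x
  proof -
   obtain b where b: "b \<in> B" "x = ap b \<zeta>'" using x by (auto simp: D_def)
   have "c *\<^sub>C x = ap (scalar_op c oL b) \<zeta>'" by (simp add: b(2) scalar_op_apply)
   moreover have "scalar_op c oL b \<in> B" by (intro alg vn_scalar[OF B] b)
   ultimately show ?thesis unfolding D_def by blast
  qed
 qed
 obtain T where T: "norm T \<le> 1" "!!c x. ap T (c *\<^sub>C x) = c *\<^sub>C ap T x"
  "!!x. x \<in> D ==> ap T x = f x" "!!x. (!!y. y \<in> D ==> cinner x y = 0) ==> ap T x = 0"
 proof -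
  have "\<exists>T. norm T \<le> 1 & (\<forall>c x. ap T (c *\<^sub>C x) = c *\<^sub>C ap T x) & (\<forall>x\<in>D. ap T x = f x) &
   (\<forall>x. (\<forall>y\<in>D. cinner x y = 0) --> ap T x = 0)"
  proof (rule extend_bounded[OF Dsub])
   fix x y assume "x \<in> D" "y \<in> D"
   then obtain a b where ab: "a \<in> B" "x = ap a \<zeta>'" "b \<in> B" "y = ap b \<zeta>'" by (auto simp: D_def)
   have "f (x + y) = f (ap (a + b) \<zeta>')" by (simp add: ab blinfun.add_left)
   also have "... = f x + f y"
    unfolding f[OF alg(4)[OF ab(1,3)]] ab(2,4) f[OF ab(1)] f[OF ab(3)] fD(2)[OF ab(1,3)] by (simp add: blinfun.add_left)
   finally show "f (x + y) = f x + f y" .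
  next
   fix c x assume "x \<in> D"
   then obtain a where a: "a \<in> B" "x = ap a \<zeta>'" by (auto simp: D_def)
   have sa: "scalar_op c oL a \<in> B" by (intro alg vn_scalar[OF B] a)
   have "f (c *\<^sub>C x) = f (ap (scalar_op c oL a) \<zeta>')" by (simp add: a scalar_op_apply)
   also have "... = c *\<^sub>C f x" unfolding f[OF sa] fD(5)[OF a(1)] by (simp add: scalar_op_apply a(2) f[OF a(1)])
   finally show "f (c *\<^sub>C x) = c *\<^sub>C f x" .
  next
   fix x assume "x \<in> D"
   then show "norm (f x) \<le> 1 * norm x" using f key by (auto simp: D_def)
  qed simp
  then show ?thesis using that by blast
 qed
 have Tc: "T \<in> \<L>" using T(2) by (simp add: clinear_ops_def)
 have TD: "ap T (ap x \<zeta>') = ap (\<phi> x) \<eta>'" if "x \<in> B" for x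
  using T(3)[of "ap x \<zeta>'"] f[OF that] that by (auto simp: D_def)
 have "T \<noteq> 0" using TD[OF alg(3)] fM(1) \<open>\<eta>' \<noteq> 0\<close> by auto
 moreover have "T oL b = \<phi> b oL T" if b: "b \<in> B" for b
 proof -
  have bc: "b \<in> \<L>" "\<phi> b \<in> \<L>" using vn_clinear[OF B] b fD(1) by auto
  obtain z where z: "!!x. z x \<in> ccspan D" "!!x y. y \<in> ccspan D ==> cinner (x - z x) y = 0"
   using closest_point_subspace[OF ccspan_closed ccspan_csubspace] by metis
  have on: "ap (T oL b) x = ap (\<phi> b oL T) x" if "x \<in> ccspan D" for x
   using that
  proof (rule eq_on_ccspan[OF clinear_compose[OF Tc bc(1)] clinear_compose[OF bc(2) Tc], rotated])
   fix x assume "x \<in> D"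
   then obtain a where a: "a \<in> B" "x = ap a \<zeta>'" by (auto simp: D_def)
   show "ap (T oL b) x = ap (\<phi> b oL T) x"
    using TD[OF a(1)] TD[OF alg(5)[OF b a(1)]] fD(3)[OF b a(1)] by (simp add: a(2))
  qed
  have off: "ap (T oL b) x = 0 & ap T x = 0" if "!!y. y \<in> D ==> cinner x y = 0" for x
  proof -
   have "fm b x y = 0" if y: "y \<in> D" for y
   proof -
    obtain a where a: "a \<in> B" "y = ap a \<zeta>'" using y by (auto simp: D_def)
    have "adj b oL a \<in> B" by (intro alg vn_adj[OF B] b a)
    then have "ap (adj b oL a) \<zeta>' \<in> D" unfolding D_def by blast
    then show ?thesis using \<open>!!y. y \<in> D ==> cinner x y = 0\<close> by (simp add: adj_works(1)[OF bc(1)] a(2))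
   qed
   then show ?thesis using T(4) that by simp
  qed
  show ?thesis
  proof (rule blinfun_eqI)
   fix x
   have "cinner (x - z x) y = 0" if "y \<in> D" for y using z(2) ccspan_inc[OF that] by blast
   then have o: "ap (T oL b) (x - z x) = 0" "ap T (x - z x) = 0" using off by blast+
   have "ap (T oL b) x = ap (T oL b) (z x)" using o(1) by (simp add: blinfun.diff_right)
   also have "... = ap (\<phi> b oL T) (z x)" by (rule on[OF z(1)])
   also have "... = ap (\<phi> b oL T) x" using o(2) by (simp add: blinfun.diff_right)
   finally show "ap (T oL b) x = ap (\<phi> b oL T) x" .
  qed
 qed
 ultimately show ?thesis using Tc by blast
qed

lemma scalar_projection:
 fixes p :: "'h::complex_hilbert_space op"
 assumes "p \<in> range scalar_op" "p oL p = p" "p \<noteq> 0" shows "p = Id1"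
proof -
 obtain c where c: "p = scalar_op c" using assms(1) by blast
 have "(c * c - c) *\<^sub>C x = 0" for x :: 'h
 proof -
  have "ap (p oL p) x = ap p x" by (simp add: assms(2))
  then have "(c * c) *\<^sub>C x = c *\<^sub>C x" by (simp add: c scalar_op_apply scaleC_scaleC)
  then show ?thesis using scaleC_add_left[of "c * c - c" c x] by simp
 qed
 moreover have "\<not> (\<forall>x::'h. c *\<^sub>C x = 0)" using assms(3) c by (auto intro!: blinfun_eqI simp: scalar_op_apply)
 then obtain x :: 'h where "c *\<^sub>C x \<noteq> 0" by blast
 then have "norm c \<noteq> 0" "norm x \<noteq> 0" by (auto simp: scaleC_zero_left scaleC_zero_right)
 ultimately have "norm (c * c - c) * norm x = 0" by (metis norm_scaleC norm_zero)
 then have "c * c = c" using \<open>norm x \<noteq> 0\<close> by simp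
 then have "c = 1" using \<open>norm c \<noteq> 0\<close> by simp
 then show ?thesis by (intro blinfun_eqI) (simp add: c scalar_op_apply scaleC_one)
qed

text \<open>If \<open>T\<close> intertwines, so does \<open>S oL T\<close> for \<open>S\<close> in
  the commutant of \<open>B\<close>, and \<open>b oL T = T oL \<psi> b\<close> for \<open>b\<close>
  in \<open>B\<close>. So the projection onto the span of the ranges lies in the centre of
  \<open>B\<close>; it is nonzero by \<open>ex_intertwiner\<close>.\<close>

lemma intertwiners_total:
 fixes B :: "'h::complex_hilbert_space op set"
 assumes B: "vn_factor B"
  and \<phi>: "star_automorphism B \<phi>" and \<psi>: "star_automorphism B \<psi>"
  and \<phi>\<psi>: "!!x. x \<in> B ==> \<phi> (\<psi> x) = x" and \<psi>\<phi>: "!!x. x \<in> B ==> \<psi> (\<phi> x) = x"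
 shows "ccspan {ap T v | T v. T \<in> \<L> & (\<forall>b\<in>B. T oL b = \<phi> b oL T)} = UNIV"
proof -
 have vB: "von_neumann_algebra B" and cen: "B \<inter> commutant B = range scalar_op" and B0: "B \<noteq> {0}"
  using B by (auto simp: vn_factor_def)
 note alg = op_algebraD[OF vn_op_algebra[OF vB]]
 have ne: "Id1 \<noteq> (0::'h op)"
 proof
  assume "Id1 = (0::'h op)"
  then have "T = 0" for T :: "'h op" by (metis compose_id_left compose_zero_left)
  then show False using B0 alg(8) by blast
 qed
 define X where "X = {ap T v | T v. T \<in> \<L> & (\<forall>b\<in>B. T oL b = \<phi> b oL T)}"
 obtain P where P: "P \<in> \<L>" "adj P = P" "P oL P = P" "!!x. ap P x \<in> ccspan X"
  "!!x. x \<in> ccspan X ==> ap P x = x"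
  using ex_projection[OF ccspan_closed[of X] ccspan_csubspace[of X]] by blast
 have inv1: "ap S x \<in> ccspan X" if S: "S \<in> commutant B" and x: "x \<in> ccspan X" for S x
 proof (rule ccspan_image[OF commutant_clinear[OF S] _ x])
  fix y assume "y \<in> X"
  then obtain T v where T: "y = ap T v" "T \<in> \<L>" "!!b. b \<in> B ==> T oL b = \<phi> b oL T" by (auto simp: X_def)
  have "(S oL T) oL b = \<phi> b oL (S oL T)" if "b \<in> B" for b
   using T(3)[OF that] commutantD[OF S star_autD(1)[OF \<phi> that]] by (metis compose_assoc)
  then have "ap (S oL T) v \<in> X" unfolding X_def using clinear_compose[OF commutant_clinear[OF S] T(2)] by blast
  then show "ap S y \<in> ccspan X" by (simp add: T(1) ccspan_inc)
 qed
 have inv2: "ap b x \<in> ccspan X" if b: "b \<in> B" and x: "x \<in> ccspan X" for b x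
 proof (rule ccspan_image[OF vn_clinear[OF vB b] _ x])
  fix y assume "y \<in> X"
  then obtain T v where T: "y = ap T v" "T \<in> \<L>" "!!b. b \<in> B ==> T oL b = \<phi> b oL T" by (auto simp: X_def)
  have "ap b y = ap (T oL \<psi> b) v"
   using T(3)[OF star_autD(1)[OF \<psi> b]] \<phi>\<psi>[OF b] by (simp add: T(1))
  then have "ap b y \<in> X" unfolding X_def using T by auto
  then show "ap b y \<in> ccspan X" by (rule ccspan_inc)
 qed
 have "P \<in> B"
  by (rule vn_memI[OF vB P(1)], rule proj_commute[OF P(1,2,4,5)]) (auto simp: commutant_clinear inv1 vn_commutant_adj[OF vB])
 moreover have "P \<in> commutant B"
  by (rule commutantI[OF P(1)], rule proj_commute[OF P(1,2,4,5)]) (auto simp: vn_clinear[OF vB] inv2 vn_adj[OF vB])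
 ultimately have "P \<in> range scalar_op" using cen by blast
 moreover have "P \<noteq> 0"
 proof
  assume P0: "P = 0"
  obtain T where T: "T \<in> \<L>" "T \<noteq> 0" "!!b. b \<in> B ==> T oL b = \<phi> b oL T"
   using ex_intertwiner[OF vB ne \<phi> \<psi> \<phi>\<psi> \<psi>\<phi>] by blast
  have "ap T v = 0" for v
  proof -
   have "ap T v \<in> ccspan X" using T by (intro ccspan_inc) (auto simp: X_def)
   then show ?thesis using P(5) P0 by force
  qed
  then have "T = 0" by (intro blinfun_eqI) simp
  with T(2) show False by blast
 qed
 ultimately have "P = Id1" using scalar_projection P(3) by blast
 then have "x \<in> ccspan X" for x using P(4)[of x] by simp
 then show ?thesis by (auto simp: X_def)
qed

section \<open>Averaging over an irreducible subalgebra\<close>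

text \<open>The algebraic span, built one summand at a time, so that a finite family of elements
  \<open>b\<close> and a constant can be attached to each vector by induction.\<close>

inductive_set qspan :: "'h::complex_hilbert_space op set => 'h op => 'h set" for Q g where
 zero: "0 \<in> qspan Q g"
| step: "x \<in> qspan Q g ==> b \<in> Q ==> x + ap b (ap g v) \<in> qspan Q g"

lemma qspan_csubspace:
 assumes "Q <= \<L>" "g \<in> \<L>" shows "csubspace (qspan Q g)"
proof -
 have "y + x \<in> qspan Q g" if "x \<in> qspan Q g" "y \<in> qspan Q g" for x y
  using that by (induction rule: qspan.induct) (auto simp: add.assoc[symmetric] intro: qspan.step)
 moreover have "c *\<^sub>C x \<in> qspan Q g" if "x \<in> qspan Q g" for c x
  using that
 proof (induction rule: qspan.induct)
  case (step x b v)
  have "c *\<^sub>C (x + ap b (ap g v)) = c *\<^sub>C x + ap b (ap g (c *\<^sub>C v))"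
   using step(2) assms by (auto simp: scaleC_add_right clinear_scaleC)
  then show ?case using step by (simp add: qspan.step)
 qed (simp add: scaleC_zero_right qspan.zero)
 ultimately show ?thesis by (auto simp: csubspace_def qspan.zero)
qed

text \<open>Stands for the fixed-point algebra of an open subgroup of \<open>K\<close>. Closure
  under inverses lets resolvents be formed inside \<open>Q\<close>, and \<open>ex_sqrt\<close>
  supplies their roots there.\<close>

locale irreducible_subalgebra =
 fixes B Q :: "'h::complex_hilbert_space op set"
 assumes B: "von_neumann_algebra B" and QB: "Q <= B" and Qalg: "op_algebra Q" and Qadj: "!!x. x \<in> Q ==> adj x \<in> Q"
  and Qinv: "!!x y. x \<in> Q ==> y \<in> \<L> ==> x oL y = Id1 ==> y oL x = Id1 ==> y \<in> Q"
  and irr: "commutant Q \<inter> B = range scalar_op"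
begin

lemmas Q = op_algebraD[OF Qalg]

text \<open>The closed span is invariant under the commutant of \<open>B\<close> and under
  \<open>Q\<close>, so its projection lies in \<open>B\<close> and commutes with \<open>Q\<close>.
  By irreducibility it is a scalar, and \<open>g \<noteq> 0\<close> makes it the identity.\<close>

lemma dense_range:
 assumes g: "g \<in> Q" "g \<noteq> 0"
 shows "ccspan {ap b (ap g v) | b v. b \<in> Q} = UNIV"
proof -
 define X where "X = {ap b (ap g v) | b v. b \<in> Q}"
 obtain P where P: "P \<in> \<L>" "adj P = P" "P oL P = P" "!!x. ap P x \<in> ccspan X"
  "!!x. x \<in> ccspan X ==> ap P x = x"
  using ex_projection[OF ccspan_closed[of X] ccspan_csubspace[of X]] by blast
 have inv1: "ap S x \<in> ccspan X" if S: "S \<in> commutant B" and x: "x \<in> ccspan X" for S x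
 proof (rule ccspan_image[OF commutant_clinear[OF S] _ x])
  fix y assume "y \<in> X"
  then obtain b v where b: "b \<in> Q" "y = ap b (ap g v)" by (auto simp: X_def)
  have "ap S y = ap b (ap g (ap S v))"
   using commutantD_apply[OF S] b QB g(1) by (metis subsetD)
  then have "ap S y \<in> X" unfolding X_def using b(1) by blast
  then show "ap S y \<in> ccspan X" by (rule ccspan_inc)
 qed
 have inv2: "ap a x \<in> ccspan X" if a: "a \<in> Q" and x: "x \<in> ccspan X" for a x
 proof (rule ccspan_image[OF Q(2)[OF a] _ x])
  fix y assume "y \<in> X"
  then obtain b v where b: "b \<in> Q" "y = ap b (ap g v)" by (auto simp: X_def)
  have "ap a y = ap (a oL b) (ap g v)" by (simp add: b)
  then have "ap a y \<in> X" unfolding X_def using Q(5)[OF a b(1)] by blast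
  then show "ap a y \<in> ccspan X" by (rule ccspan_inc)
 qed
 have "P \<in> B"
  by (rule vn_memI[OF B P(1)], rule proj_commute[OF P(1,2,4,5)]) (auto simp: commutant_clinear inv1 vn_commutant_adj[OF B])
 moreover have "P \<in> commutant Q"
  by (rule commutantI[OF P(1)], rule proj_commute[OF P(1,2,4,5)]) (auto simp: Q(2) inv2 Qadj)
 ultimately have "P \<in> range scalar_op" using irr by blast
 moreover have "P \<noteq> 0"
 proof
  assume P0: "P = 0"
  have "ap g v = 0" for v
  proof -
   have "ap Id1 (ap g v) \<in> X" unfolding X_def using Q(3) by blast
   then have "ap g v \<in> ccspan X" using ccspan_inc by simp
   then show ?thesis using P(5) P0 by force
  qed
  then have "g = 0" by (intro blinfun_eqI) simp
  with g(2) show False by blast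
 qed
 ultimately have "P = Id1" using scalar_projection P(3) by blast
 then have "x \<in> ccspan X" for x using P(4)[of x] by simp
 then show ?thesis by (auto simp: X_def)
qed

lemma qspan_dense:
 assumes g: "g \<in> Q" "g \<noteq> 0" and e: "0 < e"
 shows "\<exists>x\<in>qspan Q g. norm (u - x) < e"
proof -
 have sub: "csubspace (qspan Q g)" by (rule qspan_csubspace) (use Q g in auto)
 have "csubspace (closure (qspan Q g))"
  unfolding csubspace_def
 proof (intro conjI ballI allI)
  show "0 \<in> closure (qspan Q g)" using csubspaceD(1)[OF sub] closure_subset by (rule rev_subsetD)
  fix x y assume x: "x \<in> closure (qspan Q g)" and y: "y \<in> closure (qspan Q g)"
  from x y obtain s t where s: "!!n. s n \<in> qspan Q g" "s \<longlonglongrightarrow> x" and t: "!!n. t n \<in> qspan Q g" "t \<longlonglongrightarrow> y"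
   unfolding closure_sequential by blast
  show "x + y \<in> closure (qspan Q g)" unfolding closure_sequential
   by (intro exI[of _ "\<lambda>n. s n + t n"] conjI allI csubspaceD(2)[OF sub] s t tendsto_add)
 next
  fix c x assume x: "x \<in> closure (qspan Q g)"
  then obtain s where s: "!!n. s n \<in> qspan Q g" "s \<longlonglongrightarrow> x" unfolding closure_sequential by blast
  show "c *\<^sub>C x \<in> closure (qspan Q g)" unfolding closure_sequential
   by (intro exI[of _ "\<lambda>n. c *\<^sub>C s n"] conjI allI csubspaceD(3)[OF sub] s bounded_linear.tendsto[OF bounded_linear_scaleC])
 qed
 moreover have "{ap b (ap g v) | b v. b \<in> Q} <= closure (qspan Q g)"
  using qspan.step[OF qspan.zero, of _ Q g] closure_subset by fastforce
 ultimately have "u \<in> closure (qspan Q g)"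
  using ccspan_minimal[OF closed_closure] dense_range[OF g] by blast
 then obtain x where "x \<in> qspan Q g" "dist x u < e" using closure_approachable e by blast
 then show ?thesis by (auto simp: dist_norm norm_minus_commute)
qed

text \<open>With \<open>w = \<Sum>b g\<^sup>2 b\<^sup>*\<close> and \<open>X = (w + \<delta>)\<^sup>-\<^sup>1\<close>, the elements \<open>a = X\<^sup>1\<^sup>/\<^sup>2 b g\<close> satisfy
 \<open>\<Sum>a a\<^sup>* = 1 - \<delta> X\<close>, and \<open>\<delta> X\<close> tends to \<open>0\<close> strongly as \<open>\<delta> \<rightarrow> 0\<close> and the family of the \<open>b\<close> grows;
 \<open>g\<close> is chosen as \<open>|t| + t\<close> for \<open>t = h - c\<close>.\<close>

lemma averaging:
 assumes h: "h \<in> Q" "pos_op h" "h \<noteq> 0"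
 shows "\<exists>c>0. c \<le> 1 & (\<forall>\<Xi> e. finite \<Xi> --> 0 < e --> (\<exists>(F::'h op set) a r. finite F & (\<forall>i\<in>F. a i \<in> Q) & r \<in> Q & adj r = r &
   (\<Sum>i\<in>F. a i oL adj (a i)) + (r oL r) = Id1 &
   (\<forall>i\<in>F. \<forall>x. c * (norm (ap (adj (a i)) x))^2 \<le> Re (fm h (ap (adj (a i)) x) (ap (adj (a i)) x))) &
   (\<forall>u\<in>\<Xi>. norm (ap r u) < e)))"
proof -
 have hc: "h \<in> \<L>" "adj h = h" using pos_opD[OF h(2)] by auto
 have "\<not> (\<forall>x. Re (fm h x x) = 0)" using selfadj_eq_zero[OF hc] h(3) by blast
 then obtain x0 where "Re (fm h x0 x0) \<noteq> 0" by blast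
 then have x0: "0 < Re (fm h x0 x0)" using pos_opD(3)[OF h(2), of x0] by linarith
 then have nx0: "0 < (norm x0)^2" by (auto simp: cinner_zero_right)
 \<comment> \<open>At most half the value of \<open>h\<close> at the unit vector along
   \<open>x0\<close>: then \<open>t = h - c\<close> is still positive at \<open>x0\<close>, so
   \<open>m + t\<close> cannot vanish.\<close>
 define c where "c = min 1 (Re (fm h x0 x0) / (2 * (norm x0)^2))"
 have c: "0 < c" "c \<le> 1" using x0 nx0 by (auto simp: c_def)
 have cx0: "c * (norm x0)^2 < Re (fm h x0 x0)"
 proof -
  have "c * (norm x0)^2 \<le> Re (fm h x0 x0) / (2 * (norm x0)^2) * (norm x0)^2"
   by (intro mult_right_mono) (auto simp: c_def)
  also have "... < Re (fm h x0 x0)" using x0 nx0 by simp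
  finally show ?thesis .
 qed
 define t where "t = h - c *\<^sub>R Id1"
 have tQ: "t \<in> Q" unfolding t_def by (intro Q h)
 have tc: "t \<in> \<L>" "adj t = t" using hc by (auto simp: t_def clinear_intros adj_diff adj_scaleR adj_id)
 have pt: "pos_op (t oL t)" using pos_op_adj_comp(1)[OF tc(1)] tc(2) by simp
 obtain m where m: "pos_op m" "m oL m = t oL t" "!!A. op_algebra A ==> t oL t \<in> A ==> m \<in> A"
  using ex_sqrt[OF pt] by blast
 have mQ: "m \<in> Q" by (rule m(3)[OF Qalg]) (intro Q tQ)
 have "t oL t \<in> commutant {t}" using tc by (intro commutantI clinear_compose) (auto simp: compose_assoc)
 then have "m \<in> commutant {t}" by (rule m(3)[OF op_algebra_commutant])
 then have mt: "m oL t = t oL m" by (rule commutantD) simp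
 define g where "g = m + t"
 have gQ: "g \<in> Q" unfolding g_def by (intro Q mQ tQ)
 have gc: "g \<in> \<L>" "adj g = g" using pos_opD[OF m(1)] tc by (auto simp: g_def clinear_add adj_add)
 have "g \<noteq> 0"
 proof
  assume "g = 0"
  then have "t = - m" by (simp add: g_def eq_neg_iff_add_eq_0 add.commute)
  then have "Re (fm t x0 x0) \<le> 0"
   using pos_opD(3)[OF m(1), of x0] by (simp add: blinfun.minus_left cinner_minus_left)
  then show False using cx0 by (simp add: t_def blinfun.bilinear_simps cinner_simps cinner_self)
 qed
 \<comment> \<open>On the range of \<open>g = m + t\<close> the operator \<open>t\<close> agrees
   with its absolute value \<open>m\<close>, so \<open>h\<close> is at least \<open>c\<close>
   there.\<close>
 have tg: "t oL g = m oL g" by (simp add: g_def compose_add_right m(2) mt add.commute)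
 have low: "c * (norm (ap g y))^2 \<le> Re (fm h (ap g y) (ap g y))" for y
 proof -
  have "ap t (ap g y) = ap m (ap g y)"
   using tg by (metis blinfun_apply_blinfun_compose)
  then have "0 \<le> Re (fm t (ap g y) (ap g y))"
   using pos_opD(3)[OF m(1)] by simp
  then show ?thesis by (simp add: t_def blinfun.bilinear_simps cinner_simps cinner_self)
 qed
 define w where "w = (\<lambda>F. \<Sum>b\<in>F. (b oL g) oL adj (b oL g))"
 have bgQ: "b oL g \<in> Q" if "b \<in> Q" for b by (intro Q that gQ)
 have wp: "pos_op (w F)" if "F <= Q" for F
  unfolding w_def by (intro pos_op_sum pos_op_adj_comp(2) Q(2) bgQ) (use that in auto)
 have wQ: "w F \<in> Q" if "F <= Q" for F
  unfolding w_def by (intro Q(9) Q(5) bgQ Qadj) (use that in auto)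
 define isX where "isX = (\<lambda>F d X. pos_op X & (w F + d *\<^sub>R Id1) oL X = Id1 & X oL (w F + d *\<^sub>R Id1) = Id1 & norm X \<le> 1 / d)"
 have exX: "\<exists>X. isX F d X" if F: "F <= Q" and d: "0 < d" for F d
 proof -
  have "pos_op (w F + d *\<^sub>R Id1)" by (intro pos_op_add wp F pos_op_scaleR pos_op_id) (use d in simp)
  moreover have "d * (norm x)^2 \<le> Re (fm (w F + d *\<^sub>R Id1) x x)" for x
   using pos_opD(3)[OF wp[OF F], of x] by (simp add: blinfun.bilinear_simps cinner_simps cinner_self)
  ultimately show ?thesis unfolding isX_def using ex_inverse[OF _ d] by blast
 qed
 \<comment> \<open>For \<open>b\<close> in the family, \<open>(b g) (b g)\<^sup>*\<close> lies below
   \<open>w F\<close>. On the range of \<open>b g\<close> the bound \<open>1 / d\<close> for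
   \<open>X\<close> therefore improves to the order of \<open>1 / sqrt d\<close>, and
   \<open>d X\<close> tends to 0 there.\<close>
 have Xbg: "norm (ap X (ap b (ap g v))) \<le> norm v / sqrt d"
  if F: "finite F" "F <= Q" "b \<in> F" and d: "0 < d" and X: "isX F d X" for F d X b v
 proof -
  have Xp: "pos_op X" using X by (simp add: isX_def)
  have bc: "b oL g \<in> \<L>" using F bgQ Q(2) by blast
  have adj_le: "norm (ap (adj (b oL g)) (ap X y)) \<le> norm y / sqrt d" for y
  proof -
   let ?z = "ap X y"
   have R: "Re (fm (k oL adj k) ?z ?z) = (norm (ap (adj k) ?z))^2" if "k \<in> \<L>" for k
    using Re_cinner_adj_comp[OF adj_works(2)[OF that], of ?z] by (simp add: adj_adj[OF that])
   have "Re (fm (w F) ?z ?z) = (\<Sum>b\<in>F. (norm (ap (adj (b oL g)) ?z))^2)"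
    unfolding w_def blinfun.sum_left cinner_sum_left Re_sum
    by (intro sum.cong refl R) (use F bgQ Q(2) in blast)
   moreover have "(norm (ap (adj (b oL g)) ?z))^2 \<le> (\<Sum>b\<in>F. (norm (ap (adj (b oL g)) ?z))^2)"
    by (rule member_le_sum) (use F in auto)
   moreover have "ap (w F + d *\<^sub>R Id1) ?z = y"
    using X unfolding isX_def by (metis blinfun_apply_blinfun_compose blinfun_apply_id_blinfun id_apply)
   then have "ap (w F) ?z = y - d *\<^sub>R ?z" by (simp add: blinfun.bilinear_simps algebra_simps)
   then have "Re (fm (w F) ?z ?z) \<le> Re (cinner y ?z)"
    using d by (simp add: cinner_simps cinner_self)
   moreover have "Re (cinner y ?z) \<le> norm y * norm ?z" using norm_cinner_le complex_Re_le_cmod order_trans by blast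
   moreover have "norm y * norm ?z \<le> norm y * (1 / d * norm y)"
    by (intro mult_left_mono norm_blinfun_apply_le) (use X in \<open>auto simp: isX_def\<close>)
   ultimately have "(norm (ap (adj (b oL g)) ?z))^2 \<le> (norm y)^2 / d" by (simp add: power2_eq_square)
   also have "... = (norm y / sqrt d)^2" using d by (simp add: power_divide)
   finally show ?thesis by (rule power2_le_imp_le) (use d in simp)
  qed
  show ?thesis
  proof (rule norm_le_cinner)
   fix y
   have "fm X (ap b (ap g v)) y = cinner v (ap (adj (b oL g)) (ap X y))"
    using selfadj_cinner[OF pos_opD(1,2)[OF Xp]] adj_works(1)[OF bc] by simp
   also have "norm ... \<le> norm v * (norm y / sqrt d)"
    by (rule order_trans[OF norm_cinner_le]) (intro mult_left_mono adj_le, simp)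
   finally show "norm (fm X (ap b (ap g v)) y) \<le> norm v / sqrt d * norm y" by simp
  qed (use d in simp)
 qed
 have span: "\<exists>F C. finite F & F <= Q & (\<forall>F' d X. finite F' --> F <= F' --> F' <= Q --> 0 < d --> isX F' d X --> norm (ap X x) \<le> C / sqrt d)"
  if "x \<in> qspan Q g" for x
  using that
 proof (induction rule: qspan.induct)
  case zero
  show ?case by (rule exI[of _ "{}"], rule exI[of _ 0]) simp
 next
  case (step x b v)
  then obtain F C where F: "finite F" "F <= Q"
   "!!F' d X. finite F' ==> F <= F' ==> F' <= Q ==> 0 < d ==> isX F' d X ==> norm (ap X x) \<le> C / sqrt d" by blast
  have "norm (ap X (x + ap b (ap g v))) \<le> (C + norm v) / sqrt d"
   if "finite F'" "insert b F <= F'" "F' <= Q" "0 < d" "isX F' d X" for F' d X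
   using norm_triangle_ineq[of "ap X x" "ap X (ap b (ap g v))"]
    F(3)[of F' d X] Xbg[of F' b d X v] that by (simp add: blinfun.add_right add_divide_distrib)
  then show ?case using F(1,2) step(2) by (intro exI[of _ "insert b F"] exI[of _ "C + norm v"]) auto
 qed
 have fin: "\<exists>(F::'h op set) a r. finite F & (\<forall>i\<in>F. a i \<in> Q) & r \<in> Q & adj r = r &
   (\<Sum>i\<in>F. a i oL adj (a i)) + (r oL r) = Id1 &
   (\<forall>i\<in>F. \<forall>x. c * (norm (ap (adj (a i)) x))^2 \<le> Re (fm h (ap (adj (a i)) x) (ap (adj (a i)) x))) &
   (\<forall>u\<in>\<Xi>. norm (ap r u) < e)" if \<Xi>: "finite \<Xi>" and e: "0 < e" for \<Xi> :: "'h set" and e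
 proof -
  define M where "M = (\<Sum>u\<in>\<Xi>. norm u) + 1"
  have M: "norm u \<le> M" if "u \<in> \<Xi>" for u
   using member_le_sum[of u \<Xi> norm] that \<Xi> by (simp add: M_def)
  have M0: "0 < M" by (simp add: M_def sum_nonneg add_nonneg_pos)
  \<comment> \<open>Chosen so that the quadratic form of \<open>d X\<close> at \<open>u\<close> is
    at most \<open>2 * e1 * M = e^2 / 2\<close>.\<close>
  define e1 where "e1 = e^2 / (4 * M)"
  have e1: "0 < e1" using e M0 by (simp add: e1_def)
  have "\<forall>u. \<exists>x. x \<in> qspan Q g & norm (u - x) < e1" using qspan_dense[OF gQ \<open>g \<noteq> 0\<close> e1] by blast
  then obtain x where x: "!!u. x u \<in> qspan Q g" "!!u. norm (u - x u) < e1" by metis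
  have "\<exists>F C. finite F & F <= Q & (\<forall>F' d X. finite F' --> F <= F' --> F' <= Q --> 0 < d --> isX F' d X --> norm (ap X (x u)) \<le> C / sqrt d)" for u
   by (rule span[OF x(1)])
  then obtain FF CC where FC: "!!u. finite (FF u)" "!!u. FF u <= Q"
   "!!u F' d X. finite F' ==> FF u <= F' ==> F' <= Q ==> 0 < d ==> isX F' d X ==> norm (ap X (x u)) \<le> CC u / sqrt d" by metis
  define F where "F = (\<Union>u\<in>\<Xi>. FF u)"
  have F: "finite F" "F <= Q" using FC \<Xi> by (auto simp: F_def)
  define C where "C = (\<Sum>u\<in>\<Xi>. \<bar>CC u\<bar>) + 1"
  have C: "CC u \<le> C" if "u \<in> \<Xi>" for u
   using member_le_sum[of u \<Xi> "\<lambda>u. \<bar>CC u\<bar>"] that \<Xi> by (simp add: C_def)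
  have C0: "0 < C" by (simp add: C_def sum_nonneg add_nonneg_pos)
  \<comment> \<open>With this value the bound \<open>d * (C / sqrt d)\<close> on the span is exactly
    \<open>e1\<close>.\<close>
  define d where "d = (e1 / C)^2"
  have d: "0 < d" using e1 C0 by (simp add: d_def)
  have sd: "sqrt d = e1 / C" using e1 C0 by (simp add: d_def)
  obtain X where X: "isX F d X" using exX[OF F(2) d] by blast
  have Xp: "pos_op X" and X1: "(w F + d *\<^sub>R Id1) oL X = Id1" and X2: "X oL (w F + d *\<^sub>R Id1) = Id1"
   and Xn: "norm X \<le> 1 / d" using X by (auto simp: isX_def)
  have wdQ: "w F + d *\<^sub>R Id1 \<in> Q" by (intro Q wQ F)
  have XQ: "X \<in> Q" by (rule Qinv[OF wdQ pos_opD(1)[OF Xp] X1 X2])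
  have dX: "norm (d *\<^sub>R ap X u) < 2 * e1" if "u \<in> \<Xi>" for u
  proof -
   have 1: "d * norm (ap X (u - x u)) \<le> d * (1 / d * norm (u - x u))"
    by (intro mult_left_mono norm_blinfun_apply_le Xn) (use d in simp)
   have "d * norm (ap X (x u)) \<le> d * (C / sqrt d)"
    using FC(3)[OF F(1) _ F(2) d X, of u] that C[OF that] d
    by (intro mult_left_mono order_trans[OF FC(3)[OF F(1) _ F(2) d X, of u]] divide_right_mono) (auto simp: F_def)
   also have "... = sqrt d * C" using d by (simp add: real_div_sqrt flip: times_divide_eq_left)
   also have "... = e1" using C0 by (simp add: sd)
   finally have 2: "d * norm (ap X (x u)) \<le> e1" .
   have "d *\<^sub>R ap X u = d *\<^sub>R ap X (u - x u) + d *\<^sub>R ap X (x u)"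
    by (simp add: blinfun.diff_right flip: scaleR_add_right)
   then have "norm (d *\<^sub>R ap X u) \<le> norm (d *\<^sub>R ap X (u - x u)) + norm (d *\<^sub>R ap X (x u))"
    by (metis norm_triangle_ineq)
   then show ?thesis using 1 2 x(2)[of u] d by simp
  qed
  obtain k where k: "pos_op k" "k oL k = X" "!!A. op_algebra A ==> X \<in> A ==> k \<in> A" using ex_sqrt[OF Xp] by blast
  have kQ: "k \<in> Q" by (rule k(3)[OF Qalg XQ])
  obtain r where r: "pos_op r" "r oL r = d *\<^sub>R X" "!!A. op_algebra A ==> d *\<^sub>R X \<in> A ==> r \<in> A"
   using ex_sqrt[OF pos_op_scaleR[OF Xp, of d]] d by auto
  have rQ: "r \<in> Q" by (rule r(3)[OF Qalg]) (intro Q XQ)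
  have kX: "k oL X = X oL k" by (simp add: k(2)[symmetric] compose_assoc)
  have kw: "(w F + d *\<^sub>R Id1) oL k = k oL (w F + d *\<^sub>R Id1)"
  proof -
   let ?Y = "w F + d *\<^sub>R Id1"
   have "?Y oL k = (?Y oL k) oL (X oL ?Y)" by (simp add: X2 compose_id_right)
   also have "... = ?Y oL ((k oL X) oL ?Y)" by (simp only: compose_assoc)
   also have "... = (?Y oL X) oL (k oL ?Y)" by (simp only: kX compose_assoc)
   finally show ?thesis by (simp add: X1 compose_id_left)
  qed
  define a where "a = (\<lambda>b. k oL (b oL g))"
  have aQ: "a b \<in> Q" if "b \<in> F" for b unfolding a_def by (intro Q kQ bgQ) (use that F in auto)
  have aadj: "adj (a b) = g oL (adj b oL k)" if "b \<in> F" for b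
  proof -
   have "b \<in> \<L>" using that F Q(2) by blast
   then show ?thesis using gc pos_opD[OF k(1)] by (simp add: a_def adj_compose clinear_compose compose_assoc)
  qed
  have "(\<Sum>b\<in>F. a b oL adj (a b)) = k oL (w F oL k)"
  proof -
   have "a b oL adj (a b) = k oL (((b oL g) oL adj (b oL g)) oL k)" if "b \<in> F" for b
   proof -
    have "b \<in> \<L>" using that F Q(2) by blast
    then show ?thesis using gc pos_opD[OF k(1)] by (simp add: a_def adj_compose clinear_compose compose_assoc)
   qed
   then show ?thesis by (simp add: w_def compose_sum_left compose_sum_right)
  qed
  also have "... = (k oL ((w F + d *\<^sub>R Id1) oL k)) - (k oL (d *\<^sub>R Id1 oL k))"
   by (simp add: compose_simps)
  also have "k oL ((w F + d *\<^sub>R Id1) oL k) = Id1"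
   by (simp add: kw k(2) X2 flip: compose_assoc)
  also have "(k oL (d *\<^sub>R Id1 oL k)) = r oL r" by (simp add: compose_simps k(2) r(2))
  finally have S1: "(\<Sum>b\<in>F. a b oL adj (a b)) + (r oL r) = Id1" by simp
  have S2: "norm (ap r u) < e" if "u \<in> \<Xi>" for u
  proof -
   have "(norm (ap r u))^2 = Re (fm (r oL r) u u)"
    using Re_cinner_adj_comp[OF pos_opD(1)[OF r(1)], of u] pos_opD(2)[OF r(1)] by simp
   also have "... \<le> norm (d *\<^sub>R ap X u) * norm u"
    using norm_cinner_le[of "d *\<^sub>R ap X u" u] complex_Re_le_cmod order_trans
    by (fastforce simp: r(2) blinfun.scaleR_left)
   also have "... \<le> (2 * e1) * M" using dX[OF that] M[OF that] e1 by (intro mult_mono) auto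
   also have "... = e^2 / 2" using M0 by (simp add: e1_def)
   also have "... < e^2" using e by simp
   finally show ?thesis by (rule power2_less_imp_less) (use e in simp)
  qed
  have S3: "c * (norm (ap (adj (a i)) y))^2 \<le> Re (fm h (ap (adj (a i)) y) (ap (adj (a i)) y))"
   if "i \<in> F" for i y using low by (simp add: aadj[OF that])
  show ?thesis
   by (intro exI[of _ F] exI[of _ a] exI[of _ r] conjI ballI allI F(1) aQ rQ pos_opD(2)[OF r(1)] S1 S2 S3)
 qed
 show ?thesis by (rule exI[of _ c]) (use c fin in blast)
qed

end

section \<open>Totally disconnected groups\<close>

text \<open>Multiplicatively these are \<open>gA\<close> and \<open>At\<close>. Describing them by
  membership rather than as images leaves set identities to calculations in the group.\<close>

definition lc :: "'g::group_add => 'g set => 'g set" where "lc g A = {x. - g + x \<in> A}"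
definition rc :: "'g::group_add set => 'g => 'g set" where "rc A t = {x. x - t \<in> A}"

lemma lc_iff: "x \<in> lc g A \<longleftrightarrow> - g + x \<in> A" by (simp add: lc_def)
lemma rc_iff: "x \<in> rc A t \<longleftrightarrow> x - t \<in> A" by (simp add: rc_def)

lemmas grp = diff_conv_add_uminus add.assoc minus_add

lemma lc_image: "lc g A = (\<lambda>t. g + t) ` A"
proof (intro set_eqI iffI)
 fix x assume "x \<in> lc g A"
 then have "x = g + (- g + x)" "- g + x \<in> A" by (simp_all add: lc_iff add.assoc[symmetric])
 then show "x \<in> (\<lambda>t. g + t) ` A" by blast
qed (auto simp: lc_iff add.assoc[symmetric])

lemma rc_image: "rc A t = (\<lambda>x. x + t) ` A"
proof (intro set_eqI iffI)
 fix x assume "x \<in> rc A t"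
 then have "x = (x - t) + t" "x - t \<in> A" by (simp_all add: rc_iff)
 then show "x \<in> (\<lambda>x. x + t) ` A" by blast
qed (auto simp: rc_iff)

lemma lc_lc: "lc g (lc h A) = lc (g + h) A" by (auto simp: lc_iff grp simp del: add_uminus_conv_diff)
lemma lc_rc: "lc g (rc A t) = rc (lc g A) t" by (auto simp: lc_iff rc_iff grp simp del: add_uminus_conv_diff)
lemma rc_rc: "rc (rc A s) t = rc A (s + t)" by (auto simp: rc_iff grp simp del: add_uminus_conv_diff)
lemma lc_0: "lc 0 A = A" by (auto simp: lc_iff)
lemma rc_0: "rc A 0 = A" by (auto simp: rc_iff)
lemma lc_Int: "lc g (A \<inter> B) = lc g A \<inter> lc g B" by (auto simp: lc_iff)
lemma rc_Int: "rc (A \<inter> B) t = rc A t \<inter> rc B t" by (auto simp: rc_iff)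
lemma lc_mono: "A <= B ==> lc g A <= lc g B" by (auto simp: lc_iff)
lemma rc_mono: "A <= B ==> rc A t <= rc B t" by (auto simp: rc_iff)
lemma lc_empty: "lc g A = {} \<longleftrightarrow> A = {}" by (simp add: lc_image)
lemma rc_empty: "rc A t = {} \<longleftrightarrow> A = {}" by (simp add: rc_image)

lemma subgroupD:
 assumes "additive_subgroup H"
 shows "0 \<in> H" "!!g h. g \<in> H ==> h \<in> H ==> g + h \<in> H" "!!g. g \<in> H ==> - g \<in> H"
  "!!g h. g \<in> H ==> h \<in> H ==> g - h \<in> H" "!!g h. g \<in> H ==> h \<in> H ==> - g + h \<in> H"
  "!!g h. g \<in> H ==> g + h \<in> H \<longleftrightarrow> h \<in> H" "!!g h. h \<in> H ==> g + h \<in> H \<longleftrightarrow> g \<in> H"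
  "!!g. - g \<in> H \<longleftrightarrow> g \<in> H"
proof -
 show 1: "0 \<in> H" and 2: "!!g h. g \<in> H ==> h \<in> H ==> g + h \<in> H" and 3: "!!g. g \<in> H ==> - g \<in> H"
  using assms by (auto simp: additive_subgroup_def)
 show "g - h \<in> H" if "g \<in> H" "h \<in> H" for g h using 2[OF that(1) 3[OF that(2)]] by simp
 show "- g + h \<in> H" if "g \<in> H" "h \<in> H" for g h using 2[OF 3[OF that(1)] that(2)] .
 show "g + h \<in> H \<longleftrightarrow> h \<in> H" if "g \<in> H" for g h
  using 2[OF that, of h] 2[OF 3[OF that], of "g + h"] by (auto simp: add.assoc[symmetric])
 show "g + h \<in> H \<longleftrightarrow> g \<in> H" if "h \<in> H" for g h
  using 2[OF _ that, of g] 2[OF _ 3[OF that], of "g + h"] by (auto simp: add.assoc)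
 show "- g \<in> H \<longleftrightarrow> g \<in> H" for g using 3[of g] 3[of "- g"] by auto
qed

lemma subgroup_Int: "additive_subgroup H ==> additive_subgroup K ==> additive_subgroup (H \<inter> K)"
 by (auto simp: additive_subgroup_def)

lemma lc_subgroup_eq: "additive_subgroup V ==> x \<in> lc g V ==> lc x V = lc g V"
proof (intro set_eqI)
 fix y assume V: "additive_subgroup V" and x: "x \<in> lc g V"
 have "- g + y = (- g + x) + (- x + y)" by (simp add: grp add.assoc[symmetric] del: add_uminus_conv_diff)
 then show "y \<in> lc x V \<longleftrightarrow> y \<in> lc g V" using subgroupD(6)[OF V, of "- g + x" "- x + y"] x by (simp add: lc_iff)
qed

lemma lc_subgroup_disjoint: "additive_subgroup V ==> lc g V \<inter> lc h V \<noteq> {} ==> lc g V = lc h V"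
 by (metis disjoint_iff lc_subgroup_eq)

lemma rc_subgroup_eq: "additive_subgroup V ==> x \<in> rc V t ==> rc V x = rc V t"
proof (intro set_eqI)
 fix y assume V: "additive_subgroup V" and x: "x \<in> rc V t"
 have "y - t = (y - x) + (x - t)" by (simp add: grp del: add_uminus_conv_diff)
 then show "y \<in> rc V x \<longleftrightarrow> y \<in> rc V t" using subgroupD(7)[OF V, of "x - t" "y - x"] x by (simp add: rc_iff)
qed

lemma rc_subgroup_disjoint: "additive_subgroup V ==> rc V g \<inter> rc V h \<noteq> {} ==> rc V g = rc V h"
 by (metis disjoint_iff rc_subgroup_eq)

lemma lc_subgroup_self: "additive_subgroup V ==> g \<in> lc g V" by (simp add: lc_iff subgroupD)
lemma rc_subgroup_self: "additive_subgroup V ==> g \<in> rc V g" by (simp add: rc_iff subgroupD)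
lemma lc_subgroup_mem: "additive_subgroup V ==> g \<in> V ==> lc g V = V"
 using lc_subgroup_eq[of V g 0] by (simp add: lc_0)
lemma rc_subgroup_mem: "additive_subgroup V ==> g \<in> V ==> rc V g = V"
 using rc_subgroup_eq[of V g 0] by (simp add: rc_0)

lemma cont_add: "continuous_on S f ==> continuous_on S h ==> continuous_on S (\<lambda>x. f x + h x :: 'g::topological_group_add)"
 by (rule continuous_on_add)
lemma cont_minus: "continuous_on S f ==> continuous_on S (\<lambda>x. - f x :: 'g::topological_group_add)"
 unfolding continuous_on_def by (auto intro: tendsto_minus)
lemma cont_diff: "continuous_on S f ==> continuous_on S h ==> continuous_on S (\<lambda>x. f x - h x :: 'g::topological_group_add)"
 using cont_add[OF _ cont_minus, of S f h] by simp
lemmas cont_grp = cont_add cont_minus cont_diff continuous_on_const continuous_on_id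

lemma open_lc: "open A ==> open (lc g A :: 'g::topological_group_add set)"
 unfolding lc_def using open_vimage[of A "\<lambda>x. - g + x"] by (simp add: vimage_def cont_grp)
lemma open_rc: "open A ==> open (rc A t :: 'g::topological_group_add set)"
 unfolding rc_def using open_vimage[of A "\<lambda>x. x - t"] by (simp add: vimage_def cont_grp)
lemma compact_lc: "compact A ==> compact (lc g A :: 'g::topological_group_add set)"
 unfolding lc_image by (intro compact_continuous_image cont_grp)
lemma compact_rc: "compact A ==> compact (rc A t :: 'g::topological_group_add set)"
 unfolding rc_image by (intro compact_continuous_image cont_grp)

lemma open_subgroupI:
 fixes H :: "'g::topological_group_add set"
 assumes H: "additive_subgroup H" and U: "open U" "0 \<in> U" "U <= H" shows "open H"
proof -
 have "H = (\<Union>h\<in>H. lc h U)"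
 proof (intro set_eqI iffI)
  fix x assume "x \<in> (\<Union>h\<in>H. lc h U)"
  then obtain h where "h \<in> H" "- h + x \<in> U" by (auto simp: lc_iff)
  then show "x \<in> H" using subgroupD(6)[OF H, of "- h" x] subgroupD(8)[OF H] U(3) by auto
 next
  fix x assume "x \<in> H" then show "x \<in> (\<Union>h\<in>H. lc h U)" using U(2) by (intro UN_I[of x]) (auto simp: lc_iff)
 qed
 moreover have "open (\<Union>h\<in>H. lc h U)" using U(1) by (intro open_UN ballI open_lc)
 ultimately show ?thesis by simp
qed

lemma closed_open_subgroup:
 fixes H :: "'g::topological_group_add set"
 assumes H: "additive_subgroup H" "open H" shows "closed H"
proof -
 have "- H = (\<Union>x\<in>- H. lc x H)"
 proof (intro set_eqI iffI)
  fix x assume "x \<in> - H" then show "x \<in> (\<Union>x\<in>- H. lc x H)" using lc_subgroup_self[OF H(1)] by blast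
 next
  fix x assume "x \<in> (\<Union>x\<in>- H. lc x H)"
  then obtain y where y: "y \<notin> H" "- y + x \<in> H" by (auto simp: lc_iff)
  then show "x \<in> - H" using subgroupD(7)[OF H(1), of x "- y"] subgroupD(8)[OF H(1)] by auto
 qed
 moreover have "open (\<Union>x\<in>- H. lc x H)" using H(2) by (intro open_UN ballI open_lc)
 ultimately show ?thesis by (simp add: closed_def)
qed

section \<open>Open normal subgroups of a compact open subgroup\<close>

locale td_group =
 fixes K :: "'g::{topological_group_add,t2_space} set"
 assumes K_sub: "additive_subgroup K" and K_compact: "compact K" and K_open: "open K"
  and td: "totally_disconnected (UNIV :: 'g set)"
begin

text \<open>Normality is demanded only inside \<open>K\<close>; conjugation by further group
  elements is controlled on compact sets by \<open>nsub_conj_compact\<close>.\<close>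

definition nsub :: "'g set => bool" where
 "nsub V \<longleftrightarrow> additive_subgroup V & open V & V <= K & (\<forall>k\<in>K. \<forall>v\<in>V. k + v - k \<in> V)"

lemma nsubD:
 assumes "nsub V" shows "additive_subgroup V" "open V" "V <= K" "!!k v. k \<in> K ==> v \<in> V ==> k + v - k \<in> V"
  "closed V" "compact V" "0 \<in> V"
proof -
 show 1: "additive_subgroup V" "open V" "V <= K" "!!k v. k \<in> K ==> v \<in> V ==> k + v - k \<in> V"
  using assms by (auto simp: nsub_def)
 show "0 \<in> V" by (rule subgroupD(1)[OF 1(1)])
 show c: "closed V" by (rule closed_open_subgroup[OF 1(1,2)])
 show "compact V" using compact_Int_closed[OF K_compact c] 1(3) by (simp add: Int_absorb1)
qed

lemma nsub_conj: "nsub V ==> k \<in> K ==> v \<in> V ==> - k + v + k \<in> V"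
 using nsubD(4)[of V "- k" v] subgroupD(3)[OF K_sub, of k] by simp

lemma nsub_K: "nsub K"
 using K_sub K_open subgroupD[OF K_sub] by (auto simp: nsub_def)

lemma nsub_Int: "nsub V ==> nsub W ==> nsub (V \<inter> W)"
 using subgroup_Int[of V W] by (auto simp: nsub_def)

text \<open>Intersecting with \<open>K\<close> makes the empty family harmless.\<close>

lemma nsub_INT: "finite F ==> (!!i. i \<in> F ==> nsub (V i)) ==> nsub (K \<inter> (\<Inter>i\<in>F. V i))"
proof (induction F rule: finite_induct)
 case (insert i F)
 have "K \<inter> (\<Inter>j\<in>insert i F. V j) = V i \<inter> (K \<inter> (\<Inter>j\<in>F. V j))" by auto
 then show ?case using nsub_Int[of "V i"] insert by simp
qed (simp add: nsub_K)

lemma nsub_rc: "nsub V ==> k \<in> K ==> rc V k = lc k V"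
proof (intro set_eqI iffI)
 fix x assume V: "nsub V" and k: "k \<in> K"
 show "x \<in> lc k V" if "x \<in> rc V k"
  using nsub_conj[OF V k, of "x - k"] that by (simp add: rc_iff lc_iff grp del: add_uminus_conv_diff)
 show "x \<in> rc V k" if "x \<in> lc k V"
  using nsubD(4)[OF V k, of "- k + x"] that by (simp add: rc_iff lc_iff grp del: add_uminus_conv_diff)
qed

text \<open>In the compact Hausdorff space \<open>K\<close> components and quasi-components agree,
  so \<open>{0}\<close> is a quasi-component and is separated by a clopen set from the compact set
  \<open>K - U\<close>.\<close>

lemma ex_clopen_nbhd:
 assumes U: "open U" "0 \<in> U"
 shows "\<exists>C. open C & compact C & 0 \<in> C & C <= U & C <= K"
proof -
 let ?X = "top_of_set K"
 have 0: "0 \<in> K" by (rule subgroupD(1)[OF K_sub])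
 have "compact_space ?X" using K_compact by (simp add: compact_space_subtopology)
 moreover have "Hausdorff_space (euclidean :: 'g topology)"
  unfolding Hausdorff_space_def using hausdorff by (auto simp: disjnt_def)
 then have "Hausdorff_space ?X" by (rule Hausdorff_space_subtopology)
 ultimately have q: "quasi_components_of ?X = connected_components_of ?X"
  by (intro quasi_eq_connected_components_of) auto
 have "connected_component_of_set ?X 0 \<in> connected_components_of ?X"
  using 0 by (auto simp: connected_components_of_def)
 moreover have "connected_component_of_set ?X 0 = {0}"
 proof -
  have "connectedin ?X (connected_component_of_set ?X 0)" by (rule connectedin_connected_component_of)
  then have "connected (connected_component_of_set ?X 0)" by (simp add: connectedin_subtopology)
  moreover have "0 \<in> connected_component_of_set ?X 0" using 0 by (simp add: connected_component_of_refl)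
  ultimately show ?thesis using td unfolding totally_disconnected_def by blast
 qed
 ultimately have c: "{0} \<in> quasi_components_of ?X" using q by simp
 have "compact (K \<inter> - U)" using U(1) by (intro compact_Int_closed K_compact) (simp add: closed_Compl)
 then have "compactin ?X (K \<inter> - U)" by (simp add: compactin_subtopology)
 then have "separated_between ?X {0} (K \<inter> - U)"
  using separated_between_quasi_component_compact[OF c] U(2) by (simp add: disjnt_def)
 then obtain C D where CD: "openin ?X C" "openin ?X D" "C \<union> D = K" "disjnt C D" "0 \<in> C" "K \<inter> - U <= D"
  unfolding separated_between_def by auto
 have oC: "open C" "C <= K" using CD(1) K_open by (auto simp: openin_open)
 have "open D" using CD(2) K_open by (auto simp: openin_open)
 moreover have "C = K \<inter> - D" using CD(3,4) by (auto simp: disjnt_def)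
 ultimately have "compact C" using compact_Int_closed[OF K_compact, of "- D"] by (simp add: closed_Compl)
 moreover have "C <= U" using CD oC by (auto simp: disjnt_def)
 ultimately show ?thesis using oC CD by blast
qed

lemma tube:
 fixes C W :: "'g set"
 assumes C: "compact C" and O: "open W" "C <= W"
 shows "\<exists>U. open U & 0 \<in> U & (\<forall>c\<in>C. \<forall>u\<in>U. c + u \<in> W)"
proof -
 have "\<exists>A U. open A & c \<in> A & open U & 0 \<in> U & (\<forall>a\<in>A. \<forall>u\<in>U. a + u \<in> W)" if c: "c \<in> C" for c
 proof -
  have "((\<lambda>p. fst p + snd p) \<longlongrightarrow> c + 0) (nhds c \<times>\<^sub>F nhds (0::'g))" by (rule tendsto_add_Pair)
  then have "\<forall>\<^sub>F p in nhds c \<times>\<^sub>F nhds 0. fst p + snd p \<in> W"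
   by (rule topological_tendstoD) (use O c in auto)
  then obtain P Q where PQ: "eventually P (nhds c)" "eventually Q (nhds 0)" "!!x y. P x ==> Q y ==> x + y \<in> W"
   unfolding eventually_prod_filter by auto
  from PQ(1) obtain A where A: "open A" "c \<in> A" "\<forall>x\<in>A. P x" unfolding eventually_nhds by auto
  from PQ(2) obtain U where U: "open U" "0 \<in> U" "\<forall>x\<in>U. Q x" unfolding eventually_nhds by auto
  show ?thesis using A U PQ(3) by (intro exI[of _ A] exI[of _ U]) simp
 qed
 then obtain A U where AU: "!!c. c \<in> C ==> open (A c) & c \<in> A c & open (U c) & 0 \<in> U c & (\<forall>a\<in>A c. \<forall>u\<in>U c. a + u \<in> W)" by metis
 then obtain F where F: "F <= C" "finite F" "C <= (\<Union>c\<in>F. A c)" using compactE_image[OF C, of C A] by (metis UN_iff subsetI)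
 show ?thesis
 proof (intro exI[of _ "\<Inter>c\<in>F. U c"] conjI ballI)
  show "open (\<Inter>c\<in>F. U c)" using F AU by (intro open_INT ballI) auto
  show "0 \<in> (\<Inter>c\<in>F. U c)" using F AU by auto
  fix c u assume "c \<in> C" "u \<in> (\<Inter>c\<in>F. U c)"
  then show "c + u \<in> W" using F AU by blast
 qed
qed

text \<open>Van Dantzig's argument: the right stabiliser \<open>W\<close> of a compact open set
  \<open>C\<close> around 0 is an open subgroup contained in \<open>C\<close>. Intersecting its
  conjugates under \<open>K\<close> makes it normal in \<open>K\<close>.\<close>

lemma ex_nsub:
 assumes U: "open U" "0 \<in> U"
 shows "\<exists>V. nsub V & V <= U"
proof -
 obtain C where C: "open C" "compact C" "0 \<in> C" "C <= U" "C <= K" using ex_clopen_nbhd[OF U] by blast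
 obtain N where N: "open N" "0 \<in> N" "!!c n. c \<in> C ==> n \<in> N ==> c + n \<in> C" using tube[OF C(2,1)] by blast
 define W where "W = {g. \<forall>c. c + g \<in> C \<longleftrightarrow> c \<in> C}"
 have W: "additive_subgroup W"
  unfolding additive_subgroup_def
 proof (intro conjI ballI)
  show "0 \<in> W" by (simp add: W_def)
  show "g + h \<in> W" if "g \<in> W" "h \<in> W" for g h using that by (simp add: W_def add.assoc[symmetric])
  show "- g \<in> W" if "g \<in> W" for g
  proof -
   have "c + - g \<in> C \<longleftrightarrow> c \<in> C" for c using that by (simp add: W_def) (metis diff_add_cancel)
   then show ?thesis by (simp add: W_def)
  qed
 qed
 have WC: "W <= C" using C(3) by (force simp: W_def dest: spec[of _ 0])
 define N' where "N' = N \<inter> uminus -` N"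
 have "open N'" unfolding N'_def by (intro open_Int N(1) open_vimage cont_grp)
 moreover have "0 \<in> N'" using N(2) by (simp add: N'_def)
 moreover have "N' <= W"
 proof
  fix g assume g: "g \<in> N'"
  have "c \<in> C" if "c + g \<in> C" for c using N(3)[OF that, of "- g"] g by (simp add: N'_def grp del: add_uminus_conv_diff)
  moreover have "c + g \<in> C" if "c \<in> C" for c using N(3)[OF that] g by (simp add: N'_def)
  ultimately show "g \<in> W" unfolding W_def by blast
 qed
 ultimately have oW: "open W" by (rule open_subgroupI[OF W])
 have "open (lc k W)" if "k \<in> K" for k by (rule open_lc[OF oW])
 moreover have "K <= (\<Union>k\<in>K. lc k W)" using lc_subgroup_self[OF W] by blast
 ultimately obtain F where F: "F <= K" "finite F" "K <= (\<Union>k\<in>F. lc k W)" by (rule compactE_image[OF K_compact])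
 define V where "V = {v\<in>K. \<forall>k\<in>K. - k + v + k \<in> W}"
 \<comment> \<open>Conjugation by elements of \<open>W\<close> preserves \<open>W\<close>, so
   representatives of the finitely many cosets covering \<open>K\<close> suffice; this keeps
   \<open>V\<close> open.\<close>
 have "V = K \<inter> (\<Inter>k\<in>F. (\<lambda>v. - k + v + k) -` W)"
 proof (intro set_eqI iffI)
  fix v assume v: "v \<in> K \<inter> (\<Inter>k\<in>F. (\<lambda>v. - k + v + k) -` W)"
  have "- k + v + k \<in> W" if k: "k \<in> K" for k
  proof -
   obtain j where j: "j \<in> F" "- j + k \<in> W" using F(3) k by (auto simp: lc_iff)
   have "- k + v + k = - (- j + k) + (- j + v + j) + (- j + k)" by (simp add: grp del: add_uminus_conv_diff)
   also have "... \<in> W"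
    by (rule subgroupD(2)[OF W subgroupD(2)[OF W subgroupD(3)[OF W j(2)]] j(2)]) (use v j(1) in auto)
   finally show ?thesis .
  qed
  then show "v \<in> V" using v by (auto simp: V_def)
 qed (use F in \<open>auto simp: V_def\<close>)
 then have oV: "open V"
  using F(2) oW by (auto intro!: open_Int K_open open_INT open_vimage cont_grp)
 have sV: "additive_subgroup V"
  unfolding additive_subgroup_def
 proof (intro conjI ballI)
  show "0 \<in> V" using subgroupD(1)[OF W] subgroupD(1)[OF K_sub] by (simp add: V_def)
  show "g + h \<in> V" if "g \<in> V" "h \<in> V" for g h
  proof -
   have "- k + (g + h) + k = (- k + g + k) + (- k + h + k)" for k by (simp add: grp del: add_uminus_conv_diff)
   then show ?thesis using that subgroupD(2)[OF W] subgroupD(2)[OF K_sub] by (auto simp: V_def)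
  qed
  show "- g \<in> V" if "g \<in> V" for g
  proof -
   have "- k + - g + k = - (- k + g + k)" for k by (simp add: grp del: add_uminus_conv_diff)
   then show ?thesis using that subgroupD(3)[OF W] subgroupD(3)[OF K_sub] by (auto simp: V_def)
  qed
 qed
 have "j + v - j \<in> V" if "j \<in> K" "v \<in> V" for j v
 proof -
  have "- k + (j + v - j) + k = - (- j + k) + v + (- j + k)" for k by (simp add: grp del: add_uminus_conv_diff)
  then show ?thesis using that subgroupD(2,4,5)[OF K_sub] by (auto simp: V_def)
 qed
 moreover have "V <= W" using subgroupD(1)[OF K_sub] by (force simp: V_def)
 ultimately show ?thesis using oV sV WC C by (intro exI[of _ V]) (auto simp: nsub_def V_def)
qed

lemma finite_coset_cover:
 assumes C: "compact C" and V: "!!c. c \<in> C ==> nsub (V c)"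
 shows "\<exists>F. finite F & F <= C & C <= (\<Union>c\<in>F. lc c (V c))"
proof -
 have "open (lc c (V c))" if "c \<in> C" for c by (rule open_lc[OF nsubD(2)[OF V[OF that]]])
 moreover have "C <= (\<Union>c\<in>C. lc c (V c))" using lc_subgroup_self nsubD(1)[OF V] by blast
 ultimately obtain F where "F <= C" "finite F" "C <= (\<Union>c\<in>F. lc c (V c))" by (rule compactE_image[OF C])
 then show ?thesis by blast
qed

text \<open>Cosets of \<open>K\<close> control conjugation because the subgroups are normal in \<open>K\<close>.\<close>

lemma nsub_conj_compact:
 assumes C: "compact C" and U: "open U" "0 \<in> U"
 shows "\<exists>V. nsub V & (\<forall>g\<in>C. \<forall>v\<in>V. g + v - g \<in> U)"
proof -
 have "\<exists>V. nsub V & (\<forall>v\<in>V. g + v - g \<in> U)" for g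
 proof -
  have "open ((\<lambda>v. g + v - g) -` U)" using U(1) by (intro open_vimage cont_grp)
  then show ?thesis using ex_nsub[of "(\<lambda>v. g + v - g) -` U"] U(2) by auto
 qed
 then obtain V where V: "!!g. nsub (V g)" "!!g v. v \<in> V g ==> g + v - g \<in> U" by metis
 obtain F where F: "finite F" "F <= C" "C <= (\<Union>c\<in>F. lc c K)" using finite_coset_cover[OF C, of "\<lambda>_. K"] nsub_K by blast
 have "nsub (K \<inter> (\<Inter>g\<in>F. V g))" by (rule nsub_INT[OF F(1)]) (rule V)
 moreover have "g + v - g \<in> U" if g: "g \<in> C" and v: "v \<in> K \<inter> (\<Inter>g\<in>F. V g)" for g v
 proof -
  obtain c where c: "c \<in> F" "- c + g \<in> K" using F(3) g by (auto simp: lc_iff)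
  have "(- c + g) + v - (- c + g) \<in> V c" using nsubD(4)[OF V(1) c(2)] v c(1) by auto
  then have "c + ((- c + g) + v - (- c + g)) - c \<in> U" by (rule V(2))
  then show ?thesis by (simp add: grp del: add_uminus_conv_diff)
 qed
 ultimately show ?thesis by blast
qed

text \<open>Uniform continuity on a compact set with an open subgroup as the neighbourhood, so that
  \<open>f\<close> is nearly constant on left cosets of \<open>V\<close>.\<close>

lemma locally_almost_constant:
 fixes f :: "'g => 'b::metric_space"
 assumes f: "continuous_on UNIV f" and C: "compact C" and e: "0 < e"
 shows "\<exists>V. nsub V & (\<forall>x\<in>C. \<forall>v\<in>V. dist (f (x + v)) (f x) < e)"
proof -
 have "\<exists>W. nsub W & (\<forall>w\<in>W. dist (f (c + w)) (f c) < e / 2)" for c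
 proof -
  have "open {w. dist (f (c + w)) (f c) < e / 2}"
   using f by (intro open_Collect_less continuous_on_dist continuous_on_compose2[OF f] cont_grp) auto
  then show ?thesis using ex_nsub[of "{w. dist (f (c + w)) (f c) < e / 2}"] e by auto
 qed
 then obtain W where W: "!!c. nsub (W c)" "!!c w. w \<in> W c ==> dist (f (c + w)) (f c) < e / 2" by metis
 obtain F where F: "finite F" "F <= C" "C <= (\<Union>c\<in>F. lc c (W c))" using finite_coset_cover[of C W, OF C W(1)] by auto
 have "nsub (K \<inter> (\<Inter>g\<in>F. W g))" by (rule nsub_INT[OF F(1)]) (rule W)
 moreover have "dist (f (x + v)) (f x) < e" if x: "x \<in> C" and v: "v \<in> K \<inter> (\<Inter>g\<in>F. W g)" for x v
 proof -
  obtain c where c: "c \<in> F" "- c + x \<in> W c" using F(3) x by (auto simp: lc_iff)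
  have "(- c + x) + v \<in> W c" using subgroupD(2)[OF nsubD(1)[OF W(1)] c(2)] v c(1) by auto
  then have "dist (f (x + v)) (f c) < e / 2" using W(2) by (metis add.assoc add_minus_cancel)
  moreover have "dist (f x) (f c) < e / 2" using W(2)[OF c(2)] by (simp add: add.assoc[symmetric])
  ultimately show ?thesis by (rule dist_triangle_half_l)
 qed
 ultimately show ?thesis by blast
qed

lemma coset_partition:
 assumes A: "compact A" and V: "nsub V" and AV: "!!a v. a \<in> A ==> v \<in> V ==> a + v \<in> A"
 shows "\<exists>F. finite F & F <= A & A = (\<Union>g\<in>F. lc g V) & (\<forall>g\<in>F. \<forall>h\<in>F. g \<noteq> h --> lc g V \<inter> lc h V = {})"
proof -
 obtain F where F: "finite F" "F <= A" "A <= (\<Union>c\<in>F. lc c V)" using finite_coset_cover[OF A, of "\<lambda>_. V"] V by blast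
 have sub: "lc a V <= A" if "a \<in> A" for a
 proof
  fix x assume "x \<in> lc a V"
  then show "x \<in> A" using AV[OF that, of "- a + x"] by (simp add: lc_iff add.assoc[symmetric])
 qed
 obtain F' where F': "F' <= F" "inj_on (\<lambda>g. lc g V) F'" "(\<lambda>g. lc g V) ` F' = (\<lambda>g. lc g V) ` F"
  by (metis subset_image_inj order_refl)
 have "(\<Union>g\<in>F'. lc g V) = (\<Union>g\<in>F. lc g V)" by (simp only: F'(3))
 moreover have "(\<Union>g\<in>F. lc g V) = A" using F sub by (intro subset_antisym UN_least) auto
 ultimately have "A = (\<Union>g\<in>F'. lc g V)" by simp
 moreover have "lc g V \<inter> lc h V = {}" if "g \<in> F'" "h \<in> F'" "g \<noteq> h" for g h
  using lc_subgroup_disjoint[OF nsubD(1)[OF V], of g h] inj_onD[OF F'(2), of g h] that by blast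
 ultimately show ?thesis using F' F by (intro exI[of _ F']) (auto intro: finite_subset)
qed

lemma compact_open_stable:
 assumes A: "compact A" "open A" shows "\<exists>V. nsub V & (\<forall>a\<in>A. \<forall>v\<in>V. a + v \<in> A)"
proof -
 obtain U where U: "open U" "0 \<in> U" "!!c u. c \<in> A ==> u \<in> U ==> c + u \<in> A" using tube[OF A(1,2)] by blast
 obtain V where V: "nsub V" "V <= U" using ex_nsub[OF U(1,2)] by blast
 show ?thesis using V U(3) by (intro exI[of _ V]) blast
qed

lemma compact_open_hull:
 assumes C: "compact C" shows "\<exists>A. compact A & open A & C <= A & (\<forall>a\<in>A. \<forall>k\<in>K. a + k \<in> A)"
proof -
 obtain F where F: "finite F" "F <= C" "C <= (\<Union>c\<in>F. lc c K)" using finite_coset_cover[OF C, of "\<lambda>_. K"] nsub_K by blast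
 have "a + k \<in> (\<Union>c\<in>F. lc c K)" if "a \<in> (\<Union>c\<in>F. lc c K)" "k \<in> K" for a k
  using that subgroupD(2)[OF K_sub] by (auto simp: lc_iff add.assoc[symmetric])
 then show ?thesis using F by (intro exI[of _ "\<Union>c\<in>F. lc c K"] conjI compact_UN open_UN)
  (auto intro: compact_lc K_compact open_lc K_open)
qed

end

section \<open>Haar measure of compact open sets\<close>

text \<open>\<open>haar\<close> falls back to the null measure when no Haar measure exists; the
  locale records that this is not the case. \<open>left_haar_measure_haar\<close> provides the
  assumption from any nonzero operator.\<close>

locale td_haar = td_group K for K :: "'g::{topological_group_add,t2_space} set" +
 assumes haar: "left_haar_measure (haar :: 'g measure)"
begin

definition m :: "'g set => real" where "m A = measure haar A"

lemma borel_haar: "open A ==> A \<in> sets haar" "closed A ==> A \<in> sets haar" "compact (A::'g set) ==> A \<in> sets haar"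
 by (auto simp: sets_haar compact_imp_closed)

lemma emeasure_m: "compact A ==> emeasure haar A = ennreal (m A)"
 unfolding m_def using emeasure_haar_compact[of A] by (simp add: emeasure_eq_ennreal_measure less_top[symmetric])

lemma m_pos: "compact A ==> open A ==> A \<noteq> {} ==> 0 < m A"
proof -
 assume A: "compact A" "open A" "A \<noteq> {}"
 then have "0 < emeasure haar A" using haar unfolding left_haar_measure_def by blast
 then show ?thesis using emeasure_m[OF A(1)] by simp
qed

lemma m_nonneg: "0 \<le> m A" by (simp add: m_def)

lemma m_lc: "A \<in> sets haar ==> m (lc g A) = m A"
 using haar unfolding left_haar_measure_def m_def measure_def lc_image by simp

lemma m_UN:
 assumes "finite F" "!!i. i \<in> F ==> compact (A i)" "!!i j. i \<in> F ==> j \<in> F ==> i \<noteq> j ==> A i \<inter> A j = {}"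
 shows "m (\<Union>i\<in>F. A i) = (\<Sum>i\<in>F. m (A i))"
proof -
 have "emeasure haar (A i) \<noteq> \<infinity>" if "i \<in> F" for i using emeasure_haar_compact[OF assms(2)[OF that]] by simp
 then show ?thesis
  unfolding m_def using assms borel_haar(3) by (intro measure_finite_Union) (auto simp: disjoint_family_on_def)
qed

lemma m_empty: "m {} = 0" by (simp add: m_def)

text \<open>The modular function in the convention \<open>m (A t) = \<Delta> t * m A\<close>, read
  off from \<open>K\<close> and extended to all compact open sets by \<open>m_rc\<close>.\<close>

definition \<Delta> :: "'g => real" where "\<Delta> t = m (rc K t) / m K"

lemma m_K: "0 < m K" using m_pos[OF K_compact K_open] subgroupD(1)[OF K_sub] by blast

lemma \<Delta>_pos: "0 < \<Delta> t"
 unfolding \<Delta>_def by (intro divide_pos_pos m_K m_pos compact_rc open_rc K_compact K_open) (use subgroupD(1)[OF K_sub] in \<open>auto simp: rc_empty\<close>)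

lemma \<Delta>_K: "k \<in> K ==> \<Delta> k = 1"
 using m_K rc_subgroup_mem[OF K_sub] by (simp add: \<Delta>_def)

lemma m_partition_lc:
 assumes F: "finite F" "A = (\<Union>g\<in>F. lc g V)" "\<forall>g\<in>F. \<forall>h\<in>F. g \<noteq> h --> lc g V \<inter> lc h V = {}" and V: "compact V"
 shows "m A = real (card F) * m V" "m (rc A t) = real (card F) * m (rc V t)"
proof -
 have "m (\<Union>g\<in>F. lc g V) = (\<Sum>g\<in>F. m (lc g V))" by (rule m_UN) (use F V compact_lc in auto)
 then show "m A = real (card F) * m V" using m_lc[OF borel_haar(3)[OF V]] F(2) by simp
 have rA: "rc A t = (\<Union>g\<in>F. lc g (rc V t))" unfolding F(2) lc_rc by (auto simp: rc_iff)
 have "m (\<Union>g\<in>F. lc g (rc V t)) = (\<Sum>g\<in>F. m (lc g (rc V t)))"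
 proof (rule m_UN[OF F(1)])
  show "compact (lc i (rc V t))" for i using V by (intro compact_lc compact_rc)
  show "lc i (rc V t) \<inter> lc j (rc V t) = {}" if "i \<in> F" "j \<in> F" "i \<noteq> j" for i j
   using F(3) that unfolding lc_rc rc_Int[symmetric] by (simp add: rc_empty)
 qed
 then show "m (rc A t) = real (card F) * m (rc V t)" using m_lc[OF borel_haar(3)[OF compact_rc[OF V]]] by (simp add: rA)
qed

text \<open>A partition of \<open>K\<close> into left cosets of \<open>V\<close> becomes, after
  right translation, a partition of \<open>K t\<close> into as many left translates of
  \<open>V t\<close>. The ratio for \<open>K\<close> is thus the ratio for \<open>V\<close>.\<close>

lemma m_rc_nsub: "nsub V ==> m (rc V t) = \<Delta> t * m V"
proof -
 assume V: "nsub V"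
 obtain F where F: "finite F" "K = (\<Union>g\<in>F. lc g V)" "\<forall>g\<in>F. \<forall>h\<in>F. g \<noteq> h --> lc g V \<inter> lc h V = {}"
  using coset_partition[OF K_compact V] subgroupD(2)[OF K_sub] nsubD(3)[OF V] by blast
 note p = m_partition_lc[OF F nsubD(6)[OF V]]
 have "0 < real (card F)" using p(1) m_K by (metis mult_zero_left of_nat_0_less_iff less_numeral_extra(3) neq0_conv of_nat_0)
 moreover have "m V \<noteq> 0" using p(1) m_K by auto
 ultimately show ?thesis using p(1) p(2)[of t] m_K by (simp add: \<Delta>_def)
qed

lemma m_rc: "compact A ==> open A ==> m (rc A t) = \<Delta> t * m A"
proof -
 assume A: "compact A" "open A"
 obtain V where V: "nsub V" "!!a v. a \<in> A ==> v \<in> V ==> a + v \<in> A" using compact_open_stable[OF A] by blast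
 obtain F where F: "finite F" "A = (\<Union>g\<in>F. lc g V)" "\<forall>g\<in>F. \<forall>h\<in>F. g \<noteq> h --> lc g V \<inter> lc h V = {}"
  using coset_partition[OF A(1) V] by blast
 show ?thesis using m_partition_lc[OF F nsubD(6)[OF V(1)]] m_rc_nsub[OF V(1)] by simp
qed

lemma integrable_cc:
 fixes f :: "'g => complex"
 assumes f: "continuous_on UNIV f" and C: "compact C" "!!x. x \<notin> C ==> f x = 0"
 shows "integrable haar f"
proof -
 have meas: "f \<in> borel_measurable haar"
  using borel_measurable_continuous_onI[OF f] measurable_cong_sets[OF sets_haar refl] by blast
 have "compact (f ` C)" by (rule compact_continuous_image[OF continuous_on_subset[OF f] C(1)]) simp
 then obtain B where B: "!!x. x \<in> C ==> norm (f x) \<le> B" using compact_imp_bounded[of "f ` C"] by (auto simp: bounded_iff)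
 show ?thesis
 proof (rule integrableI_bounded_set[of C])
  show "C \<in> sets haar" by (rule borel_haar(3)[OF C(1)])
  show "emeasure haar C < \<infinity>" by (rule emeasure_haar_compact[OF C(1)])
  show "AE x in haar. x \<in> C --> norm (f x) \<le> B" using B by simp
  show "AE x in haar. x \<notin> C --> f x = 0" using C(2) by simp
 qed (rule meas)
qed

lemma norm_integral_le:
 fixes f :: "'g => complex"
 assumes f: "continuous_on UNIV f" and A: "compact A" "!!x. x \<notin> A ==> f x = 0" and B: "!!x. norm (f x) \<le> B" "0 \<le> B"
 shows "norm (\<integral>x. f x \<partial>haar) \<le> B * m A"
proof -
 have i: "integrable haar (\<lambda>x. B * indicator A x)"
  using A(1) emeasure_haar_compact[OF A(1)] borel_haar(3)[OF A(1)] by (intro integrable_mult_right) simp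
 have "norm (\<integral>x. f x \<partial>haar) \<le> (\<integral>x. norm (f x) \<partial>haar)" by (rule integral_norm_bound)
 also have "... \<le> (\<integral>x. B * indicator A x \<partial>haar)"
  by (rule integral_mono[OF integrable_norm[OF integrable_cc[OF f A]] i])
   (use A(2) B in \<open>auto simp: indicator_def\<close>)
 also have "... = B * m A" using borel_haar(3)[OF A(1)] by (simp add: m_def)
 finally show ?thesis .
qed

lemma integral_indicator_complex:
 assumes "compact (A::'g set)" shows "(\<integral>x. (if x \<in> A then c else 0 :: complex) \<partial>haar) = c * of_real (m A)"
proof -
 have "(\<integral>x. (if x \<in> A then c else 0) \<partial>haar) = (\<integral>x. indicator A x *\<^sub>R c \<partial>haar)"
  by (intro Bochner_Integration.integral_cong) (auto simp: indicator_def)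
 also have "... = m A *\<^sub>R c"
  using borel_haar(3)[OF assms] emeasure_haar_compact[OF assms] by (subst integral_scaleR_left) (auto simp: m_def)
 finally show ?thesis by (simp add: scaleR_conv_of_real mult.commute)
qed

lemma continuous_on_indicator_clopen:
 fixes f :: "'g => 'b::real_normed_vector"
 assumes f: "continuous_on UNIV f" and A: "open A" "closed A"
 shows "continuous_on UNIV (\<lambda>x. if x \<in> A then f x else 0)"
proof -
 have "continuous_on (A \<union> - A) (\<lambda>x. if x \<in> A then f x else 0)"
  using A by (intro continuous_on_open_Un) (auto intro: continuous_on_cong[THEN iffD1, OF refl _ continuous_on_subset[OF f]] continuous_on_cong[THEN iffD1, OF refl _ continuous_on_const])
 then show ?thesis by simp
qed

text \<open>By uniform approximation with step functions on cosets.\<close>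

lemma integral_translate:
 fixes f :: "'g => complex"
 assumes f: "continuous_on UNIV f" and C: "compact C" "!!x. x \<notin> C ==> f x = 0"
  and \<tau>: "continuous_on UNIV \<tau>" "continuous_on UNIV \<sigma>" "!!x. \<tau> (\<sigma> x) = x" "!!x. \<sigma> (\<tau> x) = x"
  and d: "!!A. compact A ==> open A ==> m (\<sigma> ` A) = d * m A"
 shows "(\<integral>x. f (\<tau> x) \<partial>haar) = of_real d * (\<integral>x. f x \<partial>haar)"
proof -
 have pre: "\<tau> x \<in> A \<longleftrightarrow> x \<in> \<sigma> ` A" for x A using \<tau>(3,4) by (metis image_iff)
 obtain A where A: "compact A" "open A" "C <= A" "!!a k. a \<in> A ==> k \<in> K ==> a + k \<in> A"
  using compact_open_hull[OF C(1)] by blast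
 have f0: "f x = 0" if "x \<notin> A" for x using C(2) A(3) that by blast
 have csA: "compact (\<sigma> ` B)" if "compact B" for B by (rule compact_continuous_image[OF continuous_on_subset[OF \<tau>(2)] that]) simp
 have f\<tau>: "continuous_on UNIV (\<lambda>x. f (\<tau> x))" by (rule continuous_on_compose2[OF f \<tau>(1)]) simp
 have "(\<integral>x. f (\<tau> x) \<partial>haar) - of_real d * (\<integral>x. f x \<partial>haar) = 0"
 proof (rule norm_le_all_eps[of _ "2 * \<bar>d\<bar> * m A"])
  fix e :: real assume e: "0 < e"
  obtain V where V: "nsub V" "!!x v. x \<in> A ==> v \<in> V ==> dist (f (x + v)) (f x) < e"
   using locally_almost_constant[OF f A(1) e] by blast
  obtain F where F: "finite F" "F <= A" "A = (\<Union>g\<in>F. lc g V)" "\<forall>g\<in>F. \<forall>h\<in>F. g \<noteq> h --> lc g V \<inter> lc h V = {}"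
  proof -
   have "a + v \<in> A" if "a \<in> A" "v \<in> V" for a v using A(4) nsubD(3)[OF V(1)] that by blast
   then show ?thesis using coset_partition[OF A(1) V(1)] that by auto
  qed
  have oV: "open (lc g V)" "compact (lc g V)" for g by (intro open_lc compact_lc nsubD[OF V(1)])+
  define \<phi> where "\<phi> x = (\<Sum>g\<in>F. if x \<in> lc g V then f g else 0)" for x
  have c\<phi>: "continuous_on UNIV \<phi>" unfolding \<phi>_def
   by (intro continuous_on_sum continuous_on_indicator_clopen continuous_on_const oV compact_imp_closed)
  have \<phi>0: "\<phi> x = 0" if "x \<notin> A" for x unfolding \<phi>_def by (rule sum.neutral) (use that F(3) in auto)
  have close: "norm (f x - \<phi> x) \<le> e" for x
  proof (cases "x \<in> A")
   case True
   then obtain g where g: "g \<in> F" "x \<in> lc g V" using F(3) by blast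
   have "(if x \<in> lc h V then f h else 0) = (if h = g then f g else 0)" if "h \<in> F" for h
    using F(4) that g by (metis disjoint_iff)
   then have "\<phi> x = f g" unfolding \<phi>_def using g F(1) by (simp add: sum.delta cong: sum.cong)
   moreover have "dist (f (g + (- g + x))) (f g) < e" using g F(2) by (intro V(2)) (auto simp: lc_iff)
   ultimately show ?thesis by (simp add: dist_norm add.assoc[symmetric])
  qed (use f0 \<phi>0 e in simp)
  have c\<phi>\<tau>: "continuous_on UNIV (\<lambda>x. \<phi> (\<tau> x))" by (rule continuous_on_compose2[OF c\<phi> \<tau>(1)]) simp
  have int\<phi>: "(\<integral>x. \<phi> x \<partial>haar) = (\<Sum>g\<in>F. f g * of_real (m (lc g V)))"
  proof -
   have "integrable haar (\<lambda>x. if x \<in> lc g V then f g else 0)" for g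
    by (rule integrable_cc[OF continuous_on_indicator_clopen[OF continuous_on_const oV(1)[of g] compact_imp_closed[OF oV(2)[of g]]] oV(2)[of g]]) simp
   then have "(\<integral>x. \<phi> x \<partial>haar) = (\<Sum>g\<in>F. \<integral>x. (if x \<in> lc g V then f g else 0) \<partial>haar)"
    unfolding \<phi>_def by (rule Bochner_Integration.integral_sum)
   then show ?thesis by (simp add: integral_indicator_complex[OF oV(2)])
  qed
  have int\<phi>\<tau>: "(\<integral>x. \<phi> (\<tau> x) \<partial>haar) = (\<Sum>g\<in>F. f g * of_real (m (\<sigma> ` lc g V)))"
  proof -
   have 1: "continuous_on UNIV (\<lambda>x. if \<tau> x \<in> lc g V then f g else 0)" for g
    using continuous_on_compose2[OF continuous_on_indicator_clopen[OF continuous_on_const oV(1) compact_imp_closed[OF oV(2)]] \<tau>(1)] by fastforce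
   have "integrable haar (\<lambda>x. if \<tau> x \<in> lc g V then f g else 0)" for g
    by (rule integrable_cc[OF 1 csA[OF oV(2)[of g]]]) (simp add: pre)
   then have "(\<integral>x. \<phi> (\<tau> x) \<partial>haar) = (\<Sum>g\<in>F. \<integral>x. (if \<tau> x \<in> lc g V then f g else 0) \<partial>haar)"
    unfolding \<phi>_def by (rule Bochner_Integration.integral_sum)
   then show ?thesis unfolding pre by (simp add: integral_indicator_complex[OF csA[OF oV(2)]])
  qed
  have eq: "(\<integral>x. \<phi> (\<tau> x) \<partial>haar) = of_real d * (\<integral>x. \<phi> x \<partial>haar)"
   unfolding int\<phi> int\<phi>\<tau> sum_distrib_left using d[OF oV(2,1)] by (intro sum.cong) (auto simp: mult_ac)
  have i1: "norm (\<integral>x. f x - \<phi> x \<partial>haar) \<le> e * m A"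
   by (rule norm_integral_le[OF continuous_on_diff[OF f c\<phi>] A(1)]) (use f0 \<phi>0 close e in auto)
  have i2: "norm (\<integral>x. f (\<tau> x) - \<phi> (\<tau> x) \<partial>haar) \<le> e * m (\<sigma> ` A)"
   by (rule norm_integral_le[OF continuous_on_diff[OF f\<tau> c\<phi>\<tau>] csA[OF A(1)]]) (use f0 \<phi>0 close e pre in auto)
  have "integrable haar f" by (rule integrable_cc[OF f A(1) f0])
  moreover have "integrable haar \<phi>" by (rule integrable_cc[OF c\<phi> A(1) \<phi>0])
  moreover have "integrable haar (\<lambda>x. f (\<tau> x))" by (rule integrable_cc[OF f\<tau> csA[OF A(1)]]) (use f0 pre in auto)
  moreover have "integrable haar (\<lambda>x. \<phi> (\<tau> x))" by (rule integrable_cc[OF c\<phi>\<tau> csA[OF A(1)]]) (use \<phi>0 pre in auto)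
  ultimately have I: "integrable haar f" "integrable haar \<phi>" and J: "integrable haar (\<lambda>x. f (\<tau> x))" "integrable haar (\<lambda>x. \<phi> (\<tau> x))" by auto
  have "(\<integral>x. f (\<tau> x) \<partial>haar) - of_real d * (\<integral>x. f x \<partial>haar)
    = (\<integral>x. f (\<tau> x) - \<phi> (\<tau> x) \<partial>haar) - of_real d * (\<integral>x. f x - \<phi> x \<partial>haar)"
   using I J eq by (simp add: algebra_simps)
  also have "norm ... \<le> e * m (\<sigma> ` A) + \<bar>d\<bar> * (e * m A)"
   by (rule order_trans[OF norm_triangle_ineq4]) (intro add_mono i2, use i1 in \<open>auto simp: norm_mult intro!: mult_left_mono\<close>)
  also have "... \<le> 2 * \<bar>d\<bar> * m A * e"
   using d[OF A(1,2)] m_nonneg[of A] e by (simp add: mult_ac mult_left_mono mult_right_mono)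
  finally show "norm ((\<integral>x. f (\<tau> x) \<partial>haar) - of_real d * (\<integral>x. f x \<partial>haar)) \<le> 2 * \<bar>d\<bar> * m A * e" .
 qed
 then show ?thesis by simp
qed

lemma integral_left:
 fixes f :: "'g => complex"
 assumes "continuous_on UNIV f" "compact C" "!!x. x \<notin> C ==> f x = 0"
 shows "(\<integral>x. f (- g + x) \<partial>haar) = (\<integral>x. f x \<partial>haar)"
 using integral_translate[OF assms, of "\<lambda>x. - g + x" "\<lambda>x. g + x" 1] m_lc[OF borel_haar(3)]
 by (simp add: cont_grp lc_image add.assoc[symmetric])

lemma integral_right:
 fixes f :: "'g => complex"
 assumes "continuous_on UNIV f" "compact C" "!!x. x \<notin> C ==> f x = 0"
 shows "(\<integral>x. f (x - t) \<partial>haar) = of_real (\<Delta> t) * (\<integral>x. f x \<partial>haar)"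
 using integral_translate[OF assms, of "\<lambda>x. x - t" "\<lambda>x. x + t" "\<Delta> t"] m_rc[of _ t]
 by (simp add: cont_grp rc_image)

end

section \<open>Operators on square-integrable functions\<close>

definition ccf :: "('g::topological_space => 'h::complex_hilbert_space) => bool" where
 "ccf F \<longleftrightarrow> continuous_on UNIV F & (\<exists>C. compact C & (\<forall>t. t \<notin> C --> F t = 0))"

definition vec :: "('g::{topological_group_add,t2_space} => 'h::complex_hilbert_space) => ('g, 'h) l2" where
 "vec F = embed (Abs_cc F)"

lemma ccfD: "ccf F ==> continuous_on UNIV F" "ccf F ==> \<exists>C. compact C & (\<forall>t. t \<notin> C --> F t = 0)"
 by (auto simp: ccf_def)

lemma Abs_cc_ccf: "ccf F ==> cc_apply (Abs_cc F) = F"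
 by (rule Abs_cc_inverse) (simp add: ccf_def)

lemma ccf_cc_apply: "ccf (cc_apply f)"
 using cc_apply[of f] by (simp add: ccf_def)

lemma vec_cc_apply: "vec (cc_apply f) = embed f"
 by (simp add: vec_def cc_apply_inverse)

lemma ccf_add: "ccf F ==> ccf G ==> ccf (\<lambda>t. F t + G t)"
 unfolding ccf_def by (rule cc_closed_binary) (auto intro: continuous_on_add)
lemma ccf_diff: "ccf F ==> ccf G ==> ccf (\<lambda>t. F t - G t)"
 unfolding ccf_def by (rule cc_closed_binary) (auto intro: continuous_on_diff)
lemma ccf_zero: "ccf (\<lambda>_. 0)" by (auto simp: ccf_def)
lemma ccf_scaleC: "ccf F ==> ccf (\<lambda>t. c *\<^sub>C F t)"
 by (auto simp: ccf_def scaleC_zero_right intro: continuous_on_scaleC)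
lemma ccf_sum: "(!!i. i \<in> I ==> ccf (F i)) ==> ccf (\<lambda>t. \<Sum>i\<in>I. F i t)"
 by (induction I rule: infinite_finite_induct) (auto simp: ccf_zero ccf_add)

lemma embed_add: "embed (v + w) = embed v + embed w"
 by transfer (rule sequiv_refl[OF scauchy_const])
lemma embed_scaleC: "embed (c *\<^sub>C v) = c *\<^sub>C embed v"
 by transfer (rule sequiv_refl[OF scauchy_const])
lemma embed_zero: "embed 0 = 0"
 by transfer (rule sequiv_refl[OF scauchy_const])

lemma vec_add: "ccf F ==> ccf G ==> vec (\<lambda>t. F t + G t) = vec F + vec G"
proof -
 assume "ccf F" "ccf G"
 then have "Abs_cc (\<lambda>t. F t + G t) = Abs_cc F + Abs_cc G"
  by (simp add: cc_apply_inject[symmetric] plus_cc.rep_eq Abs_cc_ccf ccf_add)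
 then show ?thesis by (simp add: vec_def embed_add)
qed
lemma vec_diff: "ccf F ==> ccf G ==> vec (\<lambda>t. F t - G t) = vec F - vec G"
proof -
 assume "ccf F" "ccf G"
 then have "Abs_cc (\<lambda>t. F t - G t) = Abs_cc F - Abs_cc G"
  by (simp add: cc_apply_inject[symmetric] minus_cc.rep_eq Abs_cc_ccf ccf_diff)
 then show ?thesis by (simp add: vec_def embed_diff)
qed
lemma vec_scaleC: "ccf F ==> vec (\<lambda>t. c *\<^sub>C F t) = c *\<^sub>C vec F"
proof -
 assume "ccf F"
 then have "Abs_cc (\<lambda>t. c *\<^sub>C F t) = c *\<^sub>C Abs_cc F"
  by (simp add: cc_apply_inject[symmetric] scaleC_cc.rep_eq Abs_cc_ccf ccf_scaleC)
 then show ?thesis by (simp add: vec_def embed_scaleC)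
qed
lemma vec_zero: "vec (\<lambda>_::'g::{topological_group_add,t2_space}. 0::'h::complex_hilbert_space) = 0"
proof -
 have "Abs_cc (\<lambda>_::'g. 0::'h) = 0" by (simp add: cc_apply_inject[symmetric] zero_cc.rep_eq Abs_cc_ccf ccf_zero)
 then show ?thesis by (simp add: vec_def embed_zero)
qed
lemma vec_sum: "(!!i. i \<in> I ==> ccf (F i)) ==> vec (\<lambda>t. \<Sum>i\<in>I. F i t) = (\<Sum>i\<in>I. vec (F i))"
 by (induction I rule: infinite_finite_induct) (auto simp: vec_zero vec_add ccf_sum)

lemma cinner_vec: "ccf F ==> ccf G ==> cinner (vec F) (vec G) = (\<integral>t. cinner (F t) (G t) \<partial>haar)"
 by (simp add: vec_def cinner_embed cinner_cc_def Abs_cc_ccf)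

lemma range_embed_csubspace: "csubspace (range (embed :: 'v::complex_semi_inner => 'v completion))"
 unfolding csubspace_def by (auto simp flip: embed_add embed_scaleC embed_zero)

lemma vec_dense: "0 < e ==> \<exists>F. ccf F & norm (vec F - (x::('g::{topological_group_add,t2_space}, 'h::complex_hilbert_space) l2)) < e"
 using embed_dense[of e x] ccf_cc_apply vec_cc_apply by metis

lemma vec_orth:
 fixes v :: "('g::{topological_group_add,t2_space}, 'h::complex_hilbert_space) l2"
 shows "(!!F. ccf F ==> cinner v (vec F) = 0) ==> v = 0"
proof -
 assume h: "!!F. ccf F ==> cinner v (vec F) = 0"
 have "norm (norm v) \<le> 1 * e" if e: "0 < e" for e
 proof (cases "v = 0")
  case False
  obtain F where F: "ccf F" "norm (vec F - v) < e" using vec_dense[OF e, of v] by blast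
  have "norm v * norm v = norm (cinner v v - cinner v (vec F))" using h[OF F(1)] by (simp add: cinner_self norm_of_real power2_eq_square norm_mult)
  also have "... \<le> norm v * norm (v - vec F)" using norm_cinner_le[of v "v - vec F"] by (simp add: cinner_diff_right)
  finally show ?thesis using False F(2) by (simp add: norm_minus_commute)
 qed (use e in simp)
 then have "norm v = 0" by (rule norm_le_all_eps)
 then show ?thesis by simp
qed

lemma l2_op_eqI:
 fixes S :: "('g::{topological_group_add,t2_space}, 'h::complex_hilbert_space) l2 op"
 assumes "S \<in> \<L>" "T \<in> \<L>" "!!F. ccf F ==> ap S (vec F) = ap T (vec F)" shows "S = T"
proof (rule blinfun_eqI)
 fix x
 have "ccspan {vec F | F. ccf F} = UNIV" by (rule ccspan_UNIV) (rule vec_orth, blast)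
 then show "ap S x = ap T x"
  using eq_on_ccspan[OF assms(1,2), of "{vec F | F. ccf F}" x] assms(3) by blast
qed

lemma l2_adjI:
 fixes T :: "('g::{topological_group_add,t2_space}, 'h::complex_hilbert_space) l2 op"
 assumes T: "T \<in> \<L>" and S: "S \<in> \<L>"
  and eq: "!!F G :: 'g => 'h. ccf F ==> ccf G ==> fm T (vec F) (vec G) = cinner (vec F) (ap S (vec G))"
 shows "adj T = S"
proof (rule l2_op_eqI[OF adj_works(2)[OF T] S])
 fix G :: "'g => 'h" assume G: "ccf G"
 have "cinner (ap (adj T) (vec G) - ap S (vec G)) (vec F) = 0" if "ccf F" for F :: "'g => 'h"
 proof -
  have "cinner (vec F) (ap (adj T) (vec G)) = cinner (vec F) (ap S (vec G))"
   using eq[OF that G] adj_works(1)[OF T] by simp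
  then show ?thesis by (subst cinner_commute) (simp add: cinner_diff_right)
 qed
 then have "ap (adj T) (vec G) - ap S (vec G) = 0" by (rule vec_orth)
 then show "ap (adj T) (vec G) = ap S (vec G)" by simp
qed

text \<open>The common form of \<open>pi_op\<close> and \<open>lambda_op\<close>, and of
  \<open>amp\<close>, \<open>rho\<close> and \<open>PA\<close> below. Its description matches the
  definitions of the first two, so that one norm estimate makes all of them meaningful.\<close>

definition gop :: "('g::{topological_group_add,t2_space} => 'h::complex_hilbert_space op) => ('g => 'g) => ('g, 'h) l2 op" where
 "gop \<Theta> \<tau> = (THE T. \<forall>f. ap T (embed f) = embed (Abs_cc (\<lambda>t. ap (\<Theta> t) (cc_apply f (\<tau> t)))))"

definition field :: "real => ('g::topological_space => 'h::complex_hilbert_space op) => bool" where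
 "field C \<Theta> \<longleftrightarrow> (\<forall>t. \<Theta> t \<in> \<L> & norm (\<Theta> t) \<le> C) & (\<forall>\<xi>. continuous_on UNIV (\<lambda>t. ap (\<Theta> t) \<xi>))"

lemma field_const: "T \<in> \<L> ==> field (norm T) (\<lambda>_. T)" by (simp add: field_def)

section \<open>Boundedness of weighted composition operators\<close>

context td_haar
begin

text \<open>\<open>\<sigma>\<close> is the inverse of \<open>\<tau>\<close>. The factor
  \<open>d\<close> refers to images under \<open>\<sigma>\<close> because composing with
  \<open>\<tau>\<close> turns the indicator of \<open>A\<close> into that of its image under
  \<open>\<sigma>\<close>.\<close>

definition trans :: "real => ('g => 'g) => bool" where
 "trans d \<tau> \<longleftrightarrow> 0 \<le> d & (\<exists>\<sigma>. continuous_on UNIV \<tau> & continuous_on UNIV \<sigma> & (\<forall>x. \<tau> (\<sigma> x) = x & \<sigma> (\<tau> x) = x) &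
   (\<forall>A. compact A --> open A --> m (\<sigma> ` A) = d * m A))"

lemma trans_id: "trans 1 (\<lambda>t. t)"
 unfolding trans_def by (intro conjI exI[of _ "\<lambda>t. t"]) (auto intro: continuous_on_id)
lemma trans_left: "trans 1 (\<lambda>t. - g + t)"
 unfolding trans_def using m_lc[OF borel_haar(3), of _ g]
 by (intro conjI exI[of _ "\<lambda>t. g + t"]) (auto simp: cont_grp lc_image add.assoc[symmetric])
lemma trans_right: "trans (\<Delta> t) (\<lambda>x. x - t)"
 unfolding trans_def using m_rc[of _ t] less_imp_le[OF \<Delta>_pos[of t]]
 by (intro conjI exI[of _ "\<lambda>x. x + t"]) (auto simp: cont_grp rc_image)

lemma ccf_gop:
 assumes \<Theta>: "field C \<Theta>" and \<tau>: "trans d \<tau>" and F: "ccf F"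
 shows "ccf (\<lambda>t. ap (\<Theta> t) (F (\<tau> t)))"
proof -
 obtain \<sigma> where \<sigma>: "continuous_on UNIV \<tau>" "continuous_on UNIV \<sigma>" "!!x. \<tau> (\<sigma> x) = x" "!!x. \<sigma> (\<tau> x) = x"
  using \<tau> unfolding trans_def by blast
 obtain D where D: "compact D" "!!t. t \<notin> D ==> F t = 0" using ccfD(2)[OF F] by blast
 have F\<tau>: "continuous_on UNIV (\<lambda>t. F (\<tau> t))" by (rule continuous_on_compose2[OF ccfD(1)[OF F] \<sigma>(1)]) simp
 have "((\<lambda>t. ap (\<Theta> t) (F (\<tau> t))) \<longlongrightarrow> ap (\<Theta> t0) (F (\<tau> t0))) (at t0)" for t0
 proof -
  have 1: "((\<lambda>t. ap (\<Theta> t) (F (\<tau> t0))) \<longlongrightarrow> ap (\<Theta> t0) (F (\<tau> t0))) (at t0)"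
   using \<Theta> unfolding field_def continuous_on_def by simp
  have "((\<lambda>t. F (\<tau> t) - F (\<tau> t0)) \<longlongrightarrow> F (\<tau> t0) - F (\<tau> t0)) (at t0)"
   using F\<tau> unfolding continuous_on_def by (intro tendsto_intros) simp
  then have "((\<lambda>t. norm C * norm (F (\<tau> t) - F (\<tau> t0))) \<longlongrightarrow> norm C * norm (0::'a)) (at t0)" by (intro tendsto_intros) simp
  then have "((\<lambda>t. norm C * norm (F (\<tau> t) - F (\<tau> t0))) \<longlongrightarrow> 0) (at t0)" by simp
  then have 2: "((\<lambda>t. ap (\<Theta> t) (F (\<tau> t) - F (\<tau> t0))) \<longlongrightarrow> 0) (at t0)"
   by (rule Lim_null_comparison[rotated])
    (use \<Theta> in \<open>auto simp: field_def intro!: always_eventually order_trans[OF norm_blinfun_apply_le] mult_right_mono intro: order_trans[OF _ abs_ge_self]\<close>)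
  show ?thesis using tendsto_add[OF 1 2] by (simp add: blinfun.diff_right)
 qed
 then have "continuous_on UNIV (\<lambda>t. ap (\<Theta> t) (F (\<tau> t)))" by (simp add: continuous_on_def)
 moreover have "compact (\<sigma> ` D)" by (rule compact_continuous_image[OF continuous_on_subset[OF \<sigma>(2)] D(1)]) simp
 moreover have "ap (\<Theta> t) (F (\<tau> t)) = 0" if "t \<notin> \<sigma> ` D" for t
 proof -
  have "\<tau> t \<notin> D" using that \<sigma>(4)[of t] by force
  then show ?thesis using D(2) by simp
 qed
 ultimately show ?thesis unfolding ccf_def by blast
qed

lemma integral_trans:
 fixes f :: "'g => complex"
 assumes \<tau>: "trans d \<tau>" and "continuous_on UNIV f" "compact C" "!!x. x \<notin> C ==> f x = 0"
 shows "(\<integral>x. f (\<tau> x) \<partial>haar) = of_real d * (\<integral>x. f x \<partial>haar)"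
proof -
 obtain \<sigma> where "continuous_on UNIV \<tau>" "continuous_on UNIV \<sigma>" "!!x. \<tau> (\<sigma> x) = x" "!!x. \<sigma> (\<tau> x) = x"
  "!!A. compact A ==> open A ==> m (\<sigma> ` A) = d * m A"
  using \<tau> unfolding trans_def by blast
 then show ?thesis using integral_translate[OF assms(2-4)] by blast
qed

lemma cinner_cc_integrand:
 assumes "ccf F" "ccf G"
 shows "continuous_on UNIV (\<lambda>t. cinner (F t) (G t))" "\<exists>C. compact C & (\<forall>t. t \<notin> C --> cinner (F t) (G t) = 0)"
 using ccfD[OF assms(1)] ccfD[OF assms(2)] by (auto intro: continuous_on_cinner simp: cinner_zero_left)

lemma norm_gop:
 assumes \<Theta>: "field C \<Theta>" and \<tau>: "trans d \<tau>" and F: "ccf F"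
 shows "norm (vec (\<lambda>t. ap (\<Theta> t) (F (\<tau> t)))) \<le> C * sqrt d * norm (vec F)"
proof -
 let ?G = "\<lambda>t. ap (\<Theta> t) (F (\<tau> t))"
 have C: "0 \<le> C" using \<Theta> norm_ge_zero order_trans unfolding field_def by blast
 have d: "0 \<le> d" using \<tau> by (simp add: trans_def)
 have G: "ccf ?G" by (rule ccf_gop[OF assms])
 have F1: "ccf (\<lambda>t. F (\<tau> t))" using ccf_gop[OF field_const[OF clinear_id] \<tau> F] by simp
 have i: "integrable haar (\<lambda>t. Re (cinner (H t) (H t)))" if "ccf H" for H :: "'g => 'a"
  using cinner_cc_integrand[OF that that] integrable_cc by (intro integrable_Re) blast
 have n: "(norm (vec H))^2 = (\<integral>t. Re (cinner (H t) (H t)) \<partial>haar)" if H: "ccf H" for H :: "'g => 'a"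
 proof -
  have "integrable haar (\<lambda>t. cinner (H t) (H t))" using cinner_cc_integrand[OF H H] integrable_cc by blast
  then show ?thesis using cinner_vec[OF H H] Re_cinner_self[of "vec H"] by simp
 qed
 have "(norm (vec ?G))^2 = (\<integral>t. Re (cinner (?G t) (?G t)) \<partial>haar)" by (rule n[OF G])
 also have "... \<le> (\<integral>t. C^2 * Re (cinner (F (\<tau> t)) (F (\<tau> t))) \<partial>haar)"
 proof (rule integral_mono[OF i[OF G] integrable_mult_right[OF i[OF F1]]])
  fix t
  have "norm (\<Theta> t) \<le> C" using \<Theta> by (simp add: field_def)
  then have "(norm (?G t))^2 \<le> (C * norm (F (\<tau> t)))^2" by (intro power_mono norm_blinfun_apply_le) auto
  then show "Re (cinner (?G t) (?G t)) \<le> C^2 * Re (cinner (F (\<tau> t)) (F (\<tau> t)))" by (simp add: cinner_self power_mult_distrib)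
 qed
 also have "... = C^2 * (norm (vec (\<lambda>t. F (\<tau> t))))^2" by (simp add: n[OF F1])
 also have "(norm (vec (\<lambda>t. F (\<tau> t))))^2 = d * (norm (vec F))^2"
 proof -
  obtain D where "compact D" "!!t. t \<notin> D ==> cinner (F t) (F t) = 0" using cinner_cc_integrand(2)[OF F F] by blast
  then have "cinner (vec (\<lambda>t. F (\<tau> t))) (vec (\<lambda>t. F (\<tau> t))) = of_real d * cinner (vec F) (vec F)"
   unfolding cinner_vec[OF F1 F1] cinner_vec[OF F F] by (rule integral_trans[OF \<tau> cinner_cc_integrand(1)[OF F F]])
  then show ?thesis by (metis Re_cinner_self Re_complex_of_real cinner_self of_real_mult)
 qed
 finally have "(norm (vec ?G))^2 \<le> (C * sqrt d * norm (vec F))^2" using d by (simp add: power_mult_distrib)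
 then show ?thesis by (rule power2_le_imp_le) (use C d in simp)
qed

lemma gop:
 assumes \<Theta>: "field C \<Theta>" and \<tau>: "trans d \<tau>"
 shows "gop \<Theta> \<tau> \<in> \<L>" "norm (gop \<Theta> \<tau>) \<le> C * sqrt d"
  "ccf F ==> ap (gop \<Theta> \<tau>) (vec F) = vec (\<lambda>t. ap (\<Theta> t) (F (\<tau> t)))"
proof -
 have Tc: "\<Theta> t \<in> \<L>" for t using \<Theta> by (simp add: field_def)
 have C: "0 \<le> C * sqrt d" using \<Theta> \<tau> norm_ge_zero order_trans unfolding field_def trans_def by (meson mult_nonneg_nonneg real_sqrt_ge_zero)
 define L where "L F = (\<lambda>t. ap (\<Theta> t) (F (\<tau> t)))" for F
 have cL: "ccf (L F)" if "ccf F" for F unfolding L_def by (rule ccf_gop[OF assms that])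
 have Ldiff: "L (\<lambda>t. F t - G t) = (\<lambda>t. L F t - L G t)" for F G by (simp add: L_def blinfun.diff_right)
 have Ladd: "L (\<lambda>t. F t + G t) = (\<lambda>t. L F t + L G t)" for F G by (simp add: L_def blinfun.add_right)
 have wd: "vec (L F) = vec (L G)" if "ccf F" "ccf G" "vec F = vec G" for F G
 proof -
  have "norm (vec (L (\<lambda>t. F t - G t))) \<le> C * sqrt d * norm (vec (\<lambda>t. F t - G t))"
   unfolding L_def by (rule norm_gop[OF assms ccf_diff[OF that(1,2)]])
  then show ?thesis using that by (simp add: vec_diff Ldiff cL)
 qed
 define f where "f v = vec (L (SOME F. ccf F & vec F = v))" for v
 have f: "f (vec F) = vec (L F)" if "ccf F" for F
  using someI[of "\<lambda>G. ccf G & vec G = vec F" F] that unfolding f_def by (intro wd) auto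
 have D: "v \<in> range embed ==> \<exists>F. ccf F & v = vec F" for v by (metis ccf_cc_apply vec_cc_apply imageE)
 obtain T where T: "norm T \<le> C * sqrt d" "!!c x. ap T (c *\<^sub>C x) = c *\<^sub>C ap T x"
  "!!x. x \<in> range embed ==> ap T x = f x"
 proof -
  have "\<exists>T. norm T \<le> C * sqrt d & (\<forall>c x. ap T (c *\<^sub>C x) = c *\<^sub>C ap T x) & (\<forall>x\<in>range embed. ap T x = f x) &
   (\<forall>x. (\<forall>y\<in>range embed. cinner x y = 0) --> ap T x = 0)"
  proof (rule extend_bounded[OF range_embed_csubspace _ _ _ C])
   fix x y :: "('g, 'a) l2" assume "x \<in> range embed" "y \<in> range embed"
   then obtain F G where FG: "ccf F" "x = vec F" "ccf G" "y = vec G" using D by blast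
   have "f (x + y) = vec (L (\<lambda>t. F t + G t))" using FG f[OF ccf_add[OF FG(1,3)]] by (simp add: vec_add)
   also have "... = f x + f y" using FG f cL by (simp add: Ladd vec_add)
   finally show "f (x + y) = f x + f y" .
  next
   fix c and x :: "('g, 'a) l2" assume "x \<in> range embed"
   then obtain F where F: "ccf F" "x = vec F" using D by blast
   have "f (c *\<^sub>C x) = vec (L (\<lambda>t. c *\<^sub>C F t))" using F f[OF ccf_scaleC[OF F(1)]] by (simp add: vec_scaleC)
   also have "L (\<lambda>t. c *\<^sub>C F t) = (\<lambda>t. c *\<^sub>C L F t)" by (simp add: L_def clinear_scaleC[OF Tc])
   finally show "f (c *\<^sub>C x) = c *\<^sub>C f x" using F f cL by (simp add: vec_scaleC)
  next
   fix x :: "('g, 'a) l2" assume "x \<in> range embed"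
   then obtain F where F: "ccf F" "x = vec F" using D by blast
   show "norm (f x) \<le> C * sqrt d * norm x" using norm_gop[OF assms F(1)] f[OF F(1)] by (simp add: F(2) L_def)
  qed
  then show ?thesis using that by blast
 qed
 have Tcl: "T \<in> \<L>" using T(2) by (simp add: clinear_ops_def)
 have TF: "ap T (vec F) = vec (L F)" if "ccf F" for F
  using T(3)[of "vec F"] f[OF that] by (simp add: vec_def)
 have "gop \<Theta> \<tau> = T"
  unfolding gop_def
 proof (rule the_equality)
  show "\<forall>f. ap T (embed f) = embed (Abs_cc (\<lambda>t. ap (\<Theta> t) (cc_apply f (\<tau> t))))"
   using TF[OF ccf_cc_apply] by (simp add: vec_cc_apply) (simp add: vec_def L_def)
  fix S assume S: "\<forall>f. ap S (embed f) = embed (Abs_cc (\<lambda>t. ap (\<Theta> t) (cc_apply f (\<tau> t))))"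
  have eq: "ap S (vec F) = ap T (vec F)" if "ccf F" for F
   using S[rule_format, of "Abs_cc F"] TF[OF that] by (simp add: Abs_cc_ccf[OF that] vec_def L_def)
  show "S = T"
  proof (rule blinfun_eqI)
   fix x
   have "norm (ap (S - T) x) \<le> (norm (S - T)) * e" if e: "0 < e" for e
   proof -
    obtain F where F: "ccf F" "norm (vec F - x) < e" using vec_dense[OF e, of x] by blast
    have "ap (S - T) x = ap (S - T) (x - vec F)" using eq[OF F(1)] by (simp add: blinfun.bilinear_simps)
    also have "norm ... \<le> norm (S - T) * norm (x - vec F)" by (rule norm_blinfun)
    also have "... \<le> norm (S - T) * e" using F(2) by (intro mult_left_mono) (auto simp: norm_minus_commute)
    finally show ?thesis .
   qed
   then have "ap (S - T) x = 0" by (rule norm_le_all_eps)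
   then show "ap S x = ap T x" by (simp add: blinfun.diff_left)
  qed
 qed
 then show "gop \<Theta> \<tau> \<in> \<L>" "norm (gop \<Theta> \<tau>) \<le> C * sqrt d"
  "ccf F ==> ap (gop \<Theta> \<tau>) (vec F) = vec (\<lambda>t. ap (\<Theta> t) (F (\<tau> t)))"
  using Tcl T(1) TF by (auto simp: L_def)
qed

definition amp :: "'h::complex_hilbert_space op => ('g, 'h) l2 op" where "amp T = gop (\<lambda>_. T) (\<lambda>t. t)"
text \<open>Right translation without normalisation: it multiplies inner products by
  \<open>\<Delta> t\<close>, which is the factor appearing in \<open>cf_translate\<close>.\<close>

definition rho :: "'g => ('g, 'h::complex_hilbert_space) l2 op" where "rho t = gop (\<lambda>_. Id1) (\<lambda>x. x - t)"
definition PA :: "'g set => ('g, 'h::complex_hilbert_space) l2 op" where "PA A = gop (\<lambda>t. if t \<in> A then Id1 else 0) (\<lambda>t. t)"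

lemma amp:
 assumes "T \<in> \<L>"
 shows "amp T \<in> \<L>" "ccf F ==> ap (amp T) (vec F) = vec (\<lambda>t. ap T (F t))"
  "ccf F ==> ccf (\<lambda>t. ap T (F t))"
 using gop[OF field_const[OF assms] trans_id] ccf_gop[OF field_const[OF assms] trans_id] unfolding amp_def by blast+

lemma rho:
 "rho t \<in> \<L>" "ccf F ==> ap (rho t) (vec F) = vec (\<lambda>x. F (x - t))" "ccf F ==> ccf (\<lambda>x. F (x - t))"
 using gop[OF field_const[OF clinear_id] trans_right[of t]] ccf_gop[OF field_const[OF clinear_id] trans_right[of t], of F] unfolding rho_def by simp_all

lemma lambda_gop: "(lambda_op g :: ('g, 'h::complex_hilbert_space) l2 op) = gop (\<lambda>_. Id1) (\<lambda>t. - g + t)"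
 unfolding lambda_op_def gop_def by simp

lemma lam:
 fixes F :: "'g => 'h::complex_hilbert_space"
 shows "(lambda_op g :: ('g, 'h) l2 op) \<in> \<L>" "ccf F ==> ap (lambda_op g) (vec F) = vec (\<lambda>x. F (- g + x))" "ccf F ==> ccf (\<lambda>x. F (- g + x))"
 using gop[OF field_const[OF clinear_id] trans_left[of g]] ccf_gop[OF field_const[OF clinear_id] trans_left[of g], of F] unfolding lambda_gop by simp_all

lemma PA:
 fixes F :: "'g => 'h::complex_hilbert_space"
 assumes "open A" "closed A"
 shows "(PA A :: ('g, 'h) l2 op) \<in> \<L>" "norm (PA A :: ('g, 'h) l2 op) \<le> 1" "ccf F ==> ap (PA A) (vec F) = vec (\<lambda>t. if t \<in> A then F t else 0)"
  "ccf F ==> ccf (\<lambda>t. if t \<in> A then F t else 0)"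
proof -
 have f: "field 1 (\<lambda>t. if t \<in> A then Id1 else (0::'h op))"
  unfolding field_def
 proof (intro conjI allI)
  show "(if t \<in> A then Id1 else 0) \<in> \<L>" for t by (simp add: clinear_id clinear_zero)
  show "norm (if t \<in> A then Id1 else (0::'h op)) \<le> 1" for t using norm_blinfun_id_le[where 'a='h] by simp
  fix u :: 'h
  have "continuous_on UNIV (\<lambda>t. if t \<in> A then u else 0)" by (rule continuous_on_indicator_clopen[OF continuous_on_const assms])
  then show "continuous_on UNIV (\<lambda>t. ap (if t \<in> A then Id1 else 0) u)"
   by (rule continuous_on_cong[THEN iffD1, OF refl, rotated]) simp
 qed
 have e: "(\<lambda>t. ap (if t \<in> A then Id1 else 0) (F t)) = (\<lambda>t. if t \<in> A then F t else 0)" for F :: "'g => 'h" by auto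
 show "(PA A :: ('g, 'h) l2 op) \<in> \<L>" "norm (PA A :: ('g, 'h) l2 op) \<le> 1" "ccf F ==> ap (PA A) (vec F) = vec (\<lambda>t. if t \<in> A then F t else 0)"
  "ccf F ==> ccf (\<lambda>t. if t \<in> A then F t else 0)"
  using gop[OF f trans_id] ccf_gop[OF f trans_id, of F] unfolding PA_def by (simp_all add: e)
qed

lemma PA_adj: "open A ==> closed A ==> adj (PA A :: ('g, 'h::complex_hilbert_space) l2 op) = PA A"
proof (rule l2_adjI)
 fix F G :: "'g => 'h" assume A: "open A" "closed A" and FG: "ccf F" "ccf G"
 show "fm (PA A) (vec F) (vec G) = cinner (vec F) (ap (PA A) (vec G))"
  unfolding PA(3)[OF A FG(1)] PA(3)[OF A FG(2)] cinner_vec[OF PA(4)[OF A FG(1)] FG(2)] cinner_vec[OF FG(1) PA(4)[OF A FG(2)]]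
  by (rule Bochner_Integration.integral_cong) (auto simp: cinner_zero_left cinner_zero_right)
qed (auto intro: PA)

lemma PA_compose: "open A ==> closed A ==> open C ==> closed C ==> PA A oL PA C = (PA (A \<inter> C) :: ('g, 'h::complex_hilbert_space) l2 op)"
proof (rule l2_op_eqI)
 fix F :: "'g => 'h" assume A: "open A" "closed A" "open C" "closed C" and F: "ccf F"
 have e: "(\<lambda>t. if t \<in> A then if t \<in> C then F t else 0 else 0) = (\<lambda>t. if t \<in> A \<inter> C then F t else 0)" by auto
 show "ap (PA A oL PA C) (vec F) = ap (PA (A \<inter> C)) (vec F)"
  using A F PA(4)[OF A(3,4) F] by (simp add: PA(3) open_Int closed_Int e del: Int_iff)
qed (auto intro!: PA clinear_compose open_Int closed_Int)

lemma PA_Un: "open A ==> closed A ==> open C ==> closed C ==> A \<inter> C = {} ==> (PA (A \<union> C) :: ('g, 'h::complex_hilbert_space) l2 op) = PA A + PA C"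
proof (rule l2_op_eqI)
 fix F :: "'g => 'h" assume A: "open A" "closed A" "open C" "closed C" "A \<inter> C = {}" and F: "ccf F"
 have e: "(\<lambda>t. if t \<in> A \<union> C then F t else 0) = (\<lambda>t. (if t \<in> A then F t else 0) + (if t \<in> C then F t else 0))" using A(5) by (intro ext) auto
 show "ap (PA (A \<union> C)) (vec F) = ap (PA A + PA C) (vec F)"
  using A F PA(4)[OF A(3,4) F] PA(4)[OF A(1,2) F] by (simp add: PA(3) open_Un closed_Un e blinfun.add_left vec_add del: Un_iff)
qed (auto intro!: PA clinear_add open_Un closed_Un)

lemma PA_empty: "(PA {} :: ('g, 'h::complex_hilbert_space) l2 op) = 0"
 by (rule l2_op_eqI) (auto simp: PA clinear_zero vec_zero)

lemma PA_disjoint: "open A ==> closed A ==> open C ==> closed C ==> A \<inter> C = {} ==> PA A oL PA C = (0 :: ('g, 'h::complex_hilbert_space) l2 op)"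
 by (simp add: PA_compose PA_empty)

lemma lam_zero: "(lambda_op 0 :: ('g, 'h::complex_hilbert_space) l2 op) = Id1"
 by (rule l2_op_eqI) (auto simp: lam clinear_id)

lemma lam_add: "(lambda_op (g + h) :: ('g, 'h::complex_hilbert_space) l2 op) = lambda_op g oL lambda_op h"
 by (rule l2_op_eqI) (auto simp: lam clinear_compose grp simp del: add_uminus_conv_diff)

lemma lam_adj: "adj (lambda_op g :: ('g, 'h::complex_hilbert_space) l2 op) = lambda_op (- g)"
proof (rule l2_adjI)
 fix F G :: "'g => 'h" assume FG: "ccf F" "ccf G"
 have G': "ccf (\<lambda>x. G (g + x))" using lam(3)[OF FG(2), of "- g"] by simp
 obtain D where D: "compact D" "!!t. t \<notin> D ==> cinner (F t) (G (g + t)) = 0" using cinner_cc_integrand(2)[OF FG(1) G'] by blast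
 have "(\<integral>x. cinner (F (- g + x)) (G (g + (- g + x))) \<partial>haar) = (\<integral>x. cinner (F x) (G (g + x)) \<partial>haar)"
  by (rule integral_left[OF cinner_cc_integrand(1)[OF FG(1) G'] D])
 then show "fm (lambda_op g) (vec F) (vec G) = cinner (vec F) (ap (lambda_op (- g)) (vec G))"
  using FG G' lam(3)[OF FG(1), of g] by (simp add: lam cinner_vec add.assoc[symmetric])
qed (auto intro: lam)

lemma lam_PA: "open A ==> closed A ==> lambda_op g oL PA A = (PA (lc g A) :: ('g, 'h::complex_hilbert_space) l2 op) oL lambda_op g"
proof (rule l2_op_eqI)
 fix F :: "'g => 'h" assume A: "open A" "closed A" and F: "ccf F"
 have "closed (lc g A)" unfolding lc_def using closed_vimage[of A "\<lambda>x. - g + x"] A by (simp add: vimage_def cont_grp)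
 then show "ap (lambda_op g oL PA A) (vec F) = ap (PA (lc g A) oL lambda_op g) (vec F)"
  using A F open_lc[OF A(1)] PA(4)[OF A F] lam(3)[OF F, of g] by (simp add: lam PA(3) lc_iff)
next
 assume A: "open A" "closed A"
 have "closed (lc g A)" unfolding lc_def using closed_vimage[of A "\<lambda>x. - g + x"] A by (simp add: vimage_def cont_grp)
 then show "PA (lc g A) oL lambda_op g \<in> \<L>" by (intro clinear_compose PA lam open_lc A)
qed (auto intro!: PA lam clinear_compose)

lemma amp_adj: "T \<in> \<L> ==> adj (amp T) = amp (adj T)"
 by (rule l2_adjI) (auto intro!: amp Bochner_Integration.integral_cong simp: amp(2) cinner_vec amp(3) adj_works)

section \<open>Step functions\<close>

definition sv :: "'g set => 'h::complex_hilbert_space => ('g, 'h) l2" where "sv A \<eta> = vec (\<lambda>t. if t \<in> A then \<eta> else 0)"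

lemma ccf_step: "compact A ==> open A ==> ccf (\<lambda>t::'g. if t \<in> A then u else 0)"
 unfolding ccf_def by (auto intro!: continuous_on_indicator_clopen compact_imp_closed)

lemma sv_add: "compact A ==> open A ==> sv A (u + v) = sv A u + sv A v"
proof -
 assume A: "compact A" "open A"
 have "(\<lambda>t. if t \<in> A then u + v else 0) = (\<lambda>t. (if t \<in> A then u else 0) + (if t \<in> A then v else 0))" by auto
 then show ?thesis unfolding sv_def by (simp add: vec_add ccf_step[OF A])
qed
lemma sv_scaleC: "compact A ==> open A ==> sv A (c *\<^sub>C u) = c *\<^sub>C sv A u"
proof -
 assume A: "compact A" "open A"
 have "(\<lambda>t. if t \<in> A then c *\<^sub>C u else 0) = (\<lambda>t. c *\<^sub>C (if t \<in> A then u else 0))" by (auto simp: scaleC_zero_right)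
 then show ?thesis unfolding sv_def by (simp add: vec_scaleC ccf_step[OF A])
qed
lemma cinner_sv: "compact A ==> open A ==> compact C ==> open C ==> cinner (sv A u) (sv C v) = of_real (m (A \<inter> C)) * cinner u v"
proof -
 assume A: "compact A" "open A" "compact C" "open C"
 have "cinner (sv A u) (sv C v) = (\<integral>t. (if t \<in> A \<inter> C then cinner u v else 0) \<partial>haar)"
  unfolding sv_def cinner_vec[OF ccf_step[OF A(1,2)] ccf_step[OF A(3,4)]]
  by (rule Bochner_Integration.integral_cong) (auto simp: cinner_zero_left cinner_zero_right)
 also have "... = cinner u v * of_real (m (A \<inter> C))"
  by (rule integral_indicator_complex) (intro compact_Int_closed A compact_imp_closed)
 finally show ?thesis by (simp add: mult.commute)
qed

lemma norm_sv: "compact A ==> open A ==> norm (sv A u) = sqrt (m A) * norm u"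
proof -
 assume A: "compact A" "open A"
 have "(norm (sv A u))^2 = (sqrt (m A) * norm u)^2"
  using cinner_sv[OF A A, of u u] Re_cinner_self[of "sv A u"] m_nonneg[of A] by (simp add: cinner_self power_mult_distrib)
 then show ?thesis using m_nonneg[of A] by (simp add: power2_eq_iff_nonneg)
qed

lemma lam_sv: "compact A ==> open A ==> ap (lambda_op g) (sv A u) = sv (lc g A) u"
 unfolding sv_def by (simp add: lam ccf_step lc_iff)
lemma amp_sv: "T \<in> \<L> ==> compact A ==> open A ==> ap (amp T) (sv A u) = sv A (ap T u)"
 unfolding sv_def by (auto simp: amp ccf_step intro!: arg_cong[of _ _ vec])
lemma rho_sv: "compact A ==> open A ==> ap (rho t) (sv A u) = sv (rc A t) u"
 unfolding sv_def by (simp add: rho ccf_step rc_iff)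
lemma PA_sv: "open C ==> closed C ==> compact A ==> open A ==> ap (PA C) (sv A u) = sv (C \<inter> A) u"
 unfolding sv_def by (auto simp: PA(3) ccf_step intro!: arg_cong[of _ _ vec])

lemma norm_vec_le:
 assumes F: "ccf F" and A: "compact A" "!!t. t \<notin> A ==> F t = 0" and e: "!!t. norm (F t) \<le> e" "0 \<le> e"
 shows "norm (vec F) \<le> e * sqrt (m A)"
proof -
 have "norm (\<integral>t. cinner (F t) (F t) \<partial>haar) \<le> e^2 * m A"
 proof (rule norm_integral_le[OF cinner_cc_integrand(1)[OF F F] A(1)])
  show "norm (cinner (F t) (F t)) \<le> e^2" for t using power_mono[OF e(1)[of t], of 2] by (simp add: cinner_self norm_power)
 qed (use A in \<open>auto simp: cinner_zero_left\<close>)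
 then have "(norm (vec F))^2 \<le> (e * sqrt (m A))^2"
  unfolding cinner_vec[OF F F, symmetric] using m_nonneg[of A] by (simp add: cinner_self norm_power power_mult_distrib)
 then show ?thesis by (rule power2_le_imp_le) (use e m_nonneg in simp)
qed

lemma step_approx:
 fixes F :: "'g => 'h::complex_hilbert_space"
 assumes F: "continuous_on UNIV F" and A: "compact A" "open A" "!!a k. a \<in> A ==> k \<in> V0 ==> a + k \<in> A" "!!t. t \<notin> A ==> F t = 0"
  and V0: "nsub V0" and e: "0 < e"
 shows "\<exists>V I. nsub V & V <= V0 & finite I & I <= A & (\<forall>t. norm (F t - (\<Sum>g\<in>I. if t \<in> lc g V then F g else 0)) \<le> e) & A = (\<Union>g\<in>I. lc g V)"
proof -
 obtain V1 where V1: "nsub V1" "!!x v. x \<in> A ==> v \<in> V1 ==> dist (F (x + v)) (F x) < e"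
  using locally_almost_constant[OF F A(1) e] by blast
 define V where "V = V1 \<inter> V0"
 have V: "nsub V" unfolding V_def by (rule nsub_Int[OF V1(1) V0])
 have AV: "a + v \<in> A" if "a \<in> A" "v \<in> V" for a v using A(3) that by (auto simp: V_def)
 obtain I where I: "finite I" "I <= A" "A = (\<Union>g\<in>I. lc g V)" "\<forall>g\<in>I. \<forall>h\<in>I. g \<noteq> h --> lc g V \<inter> lc h V = {}"
  using coset_partition[OF A(1) V AV] by blast
 have "norm (F t - (\<Sum>g\<in>I. if t \<in> lc g V then F g else 0)) \<le> e" for t
 proof (cases "t \<in> A")
  case True
  then obtain g where g: "g \<in> I" "t \<in> lc g V" using I(3) by blast
  have "(if t \<in> lc h V then F h else 0) = (if h = g then F g else 0)" if "h \<in> I" for h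
   using I(4) that g by (metis disjoint_iff)
  then have "(\<Sum>g\<in>I. if t \<in> lc g V then F g else 0) = F g" using g I(1) by (simp add: sum.delta cong: sum.cong)
  moreover have "dist (F (g + (- g + t))) (F g) < e" using g I(2) by (intro V1(2)) (auto simp: lc_iff V_def)
  ultimately show ?thesis by (simp add: dist_norm add.assoc[symmetric])
 next
  case False
  then have "t \<notin> lc g V" if "g \<in> I" for g using that I(3) by auto
  then have "(\<Sum>g\<in>I. if t \<in> lc g V then F g else 0) = 0" by (intro sum.neutral) simp
  then show ?thesis using A(4)[OF False] e by simp
 qed
 then show ?thesis using V I by (intro exI[of _ V] exI[of _ I]) (auto simp: V_def)
qed

lemma vec_step_approx:
 fixes F :: "'g => 'h::complex_hilbert_space"
 assumes F: "ccf F" and A: "compact A" "open A" "!!a k. a \<in> A ==> k \<in> V0 ==> a + k \<in> A" "!!t. t \<notin> A ==> F t = 0"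
  and V0: "nsub V0" and e: "0 < e"
 shows "\<exists>V I. nsub V & V <= V0 & finite I & I <= A & norm (vec F - (\<Sum>g\<in>I. sv (lc g V) (F g))) \<le> e"
proof -
 define e1 where "e1 = e / (sqrt (m A) + 1)"
 have p: "0 < sqrt (m A) + 1" using m_nonneg[of A] by (simp add: add_nonneg_pos)
 have e1: "0 < e1" using e p by (simp add: e1_def)
 obtain V I where V: "nsub V" "V <= V0" and I: "finite I" "I <= A"
  and le: "!!t. norm (F t - (\<Sum>g\<in>I. if t \<in> lc g V then F g else 0)) \<le> e1" and AI: "A = (\<Union>g\<in>I. lc g V)"
  using step_approx[OF ccfD(1)[OF F] A V0 e1] by blast
 have oV: "compact (lc g V)" "open (lc g V)" for g by (intro compact_lc open_lc nsubD[OF V(1)])+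
 let ?G = "\<lambda>t. F t - (\<Sum>g\<in>I. if t \<in> lc g V then F g else 0)"
 have s: "ccf (\<lambda>t. \<Sum>g\<in>I. if t \<in> lc g V then F g else 0)" by (intro ccf_sum ccf_step oV)
 have G: "ccf ?G" by (intro ccf_diff F s)
 have "norm (vec ?G) \<le> e1 * sqrt (m A)"
 proof (rule norm_vec_le[OF G A(1) _ le])
  fix t assume t: "t \<notin> A"
  then have "t \<notin> lc g V" if "g \<in> I" for g using that AI by auto
  then have "(\<Sum>g\<in>I. if t \<in> lc g V then F g else 0) = 0" by (intro sum.neutral) simp
  then show "?G t = 0" using A(4)[OF t] by simp
 qed (use e1 in simp)
 also have "... \<le> e" using e p m_nonneg[of A] by (simp add: e1_def field_simps)
 finally have "norm (vec ?G) \<le> e" .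
 moreover have "vec ?G = vec F - (\<Sum>g\<in>I. sv (lc g V) (F g))"
  unfolding vec_diff[OF F s] sv_def by (subst vec_sum) (auto intro: ccf_step oV)
 ultimately show ?thesis using V I by (intro exI[of _ V] exI[of _ I]) auto
qed

text \<open>The admissible subgroups may shrink with the coset of \<open>K\<close>: a compact
  support meets only finitely many cosets, so a common subgroup serves all of them.\<close>

lemma step_total:
 fixes v :: "('g, 'h::complex_hilbert_space) l2"
 assumes "!!g. \<exists>V0. nsub V0 & (\<forall>k\<in>K. \<forall>V. nsub V --> V <= V0 --> (\<forall>u. cinner v (sv (lc (g + k) V) u) = 0))"
 shows "v = 0"
proof (rule vec_orth)
 fix F :: "'g => 'h" assume F: "ccf F"
 obtain V0 where V0: "!!g. nsub (V0 g)" "!!g k V u. k \<in> K ==> nsub V ==> V <= V0 g ==> cinner v (sv (lc (g + k) V) u) = 0"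
  using assms by metis
 obtain C where C: "compact C" "!!t. t \<notin> C ==> F t = 0" using ccfD(2)[OF F] by blast
 obtain A where A: "compact A" "open A" "C <= A" "!!a k. a \<in> A ==> k \<in> K ==> a + k \<in> A" using compact_open_hull[OF C(1)] by blast
 obtain J where J: "finite J" "J <= A" "A <= (\<Union>c\<in>J. lc c K)" using finite_coset_cover[OF A(1), of "\<lambda>_. K"] nsub_K by blast
 define V1 where "V1 = K \<inter> (\<Inter>g\<in>J. V0 g)"
 have V1: "nsub V1" unfolding V1_def by (rule nsub_INT[OF J(1)]) (rule V0)
 have "norm (cinner v (vec F)) \<le> norm v * e" if e: "0 < e" for e
 proof -
  have AV: "a + k \<in> A" if "a \<in> A" "k \<in> V1" for a k using A(4) that by (auto simp: V1_def)
  have F0: "F t = 0" if "t \<notin> A" for t using C(2) A(3) that by blast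
  obtain V I where VI: "nsub V" "V <= V1" "finite I" "I <= A" "norm (vec F - (\<Sum>g\<in>I. sv (lc g V) (F g))) \<le> e"
   using vec_step_approx[OF F A(1,2) AV F0 V1 e] by blast
  have "cinner v (sv (lc g V) (F g)) = 0" if g: "g \<in> I" for g
  proof -
   obtain c where c: "c \<in> J" "- c + g \<in> K" using J(3) VI(4) g by (auto simp: lc_iff)
   have "V <= V0 c" using VI(2) c(1) by (auto simp: V1_def)
   then have "cinner v (sv (lc (c + (- c + g)) V) (F g)) = 0" by (rule V0(2)[OF c(2) VI(1)])
   then show ?thesis by (simp add: add.assoc[symmetric])
  qed
  then have "cinner v (vec F) = cinner v (vec F - (\<Sum>g\<in>I. sv (lc g V) (F g)))"
   by (simp add: cinner_diff_right cinner_sum_right)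
  also have "norm ... \<le> norm v * e" by (rule order_trans[OF norm_cinner_le]) (intro mult_left_mono VI(5), simp)
  finally show ?thesis .
 qed
 then show "cinner v (vec F) = 0" by (rule norm_le_all_eps)
qed

lemma sv_orth: "(!!A u. compact A ==> open A ==> cinner v (sv A u) = 0) ==> v = 0"
 by (rule step_total) (meson nsub_K compact_lc open_lc nsubD(2,6))

lemma l2_op_eq_stepI:
 fixes S T :: "('g, 'h::complex_hilbert_space) l2 op"
 assumes "S \<in> \<L>" "T \<in> \<L>" "!!A u. compact A ==> open A ==> ap S (sv A u) = ap T (sv A u)" shows "S = T"
proof (rule blinfun_eqI)
 fix x
 have "ccspan {sv A (u::'h) | A u. compact A & open A} = UNIV" by (rule ccspan_UNIV) (rule sv_orth, blast)
 then show "ap S x = ap T x"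
  using eq_on_ccspan[OF assms(1,2), of "{sv A (u::'h) | A u. compact A & open A}" x] assms(3) by blast
qed

end

section \<open>Crossed products\<close>

context td_haar
begin

lemma rho_cinner: "fm (rho t) v (ap (rho t) w) = of_real (\<Delta> t) * cinner v (w :: ('g, 'h::complex_hilbert_space) l2)"
proof -
 have "adj (rho t) oL rho t = (\<Delta> t *\<^sub>R Id1 :: ('g, 'h) l2 op)"
 proof (rule l2_op_eqI)
  fix F :: "'g => 'h" assume F: "ccf F"
  have "cinner (ap (adj (rho t) oL rho t) (vec F) - ap (\<Delta> t *\<^sub>R Id1) (vec F)) (vec G) = 0"
   if G: "ccf G" for G :: "'g => 'h"
  proof -
   obtain D where D: "compact D" "!!t. t \<notin> D ==> cinner (F t) (G t) = 0" using cinner_cc_integrand(2)[OF F G] by blast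
   have "fm (adj (rho t)) (ap (rho t) (vec F)) (vec G) = fm (rho t) (vec F) (ap (rho t) (vec G))"
    by (rule adj_works_right[OF rho(1), symmetric])
   also have "... = (\<integral>x. cinner (F (x - t)) (G (x - t)) \<partial>haar)" by (simp add: rho(2) F G cinner_vec rho(3))
   also have "... = of_real (\<Delta> t) * cinner (vec F) (vec G)"
    using integral_right[OF cinner_cc_integrand(1)[OF F G] D] by (simp add: cinner_vec F G)
   finally show ?thesis by (simp add: cinner_diff_left blinfun.scaleR_left cinner_scaleR_left)
  qed
  then have "ap (adj (rho t) oL rho t) (vec F) - ap (\<Delta> t *\<^sub>R Id1) (vec F) = 0" by (rule vec_orth)
  then show "ap (adj (rho t) oL rho t) (vec F) = ap (\<Delta> t *\<^sub>R Id1) (vec F)" by simp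
 qed (auto intro!: clinear_intros rho)
 then have "ap (adj (rho t)) (ap (rho t) v) = \<Delta> t *\<^sub>R v"
  by (metis blinfun_apply_blinfun_compose blinfun.scaleR_left blinfun_apply_id_blinfun id_apply)
 moreover have "fm (rho t) v (ap (rho t) w) = fm (adj (rho t)) (ap (rho t) v) w"
  by (rule adj_works_right[OF rho(1)])
 ultimately show ?thesis by (simp add: cinner_scaleR_left)
qed

lemma rho_lam: "rho t oL lambda_op g = (lambda_op g :: ('g, 'h::complex_hilbert_space) l2 op) oL rho t"
 by (rule l2_op_eqI) (auto intro!: clinear_intros rho lam simp: rho lam add_diff_eq)

lemma amp_lam: "T \<in> \<L> ==> amp T oL lambda_op g = (lambda_op g :: ('g, 'h::complex_hilbert_space) l2 op) oL amp T"
 by (rule l2_op_eqI) (auto intro!: clinear_intros amp lam simp: amp lam)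

lemma amp_PA: "T \<in> \<L> ==> open A ==> closed A ==> amp T oL PA A = (PA A :: ('g, 'h::complex_hilbert_space) l2 op) oL amp T"
proof (rule l2_op_eqI)
 fix F :: "'g => 'h" assume T: "T \<in> \<L>" and A: "open A" "closed A" and F: "ccf F"
 have e: "(\<lambda>t. ap T (if t \<in> A then F t else 0)) = (\<lambda>t. if t \<in> A then ap T (F t) else 0)" by auto
 show "ap (amp T oL PA A) (vec F) = ap (PA A oL amp T) (vec F)"
  using T A F by (simp add: amp PA e)
qed (auto intro!: clinear_intros amp PA)

text \<open>The block of \<open>x\<close> from \<open>1_A \<otimes> h\<close> to
  \<open>1_A' \<otimes> h\<close>, read as an operator on the Hilbert space of \<open>B\<close> and
  not normalised by the measures. The target comes first, as in a product of operators.\<close>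

definition cf :: "('g, 'h::complex_hilbert_space) l2 op => 'g set => 'g set => 'h op" where
 "cf x A' A = (SOME c. c \<in> \<L> & (\<forall>\<eta> \<zeta>. fm c \<eta> \<zeta> = fm x (sv A \<eta>) (sv A' \<zeta>)))"

lemma cf:
 fixes x :: "('g, 'h::complex_hilbert_space) l2 op"
 assumes x: "x \<in> \<L>" and A: "compact A" "open A" "compact A'" "open A'"
 shows "cf x A' A \<in> \<L>" "fm (cf x A' A) u v = fm x (sv A u) (sv A' v)"
proof -
 have "\<exists>c\<in>\<L>. norm c \<le> norm x * sqrt (m A) * sqrt (m A') &
  (\<forall>u v. fm c u v = fm x (sv A u) (sv A' v))"
 proof (rule form_op)
  fix u v :: 'h
  have "norm (fm x (sv A u) (sv A' v)) \<le> (norm x * norm (sv A u)) * norm (sv A' v)"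
   by (rule order_trans[OF norm_cinner_le]) (intro mult_right_mono norm_blinfun norm_ge_zero)
  then show "norm (fm x (sv A u) (sv A' v)) \<le> norm x * sqrt (m A) * sqrt (m A') * norm u * norm v"
   by (simp add: norm_sv A mult_ac)
 qed (use A x in \<open>auto simp: sv_add sv_scaleC cinner_simps blinfun.add_right clinear_scaleC m_nonneg\<close>)
 then have "\<exists>c. c \<in> \<L> & (\<forall>u v. fm c u v = fm x (sv A u) (sv A' v))" by auto
 from someI_ex[OF this] show "cf x A' A \<in> \<L>" "fm (cf x A' A) u v = fm x (sv A u) (sv A' v)"
  unfolding cf_def by auto
qed

lemma op_eq_cinnerI: "(!!u v. fm S u v = fm T u v) ==> S = (T :: 'h::complex_hilbert_space op)"
 by (rule blinfun_eqI) (metis cinner_ext)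

lemma cf_eqI:
 assumes "x \<in> \<L>" "compact A" "open A" "compact A'" "open A'"
  "!!u v. fm c u v = fm x (sv A u) (sv A' v)"
 shows "cf x A' A = c"
 by (rule op_eq_cinnerI) (simp only: cf[OF assms(1-5)] assms(6))

end

locale crossed = td_haar K for K :: "'g::{topological_group_add,t2_space} set" +
 fixes \<alpha> :: "'g => 'h::complex_hilbert_space op => 'h op" and B :: "'h op set"
 assumes factor: "vn_factor B" and act: "continuous_action \<alpha> B"
begin

lemma vB: "von_neumann_algebra B" using factor by (simp add: vn_factor_def)
lemma aut: "star_automorphism B (\<alpha> g)" using act by (simp add: continuous_action_def)
lemma act_zero: "b \<in> B ==> \<alpha> 0 b = b" using act by (simp add: continuous_action_def)
lemma act_add: "b \<in> B ==> \<alpha> (g + h) b = \<alpha> g (\<alpha> h b)" using act by (simp add: continuous_action_def)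
lemma act_cont: "b \<in> B ==> continuous_on UNIV (\<lambda>g. ap (\<alpha> g b) u)" using act by (simp add: continuous_action_def)

lemmas Balg = op_algebraD[OF vn_op_algebra[OF vB]]
lemmas act_simps = star_autD(2-5)[OF aut] star_aut_more(1-4)[OF vB aut]
lemmas act_B = star_autD(1)[OF aut]
lemmas act_norm = star_aut_more(6)[OF vB aut]

lemma act_inverse: "b \<in> B ==> \<alpha> (- g) (\<alpha> g b) = b" "b \<in> B ==> \<alpha> g (\<alpha> (- g) b) = b"
 using act_add[of b "- g" g] act_add[of b g "- g"] by (simp_all add: act_zero)

lemma act_field: "b \<in> B ==> field (norm b) (\<lambda>t. \<alpha> (- t) b)"
 unfolding field_def
proof (intro conjI allI)
 assume b: "b \<in> B"
 show "\<alpha> (- t) b \<in> \<L>" for t by (rule Balg(2)[OF act_B[OF b]])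
 show "norm (\<alpha> (- t) b) \<le> norm b" for t by (rule act_norm[OF b])
 show "continuous_on UNIV (\<lambda>t. ap (\<alpha> (- t) b) u)" for u
  by (rule continuous_on_compose2[OF act_cont[OF b]]) (auto intro: cont_grp)
qed

abbreviation \<pi> :: "'h op => ('g, 'h) l2 op" where "\<pi> \<equiv> pi_op \<alpha>"
abbreviation \<Lambda> :: "'g => ('g, 'h) l2 op" where "\<Lambda> \<equiv> lambda_op"

lemma pi:
 assumes "b \<in> B"
 shows "\<pi> b \<in> \<L>" "ccf F ==> ap (\<pi> b) (vec F) = vec (\<lambda>t. ap (\<alpha> (- t) b) (F t))"
  "ccf F ==> ccf (\<lambda>t. ap (\<alpha> (- t) b) (F t))"
proof -
 have "\<pi> b = gop (\<lambda>t. \<alpha> (- t) b) (\<lambda>t. t)" unfolding pi_op_def gop_def ..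
 then show "\<pi> b \<in> \<L>" "ccf F ==> ap (\<pi> b) (vec F) = vec (\<lambda>t. ap (\<alpha> (- t) b) (F t))"
  "ccf F ==> ccf (\<lambda>t. ap (\<alpha> (- t) b) (F t))"
  using gop[OF act_field[OF assms] trans_id] ccf_gop[OF act_field[OF assms] trans_id, of F] by simp_all
qed

lemma pi_compose: "b \<in> B ==> c \<in> B ==> \<pi> (b oL c) = \<pi> b oL \<pi> c"
 by (rule l2_op_eqI) (auto intro!: clinear_intros simp: pi Balg act_simps)
lemma pi_add: "b \<in> B ==> c \<in> B ==> \<pi> (b + c) = \<pi> b + \<pi> c"
 by (rule l2_op_eqI) (auto intro!: clinear_intros simp: pi Balg act_simps blinfun.add_left vec_add)
lemma pi_scaleR: "b \<in> B ==> \<pi> (r *\<^sub>R b) = r *\<^sub>R \<pi> b"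
proof (rule l2_op_eqI)
 fix F :: "'g => 'h" assume b: "b \<in> B" and F: "ccf F"
 show "ap (\<pi> (r *\<^sub>R b)) (vec F) = ap (r *\<^sub>R \<pi> b) (vec F)"
  using b F vec_scaleC[OF pi(3)[OF b F], of "of_real r"] by (simp add: pi Balg act_simps blinfun.scaleR_left scaleC_of_real)
qed (auto intro!: clinear_intros simp: pi Balg)
lemma pi_id: "\<pi> Id1 = Id1"
 by (rule l2_op_eqI) (auto intro!: clinear_intros simp: pi Balg act_simps)
lemma pi_adj: "b \<in> B ==> adj (\<pi> b) = \<pi> (adj b)"
proof (rule l2_adjI)
 fix F G :: "'g => 'h" assume b: "b \<in> B" and FG: "ccf F" "ccf G"
 have "fm (\<alpha> (- t) b) (F t) (G t) = cinner (F t) (ap (\<alpha> (- t) (adj b)) (G t))" for t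
  using adj_works(1)[OF Balg(2)[OF act_B[OF b]]] by (simp add: act_simps b)
 then show "fm (\<pi> b) (vec F) (vec G) = cinner (vec F) (ap (\<pi> (adj b)) (vec G))"
  using b FG vn_adj[OF vB b] by (simp add: pi cinner_vec)
qed (auto intro: pi vn_adj[OF vB])

lemma lam_pi: "b \<in> B ==> \<Lambda> g oL \<pi> b = \<pi> (\<alpha> g b) oL \<Lambda> g"
proof (rule l2_op_eqI)
 fix F :: "'g => 'h" assume b: "b \<in> B" and F: "ccf F"
 have "\<alpha> (- (- g + t)) b = \<alpha> (- t) (\<alpha> g b)" for t using act_add[OF b, of "- t" g] by (simp add: minus_add)
 then show "ap (\<Lambda> g oL \<pi> b) (vec F) = ap (\<pi> (\<alpha> g b) oL \<Lambda> g) (vec F)"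
  using b F by (simp add: lam pi act_B)
qed (auto intro!: clinear_intros lam pi act_B)

lemma pi_PA: "b \<in> B ==> open A ==> closed A ==> \<pi> b oL PA A = PA A oL \<pi> b"
proof (rule l2_op_eqI)
 fix F :: "'g => 'h" assume b: "b \<in> B" and A: "open A" "closed A" and F: "ccf F"
 have e: "(\<lambda>t. ap (\<alpha> (- t) b) (if t \<in> A then F t else 0)) = (\<lambda>t. if t \<in> A then ap (\<alpha> (- t) b) (F t) else 0)" by auto
 show "ap (\<pi> b oL PA A) (vec F) = ap (PA A oL \<pi> b) (vec F)"
  using b A F by (simp add: pi PA e)
qed (auto intro!: clinear_intros pi PA)

lemma pi_sv: "b \<in> B ==> compact A ==> open A ==> (!!t. t \<in> A ==> \<alpha> (- t) b = b') ==> ap (\<pi> b) (sv A u) = sv A (ap b' u)"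
 unfolding sv_def by (auto simp: pi ccf_step intro!: arg_cong[of _ _ vec])

text \<open>The commutant of the crossed product by the whole group, so that
  \<open>commutant MC\<close> is that crossed product itself.\<close>

definition MC :: "('g, 'h) l2 op set" where "MC = commutant (\<pi> ` B \<union> range lambda_op)"

text \<open>At \<open>x\<close> the operator \<open>\<pi> b\<close> acts by
  \<open>\<alpha> (- x) b\<close>. Right translation replaces \<open>x\<close> by
  \<open>x - t\<close>, and moving \<open>T\<close> across supplies the missing
  \<open>\<alpha> (- t)\<close>.\<close>

lemma MC_I:
 assumes T: "T \<in> \<L>" and i: "!!b. b \<in> B ==> T oL b = \<alpha> (- t) b oL T"
 shows "amp T oL rho t \<in> MC"
 unfolding MC_def
proof (rule commutantI)
 have "(amp T oL rho t) oL \<pi> b = \<pi> b oL (amp T oL rho t)" if b: "b \<in> B" for b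
 proof (rule l2_op_eqI)
  fix F :: "'g => 'h" assume F: "ccf F"
  have "ap T (ap (\<alpha> (- (x - t)) b) u) = ap (\<alpha> (- x) b) (ap T u)" for x u
  proof -
   have "T oL \<alpha> (- (x - t)) b = \<alpha> (- t) (\<alpha> (- (x - t)) b) oL T" by (rule i[OF act_B[OF b]])
   also have "\<alpha> (- t) (\<alpha> (- (x - t)) b) = \<alpha> (- x) b" using act_add[OF b, of "- t" "- (x - t)"] by (simp add: grp del: add_uminus_conv_diff)
   finally show ?thesis by (metis blinfun_apply_blinfun_compose)
  qed
  then show "ap ((amp T oL rho t) oL \<pi> b) (vec F) = ap (\<pi> b oL (amp T oL rho t)) (vec F)"
   using F b T rho(3)[OF pi(3)[OF b F], of t] amp(3)[OF T rho(3)[OF F, of t]] by (simp add: pi amp rho)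
 qed (auto intro!: clinear_intros amp rho pi T b)
 moreover have "(amp T oL rho t) oL \<Lambda> g = \<Lambda> g oL (amp T oL rho t)" for g
  by (simp only: compose_assoc rho_lam) (simp only: compose_assoc[symmetric] amp_lam[OF T])
 ultimately show "(amp T oL rho t) oL A = A oL (amp T oL rho t)" if "A \<in> \<pi> ` B \<union> range lambda_op" for A using that by auto
qed (intro clinear_intros amp rho T)

lemma rho_zero: "(rho 0 :: ('g, 'h) l2 op) = Id1"
 by (rule l2_op_eqI) (auto simp: rho clinear_id)

lemma amp_MC: assumes "T \<in> commutant B" shows "amp T \<in> MC"
proof -
 have "amp T oL rho 0 \<in> MC"
  by (rule MC_I) (use commutantD[OF assms] commutant_clinear[OF assms] in \<open>auto simp: act_zero\<close>)
 then show ?thesis by (simp add: rho_zero compose_id_right)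
qed

lemma MC_commute: "x \<in> commutant MC ==> R \<in> MC ==> ap x (ap R v) = ap R (ap x v)"
 by (rule commutantD_apply)

text \<open>For \<open>S\<close> in the commutant of \<open>B\<close> the operator
  \<open>1 \<otimes> S\<close> lies in \<open>MC\<close>, so the coefficients commute with
  \<open>S\<close>.\<close>

lemma cf_B:
 assumes x: "x \<in> commutant MC" and A: "compact A" "open A" "compact A'" "open A'"
 shows "cf x A' A \<in> B"
proof (rule vn_memI[OF vB cf(1)[OF commutant_clinear[OF x] A]])
 fix S assume S: "S \<in> commutant B"
 have Sc: "S \<in> \<L>" by (rule commutant_clinear[OF S])
 note c = cf(2)[OF commutant_clinear[OF x] A]
 show "cf x A' A oL S = S oL cf x A' A"
 proof (rule op_eq_cinnerI)
  fix u v
  have "fm (cf x A' A oL S) u v = fm x (ap (amp S) (sv A u)) (sv A' v)"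
   by (simp add: c amp_sv Sc A)
  also have "... = fm x (sv A u) (ap (amp (adj S)) (sv A' v))"
   using adj_works(1)[OF amp(1)[OF Sc]] by (simp add: MC_commute[OF x amp_MC[OF S]] amp_adj[OF Sc])
  also have "... = fm (S oL cf x A' A) u v"
   by (simp add: amp_sv adj_works(2)[OF Sc] A c[symmetric] adj_works(1)[OF Sc])
  finally show "fm (cf x A' A oL S) u v = fm (S oL cf x A' A) u v" .
 qed
qed

text \<open>On a vector in the range of an intertwiner \<open>T\<close> the element
  \<open>amp T oL rho t\<close> of \<open>MC\<close> can be moved through \<open>x\<close>, which
  gives the formula there. Such vectors are total by \<open>intertwiners_total\<close>;
  \<open>rho_cinner\<close> contributes the modular factor.\<close>

lemma cf_translate:
 assumes x: "x \<in> commutant MC" and A: "compact A" "open A" "compact A'" "open A'"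
 shows "cf x (rc A' t) (rc A t) = \<Delta> t *\<^sub>R \<alpha> (- t) (cf x A' A)"
proof -
 have xc: "x \<in> \<L>" by (rule commutant_clinear[OF x])
 have At: "compact (rc A t)" "open (rc A t)" "compact (rc A' t)" "open (rc A' t)" by (intro compact_rc open_rc A)+
 note c = cf(2)[OF xc A] and c' = cf(2)[OF xc At] and cB = cf_B[OF x A]
 define X where "X = {ap T v | T v. T \<in> \<L> & (\<forall>b\<in>B. T oL b = \<alpha> (- t) b oL T)}"
 have tot: "ccspan X = UNIV" unfolding X_def
  by (rule intertwiners_total[OF factor aut aut, of "- t" t]) (simp_all add: act_inverse)
 have "ap (cf x (rc A' t) (rc A t)) v = ap (\<Delta> t *\<^sub>R \<alpha> (- t) (cf x A' A)) v" if v: "v \<in> X" for v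
 proof -
  obtain T u where T: "T \<in> \<L>" "!!b. b \<in> B ==> T oL b = \<alpha> (- t) b oL T" and v: "v = ap T u"
   using v unfolding X_def by blast
  have "fm (cf x (rc A' t) (rc A t)) v w = fm (\<Delta> t *\<^sub>R \<alpha> (- t) (cf x A' A)) v w" for w
  proof -
   have "fm (cf x (rc A' t) (rc A t)) v w = fm x (ap (amp T oL rho t) (sv A u)) (sv (rc A' t) w)"
    by (simp add: c' v rho_sv amp_sv T A At)
   also have "... = fm (amp T) (ap (rho t) (ap x (sv A u))) (sv (rc A' t) w)"
    using MC_commute[OF x MC_I[OF T], of "sv A u"] by simp
   also have "... = fm (rho t) (ap x (sv A u)) (ap (rho t) (sv A' (ap (adj T) w)))"
    using adj_works(1)[OF amp(1)[OF T(1)]] by (simp add: amp_adj[OF T(1)] amp_sv adj_works(2)[OF T(1)] At rho_sv A)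
   also have "... = of_real (\<Delta> t) * fm T (ap (cf x A' A) u) w"
    by (simp add: rho_cinner c[symmetric] adj_works(1)[OF T(1)])
   also have "ap T (ap (cf x A' A) u) = ap (\<alpha> (- t) (cf x A' A)) v"
    using T(2)[OF cB] unfolding v by (metis blinfun_apply_blinfun_compose)
   finally show ?thesis by (simp add: blinfun.scaleR_left cinner_scaleR_left)
  qed
  then show ?thesis by (metis cinner_ext)
 qed
 then have eq: "!!v. v \<in> X ==> ap (cf x (rc A' t) (rc A t)) v = ap (\<Delta> t *\<^sub>R \<alpha> (- t) (cf x A' A)) v" .
 have cl: "\<Delta> t *\<^sub>R \<alpha> (- t) (cf x A' A) \<in> \<L>" by (rule clinear_scaleR[OF Balg(2)[OF act_B[OF cB]]])
 show ?thesis
  by (rule blinfun_eqI) (rule eq_on_ccspan[OF cf(1)[OF xc At] cl eq], assumption, simp only: tot UNIV_I)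
qed

end

section \<open>Fixed-point algebras of open subgroups\<close>

lemma ex_rank_one: "\<exists>T\<in>\<L>. \<forall>x. ap T x = cinner x u *\<^sub>C (v::'h::complex_hilbert_space)"
proof -
 have "\<exists>T\<in>\<L>. (\<forall>x. ap T x = cinner x u *\<^sub>C v) & norm T \<le> norm u * norm v"
 proof (rule ex_clinear_op)
  fix x :: 'h
  have "norm (cinner x u) * norm v \<le> (norm x * norm u) * norm v" by (intro mult_right_mono norm_cinner_le) simp
  then show "norm (cinner x u *\<^sub>C v) \<le> norm u * norm v * norm x" by (simp add: norm_scaleC mult_ac)
 qed (simp_all add: cinner_simps scaleC_add_left scaleC_scaleC)
 then show ?thesis by blast
qed

context crossed
begin

abbreviation Q :: "'g set => 'h op set" where "Q V \<equiv> fixed_algebra \<alpha> V B"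

lemma Q_iff: "a \<in> Q V \<longleftrightarrow> a \<in> B & (\<forall>k\<in>V. \<alpha> k a = a)" by (simp add: fixed_algebra_def)

lemma Q_closed: "closed (Q V)"
proof -
 have "closure (Q V) <= Q V"
 proof
  fix x assume x: "x \<in> closure (Q V)"
  have "closure (Q V) <= B" by (rule closure_minimal[OF _ Balg(1)]) (auto simp: Q_iff)
  then have xB: "x \<in> B" using x by blast
  have "\<alpha> k x = x" if k: "k \<in> V" for k
  proof -
   have "norm (\<alpha> k x - x) \<le> 2 * e" if e: "0 < e" for e
   proof -
    obtain y where y: "y \<in> Q V" "dist y x < e" using x e unfolding closure_approachable by blast
    have yB: "y \<in> B" and ky: "\<alpha> k y = y" using y(1) k by (auto simp: Q_iff)
    have "\<alpha> k x - x = \<alpha> k (x - y) + (y - x)" by (simp add: star_aut_more(3)[OF vB aut] xB yB ky)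
    also have "norm ... \<le> norm (x - y) + norm (y - x)" by (intro norm_triangle_mono act_norm Balg(7) xB yB order_refl)
    also have "... \<le> 2 * e" using y(2) by (simp add: dist_norm norm_minus_commute)
    finally show ?thesis .
   qed
   then have "\<alpha> k x - x = 0" by (rule norm_le_all_eps)
   then show ?thesis by simp
  qed
  then show "x \<in> Q V" using xB by (simp add: Q_iff)
 qed
 then show ?thesis using closure_subset_eq by blast
qed

lemma Q_algebra: "op_algebra (Q V)"
 unfolding op_algebra_def using Q_closed by (auto simp: Q_iff Balg act_simps)

lemma Q_adj: "a \<in> Q V ==> adj a \<in> Q V"
 by (simp add: Q_iff vn_adj[OF vB] act_simps)

lemma Q_inverse: "a \<in> Q V ==> y \<in> \<L> ==> a oL y = Id1 ==> y oL a = Id1 ==> y \<in> Q V"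
proof -
 assume a: "a \<in> Q V" and y: "y \<in> \<L>" "a oL y = Id1" "y oL a = Id1"
 have aB: "a \<in> B" using a by (simp add: Q_iff)
 have yB: "y \<in> B" by (rule vn_inverse[OF vB aB y])
 have "\<alpha> k y = y" if k: "k \<in> V" for k
 proof -
  have "a oL \<alpha> k y = Id1" using act_simps(2)[OF aB yB, of k] a k y(2) by (simp add: Q_iff act_simps)
  then have "y oL (a oL \<alpha> k y) = y" by (simp add: compose_id_right)
  then show ?thesis by (simp add: compose_assoc[symmetric] y(3) compose_id_left)
 qed
 then show ?thesis using yB by (simp add: Q_iff)
qed

lemma Q_antimono: "V <= W ==> Q W <= Q V" unfolding fixed_algebra_def by blast

lemma Q_sub: "additive_subgroup V ==> a \<in> Q V ==> t \<in> V ==> \<alpha> (- t) a = a"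
 using subgroupD(3) by (auto simp: Q_iff)

lemma pi_sv_Q: "nsub V ==> a \<in> Q V ==> compact A ==> open A ==> A <= V ==> ap (\<pi> a) (sv A u) = sv A (ap a u)"
 by (rule pi_sv) (auto simp: Q_iff Q_sub[OF nsubD(1)])

lemma ex_nonzero: "\<exists>u::'h. u \<noteq> 0"
proof (rule ccontr)
 assume "\<not> ?thesis"
 then have "T = 0" for T :: "'h op" by (intro blinfun_eqI) simp
 then have "B = {0}" using Balg(8) by blast
 then show False using factor by (simp add: vn_factor_def)
qed

lemma pi_M: "b \<in> B ==> \<pi> b \<in> commutant MC"
 by (rule commutantI) (auto simp: pi MC_def dest!: commutantD[where A="\<pi> b"])

lemma lam_M: "\<Lambda> g \<in> commutant MC"
 by (rule commutantI) (auto simp: lam MC_def dest!: commutantD[where A="\<Lambda> g"])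

end

section \<open>Density and a Galois property from minimality\<close>

locale crossed_min = crossed K \<alpha> B for K :: "'g::{topological_group_add,t2_space} set" and \<alpha> and B :: "'h::complex_hilbert_space op set" +
 assumes minimal: "minimal_action \<alpha> B K" and outer: "properly_outer_relative \<alpha> B K"
begin

text \<open>Minimality is assumed for \<open>K\<close> only; \<open>Q K <= Q V\<close> makes the
  commutant of \<open>Q V\<close> smaller.\<close>

lemma irreducible: assumes V: "nsub V" shows "irreducible_subalgebra B (Q V)"
proof
 have "commutant (Q V) <= commutant (Q K)" by (rule commutant_antimono[OF Q_antimono[OF nsubD(3)[OF V]]])
 then have "commutant (Q V) \<inter> B <= range scalar_op" using minimal unfolding minimal_action_def by blast
 moreover have "Q V <= \<L>" using Balg(2) by (auto simp: Q_iff)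
 ultimately show "commutant (Q V) \<inter> B = range scalar_op" using commutant_scalar vn_scalar[OF vB] by blast
 show "von_neumann_algebra B" by (rule vB)
 show "Q V <= B" unfolding fixed_algebra_def by blast
 show "op_algebra (Q V)" by (rule Q_algebra)
 show "adj x \<in> Q V" if "x \<in> Q V" for x by (rule Q_adj[OF that])
 show "y \<in> Q V" if "x \<in> Q V" "y \<in> \<L>" "x oL y = Id1" "y oL x = Id1" for x y by (rule Q_inverse[OF that])
qed

lemma scalarI: "nsub V ==> c \<in> B ==> (!!a. a \<in> Q V ==> c oL a = a oL c) ==> \<exists>z. c = scalar_op z"
 using irreducible_subalgebra.irr[OF irreducible] commutantI[of c "Q V"] Balg(2)[of c] by blast

text \<open>The projection \<open>R\<close> onto the orthogonal complement has scalar matrix coefficients between step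
 vectors, hence commutes with \<open>1 \<otimes> T\<close> for all \<open>T\<close>.  Sandwiching \<open>\<pi>(b)\<close> between rank one operators,
 its kernel is invariant under multiplication by \<open>t \<mapsto> \<langle>\<alpha>\<^bsub>-t\<^esub>(b)\<eta>, \<zeta>\<rangle>\<close>; these separate the points of
 \<open>V\<close> by faithfulness, so Stone-Weierstrass applies.\<close>

lemma orth_pi_sv:
 assumes V: "nsub V" and v: "!!b u. b \<in> B ==> cinner v (ap (\<pi> b) (sv V u)) = 0"
 shows "ap (PA V) v = 0"
proof -
 note oV = nsubD(2)[OF V] nsubD(5)[OF V] nsubD(6)[OF V]
 define X where "X = {ap (\<pi> b) (sv V u) | b u. b \<in> B}"
 obtain p :: "('g, 'h) l2 op" where p: "p \<in> \<L>" "adj p = p" "!!x. ap p x \<in> ccspan X" "!!x. x \<in> ccspan X ==> ap p x = x"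
  "!!x y. y \<in> ccspan X ==> cinner (x - ap p x) y = 0"
  using ex_projection[OF ccspan_closed ccspan_csubspace, of X] by blast
 define R where "R = PA V - p"
 have Rc: "R \<in> \<L>" unfolding R_def by (intro clinear_intros PA oV p)
 have pPA: "PA V oL p = p"
 proof (rule blinfun_eqI)
  fix x
  have "ap (PA V) y = ap Id1 y" if y: "y \<in> X" for y
  proof -
   obtain b u where b: "b \<in> B" "y = ap (\<pi> b) (sv V u)" using y unfolding X_def by blast
   have "ap (PA V) y = ap (PA V oL \<pi> b) (sv V u)" by (simp add: b(2))
   also have "... = y" by (simp only: pi_PA[OF b(1) oV(1,2), symmetric]) (simp add: PA_sv oV b(2))
   finally show ?thesis by simp
  qed
  then have "ap (PA V) (ap p x) = ap Id1 (ap p x)"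
   by (rule eq_on_ccspan[OF PA(1)[OF oV(1,2)] clinear_id _ p(3)])
  then show "ap (PA V oL p) x = ap p x" by simp
 qed
 have "adj (PA V oL p) = p" by (simp only: pPA p(2))
 then have pPA': "p oL PA V = p" by (simp add: adj_compose PA oV p PA_adj)
 have PAPA: "PA V oL PA V = (PA V :: ('g, 'h) l2 op)" by (simp add: PA_compose oV)
 have RPA: "R oL PA V = R" "PA V oL R = R" unfolding R_def by (simp_all add: compose_simps PAPA pPA pPA')
 have Rpi: "R oL \<pi> b = \<pi> b oL R" if b: "b \<in> B" for b
 proof -
  have st: "ap (\<pi> c) x \<in> ccspan X" if c: "c \<in> B" and x: "x \<in> ccspan X" for c x
  proof (rule ccspan_image[OF pi(1)[OF c] _ x])
   fix x assume "x \<in> X"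
   then obtain b u where b: "b \<in> B" "x = ap (\<pi> b) (sv V u)" unfolding X_def by blast
   then have "ap (\<pi> c) x = ap (\<pi> (c oL b)) (sv V u)" by (simp add: pi_compose c)
   then show "ap (\<pi> c) x \<in> ccspan X" using Balg(5)[OF c b(1)] unfolding X_def by (intro ccspan_inc) blast
  qed
  have "p oL \<pi> b = \<pi> b oL p"
   by (rule proj_commute[OF p(1-4) pi(1)[OF b] st[OF b]]) (simp_all add: pi_adj b st vn_adj[OF vB])
  then show ?thesis unfolding R_def by (simp add: compose_diff_left compose_diff_right pi_PA b oV)
 qed
 have Ramp: "R oL amp S = amp S oL R" if S: "S \<in> commutant B" for S
 proof -
  have st: "ap (amp S) x \<in> ccspan X" if S: "S \<in> commutant B" and x: "x \<in> ccspan X" for S x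
  proof (rule ccspan_image[OF amp(1)[OF commutant_clinear[OF S]] _ x])
   fix x assume "x \<in> X"
   then obtain b u where b: "b \<in> B" "x = ap (\<pi> b) (sv V u)" unfolding X_def by blast
   have "ap (amp S) x = ap (\<pi> b) (ap (amp S) (sv V u))"
    using MC_commute[OF pi_M[OF b(1)] amp_MC[OF S]] b(2) by simp
   then show "ap (amp S) x \<in> ccspan X"
    using b(1) unfolding X_def by (intro ccspan_inc) (auto simp: amp_sv commutant_clinear[OF S] oV)
  qed
  have "p oL amp S = amp S oL p"
   by (rule proj_commute[OF p(1-4) amp(1)[OF commutant_clinear[OF S]] st[OF S]])
    (simp_all add: amp_adj commutant_clinear[OF S] st vn_commutant_adj[OF vB S])
  then show ?thesis unfolding R_def by (simp add: compose_diff_left compose_diff_right amp_PA commutant_clinear[OF S] oV)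
 qed
 \<comment> \<open>The coefficients commute with the commutant of \<open>B\<close> by
   \<open>Ramp\<close>, so they lie in \<open>B\<close>. On subsets of \<open>V\<close> the operator
   \<open>\<pi> a\<close> acts as \<open>1 \<otimes> a\<close> for \<open>a\<close> in
   \<open>Q V\<close>, so by \<open>Rpi\<close> they commute with \<open>Q V\<close> and
   irreducibility makes them scalars.\<close>
 have Rcoef: "\<exists>z. \<forall>u q. fm R (sv A u) (sv A' q) = z * cinner u q"
  if A0: "compact A" "open A" "compact A'" "open A'" for A A'
 proof -
  define C C' where "C = V \<inter> A" and "C' = V \<inter> A'"
  have C: "compact C" "open C" "compact C'" "open C'" "C <= V" "C' <= V"
   unfolding C_def C'_def using A0 oV by (auto intro: closed_Int_compact)
  note c = cf(2)[OF Rc C(1-4)]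
  have "cf R C' C \<in> B"
  proof (rule vn_memI[OF vB cf(1)[OF Rc C(1-4)]])
   fix S assume S: "S \<in> commutant B"
   have Sc: "S \<in> \<L>" by (rule commutant_clinear[OF S])
   show "cf R C' C oL S = S oL cf R C' C"
   proof (rule op_eq_cinnerI)
    fix u q
    have "fm (cf R C' C oL S) u q = fm (R oL amp S) (sv C u) (sv C' q)"
     by (simp add: c amp_sv Sc C)
    also have "... = fm R (sv C u) (sv C' (ap (adj S) q))"
     using adj_works(1)[OF amp(1)[OF Sc]] by (simp add: Ramp[OF S] amp_adj[OF Sc] amp_sv adj_works(2)[OF Sc] C)
    also have "... = fm (S oL cf R C' C) u q"
     by (simp add: c[symmetric] adj_works(1)[OF Sc])
    finally show "fm (cf R C' C oL S) u q = fm (S oL cf R C' C) u q" .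
   qed
  qed
  moreover have "cf R C' C oL a = a oL cf R C' C" if a: "a \<in> Q V" for a
  proof (rule op_eq_cinnerI)
   fix u q
   have aB: "a \<in> B" using a by (simp add: Q_iff)
   have "fm (cf R C' C oL a) u q = fm (R oL \<pi> a) (sv C u) (sv C' q)"
    by (simp add: c pi_sv_Q[OF V a] C)
   also have "... = fm R (sv C u) (sv C' (ap (adj a) q))"
    using adj_works(1)[OF pi(1)[OF aB]] by (simp add: Rpi[OF aB] pi_adj aB pi_sv_Q[OF V Q_adj[OF a]] C)
   also have "... = fm (a oL cf R C' C) u q"
    by (simp add: c[symmetric] adj_works(1)[OF Balg(2)[OF aB]])
   finally show "fm (cf R C' C oL a) u q = fm (a oL cf R C' C) u q" .
  qed
  ultimately obtain z where z: "cf R C' C = scalar_op z" using scalarI[OF V] by blast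
  have "fm R (sv A u) (sv A' q) = z * cinner u q" for u q
  proof -
   have "fm R (sv A u) (sv A' q) = fm (PA V oL (R oL PA V)) (sv A u) (sv A' q)"
    by (simp only: RPA)
   also have "... = fm R (sv C u) (sv C' q)"
    using adj_works(1)[OF PA(1)[OF oV(1,2)], of "ap R (ap (PA V) (sv A u))" "sv A' q"]
    by (simp add: PA_adj oV PA_sv A0 C_def C'_def)
   finally show ?thesis by (simp add: c[symmetric] z scalar_op_apply cinner_scaleC_left)
  qed
  then show ?thesis by blast
 qed
 have RampT: "R oL amp T = amp T oL R" if T: "T \<in> \<L>" for T
 proof (rule l2_op_eq_stepI)
  fix A :: "'g set" and u :: 'h assume A: "compact A" "open A"
  have "cinner (ap (R oL amp T) (sv A u) - ap (amp T oL R) (sv A u)) (sv A' q) = 0"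
   if A': "compact A'" "open A'" for A' q
  proof -
   obtain z where z: "!!u q. fm R (sv A u) (sv A' q) = z * cinner u q" using Rcoef[OF A A'] by blast
   have "fm (amp T) (ap R (sv A u)) (sv A' q) = fm R (sv A u) (sv A' (ap (adj T) q))"
    using adj_works(1)[OF amp(1)[OF T]] by (simp add: amp_adj[OF T] amp_sv adj_works(2)[OF T] A')
   then show ?thesis by (simp add: cinner_diff_left amp_sv T A z adj_works(1)[OF T])
  qed
  then have "ap (R oL amp T) (sv A u) - ap (amp T oL R) (sv A u) = 0" by (rule sv_orth)
  then show "ap (R oL amp T) (sv A u) = ap (amp T oL R) (sv A u)" by simp
 qed (intro clinear_intros Rc amp T)+
 define E :: "('g => complex) => 'h => 'g => 'h" where "E f q = (\<lambda>t. if t \<in> V then f t *\<^sub>C q else 0)" for f q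
 have bl: "bounded_linear (\<lambda>c::complex. c *\<^sub>C q)" for q :: 'h
  by (rule bounded_linear_intro[of _ "norm q"]) (simp_all add: scaleC_add_left norm_scaleC, simp add: scaleR_conv_of_real scaleC_scaleC[symmetric] scaleC_of_real)
 have E: "ccf (E f q)" if f: "continuous_on UNIV f" for f q
 proof -
  have "continuous_on UNIV (\<lambda>t. f t *\<^sub>C q)" by (rule bounded_linear.continuous_on[OF bl f])
  then show ?thesis unfolding E_def ccf_def using continuous_on_indicator_clopen oV by (metis (full_types))
 qed
 \<comment> \<open>\<open>R\<close> annihilates all vectors \<open>f 1_V \<otimes> q\<close>. The
   aim is to reach, by approximation, the indicator functions of compact open sets.\<close>
 define kill where "kill f \<longleftrightarrow> continuous_on UNIV f & (\<forall>q. ap R (vec (E f q)) = 0)" for f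
 have kill_add: "kill (\<lambda>t. f t + g t)" if "kill f" "kill g" for f g
 proof -
  have c: "continuous_on UNIV f" "continuous_on UNIV g" using that by (auto simp: kill_def)
  have "E (\<lambda>t. f t + g t) q = (\<lambda>t. E f q t + E g q t)" for q by (auto simp: E_def scaleC_add_left)
  then show ?thesis using that c by (simp add: kill_def vec_add E blinfun.add_right continuous_on_add)
 qed
 have kill_scale: "kill (\<lambda>t. c * f t)" if "kill f" for f c
 proof -
  have f: "continuous_on UNIV f" using that by (auto simp: kill_def)
  have "E (\<lambda>t. c * f t) q = (\<lambda>t. c *\<^sub>C E f q t)" for q by (auto simp: E_def scaleC_scaleC scaleC_zero_right)
  then show ?thesis using that f by (simp add: kill_def vec_scaleC E clinear_scaleC[OF Rc] scaleC_zero_right continuous_on_mult_left)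
 qed
 have kill_phi: "kill (\<lambda>t. fm (\<alpha> (- t) b) u k * f t)" if f: "kill f" and b: "b \<in> B" for f b u k
 proof -
  have cf: "continuous_on UNIV f" using f by (simp add: kill_def)
  have "continuous_on UNIV (\<lambda>t. ap (\<alpha> (- t) b) u)" using act_field[OF b] by (simp add: field_def)
  then have c\<phi>: "continuous_on UNIV (\<lambda>t. fm (\<alpha> (- t) b) u k * f t)"
   by (intro continuous_on_mult cf continuous_on_cinner continuous_on_const)
  have "ap R (vec (E (\<lambda>t. fm (\<alpha> (- t) b) u k * f t) q)) = 0" for q
  proof -
   \<comment> \<open>The rank one operator turns the vector \<open>\<alpha> (- t) b\<close> applied
     to \<open>u\<close> into its coefficient against \<open>k\<close>, times \<open>q\<close>. It
     may be moved past \<open>R\<close> because \<open>RampT\<close> holds for all complex-linear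
     operators.\<close>
   obtain T where T: "T \<in> \<L>" "!!x. ap T x = cinner x k *\<^sub>C q" using ex_rank_one by blast
   have e: "E (\<lambda>t. fm (\<alpha> (- t) b) u k * f t) q = (\<lambda>t. ap T (ap (\<alpha> (- t) b) (E f u t)))"
    by (auto simp: E_def T clinear_scaleC[OF Balg(2)[OF act_B[OF b]]] cinner_simps scaleC_scaleC mult_ac scaleC_zero_left)
   have "vec (E (\<lambda>t. fm (\<alpha> (- t) b) u k * f t) q) = ap (amp T) (ap (\<pi> b) (vec (E f u)))"
    unfolding e by (simp add: pi b E[OF cf] amp(2)[OF T(1) pi(3)[OF b E[OF cf]]])
   moreover have "ap (R oL amp T) (ap (\<pi> b) (vec (E f u))) = ap (amp T) (ap (R oL \<pi> b) (vec (E f u)))"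
    by (simp add: RampT[OF T(1)])
   moreover have "ap (R oL \<pi> b) (vec (E f u)) = 0" using f by (simp add: Rpi[OF b] kill_def)
   ultimately show ?thesis by simp
  qed
  then show ?thesis using c\<phi> by (simp add: kill_def)
 qed
 \<comment> \<open>The real multipliers that preserve \<open>kill\<close>: a real algebra of
   functions, as Stone-Weierstrass demands. Real parts of coefficients belong to it because the
   conjugate of a coefficient of \<open>b\<close> is one of \<open>adj b\<close>.\<close>
 define P where "P f \<longleftrightarrow> continuous_on UNIV f & (\<forall>f'. kill f' --> kill (\<lambda>t. complex_of_real (f t) * f' t))" for f :: "'g => real"
 have P_add: "P (\<lambda>t. f t + g t)" if "P f" "P g" for f g
  using that kill_add[of "\<lambda>t. complex_of_real (f t) * _ t" "\<lambda>t. complex_of_real (g t) * _ t"] by (auto simp: P_def distrib_right intro: continuous_on_add)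
 have P_scale: "P (\<lambda>t. r)" for r using kill_scale by (auto simp: P_def)
 have P_mult: "P (\<lambda>t. f t * g t)" if "P f" "P g" for f g
  using that by (auto simp: P_def mult.assoc intro: continuous_on_mult)
 have P_Re: "P (\<lambda>t. Re (z * fm (\<alpha> (- t) b) u k))" if b: "b \<in> B" for b u k z
 proof -
  have c: "continuous_on UNIV (\<lambda>t. ap (\<alpha> (- t) b) u)" using act_field[OF b] by (simp add: field_def)
  have 1: "complex_of_real (Re (z * fm (\<alpha> (- t) b) u k)) * w = (z / 2) * (fm (\<alpha> (- t) b) u k * w) +
   (cnj z / 2) * (fm (\<alpha> (- t) (adj b)) k u * w)" for t w
  proof -
   have "fm (\<alpha> (- t) (adj b)) k u = cnj (fm (\<alpha> (- t) b) u k)"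
    by (metis act_simps(3)[OF b] adj_works(1)[OF Balg(2)[OF act_B[OF b]]] cinner_commute)
   moreover have "complex_of_real (Re (z * x)) * w = (z / 2) * (x * w) + (cnj z / 2) * (cnj x * w)" for x
   proof -
    have "complex_of_real (Re y) = y / 2 + cnj y / 2" for y by (simp add: complex_eq_iff)
    from this[of "z * x"] show ?thesis by (simp only: complex_cnj_mult) (simp add: distrib_left distrib_right mult_ac)
   qed
   ultimately show ?thesis by simp
  qed
  have "kill (\<lambda>t. complex_of_real (Re (z * fm (\<alpha> (- t) b) u k)) * f t)" if "kill f" for f
   unfolding 1 by (intro kill_add kill_scale kill_phi that b vn_adj[OF vB])
  moreover have "continuous_on UNIV (\<lambda>t. Re (z * fm (\<alpha> (- t) b) u k))"
   by (intro continuous_on_Re continuous_on_mult continuous_on_const continuous_on_cinner c)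
  ultimately show ?thesis by (simp add: P_def)
 qed
 have P_sep: "\<exists>f. P f & f s \<noteq> f t" if st: "s \<in> V & t \<in> V & s \<noteq> t" for s t
 proof (rule ccontr)
  assume n: "\<not> ?thesis"
  have "\<alpha> (t - s) b = b" if b: "b \<in> B" for b
  proof -
   have "fm (\<alpha> (- s) b) u k = fm (\<alpha> (- t) b) u k" for u k
   proof -
    have eq: "f s = f t" if "P f" for f using n that by blast
    \<comment> \<open>The factors \<open>1\<close> and \<open>- \<i>\<close> pick out the real and
      the imaginary part of the coefficient.\<close>
    show ?thesis using eq[OF P_Re[OF b, of 1 u k]] eq[OF P_Re[OF b, of "- \<i>" u k]] by (simp add: complex_eq_iff)
   qed
   then have "\<alpha> (- s) b = \<alpha> (- t) b" by (rule op_eq_cinnerI)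
   then show ?thesis using act_add[OF b, of t "- s"] act_inverse(2)[OF b, of t] by simp
  qed
  moreover have "t - s \<in> K" using st nsubD(3)[OF V] subgroupD(4)[OF K_sub] by blast
  ultimately have "t - s = 0" using minimal unfolding minimal_action_def by blast
  then show False using st by simp
 qed
 have kill1: "kill (\<lambda>_. 1)"
 proof -
  have "ap R (sv V q) = 0" for q
  proof -
   have "sv V q \<in> X" unfolding X_def using pi_id Balg(3) by (metis (mono_tags, lifting) mem_Collect_eq blinfun_apply_id_blinfun id_apply)
   then show ?thesis by (simp add: R_def blinfun.diff_left PA_sv oV p(4) ccspan_inc)
  qed
  moreover have "vec (E (\<lambda>_. 1) q) = sv V q" for q unfolding E_def sv_def by (simp add: scaleC_one cong: if_cong)
  ultimately show ?thesis by (simp add: kill_def)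
 qed
 have "R = 0"
 proof (rule l2_op_eq_stepI[OF Rc clinear_zero])
  fix A :: "'g set" and u :: 'h assume A: "compact A" "open A"
  define f :: "'g => real" where "f t = (if t \<in> A then 1 else 0)" for t
  have cf: "continuous_on UNIV f" unfolding f_def by (rule continuous_on_indicator_clopen[OF continuous_on_const A(2) compact_imp_closed[OF A(1)]])
  have AE: "ap R (sv A u) = ap R (vec (E (\<lambda>t. complex_of_real (f t)) u))"
  proof -
   have "E (\<lambda>t. complex_of_real (f t)) u = (\<lambda>t. if t \<in> V \<inter> A then u else 0)" by (auto simp: E_def f_def scaleC_one scaleC_zero_left)
   then have "vec (E (\<lambda>t. complex_of_real (f t)) u) = ap (PA V) (sv A u)" by (simp add: PA_sv[OF oV(1,2) A]) (simp add: sv_def)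
   moreover have "ap (R oL PA V) (sv A u) = ap R (sv A u)" by (simp only: RPA)
   ultimately show ?thesis by simp
  qed
  have "norm (ap R (sv A u)) \<le> (norm R * (norm u * sqrt (m V))) * e" if e: "0 < e" for e
  proof -
   have "\<exists>g. P g & (\<forall>x\<in>V. \<bar>f x - g x\<bar> < e)"
    by (rule Stone_Weierstrass_HOL[OF oV(3) P_scale _ _ _ P_sep continuous_on_subset[OF cf] e])
     (auto simp: P_add P_mult, auto simp: P_def intro: continuous_on_subset)
   then obtain g where g: "P g" "!!x. x \<in> V ==> \<bar>f x - g x\<bar> < e" by blast
   have kg: "kill (\<lambda>t. complex_of_real (g t))" using g(1) kill1 unfolding P_def by force
   have cg: "continuous_on UNIV (\<lambda>t. complex_of_real (g t))" using kg by (simp add: kill_def)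
   have cf': "continuous_on UNIV (\<lambda>t. complex_of_real (f t))" using cf by (rule continuous_on_of_real)
   let ?D = "\<lambda>t. E (\<lambda>t. complex_of_real (f t)) u t - E (\<lambda>t. complex_of_real (g t)) u t"
   have "norm (vec ?D) \<le> (e * norm u) * sqrt (m V)"
   proof (rule norm_vec_le[OF ccf_diff[OF E[OF cf'] E[OF cg]] oV(3)])
    show "?D t = 0" if "t \<notin> V" for t using that by (simp add: E_def)
    fix t
    show "norm (?D t) \<le> e * norm u"
    proof (cases "t \<in> V")
     case True
     have "?D t = (complex_of_real (f t) - complex_of_real (g t)) *\<^sub>C u"
      using True scaleC_add_left[of "complex_of_real (f t) - complex_of_real (g t)" "complex_of_real (g t)" u] by (simp add: E_def)
     then have "norm (?D t) = \<bar>f t - g t\<bar> * norm u" by (simp add: norm_scaleC flip: of_real_diff)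
     then show ?thesis using g(2)[OF True] by (simp add: mult_right_mono less_imp_le)
    qed (use e in \<open>simp add: E_def\<close>)
   qed (use e in simp)
   moreover have "ap R (sv A u) = ap R (vec ?D)"
    using kg by (simp only: AE vec_diff[OF E[OF cf'] E[OF cg]] blinfun.diff_right) (simp add: kill_def)
   ultimately have "norm (ap R (sv A u)) \<le> norm R * ((e * norm u) * sqrt (m V))"
    using norm_blinfun[of R "vec ?D"] mult_left_mono[of "norm (vec ?D)" "(e * norm u) * sqrt (m V)" "norm R"] by simp
   then show ?thesis by (simp add: mult_ac)
  qed
  then have "ap R (sv A u) = 0" by (rule norm_le_all_eps)
  then show "ap R (sv A u) = ap 0 (sv A u)" by simp
 qed
 then have "ap (PA V) v = ap p v" unfolding R_def by simp
 moreover have "ap p v = 0"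
 proof -
  have "cinner x v = 0" if "x \<in> X" for x
   using that v cinner_commute[of x v] unfolding X_def by auto
  then have "fm p v v = 0" using ccspan_orth[of X v] p(3) by blast
  then have "cinner v (ap p v) = 0" by (metis cinner_commute complex_cnj_zero)
  then have "fm p v (ap p v) = 0" using p(5)[OF p(3), of v v] by (simp add: cinner_diff_left)
  then show ?thesis by (simp add: cinner_self)
 qed
 ultimately show ?thesis by simp
qed

text \<open>The dual form of \<open>orth_pi_sv\<close>, applied to vectors in the range of
  \<open>adj T\<close>.\<close>

lemma zero_on_PA:
 assumes V: "nsub V" and T: "T \<in> \<L>" and z: "!!b u. b \<in> B ==> ap T (ap (\<pi> b) (sv V u)) = 0"
 shows "T oL PA V = 0"
proof (rule op_eq_cinnerI)
 fix v w
 have "ap (PA V) (ap (adj T) w) = 0"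
 proof (rule orth_pi_sv[OF V])
  fix b u assume "b \<in> B"
  then show "fm (adj T) w (ap (\<pi> b) (sv V u)) = 0"
   using z adj_works_right[OF T, of w] by (metis cinner_zero_right)
 qed
 then show "fm (T oL PA V) v w = fm 0 v w"
  using adj_works(1)[OF T, of "ap (PA V) v" w] adj_works(1)[OF PA(1)[OF nsubD(2,5)[OF V]], of v "ap (adj T) w"] by (simp add: PA_adj nsubD[OF V] cinner_zero_left cinner_zero_right)
qed

text \<open>The coefficient of \<open>\<pi> b\<close> from \<open>K\<close> to \<open>V\<close> lies
  in \<open>Q V\<close> by covariance. If \<open>g\<close> fixes \<open>Q V\<close>, covariance
  under \<open>g\<close> shows that the coefficients to \<open>V\<close> and to \<open>V g\<close>
  agree, so \<open>1_V - 1_Vg\<close> is orthogonal to a total set in the part over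
  \<open>K\<close>. This is impossible for disjoint \<open>V\<close> and \<open>V g\<close>.\<close>

lemma galois:
 assumes V: "nsub V" and g: "g \<in> K" and fix_g: "!!a. a \<in> Q V ==> \<alpha> g a = a"
 shows "g \<in> V"
proof (rule ccontr)
 assume gV: "g \<notin> V"
 note oV = nsubD(6,2)[OF V]
 have oVg: "compact (rc V g)" "open (rc V g)" by (intro compact_rc open_rc oV)+
 have KK: "rc K t = K" if "t \<in> K" for t by (rule rc_subgroup_mem[OF K_sub that])
 obtain v :: 'h where v: "v \<noteq> 0" using ex_nonzero by blast
 have "cinner (sv (rc V g) v - sv V v) (ap (\<pi> b) (sv K u)) = 0" if b: "b \<in> B" for b u
 proof -
  note pb = pi_M[OF b] and pc = pi(1)[OF b]
  have "\<alpha> t (cf (\<pi> b) V K) = cf (\<pi> b) V K" if t: "t \<in> V" for t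
  proof -
   have t': "- t \<in> V" "- t \<in> K" using t nsubD(3)[OF V] subgroupD(3)[OF nsubD(1)[OF V]] by auto
   show ?thesis using cf_translate[OF pb K_compact K_open oV, of "- t"] t'
    by (simp add: KK rc_subgroup_mem[OF nsubD(1)[OF V]] \<Delta>_K)
  qed
  then have "cf (\<pi> b) V K \<in> Q V" using cf_B[OF pb K_compact K_open oV] by (simp add: Q_iff)
  then have "\<alpha> (- g) (cf (\<pi> b) V K) = cf (\<pi> b) V K" using fix_g act_inverse(1) by (metis Q_iff)
  then have "cf (\<pi> b) (rc V g) K = cf (\<pi> b) V K"
   using cf_translate[OF pb K_compact K_open oV, of g] g by (simp add: KK \<Delta>_K)
  then have "fm (\<pi> b) (sv K u) (sv (rc V g) v) = fm (\<pi> b) (sv K u) (sv V v)"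
   using cf(2)[OF pc K_compact K_open oV] cf(2)[OF pc K_compact K_open oVg] by metis
  then have "fm (\<pi> b) (sv K u) (sv (rc V g) v - sv V v) = 0" by (simp add: cinner_diff_right)
  then show ?thesis by (metis cinner_commute complex_cnj_zero)
 qed
 then have "ap (PA K) (sv (rc V g) v - sv V v) = 0" by (rule orth_pi_sv[OF nsub_K])
 moreover have "K \<inter> rc V g = rc V g" using rc_mono[OF nsubD(3)[OF V], of g] KK[OF g] by blast
 moreover have "K \<inter> V = V" using nsubD(3)[OF V] by blast
 ultimately have "sv (rc V g) v = sv V v"
  by (simp add: blinfun.diff_right PA_sv K_open compact_imp_closed[OF K_compact] oV oVg)
 moreover have "rc V g \<inter> V = {}"
  using rc_subgroup_disjoint[OF nsubD(1)[OF V], of g 0] rc_subgroup_self[OF nsubD(1)[OF V], of g] gV by (auto simp: rc_0)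
 ultimately have "cinner (sv V v) (sv V v) = 0" using cinner_sv[OF oVg oV, of v v] by (simp add: m_empty)
 then show False using cinner_sv[OF oV oV, of v v] m_pos[OF oV] nsubD(7)[OF V] v by (auto simp: cinner_self)
qed

end

section \<open>Averaging over fixed-point algebras\<close>

lemma real_le_all_eps: assumes "!!e. 0 < e ==> x \<le> y + C * e^2" shows "x \<le> (y::real)"
proof (rule field_le_epsilon)
 fix d :: real assume d: "0 < d"
 define e where "e = sqrt (d / (\<bar>C\<bar> + 1))"
 have p: "0 < \<bar>C\<bar> + 1" by (simp add: add_nonneg_pos)
 have e: "0 < e" "e^2 = d / (\<bar>C\<bar> + 1)" using d p by (auto simp: e_def)
 have "C * e^2 \<le> (\<bar>C\<bar> + 1) * e^2" by (intro mult_right_mono) auto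
 also have "... = d" using p e(2) by simp
 finally show "x \<le> y + d" using assms[OF e(1)] by linarith
qed

lemma cinner_partition:
 assumes I: "!!i. i \<in> I ==> A i \<in> \<L>" and r: "r \<in> \<L>" "adj r = r"
  and s: "(\<Sum>i\<in>I. A i oL adj (A i)) + (r oL r) = Id1"
 shows "(\<Sum>i\<in>I. fm (adj (A i)) v (ap (adj (A i)) w)) + fm r v (ap r w) = cinner v (w::'h::complex_hilbert_space)"
  "(\<Sum>i\<in>I. (norm (ap (adj (A i)) v))^2) + (norm (ap r v))^2 = (norm v)^2"
proof -
 show 1: "(\<Sum>i\<in>I. fm (adj (A i)) v (ap (adj (A i)) w)) + fm r v (ap r w) = cinner v w" for v w
 proof -
  have "fm ((\<Sum>i\<in>I. A i oL adj (A i)) + (r oL r)) v w = cinner v w" by (simp add: s)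
  moreover have "fm (A i) (ap (adj (A i)) v) w = fm (adj (A i)) v (ap (adj (A i)) w)" if "i \<in> I" for i
   using adj_works(1)[OF I[OF that]] by simp
  moreover have "fm r (ap r v) w = fm r v (ap r w)"
   using adj_works(1)[OF r(1), of "ap r v" w] r(2) by simp
  ultimately show ?thesis by (simp add: blinfun.add_left blinfun.sum_left cinner_add_left cinner_sum_left)
 qed
 have "Re ((\<Sum>i\<in>I. fm (adj (A i)) v (ap (adj (A i)) v)) + fm r v (ap r v)) = Re (cinner v v)"
  by (simp only: 1)
 then show "(\<Sum>i\<in>I. (norm (ap (adj (A i)) v))^2) + (norm (ap r v))^2 = (norm v)^2"
  by (simp add: Re_cinner_self)
qed

text \<open>The column of the adjoints is a contraction by hypothesis, hence so is the row; the
  proof pairs the sum with itself and uses Cauchy-Schwarz for finite sums.\<close>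

lemma row_contraction:
 assumes I: "!!i. i \<in> I ==> A i \<in> \<L>" and c: "!!v. (\<Sum>i\<in>I. (norm (ap (adj (A i)) v))^2) \<le> (norm v)^2"
 shows "(norm (\<Sum>i\<in>I. ap (A i) (v i)))^2 \<le> (\<Sum>i\<in>I. (norm (v i :: 'h::complex_hilbert_space))^2)"
proof -
 define w where "w = (\<Sum>i\<in>I. ap (A i) (v i))"
 have "(norm w)^2 = norm (cinner w w)" by (simp add: cinner_self norm_power)
 also have "cinner w w = (\<Sum>i\<in>I. cinner (v i) (ap (adj (A i)) w))"
  unfolding w_def cinner_sum_left by (intro sum.cong refl adj_works(1) I)
 also have "norm ... \<le> (\<Sum>i\<in>I. \<bar>norm (v i)\<bar> * \<bar>norm (ap (adj (A i)) w)\<bar>)"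
  by (rule order_trans[OF norm_sum]) (intro sum_mono, simp add: norm_cinner_le)
 also have "... \<le> L2_set (\<lambda>i. norm (v i)) I * L2_set (\<lambda>i. norm (ap (adj (A i)) w)) I" by (rule L2_set_mult_ineq)
 also have "... \<le> L2_set (\<lambda>i. norm (v i)) I * norm w"
  by (intro mult_left_mono L2_set_nonneg) (simp add: L2_set_def real_le_lsqrt c)
 finally have "norm w * norm w \<le> L2_set (\<lambda>i. norm (v i)) I * norm w" by (simp add: power2_eq_square)
 then have "norm w \<le> L2_set (\<lambda>i. norm (v i)) I" using L2_set_nonneg[of "\<lambda>i. norm (v i)" I] by (cases "w = 0") auto
 then have "(norm w)^2 \<le> (L2_set (\<lambda>i. norm (v i)) I)^2" by (intro power_mono) auto
 then show ?thesis unfolding w_def by (simp add: L2_set_def sum_nonneg)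
qed

text \<open>Lower semicontinuity: the approximants are tested against \<open>ap T v\<close> and
  \<open>ap (adj T) v\<close> themselves. Absorbing half of each square doubles its error
  \<open>e^2\<close>, which gives the constant 4 in total.\<close>

lemma wot_closure_norm_lsc:
 assumes T: "T \<in> wot_closure S" "T \<in> \<L>" and S: "S <= \<L>"
  and le: "!!W. W \<in> S ==> (norm (ap W v))^2 + (norm (ap (adj W) v))^2 \<le> k"
 shows "(norm (ap T v))^2 + (norm (ap (adj T) (v::'h::complex_hilbert_space)))^2 \<le> k"
proof (rule real_le_all_eps[of _ _ 4])
 fix e :: real assume e: "0 < e"
 let ?a = "ap T v" and ?b = "ap (adj T) v"
 obtain W where W: "W \<in> S" "\<forall>(x, y)\<in>{(v, ?a), (?b, v)}. norm (fm W x y - fm T x y) < e^2"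
  using wot_closureD[OF T(1), of "{(v, ?a), (?b, v)}" "e^2"] e by auto
 have Wc: "W \<in> \<L>" using S W(1) by blast
 have young: "Re (cinner x y) \<le> ((norm x)^2 + (norm y)^2) / 2" for x y :: 'h
 proof -
  have "Re (cinner x y) \<le> norm x * norm y" using norm_cinner_le[of x y] complex_Re_le_cmod order_trans by blast
  also have "... \<le> ((norm x)^2 + (norm y)^2) / 2" using sum_squares_bound[of "norm x" "norm y"] by simp
  finally show ?thesis .
 qed
 have "\<bar>Re (fm W v ?a - cinner ?a ?a)\<bar> < e^2" using W(2) abs_Re_le_cmod order_le_less_trans by fastforce
 then have 1: "(norm ?a)^2 \<le> Re (fm W v ?a) + e^2" by (simp add: Re_cinner_self)
 have "\<bar>Re (fm W ?b v - fm T ?b v)\<bar> < e^2" using W(2) abs_Re_le_cmod order_le_less_trans by fastforce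
 moreover have "fm T ?b v = cinner ?b ?b" by (rule adj_works(1)[OF T(2)])
 moreover have "fm W ?b v = cinner ?b (ap (adj W) v)" by (rule adj_works(1)[OF Wc])
 ultimately have 2: "(norm ?b)^2 \<le> Re (cinner ?b (ap (adj W) v)) + e^2" by (simp add: Re_cinner_self)
 show "(norm ?a)^2 + (norm ?b)^2 \<le> k + 4 * e^2"
  using 1 2 young[of "ap W v" ?a] young[of ?b "ap (adj W) v"] le[OF W(1)] by (simp add: field_simps)
qed

context crossed
begin

lemma M_algebra: "op_algebra (commutant MC)" by (rule op_algebra_commutant)
lemmas M = op_algebraD[OF M_algebra]

lemma M_adj: "x \<in> commutant MC ==> adj x \<in> commutant MC"
proof (rule commutant_adj)
 fix A assume A: "A \<in> MC"
 show "A \<in> \<L>" using A unfolding MC_def by (rule commutant_clinear)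
 show "adj A \<in> MC" using A unfolding MC_def
 proof (rule commutant_adj)
  fix C assume "C \<in> \<pi> ` B \<union> range lambda_op"
  then show "C \<in> \<L>" "adj C \<in> \<pi> ` B \<union> range lambda_op"
   using vn_adj[OF vB] by (auto simp: pi lam pi_adj lam_adj)
 qed
qed

lemma pi_sum: "(!!i. i \<in> I ==> a i \<in> B) ==> \<pi> (\<Sum>i\<in>I. a i) = (\<Sum>i\<in>I. \<pi> (a i))"
proof (induction I rule: infinite_finite_induct)
 case (insert i I)
 then show ?case by (simp add: pi_add Balg(9))
qed (use pi_scaleR[OF Balg(8), of 0] in simp_all)

lemma act_scalar: "\<alpha> g (scalar_op c) = scalar_op c"
 using act_simps(4)[OF Balg(3), of g c] by (simp add: act_simps compose_id_right)

lemma Q_scalar: "scalar_op c \<in> Q V" by (simp add: Q_iff act_scalar vn_scalar[OF vB])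

lemma pi_scalar: "\<pi> (scalar_op c) = scalar_op c"
proof (rule l2_op_eqI)
 fix F :: "'g => 'h" assume F: "ccf F"
 show "ap (\<pi> (scalar_op c)) (vec F) = ap (scalar_op c) (vec F)"
  using F by (simp add: pi vn_scalar[OF vB] act_scalar scalar_op_apply vec_scaleC)
qed (auto intro: pi vn_scalar[OF vB] clinear_scalar)

end

text \<open>Modelled on the translate of \<open>N\<close> by \<open>\<Lambda> (- s)\<close>. In
  general this is neither an algebra nor closed under adjoints; it is a weakly closed
  bimodule.\<close>

locale bimodule = crossed_min K \<alpha> B for K :: "'g::{topological_group_add,t2_space} set" and \<alpha> and B :: "'h::complex_hilbert_space op set" +
 fixes V :: "'g set" and X :: "('g, 'h) l2 op set"
 assumes V: "nsub V" and XM: "X <= commutant MC"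
  and X_add: "!!x y. x \<in> X ==> y \<in> X ==> x + y \<in> X" and X_scaleR: "!!r x. x \<in> X ==> r *\<^sub>R x \<in> X"
  and X_bi: "!!a c x. a \<in> B ==> c \<in> B ==> x \<in> X ==> \<pi> a oL x oL \<pi> c \<in> X"
  and X_wot: "!!S T. S <= X ==> T \<in> wot_closure S ==> T \<in> \<L> ==> T \<in> X"
begin

lemmas oV = nsubD(6)[OF V] nsubD(2)[OF V]

lemma mV: "0 < m V" using m_pos[OF oV] nsubD(7)[OF V] by blast

text \<open>The compression to \<open>1_V \<otimes> h\<close>, normalised to preserve the identity.
  On the crossed product it takes values in \<open>Q V\<close>, and it is bimodular over
  \<open>Q V\<close>.\<close>

definition F :: "('g, 'h) l2 op => 'h op" where "F y = (1 / m V) *\<^sub>R cf y V V"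
text \<open>Both \<open>y\<close> and \<open>adj y\<close> are measured: \<open>lam_mem\<close>
  needs both of them to fix step functions, and \<open>X\<close> is not assumed to be closed under
  adjoints.\<close>

definition D :: "('g, 'h) l2 op => 'h => real" where
 "D y \<eta> = ((norm (ap y (sv V \<eta>)))^2 + (norm (ap (adj y) (sv V \<eta>)))^2) / m V"

lemma X_clinear: "x \<in> X ==> x \<in> \<L>" using XM M(2) by blast

lemma F_cinner: "y \<in> \<L> ==> fm (F y) u v = fm y (sv V u) (sv V v) / of_real (m V)"
 by (simp add: F_def blinfun.scaleR_left cinner_scaleR_left cf(2)[OF _ oV oV])

text \<open>For \<open>t\<close> in \<open>V\<close> right translation fixes \<open>V\<close> and
  \<open>\<Delta> t = 1\<close>, so covariance becomes invariance.\<close>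

lemma F_Q: assumes y: "y \<in> commutant MC" shows "F y \<in> Q V"
proof -
 have B: "cf y V V \<in> B" by (rule cf_B[OF y oV oV])
 have "\<alpha> t (cf y V V) = cf y V V" if t: "t \<in> V" for t
 proof -
  have t': "- t \<in> V" "- t \<in> K" using t nsubD(3)[OF V] subgroupD(3)[OF nsubD(1)[OF V]] by auto
  show ?thesis using cf_translate[OF y oV oV, of "- t"] t' by (simp add: rc_subgroup_mem[OF nsubD(1)[OF V]] \<Delta>_K)
 qed
 then show ?thesis using B by (simp add: F_def Q_iff Balg(6) act_simps)
qed

lemma pi_V: "a \<in> Q V ==> ap (\<pi> a) (sv V u) = sv V (ap a u)"
 by (rule pi_sv_Q[OF V _ oV order_refl])

lemma QB: "a \<in> Q V ==> a \<in> B" by (simp add: Q_iff)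
lemma Qc: "a \<in> Q V ==> a \<in> \<L>" using QB Balg(2) by blast
lemma pic: "a \<in> Q V ==> \<pi> a \<in> \<L>" by (rule pi(1)[OF QB])

lemma F_bi: "y \<in> \<L> ==> a \<in> Q V ==> c \<in> Q V ==> F (\<pi> a oL y oL \<pi> c) = a oL F y oL c"
proof (rule op_eq_cinnerI)
 fix u v assume y: "y \<in> \<L>" and a: "a \<in> Q V" and c: "c \<in> Q V"
 have "fm (\<pi> a oL y oL \<pi> c) (sv V u) (sv V v) = fm y (sv V (ap c u)) (sv V (ap (adj a) v))"
  using adj_works(1)[OF pic[OF a], of _ "sv V v"] by (simp add: pi_V c pi_adj QB a Q_adj)
 then show "fm (F (\<pi> a oL y oL \<pi> c)) u v = fm (a oL F y oL c) u v"
  using adj_works(1)[OF Qc[OF a], of _ v] by (simp add: F_cinner clinear_compose pic a c y)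
qed

lemma F_wot:
 assumes T: "T \<in> wot_closure S" "T \<in> \<L>" and S: "S <= \<L>" and E: "finite E" and e: "0 < e"
 shows "\<exists>W\<in>S. \<forall>(u, v)\<in>E. norm (fm (F W) u v - fm (F T) u v) < e"
proof -
 let ?E = "(\<lambda>(u, v). (sv V u, sv V v)) ` E"
 have me: "0 < e * m V" using e mV by simp
 obtain W where W: "W \<in> S" "\<forall>(x, y)\<in>?E. norm (fm W x y - fm T x y) < e * m V"
  using wot_closureD[OF T(1) finite_imageI[OF E] me] by blast
 have Wc: "W \<in> \<L>" using W(1) S by blast
 have "norm (fm (F W) u v - fm (F T) u v) < e" if "(u, v) \<in> E" for u v
 proof -
  have "norm (fm W (sv V u) (sv V v) - fm T (sv V u) (sv V v)) < e * m V"
   using W(2) that by force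
  then show ?thesis using mV by (simp add: F_cinner Wc T(2) norm_divide pos_divide_less_eq flip: diff_divide_distrib)
 qed
 then show ?thesis using W(1) by (intro bexI[of _ W]) auto
qed

lemma X_sum: "finite I ==> I \<noteq> {} ==> (!!i. i \<in> I ==> x i \<in> X) ==> (\<Sum>i\<in>I. x i) \<in> X"
 by (induction I rule: finite_ne_induct) (auto intro: X_add)

lemma X_sum0: "y \<in> X ==> finite I ==> (!!i. i \<in> I ==> x i \<in> X) ==> (\<Sum>i\<in>I. x i) \<in> X"
 using X_sum[of I x] X_scaleR[of y 0] by (cases "I = {}") auto

text \<open>\<open>T\<close> is a weak limit of sums of \<open>\<pi> a oL y oL \<pi> (adj a)\<close>
  over the families given by \<open>averaging\<close>. At \<open>u\<close>, \<open>F\<close> of such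
  a sum is the sum of the values of \<open>F y\<close> at the vectors \<open>ap (adj a) u\<close>,
  and \<open>D\<close> is at most the corresponding sum; on those vectors \<open>h\<close> is at
  least \<open>c\<close>. The first clause provides invertible coefficients in
  \<open>ex_unit\<close>; the last is the strict decrease that contradicts minimality in
  \<open>ex_minimiser\<close>.\<close>

lemma average:
 assumes y: "y \<in> X" and h: "h \<in> Q V" "pos_op h" "h \<noteq> 0"
 shows "\<exists>c>0. \<exists>T\<in>X. norm T \<le> norm y &
  ((\<forall>u. Re (fm h u u) \<le> Re (fm (F y) u u)) --> (\<forall>u w. fm (F y) u w = cinner u (ap (F y) w)) -->
   pos_op (F T) & (\<forall>u. c * (norm u)^2 \<le> Re (fm (F T) u u))) &
  (F y = Id1 --> F T = Id1) &
  (\<forall>k. (\<forall>u. D y u + Re (fm h u u) \<le> k * (norm u)^2) --> (\<forall>u. D T u \<le> (k - c) * (norm u)^2))"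
proof -
 obtain c where c: "0 < c" "c \<le> 1" and av: "!!\<Xi> e. finite \<Xi> ==> 0 < e ==> \<exists>(I::'h op set) a r. finite I & (\<forall>i\<in>I. a i \<in> Q V) & r \<in> Q V & adj r = r &
   (\<Sum>i\<in>I. a i oL adj (a i)) + (r oL r) = Id1 &
   (\<forall>i\<in>I. \<forall>x. c * (norm (ap (adj (a i)) x))^2 \<le> Re (fm h (ap (adj (a i)) x) (ap (adj (a i)) x))) &
   (\<forall>z\<in>\<Xi>. norm (ap r z) < e)"
  using irreducible_subalgebra.averaging[OF irreducible[OF V] h] by blast
 have yc: "y \<in> \<L>" by (rule X_clinear[OF y])
 define dat where "dat \<Xi> e I a r \<longleftrightarrow> finite I & (\<forall>i\<in>I. a i \<in> Q V) & r \<in> Q V & adj r = r &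
   (\<Sum>i\<in>I. a i oL adj (a i)) + (r oL r) = Id1 &
   (\<forall>i\<in>I. \<forall>x. c * (norm (ap (adj (a i)) x))^2 \<le> Re (fm h (ap (adj (a i)) x) (ap (adj (a i)) x))) &
   (\<forall>z\<in>\<Xi>. norm (ap r z) < e)" for \<Xi> e a r and I :: "'h op set"
 have av': "\<exists>I a r. dat \<Xi> e I a r" if "finite \<Xi>" "0 < e" for \<Xi> e unfolding dat_def using av[OF that] .
 define G where "G \<Xi> e W \<longleftrightarrow> (\<exists>I a r. dat \<Xi> e I a r & W = (\<Sum>i\<in>I. \<pi> (a i) oL y oL \<pi> (adj (a i))))" for \<Xi> e W
 have G: "W \<in> X & norm W \<le> norm y &
   (\<forall>u\<in>\<Xi>. \<exists>J v (r::'h op). finite (J :: 'h op set) & (\<Sum>i\<in>J. (norm (v i))^2) + (norm (ap r u))^2 = (norm u)^2 & norm (ap r u) < e &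
    (\<forall>i\<in>J. c * (norm (v i))^2 \<le> Re (fm h (v i) (v i))) &
    fm (F W) u u = (\<Sum>i\<in>J. fm (F y) (v i) (v i)) & D W u \<le> (\<Sum>i\<in>J. D y (v i))) &
   ((\<forall>u w. fm (F y) u w = cinner u (ap (F y) w)) --> (\<forall>u w. fm (F W) u w = cinner u (ap (F W) w))) &
   (F y = Id1 --> (\<forall>u\<in>\<Xi>. \<forall>w\<in>\<Xi>. norm (fm (F W) u w - cinner u w) \<le> e^2))"
  if GW: "G \<Xi> e W" for \<Xi> e W
 proof -
  from GW obtain I :: "'h op set" and a r where dat: "dat \<Xi> e I a r" and W: "W = (\<Sum>i\<in>I. \<pi> (a i) oL y oL \<pi> (adj (a i)))"
   unfolding G_def by (elim exE conjE)
  from dat have I: "finite I" and a: "!!i. i \<in> I ==> a i \<in> Q V" and r: "r \<in> Q V" "adj r = r" and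
   s: "(\<Sum>i\<in>I. a i oL adj (a i)) + (r oL r) = Id1" and
   ch: "!!i x. i \<in> I ==> c * (norm (ap (adj (a i)) x))^2 \<le> Re (fm h (ap (adj (a i)) x) (ap (adj (a i)) x))" and
   rs: "!!z. z \<in> \<Xi> ==> norm (ap r z) < e"
   unfolding dat_def by simp_all
  have aB: "a i \<in> B" "a i \<in> \<L>" "adj (a i) \<in> Q V" "adj (a i) \<in> B" "\<pi> (a i) \<in> \<L>" "\<pi> (adj (a i)) \<in> \<L>" "adj (\<pi> (a i)) = \<pi> (adj (a i))"
    "adj (\<pi> (adj (a i))) = \<pi> (a i)" if "i \<in> I" for i
   using a[OF that] Q_adj[OF a[OF that]] by (auto simp: QB Qc pic pi_adj adj_adj)
  have rB: "r \<in> B" "r \<in> \<L>" using r by (auto simp: QB Qc)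
  note part = cinner_partition[of I a r, OF aB(2) rB(2) r(2) s]
  have "\<pi> ((\<Sum>i\<in>I. a i oL adj (a i)) + (r oL r)) = Id1" by (simp only: s pi_id)
  moreover have "\<pi> ((\<Sum>i\<in>I. a i oL adj (a i)) + (r oL r)) = (\<Sum>i\<in>I. \<pi> (a i) oL adj (\<pi> (a i))) + (\<pi> r oL \<pi> r)"
  proof -
   have "(\<Sum>i\<in>I. a i oL adj (a i)) \<in> B" by (intro Balg(9) Balg(5) aB)
   moreover have "\<pi> (\<Sum>i\<in>I. a i oL adj (a i)) = (\<Sum>i\<in>I. \<pi> (a i) oL adj (\<pi> (a i)))"
    by (subst pi_sum) (auto intro!: sum.cong Balg(5) aB simp: pi_compose aB)
   ultimately show ?thesis by (simp add: pi_add pi_compose rB Balg(5))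
  qed
  ultimately have s2: "(\<Sum>i\<in>I. \<pi> (a i) oL adj (\<pi> (a i))) + (\<pi> r oL \<pi> r) = Id1" by simp
  have \<pi>r: "\<pi> r \<in> \<L>" "adj (\<pi> r) = \<pi> r" using rB r(2) by (auto simp: pi pi_adj)
  note part2 = cinner_partition[of I "\<lambda>i. \<pi> (a i)", OF aB(5) \<pi>r s2]
  have c2: "(\<Sum>i\<in>I. (norm (ap (adj (\<pi> (a i))) v))^2) \<le> (norm v)^2" for v using part2(2)[of v] by (simp add: add_increasing2 flip: part2(2)[of v])
  note row = row_contraction[of I "\<lambda>i. \<pi> (a i)", OF aB(5) c2]
  have WX: "W \<in> X" unfolding W by (rule X_sum0[OF y I]) (intro X_bi aB y)
  have Wc: "W \<in> \<L>" by (rule X_clinear[OF WX])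
  have "norm (ap W v) \<le> norm y * norm v" for v
  proof -
   have "(norm (ap W v))^2 \<le> (\<Sum>i\<in>I. (norm (ap y (ap (\<pi> (adj (a i))) v)))^2)"
    using row[of "\<lambda>i. ap y (ap (\<pi> (adj (a i))) v)"] by (simp add: W blinfun.sum_left)
   also have "... \<le> (\<Sum>i\<in>I. (norm y)^2 * (norm (ap (adj (\<pi> (a i))) v))^2)"
    by (intro sum_mono) (use power_mono[OF norm_blinfun norm_ge_zero, of y _ 2] in \<open>auto simp: aB power_mult_distrib\<close>)
   also have "... \<le> (norm y)^2 * (norm v)^2" unfolding sum_distrib_left[symmetric] by (intro mult_left_mono c2) simp
   finally have "(norm (ap W v))^2 \<le> (norm y * norm v)^2" by (simp add: power_mult_distrib)
   then show ?thesis by (rule power2_le_imp_le) simp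
  qed
  then have nW: "norm W \<le> norm y" by (intro norm_blinfun_bound) auto
  have FW: "fm (F W) u w = (\<Sum>i\<in>I. fm (F y) (ap (adj (a i)) u) (ap (adj (a i)) w))" for u w
  proof -
   have "fm (\<pi> (a i)) (ap y (ap (\<pi> (adj (a i))) (sv V u))) (sv V w)
     = fm y (sv V (ap (adj (a i)) u)) (sv V (ap (adj (a i)) w))" if i: "i \<in> I" for i
    using adj_works(1)[OF aB(5)[OF i], of _ "sv V w"] by (simp add: aB i pi_V)
   then show ?thesis by (simp add: F_cinner Wc yc W blinfun.sum_left cinner_sum_left sum_divide_distrib clinear_intros X_clinear[OF WX, unfolded W])
  qed
  have adjW: "adj W = (\<Sum>i\<in>I. \<pi> (a i) oL adj y oL \<pi> (adj (a i)))"
   unfolding W by (subst adj_sum) (auto intro!: sum.cong clinear_intros simp: aB yc adj_compose clinear_intros compose_assoc)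
  have DW: "D W u \<le> (\<Sum>i\<in>I. D y (ap (adj (a i)) u))" for u
  proof -
   have "(norm (ap W (sv V u)))^2 \<le> (\<Sum>i\<in>I. (norm (ap y (sv V (ap (adj (a i)) u))))^2)"
    using row[of "\<lambda>i. ap y (sv V (ap (adj (a i)) u))"] by (simp add: W blinfun.sum_left pi_V aB cong: sum.cong)
   moreover have "(norm (ap (adj W) (sv V u)))^2 \<le> (\<Sum>i\<in>I. (norm (ap (adj y) (sv V (ap (adj (a i)) u))))^2)"
    using row[of "\<lambda>i. ap (adj y) (sv V (ap (adj (a i)) u))"] by (simp add: adjW blinfun.sum_left pi_V aB cong: sum.cong)
   ultimately show ?thesis unfolding D_def sum_divide_distrib[symmetric] sum.distrib using mV by (intro divide_right_mono add_mono) auto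
  qed
  have P1: "\<exists>J v (r::'h op). finite (J :: 'h op set) & (\<Sum>i\<in>J. (norm (v i))^2) + (norm (ap r u))^2 = (norm u)^2 & norm (ap r u) < e &
    (\<forall>i\<in>J. c * (norm (v i))^2 \<le> Re (fm h (v i) (v i))) &
    fm (F W) u u = (\<Sum>i\<in>J. fm (F y) (v i) (v i)) & D W u \<le> (\<Sum>i\<in>J. D y (v i))" if "u \<in> \<Xi>" for u
   by (intro exI[of _ I] exI[of _ "\<lambda>i. ap (adj (a i)) u"] exI[of _ r] conjI ballI I part(2) rs[OF that] FW DW ch)
  have P2: "fm (F W) u w = cinner u (ap (F W) w)"
   if sa: "\<forall>u w. fm (F y) u w = cinner u (ap (F y) w)" for u w
  proof -
   have "cnj (fm (F W) w u) = fm (F W) u w"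
    unfolding FW cnj_sum by (intro sum.cong refl) (metis sa cinner_commute)
   then show ?thesis by (metis cinner_commute)
  qed
  have P3: "norm (fm (F W) u w - cinner u w) \<le> e^2" if "F y = Id1" "u \<in> \<Xi>" "w \<in> \<Xi>" for u w
  proof -
   have "fm (F W) u w - cinner u w = - fm r u (ap r w)"
   proof -
    have "S - x = - y" if "S + y = x" for S x y :: complex using that by auto
    from this[OF part(1)[of u w]] show ?thesis by (simp add: FW that(1))
   qed
   also have "norm ... \<le> norm (ap r u) * norm (ap r w)" using norm_cinner_le by simp
   also have "... \<le> e * e" using rs[OF that(2)] rs[OF that(3)] norm_ge_zero[of "ap r u"] norm_ge_zero[of "ap r w"] by (intro mult_mono) linarith+
   finally show ?thesis by (simp add: power2_eq_square)
  qed
  show ?thesis using WX nW P1 P2 P3 by blast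
 qed
 have GX1: "W \<in> X" "norm W \<le> norm y" if "G \<Xi> e W" for \<Xi> e W using G[OF that] by simp_all
 have GP1: "\<exists>J v (r::'h op). finite (J :: 'h op set) & (\<Sum>i\<in>J. (norm (v i))^2) + (norm (ap r u))^2 = (norm u)^2 & norm (ap r u) < e &
    (\<forall>i\<in>J. c * (norm (v i))^2 \<le> Re (fm h (v i) (v i))) &
    fm (F W) u u = (\<Sum>i\<in>J. fm (F y) (v i) (v i)) & D W u \<le> (\<Sum>i\<in>J. D y (v i))"
  if "G {u} e W" for u e W
  using G[OF that] by (elim conjE) (erule bspec, simp)
 have GP2: "fm (F W) u w = cinner u (ap (F W) w)"
  if "G \<Xi> e W" "\<forall>u w. fm (F y) u w = cinner u (ap (F y) w)" for \<Xi> e W u w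
  using G[OF that(1)] that(2) by (elim conjE) simp
 have GP3: "norm (fm (F W) u w - cinner u w) \<le> e^2"
  if "G {u, w} e W" "F y = Id1" for e W u w
  using G[OF that(1)] that(2) by (elim conjE) simp
 \<comment> \<open>Enlarging \<open>\<Xi>\<close> and shrinking \<open>e\<close> makes these sets of
   averages directed, so they have a common weak cluster point, for which the remainders
   \<open>r\<close> disappear.\<close>
 define FF where "FF = {Collect (G \<Xi> e) | \<Xi> e. finite \<Xi> & 0 < e}"
 have "\<exists>T\<in>\<L>. norm T \<le> norm y & (\<forall>S\<in>FF. T \<in> wot_closure S)"
 proof (rule wot_compact)
  show "FF \<noteq> {}" unfolding FF_def using zero_less_one by blast
  show "S \<noteq> {}" if "S \<in> FF" for S
  proof -
   obtain \<Xi> e where S: "S = Collect (G \<Xi> e)" "finite \<Xi>" "0 < e" using \<open>S \<in> FF\<close> unfolding FF_def by blast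
   obtain I a r where "dat \<Xi> e I a r" using av'[OF S(2,3)] by (elim exE)
   then have "G \<Xi> e (\<Sum>i\<in>I. \<pi> (a i) oL y oL \<pi> (adj (a i)))" unfolding G_def by (intro exI[of _ I] exI[of _ a] exI[of _ r]) simp
   then show ?thesis unfolding S(1) by blast
  qed
  show "T \<in> \<L> & norm T \<le> norm y" if "S \<in> FF" "T \<in> S" for S T
   using that GX1 X_clinear unfolding FF_def by auto
  fix S S' assume "S \<in> FF" "S' \<in> FF"
  then obtain \<Xi> e \<Xi>' e' where S: "S = Collect (G \<Xi> e)" "finite \<Xi>" "0 < e" "S' = Collect (G \<Xi>' e')" "finite \<Xi>'" "0 < e'" unfolding FF_def by blast
  have "Collect (G (\<Xi> \<union> \<Xi>') (min e e')) <= S \<inter> S'"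
  proof
   fix W assume "W \<in> Collect (G (\<Xi> \<union> \<Xi>') (min e e'))"
   then obtain I a r where d: "dat (\<Xi> \<union> \<Xi>') (min e e') I a r" "W = (\<Sum>i\<in>I. \<pi> (a i) oL y oL \<pi> (adj (a i)))"
    unfolding G_def mem_Collect_eq by (elim exE conjE)
   have "dat \<Xi> e I a r" "dat \<Xi>' e' I a r" using d(1) unfolding dat_def by simp_all
   then have "G \<Xi> e W" "G \<Xi>' e' W" unfolding G_def using d(2) by (intro exI[of _ I] exI[of _ a] exI[of _ r], simp)+
   then show "W \<in> S \<inter> S'" unfolding S by simp
  qed
  moreover have "Collect (G (\<Xi> \<union> \<Xi>') (min e e')) \<in> FF"
   unfolding FF_def using S by (intro CollectI exI[of _ "\<Xi> \<union> \<Xi>'"] exI[of _ "min e e'"]) simp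
  ultimately show "\<exists>S''\<in>FF. S'' <= S \<inter> S'" by blast
 qed
 then obtain T where T: "T \<in> \<L>" "norm T \<le> norm y" and TS: "!!S. S \<in> FF ==> T \<in> wot_closure S" by blast
 have TG: "T \<in> wot_closure (Collect (G \<Xi> e))" if "finite \<Xi>" "0 < e" for \<Xi> e by (rule TS) (use that in \<open>auto simp: FF_def\<close>)
 have GX: "Collect (G \<Xi> e) <= X" for \<Xi> e using GX1 by auto
 have Gc: "Collect (G \<Xi> e) <= \<L>" for \<Xi> e using GX X_clinear by blast
 have TX: "T \<in> X" using X_wot[OF GX TG T(1), of "{}" 1] by simp
 have P1: "pos_op (F T) & (\<forall>u. c * (norm u)^2 \<le> Re (fm (F T) u u))"
  if le: "\<forall>u. Re (fm h u u) \<le> Re (fm (F y) u u)"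
   and sa: "\<forall>u w. fm (F y) u w = cinner u (ap (F y) w)"
 proof -
  have ge: "c * (norm u)^2 \<le> Re (fm (F T) u u)" for u
  proof (rule real_le_all_eps[of _ _ "c + 1"])
   fix e :: real assume e: "0 < e"
   then have e2: "0 < e^2" by simp
   obtain W where W: "G {u} e W" "norm (fm (F W) u u - fm (F T) u u) < e^2"
    using F_wot[OF TG[of "{u}" e] T(1) Gc, of "{(u, u)}" "e^2"] e e2 by auto
   obtain J :: "'h op set" and v r where J: "(\<Sum>i\<in>J. (norm (v i))^2) + (norm (ap (r::'h op) u))^2 = (norm u)^2" "norm (ap r u) < e"
    "!!i. i \<in> J ==> c * (norm (v i))^2 \<le> Re (fm h (v i) (v i))"
    "fm (F W) u u = (\<Sum>i\<in>J. fm (F y) (v i) (v i))"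
    using GP1[OF W(1)] by (elim exE conjE) simp
   have "(norm (ap r u))^2 \<le> e^2" using J(2) by (intro power_mono) auto
   then have "c * (norm u)^2 \<le> c * (\<Sum>i\<in>J. (norm (v i))^2) + c * e^2"
    unfolding J(1)[symmetric] distrib_left using c(1) by (intro add_left_mono mult_left_mono) auto
   also have "c * (\<Sum>i\<in>J. (norm (v i))^2) \<le> (\<Sum>i\<in>J. Re (fm (F y) (v i) (v i)))"
    unfolding sum_distrib_left by (intro sum_mono order_trans[OF J(3)]) (use le in auto)
   also have "... = Re (fm (F W) u u)" by (simp add: J(4))
   also have "... \<le> Re (fm (F T) u u) + e^2"
    using W(2) abs_Re_le_cmod[of "fm (F W) u u - fm (F T) u u"] by simp
   finally show "c * (norm u)^2 \<le> Re (fm (F T) u u) + (c + 1) * e^2" by (simp add: algebra_simps)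
  qed
  have FTc: "F T \<in> \<L>" using F_Q Qc XM TX by blast
  have "fm (F T) u w - cinner u (ap (F T) w) = 0" for u w
  proof (rule norm_le_all_eps[of _ 2])
   fix e :: real assume e: "0 < e"
   obtain W where W: "G {} e W" "norm (fm (F W) u w - fm (F T) u w) < e"
    "norm (fm (F W) w u - fm (F T) w u) < e"
    using F_wot[OF TG[of "{}" e] T(1) Gc, of "{(u, w), (w, u)}" e] e by auto
   have "fm (F W) u w = cinner u (ap (F W) w)" by (rule GP2[OF W(1) sa])
   then have "fm (F T) u w - cinner u (ap (F T) w) =
    cnj (fm (F W) w u - fm (F T) w u) - (fm (F W) u w - fm (F T) u w)"
    by (simp add: cinner_commute[symmetric])
   also have "norm ... \<le> norm (cnj (fm (F W) w u - fm (F T) w u)) + norm (fm (F W) u w - fm (F T) u w)"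
    by (rule norm_triangle_ineq4)
   also have "... \<le> 2 * e" using W unfolding complex_mod_cnj by linarith
   finally show "norm (fm (F T) u w - cinner u (ap (F T) w)) \<le> 2 * e" .
  qed
  then have "adj (F T) = F T" by (intro adj_unique FTc) simp
  moreover have "0 \<le> Re (fm (F T) u u)" for u using order_trans[OF _ ge[of u]] c(1) by simp
  ultimately show ?thesis using ge FTc by (simp add: pos_op_def)
 qed
 have P2: "F T = Id1" if Fy: "F y = Id1"
 proof -
  have "fm (F T) u w - cinner u w = 0" for u w
  proof -
   have "norm (fm (F T) u w - cinner u w) \<le> 0"
   proof (rule real_le_all_eps[of _ _ 2])
    fix e :: real assume e: "0 < e"
    then have e2: "0 < e^2" by simp
    obtain W where W: "G {u, w} e W" "norm (fm (F W) u w - fm (F T) u w) < e^2"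
     using F_wot[OF TG[of "{u, w}" e] T(1) Gc, of "{(u, w)}" "e^2"] e e2 by auto
    have "norm (fm (F W) u w - cinner u w) \<le> e^2" by (rule GP3[OF W(1) Fy])
    then show "norm (fm (F T) u w - cinner u w) \<le> 0 + 2 * e^2"
     using W(2) norm_triangle_ineq4[of "fm (F W) u w - cinner u w" "fm (F W) u w - fm (F T) u w"] by simp
   qed
   then show ?thesis by simp
  qed
  then show ?thesis by (intro op_eq_cinnerI) simp
 qed
 \<comment> \<open>The sign of \<open>k - c\<close> is not known, so the error caused by the
   remainder is bounded with its absolute value.\<close>
 have P3: "D T u \<le> (k - c) * (norm u)^2" if k: "\<forall>u. D y u + Re (fm h u u) \<le> k * (norm u)^2" for k u
 proof (rule real_le_all_eps[of _ _ "\<bar>k - c\<bar>"])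
  fix e :: real assume e: "0 < e"
  have "(norm (ap T (sv V u)))^2 + (norm (ap (adj T) (sv V u)))^2 \<le> ((k - c) * (norm u)^2 + \<bar>k - c\<bar> * e^2) * m V"
  proof (rule wot_closure_norm_lsc[OF TG[of "{u}" e] T(1) Gc])
   fix W assume "W \<in> Collect (G {u} e)"
   then have W: "G {u} e W" by simp
   obtain J :: "'h op set" and v r where J: "(\<Sum>i\<in>J. (norm (v i))^2) + (norm (ap (r::'h op) u))^2 = (norm u)^2" "norm (ap r u) < e"
    "!!i. i \<in> J ==> c * (norm (v i))^2 \<le> Re (fm h (v i) (v i))" "D W u \<le> (\<Sum>i\<in>J. D y (v i))"
    using GP1[OF W] by (elim exE conjE) simp
   have r2: "(norm (ap r u))^2 \<le> e^2" using J(2) by (intro power_mono) auto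
   note J(4)
   also have "(\<Sum>i\<in>J. D y (v i)) \<le> (\<Sum>i\<in>J. (k - c) * (norm (v i))^2)"
   proof (rule sum_mono)
    fix i assume "i \<in> J"
    then show "D y (v i) \<le> (k - c) * (norm (v i))^2" using J(3)[of i] k[rule_format, of "v i"] by (simp add: left_diff_distrib)
   qed
   also have "... = (k - c) * ((norm u)^2 - (norm (ap r u))^2)" unfolding J(1)[symmetric] by (simp add: sum_distrib_left)
   also have "... \<le> (k - c) * (norm u)^2 + \<bar>k - c\<bar> * e^2"
   proof -
    have "- ((k - c) * (norm (ap r u))^2) \<le> \<bar>k - c\<bar> * (norm (ap r u))^2"
     by (simp add: mult_right_mono flip: mult_minus_left)
    also have "... \<le> \<bar>k - c\<bar> * e^2" by (intro mult_left_mono r2) simp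
    finally show ?thesis by (simp add: right_diff_distrib)
   qed
   finally show "(norm (ap W (sv V u)))^2 + (norm (ap (adj W) (sv V u)))^2 \<le> ((k - c) * (norm u)^2 + \<bar>k - c\<bar> * e^2) * m V"
    unfolding D_def using mV by (simp add: pos_divide_le_eq)
  qed (use e in auto)
  then show "D T u \<le> (k - c) * (norm u)^2 + \<bar>k - c\<bar> * e^2" unfolding D_def using mV by (simp add: pos_divide_le_eq)
 qed
 show ?thesis using c(1) TX T(2) P1 P2 P3 by blast
qed

end

section \<open>Minimisation\<close>

lemma isometry_norm: "a \<in> \<L> ==> adj a oL a = Id1 ==> norm (ap a v) = norm (v::'h::complex_hilbert_space)"
proof -
 assume a: "a \<in> \<L>" "adj a oL a = Id1"
 have "(norm (ap a v))^2 = (norm v)^2" using Re_cinner_adj_comp[OF a(1), of v] by (simp add: a(2) Re_cinner_self)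
 then show ?thesis by simp
qed

lemma parallelogram_mid:
 "(norm ((1/2) *\<^sub>R (u + w)))^2 = (norm u)^2 / 2 + (norm w)^2 / 2 - (norm (u - w :: 'h::real_inner))^2 / 4"
 by (simp add: power2_norm_eq_inner inner_add_left inner_add_right inner_diff_left inner_diff_right inner_commute field_simps)

text \<open>A self-adjoint contraction \<open>a\<close> is the mean of the unitaries \<open>a \<plusminus> i (1 - a\<^sup>2)\<^sup>1\<^sup>/\<^sup>2\<close>.\<close>

lemma unitaries_span:
 fixes A :: "'h::complex_hilbert_space op set"
 assumes A: "op_algebra A" and Aadj: "!!a. a \<in> A ==> adj a \<in> A" and Asc: "!!c. scalar_op c \<in> A"
  and Padd: "!!a b. a \<in> A ==> b \<in> A ==> P a ==> P b ==> P (a + b)" and Psc: "!!c a. a \<in> A ==> P a ==> P (scalar_op c oL a)"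
  and Pu: "!!u. u \<in> A ==> adj u oL u = Id1 ==> u oL adj u = Id1 ==> P u"
 shows "a \<in> A ==> P a"
proof -
 note alg = op_algebraD[OF A]
 have sc_mult: "scalar_op c oL (scalar_op d oL T) = scalar_op (c * d) oL T" for c d and T :: "'h op"
  by (rule blinfun_eqI) (simp add: scalar_op_apply scaleC_scaleC)
 have sc_comm: "T oL scalar_op c = scalar_op c oL T" if "T \<in> \<L>" for c and T :: "'h op"
  by (rule blinfun_eqI) (simp add: scalar_op_apply clinear_scaleC[OF that])
 have sc1: "scalar_op (of_real r) oL T = r *\<^sub>R T" for r and T :: "'h op" by (rule scalar_op_of_real)
 have contr: "P s" if s: "s \<in> A" "adj s = s" "norm s \<le> 1" for s
 proof -
  have sc: "s \<in> \<L>" by (rule alg(2)[OF s(1)])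
  define t where "t = Id1 - (s oL s)"
  have tA: "t \<in> A" unfolding t_def by (intro alg s)
  have tc: "t \<in> \<L>" by (rule alg(2)[OF tA])
  have "pos_op t"
   unfolding pos_op_def
  proof (intro conjI allI)
   show "adj t = t" unfolding t_def by (simp add: adj_diff adj_compose clinear_intros sc s(2) adj_id)
   fix x
   have "(norm (ap s x))^2 \<le> (norm x)^2"
    using norm_blinfun_apply_le[OF s(3), of x] by (intro power_mono) auto
   then show "0 \<le> Re (fm t x x)"
    using Re_cinner_adj_comp[OF sc, of x] by (simp add: t_def s(2) blinfun.diff_left cinner_diff_left Re_cinner_self)
  qed (rule tc)
  then obtain S where S: "pos_op S" "S oL S = t" "!!C. op_algebra C ==> t \<in> C ==> S \<in> C" using ex_sqrt by blast
  have SA: "S \<in> A" by (rule S(3)[OF A tA])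
  have "t \<in> commutant {s}" by (rule commutantI[OF tc]) (auto simp: t_def compose_simps)
  then have "S \<in> commutant {s}" by (rule S(3)[OF op_algebra_commutant])
  then have Ss: "S oL s = s oL S" by (rule commutantD) simp
  have Sc: "S \<in> \<L>" "adj S = S" using pos_opD[OF S(1)] by auto
  define u where "u c = s + (scalar_op c oL S)" for c
  have uA: "u c \<in> A" for c unfolding u_def by (intro alg Asc SA s)
  have au: "adj (u c) = u (cnj c)" for c
   unfolding u_def by (simp add: adj_add adj_compose clinear_intros sc Sc s(2) adj_scalar sc_comm)
  have uu: "u c oL u d = Id1" if "c + d = 0" "c * d = 1" for c d
  proof -
   have "u c oL u d = (s oL s) + (scalar_op (c + d) oL (s oL S)) + (scalar_op (c * d) oL t)"
   proof (rule blinfun_eqI)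
    fix x
    have 1: "ap S (ap s x) = ap s (ap S x)" "ap S (ap S x) = ap t x"
     using arg_cong[OF Ss, of "\<lambda>T. ap T x"] arg_cong[OF S(2), of "\<lambda>T. ap T x"] by simp_all
    show "ap (u c oL u d) x = ap ((s oL s) + (scalar_op (c + d) oL (s oL S)) + (scalar_op (c * d) oL t)) x"
     by (simp add: u_def blinfun.bilinear_simps scalar_op_apply clinear_scaleC[OF sc] clinear_scaleC[OF Sc(1)] scaleC_add_left scaleC_scaleC scaleC_add_right 1)
   qed
   then show ?thesis using that by (intro blinfun_eqI) (simp add: scalar_op_apply scaleC_zero_left scaleC_one t_def blinfun.bilinear_simps)
  qed
  have "P (u \<i>)" "P (u (- \<i>))" using uu[of \<i> "- \<i>"] uu[of "- \<i>" \<i>] by (auto intro!: Pu uA simp: au)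
  then have "P (scalar_op (1/2) oL (u \<i> + u (- \<i>)))" by (intro Psc Padd uA alg(4))
  moreover have "scalar_op (1/2) oL (u \<i> + u (- \<i>)) = s"
  proof (rule blinfun_eqI)
   fix x
   have "ap (u \<i> + u (- \<i>)) x = 2 *\<^sub>R ap s x"
    using scaleC_add_left[of \<i> "- \<i>" "ap S x"] by (simp add: u_def blinfun.bilinear_simps scalar_op_apply scaleC_zero_left scaleR_2)
   then show "ap (scalar_op (1/2) oL (u \<i> + u (- \<i>))) x = ap s x"
    by (simp add: scalar_op_apply scaleC_scaleC scaleC_one flip: scaleC_of_real)
  qed
  ultimately show ?thesis by simp
 qed
 have selfadj: "P s" if s: "s \<in> A" "adj s = s" for s
 proof -
  have p: "0 < norm s + 1" by (simp add: add_nonneg_pos)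
  have "P ((1 / (norm s + 1)) *\<^sub>R s)"
   by (rule contr) (use s p alg(2) in \<open>auto intro: alg simp: adj_scaleR divide_simps\<close>)
  then have "P (scalar_op (of_real (norm s + 1)) oL ((1 / (norm s + 1)) *\<^sub>R s))" by (intro Psc alg s)
  then show ?thesis using p by (simp only: sc1) simp
 qed
 assume a: "a \<in> A"
 have ac: "a \<in> \<L>" by (rule alg(2)[OF a])
 define b where "b = scalar_op (- \<i>) oL (a - adj a)"
 have bA: "b \<in> A" unfolding b_def by (intro alg Asc Aadj a)
 have neg: "(- c) *\<^sub>C x = - (c *\<^sub>C x)" for c and x :: 'h using scaleC_scaleC[of "-1" c x] by (simp add: scaleC_minus1)
 have "adj b = scalar_op \<i> oL (adj a - a)"
  unfolding b_def by (simp add: adj_compose adj_diff clinear_intros ac adj_adj adj_scalar sc_comm)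
 also have "... = b"
  unfolding b_def by (rule blinfun_eqI) (simp add: scalar_op_apply blinfun.bilinear_simps scaleC_diff_right neg)
 finally have "adj b = b" .
 then have "P b" by (rule selfadj[OF bA])
 moreover have "P (a + adj a)" by (rule selfadj) (simp_all add: alg a Aadj adj_add clinear_intros ac adj_adj add.commute)
 ultimately have "P ((a + adj a) + (scalar_op \<i> oL b))"
  by (intro Padd[OF alg(4)[OF a Aadj[OF a]] alg(5)[OF Asc bA]] Psc[OF bA])
 then have "P (scalar_op (1/2) oL ((a + adj a) + (scalar_op \<i> oL b)))"
  by (rule Psc[OF alg(4)[OF alg(4)[OF a Aadj[OF a]] alg(5)[OF Asc bA]]])
 moreover have "scalar_op (1/2) oL ((a + adj a) + (scalar_op \<i> oL b)) = a"
 proof (rule blinfun_eqI)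
  fix x
  have "ap ((a + adj a) + (scalar_op \<i> oL b)) x = 2 *\<^sub>R ap a x"
   by (simp add: b_def blinfun.bilinear_simps scalar_op_apply scaleC_scaleC scaleC_one scaleR_2)
  then show "ap (scalar_op (1/2) oL ((a + adj a) + (scalar_op \<i> oL b))) x = ap a x"
   by (simp add: scalar_op_apply scaleC_scaleC scaleC_one flip: scaleC_of_real)
 qed
 ultimately show "P a" by simp
qed

context td_haar
begin

lemma sv_UN:
 assumes I: "finite I" and A: "!!i. i \<in> I ==> compact (A i)" "!!i. i \<in> I ==> open (A i)"
  and dis: "\<forall>i\<in>I. \<forall>j\<in>I. i \<noteq> j --> A i \<inter> A j = {}"
 shows "sv (\<Union>i\<in>I. A i) u = (\<Sum>i\<in>I. sv (A i) (u::'h::complex_hilbert_space))"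
proof -
 have "(\<lambda>t. if t \<in> (\<Union>i\<in>I. A i) then u else 0) = (\<lambda>t. \<Sum>i\<in>I. if t \<in> A i then u else 0)"
 proof
  fix t
  show "(if t \<in> (\<Union>i\<in>I. A i) then u else 0) = (\<Sum>i\<in>I. if t \<in> A i then u else 0)"
  proof (cases "t \<in> (\<Union>i\<in>I. A i)")
   case True
   then obtain i where i: "i \<in> I" "t \<in> A i" by blast
   have "(if t \<in> A j then u else 0) = (if j = i then u else 0)" if "j \<in> I" for j
    using dis that i by (auto simp: disjoint_iff)
   then have "(\<Sum>j\<in>I. if t \<in> A j then u else 0) = u" using i I by (simp cong: sum.cong)
   then show ?thesis using True by simp
  next
   case False
   then show ?thesis by (simp add: sum.neutral)
  qed
 qed
 then show ?thesis unfolding sv_def by (simp add: vec_sum ccf_step A)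
qed

end

section \<open>A minimal element that commutes with the fixed-point algebra on
  \<open>1_V\<close>\<close>

context bimodule
begin

text \<open>By density, a nonzero block can be sandwiched between elements of \<open>\<pi>\<close>
  so that its coefficient \<open>q\<close> is nonzero. Multiplying by \<open>adj q\<close> makes it
  positive, averaging bounds it below, and its inverse again lies in \<open>Q V\<close>.\<close>

lemma ex_unit:
 assumes x: "x \<in> X" and ne: "PA V oL x oL PA V \<noteq> 0"
 shows "\<exists>y\<in>X. F y = Id1"
proof -
 have xc: "x \<in> \<L>" by (rule X_clinear[OF x])
 have PAc: "PA V \<in> (\<L> :: ('g, 'h) l2 op set)" by (rule PA(1)[OF nsubD(2,5)[OF V]])
 obtain b u where b: "b \<in> B" "ap (PA V oL x) (ap (\<pi> b) (sv V u)) \<noteq> 0"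
  using zero_on_PA[OF V clinear_compose[OF PAc xc]] ne by blast
 define v where "v = ap x (ap (\<pi> b) (sv V u))"
 have "ap (PA V) v \<noteq> 0" using b(2) by (simp add: v_def)
 then obtain b' w where b': "b' \<in> B" "cinner v (ap (\<pi> b') (sv V w)) \<noteq> 0" using orth_pi_sv[OF V] by blast
 define y1 where "y1 = \<pi> (adj b') oL x oL \<pi> b"
 have y1: "y1 \<in> X" unfolding y1_def by (intro X_bi vn_adj[OF vB] b b' x)
 have y1c: "y1 \<in> \<L>" by (rule X_clinear[OF y1])
 have "fm (\<pi> (adj b')) v (sv V w) = cinner v (ap (\<pi> b') (sv V w))"
  using adj_works_right[OF pi(1)[OF b'(1)], of v "sv V w"] by (simp add: pi_adj b')
 then have "fm (F y1) u w \<noteq> 0"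
  using b'(2) mV by (simp add: F_cinner y1c) (simp add: y1_def v_def)
 then have q0: "F y1 \<noteq> 0" by (auto simp: cinner_zero_left)
 define q where "q = F y1"
 have q: "q \<in> Q V" "q \<in> \<L>" "adj q \<in> Q V" "q \<noteq> 0" unfolding q_def using F_Q[of y1] y1 XM q0 Qc Q_adj by auto
 have idQ: "Id1 \<in> Q V" by (rule op_algebraD(3)[OF Q_algebra])
 define y2 where "y2 = \<pi> (adj q) oL y1 oL \<pi> Id1"
 have y2: "y2 \<in> X" unfolding y2_def by (intro X_bi QB q idQ y1)
 define h where "h = adj q oL q"
 have Fy2: "F y2 = h" unfolding y2_def h_def F_bi[OF y1c q(3) idQ] by (simp add: compose_id_right q_def)
 have hQ: "h \<in> Q V" unfolding h_def by (intro op_algebraD(5)[OF Q_algebra] q)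
 have hp: "pos_op h" unfolding h_def by (rule pos_op_adj_comp(1)[OF q(2)])
 have h0: "h \<noteq> 0"
 proof
  assume "h = 0"
  then have "norm (ap q v) = 0" for v using Re_cinner_adj_comp[OF q(2), of v] by (simp add: h_def cinner_zero_left)
  then have "q = 0" by (intro blinfun_eqI) simp
  then show False using q by simp
 qed
 have sa: "fm h u w = cinner u (ap h w)" for u w
  using adj_works(1)[OF pos_opD(1)[OF hp], of u w] by (simp add: pos_opD(2)[OF hp])
 obtain c T where c: "0 < c" and T: "T \<in> X" "pos_op (F T)" "!!u. c * (norm u)^2 \<le> Re (fm (F T) u u)"
  using average[OF y2 hQ hp h0] sa unfolding Fy2 by blast
 obtain Z where Z: "pos_op Z" "F T oL Z = Id1" "Z oL F T = Id1" using ex_inverse[OF T(2) c T(3)] by blast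
 have ZQ: "Z \<in> Q V" using Q_inverse[OF _ pos_opD(1)[OF Z(1)] Z(2,3)] F_Q T(1) XM by blast
 have "F (\<pi> Z oL T oL \<pi> Id1) = Id1" unfolding F_bi[OF X_clinear[OF T(1)] ZQ idQ] by (simp add: Z(3) compose_id_right)
 moreover have "\<pi> Z oL T oL \<pi> Id1 \<in> X" by (intro X_bi QB ZQ idQ T)
 ultimately show ?thesis by blast
qed

lemma norm_sv_V: "(norm (sv V u))^2 = m V * (norm (u::'h))^2"
 using mV by (simp add: norm_sv oV power_mult_distrib)

lemma D_nonneg: "0 \<le> D y u" using mV by (simp add: D_def)

lemma D_midpoint:
 assumes "y \<in> \<L>" "z \<in> \<L>"
 shows "D ((1/2) *\<^sub>R (y + z)) u = D y u / 2 + D z u / 2 - D (y - z) u / 4"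
proof -
 have e: "adj ((1/2) *\<^sub>R (y + z)) = (1/2) *\<^sub>R (adj y + adj z)" "adj (y - z) = adj y - adj z"
  using assms by (simp_all add: adj_scaleR adj_add adj_diff clinear_intros)
 show ?thesis unfolding D_def e blinfun.scaleR_left blinfun.add_left blinfun.diff_left parallelogram_mid
  by (simp add: add_divide_distrib diff_divide_distrib)
qed

text \<open>Weak compactness and semicontinuity produce a \<open>y\<close> attaining the least
  uniform bound \<open>k0\<close> for \<open>D\<close>. If a unitary \<open>a\<close> of
  \<open>Q V\<close> moved \<open>y\<close> on \<open>1_V\<close>, the midpoint of \<open>y\<close>
  and its conjugate would lower \<open>D\<close> by a quarter of \<open>D\<close> of their
  difference. That gain is the form of a nonzero positive element of \<open>Q V\<close>, and
  \<open>average\<close> makes it uniform.\<close>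

lemma ex_minimiser:
 assumes y0: "y0 \<in> X" "F y0 = Id1"
 shows "\<exists>y\<in>X. F y = Id1 & (\<forall>a\<in>Q V. adj a oL a = Id1 --> a oL adj a = Id1 --> (\<forall>u. D (y - (\<pi> a oL y oL \<pi> (adj a))) u = 0))"
proof -
 \<comment> \<open>The bound gives compactness. Conjugation by unitaries, midpoints and averages do
   not increase the norm, so the competitors stay within it.\<close>
 define R where "R = norm y0"
 define C where "C = {y \<in> X. norm y \<le> R & F y = Id1}"
 \<comment> \<open>The bound is uniform in \<open>u\<close>, so that the comparison involves one
   number instead of a family of quadratic forms.\<close>
 define KK where "KK = {k. \<exists>y\<in>C. \<forall>u. D y u \<le> k * (norm u)^2}"
 have y0C: "y0 \<in> C" using y0 by (simp add: C_def R_def)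
 have "2 * R^2 \<in> KK"
 proof -
  have "D y0 u \<le> 2 * R^2 * (norm u)^2" for u
  proof -
   have "(norm (ap T (sv V u)))^2 \<le> R^2 * (m V * (norm u)^2)" if "norm T \<le> R" for T :: "('g, 'h) l2 op"
    using power_mono[OF norm_blinfun_apply_le[OF that, of "sv V u"] norm_ge_zero, of 2] by (simp add: power_mult_distrib norm_sv_V)
   then have "(norm (ap y0 (sv V u)))^2 + (norm (ap (adj y0) (sv V u)))^2 \<le> R^2 * (m V * (norm u)^2) + R^2 * (m V * (norm u)^2)"
    using adj_works(3)[OF X_clinear[OF y0(1)]] by (intro add_mono) (auto simp: R_def)
   then show ?thesis unfolding D_def using mV by (simp add: pos_divide_le_eq mult_ac)
  qed
  then show ?thesis using y0C unfolding KK_def by blast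
 qed
 then have KKne: "KK \<noteq> {}" by blast
 obtain \<zeta>0 :: 'h where z0: "\<zeta>0 \<noteq> 0" using ex_nonzero by blast
 have KK0: "0 \<le> k" if "k \<in> KK" for k
 proof -
  obtain y where "D y \<zeta>0 \<le> k * (norm \<zeta>0)^2" using \<open>k \<in> KK\<close> unfolding KK_def by blast
  then have "0 \<le> k * (norm \<zeta>0)^2" using D_nonneg order_trans by blast
  then show ?thesis using z0 by (simp add: zero_le_mult_iff)
 qed
 then have bdd: "bdd_below KK" by (rule bdd_belowI)
 define k0 where "k0 = Inf KK"
 define S where "S e = {y \<in> C. \<forall>u. D y u \<le> (k0 + e) * (norm u)^2}" for e
 have SX: "S e <= X" for e by (auto simp: S_def C_def)
 have Sc: "S e <= \<L>" for e using SX X_clinear by blast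
 have "\<exists>T\<in>\<L>. norm T \<le> R & (\<forall>A\<in>S ` {0<..}. T \<in> wot_closure A)"
 proof (rule wot_compact)
  show "S ` {0<..} \<noteq> {}" by simp
  show "A \<noteq> {}" if A: "A \<in> S ` {0<..}" for A
  proof -
   obtain e where e: "0 < e" "A = S e" using A by auto
   have "Inf KK < k0 + e" using e by (simp add: k0_def)
   then obtain k where "k \<in> KK" "k < k0 + e" using cInf_lessD[OF KKne] by blast
   then obtain y where y: "y \<in> C" "!!u. D y u \<le> k * (norm u)^2" unfolding KK_def by blast
   have "D y u \<le> (k0 + e) * (norm u)^2" for u
    by (rule order_trans[OF y(2)]) (intro mult_right_mono less_imp_le \<open>k < k0 + e\<close> zero_le_power2)
   then show ?thesis using y(1) e(2) unfolding S_def by blast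
  qed
  show "T \<in> \<L> & norm T \<le> R" if "A \<in> S ` {0<..}" "T \<in> A" for A T
   using that Sc by (auto simp: S_def C_def X_clinear)
  fix A A' assume "A \<in> S ` {0<..}" "A' \<in> S ` {0<..}"
  then obtain e e' where e: "0 < e" "A = S e" "0 < e'" "A' = S e'" by auto
  have "S (min e e') <= S d" if "d = e \<or> d = e'" for d
  proof -
   have "(k0 + min e e') * (norm u)^2 \<le> (k0 + d) * (norm u)^2" for u :: 'h using that by (intro mult_right_mono) auto
   then show ?thesis unfolding S_def using order_trans by blast
  qed
  then have "S (min e e') <= A \<inter> A'" using e by blast
  moreover have "S (min e e') \<in> S ` {0<..}" using e by simp
  ultimately show "\<exists>A''\<in>S ` {0<..}. A'' <= A \<inter> A'" by blast
 qed
 then obtain y where yc: "y \<in> \<L>" and yR: "norm y \<le> R" and yS: "!!e. 0 < e ==> y \<in> wot_closure (S e)" by auto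
 have yX: "y \<in> X" by (rule X_wot[OF SX yS[OF zero_less_one] yc])
 have Fy: "F y = Id1"
 proof (rule op_eq_cinnerI)
  fix u w
  have "cinner u w - fm (F y) u w = 0"
  proof (rule norm_le_all_eps[of _ 1])
   fix e :: real assume e: "0 < e"
   obtain W where "W \<in> S 1" "norm (fm (F W) u w - fm (F y) u w) < e"
    using F_wot[OF yS[OF zero_less_one] yc Sc, of "{(u, w)}" e] e by auto
   then show "norm (cinner u w - fm (F y) u w) \<le> 1 * e" by (simp add: S_def C_def)
  qed
  then show "fm (F y) u w = fm Id1 u w" by simp
 qed
 have Dy: "D y u \<le> k0 * (norm u)^2" for u
 proof (rule real_le_all_eps[of _ _ "(norm u)^2"])
  fix e :: real assume e: "0 < e"
  then have e2: "0 < e^2" by simp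
  have "(norm (ap y (sv V u)))^2 + (norm (ap (adj y) (sv V u)))^2 \<le> (k0 + e^2) * (norm u)^2 * m V"
   by (rule wot_closure_norm_lsc[OF yS[OF e2] yc Sc]) (use mV in \<open>auto simp: S_def D_def pos_divide_le_eq\<close>)
  then show "D y u \<le> k0 * (norm u)^2 + (norm u)^2 * e^2" unfolding D_def using mV by (simp add: pos_divide_le_eq algebra_simps)
 qed
 have "D (y - (\<pi> a oL y oL \<pi> (adj a))) u = 0" if a: "a \<in> Q V" "adj a oL a = Id1" "a oL adj a = Id1" for a u
 proof (rule ccontr)
  assume ne: "D (y - (\<pi> a oL y oL \<pi> (adj a))) u \<noteq> 0"
  have a': "adj a \<in> Q V" "adj (adj a) = a" using Q_adj[OF a(1)] adj_adj[OF Qc[OF a(1)]] by auto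
  define z where "z = \<pi> a oL y oL \<pi> (adj a)"
  have zX: "z \<in> X" unfolding z_def by (intro X_bi QB a a' yX)
  have zc: "z \<in> \<L>" by (rule X_clinear[OF zX])
  have "adj (\<pi> a) oL \<pi> a = Id1" "adj (\<pi> (adj a)) oL \<pi> (adj a) = Id1"
   using pi_compose[OF QB[OF a'(1)] QB[OF a(1)]] pi_compose[OF QB[OF a(1)] QB[OF a'(1)]] by (simp_all add: pi_adj QB a a' pi_id)
  then have iso: "norm (ap (\<pi> a) v) = norm v" "norm (ap (\<pi> (adj a)) v) = norm v" for v
   by (auto intro!: isometry_norm pic a a')
  have isoa: "norm (ap (adj a) u) = norm u" for u by (rule isometry_norm) (simp_all add: Qc a a')
  have nz: "norm z \<le> R"
   by (rule norm_blinfun_bound) (use norm_blinfun_apply_le[OF yR] norm_ge_zero[of y] yR in \<open>auto simp: z_def iso simp del: norm_ge_zero intro: order_trans\<close>, metis iso(2) norm_blinfun_apply_le yR)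
  have Fz: "F z = Id1" unfolding z_def F_bi[OF yc a(1) a'(1)] Fy by (simp add: compose_id_right a)
  have adjz: "adj z = \<pi> a oL adj y oL \<pi> (adj a)"
   unfolding z_def by (simp add: adj_compose clinear_intros pic a a' yc pi_adj QB compose_assoc)
  have Dz: "D z u \<le> k0 * (norm u)^2" for u
  proof -
   have "D z u = D y (ap (adj a) u)" unfolding D_def adjz by (simp add: z_def iso pi_V a')
   then show ?thesis using Dy[of "ap (adj a) u"] by (simp add: isoa)
  qed
  define d where "d = y - z"
  have dX: "d \<in> X" using X_add[OF yX X_scaleR[OF zX, of "-1"]] by (simp add: d_def)
  have dc: "d \<in> \<L>" by (rule X_clinear[OF dX])
  define y1 where "y1 = (1/2) *\<^sub>R (y + z)"
  have y1X: "y1 \<in> X" unfolding y1_def by (intro X_scaleR X_add yX zX)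
  have Dy1: "D y1 u + D d u / 4 \<le> k0 * (norm u)^2" for u
   using Dy[of u] Dz[of u] by (simp add: y1_def d_def D_midpoint yc zc)
  have Fy1: "F y1 = Id1"
  proof (rule op_eq_cinnerI)
   fix u w
   have "fm (F y) u w = cinner u w" "fm (F z) u w = cinner u w" by (simp_all add: Fy Fz)
   then have "fm y (sv V u) (sv V w) / of_real (m V) = cinner u w" "fm z (sv V u) (sv V w) / of_real (m V) = cinner u w"
    by (simp_all add: F_cinner yc zc)
   then have "fm y (sv V u) (sv V w) = cinner u w * of_real (m V)" "fm z (sv V u) (sv V w) = cinner u w * of_real (m V)"
    using mV by (simp_all add: divide_eq_eq)
   then show "fm (F y1) u w = fm Id1 u w"
    by (simp add: F_cinner X_clinear[OF y1X]) (use mV in \<open>simp add: y1_def blinfun.bilinear_simps cinner_simps\<close>)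
  qed
  have ny1: "norm y1 \<le> R" using norm_triangle_ineq[of y z] yR nz by (simp add: y1_def)
  \<comment> \<open>Chosen so that the form of \<open>F e\<close> is the gain
    \<open>D d u / 4\<close> of the midpoint; this places the gain in \<open>Q V\<close>.\<close>
  define e where "e = (1/4) *\<^sub>R ((adj d oL d) + (d oL adj d))"
  have dM: "d \<in> commutant MC" using dX XM by blast
  have eM: "e \<in> commutant MC" unfolding e_def by (intro M M_adj dM)
  have ec: "e \<in> \<L>" by (rule M(2)[OF eM])
  define h where "h = F e"
  have h: "h \<in> Q V" "h \<in> \<L>" unfolding h_def using F_Q[OF eM] Qc by auto
  have hD: "fm h u u = of_real (D d u / 4)" for u
  proof -
   have "fm (adj d) (ap d (sv V u)) (sv V u) = of_real ((norm (ap d (sv V u)))^2)"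
    using adj_works_right[OF dc, of "ap d (sv V u)" "sv V u"] by (simp add: cinner_self)
   moreover have "fm d (ap (adj d) (sv V u)) (sv V u) = of_real ((norm (ap (adj d) (sv V u)))^2)"
    using adj_works(1)[OF dc, of "ap (adj d) (sv V u)" "sv V u"] by (simp add: cinner_self)
   ultimately show ?thesis unfolding h_def F_cinner[OF ec] by (simp add: e_def D_def blinfun.bilinear_simps cinner_simps)
  qed
  have "adj e = e" unfolding e_def by (simp add: adj_scaleR adj_add adj_compose clinear_intros dc adj_adj)
  then have "fm h u w = cinner u (ap h w)" for u w
  proof -
   have "fm e (sv V u) (sv V w) = cnj (fm e (sv V w) (sv V u))"
    using adj_works(1)[OF ec, of "sv V u" "sv V w"] \<open>adj e = e\<close> cinner_commute[of "sv V u"] by simp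
   then have "fm h u w = cnj (fm h w u)" by (simp add: h_def F_cinner ec)
   then show ?thesis by (metis cinner_commute)
  qed
  then have "adj h = h" by (intro adj_unique h) simp
  then have hp: "pos_op h" unfolding pos_op_def using h D_nonneg by (simp add: hD)
  have "h \<noteq> 0"
  proof
   assume "h = 0"
   then have "D d u = 0" using hD[of u] by (simp add: cinner_zero_left)
   then show False using ne by (simp add: d_def z_def)
  qed
  note av = average[OF y1X h(1) hp this]
  have kk: "\<forall>u. D y1 u + Re (fm h u u) \<le> k0 * (norm u)^2" using Dy1 by (simp add: hD)
  obtain c T where c: "0 < c" and T: "T \<in> X" "norm T \<le> norm y1" "F T = Id1" "\<forall>u. D T u \<le> (k0 - c) * (norm u)^2"
   using av Fy1 kk by blast
  have "T \<in> C" using T ny1 unfolding C_def by auto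
  then have "k0 - c \<in> KK" using T(4) unfolding KK_def by blast
  then have "k0 \<le> k0 - c" unfolding k0_def by (rule cInf_lower[OF _ bdd])
  then show False using c by simp
 qed
 then show ?thesis using yX Fy by blast
qed

lemma D_zero: "D y u = 0 ==> ap y (sv V u) = 0 & ap (adj y) (sv V u) = 0"
 using mV by (simp add: D_def sum_power2_eq_zero_iff)

text \<open>For a unitary \<open>a\<close>, vanishing of \<open>D\<close> on the difference of
  \<open>y\<close> and its conjugate says that \<open>y\<close> and \<open>adj y\<close> commute
  with \<open>a\<close> on \<open>1_V\<close>; the unitaries span \<open>Q V\<close>.\<close>

lemma ex_intertwining_unit:
 assumes y0: "y0 \<in> X" "F y0 = Id1"
 shows "\<exists>y\<in>X. F y = Id1 & (\<forall>a\<in>Q V. \<forall>u. ap y (sv V (ap a u)) = ap (\<pi> a) (ap y (sv V u)) &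
  ap (adj y) (sv V (ap a u)) = ap (\<pi> a) (ap (adj y) (sv V u)))"
proof -
 obtain y where y: "y \<in> X" "F y = Id1" and Dz: "!!a u. a \<in> Q V ==> adj a oL a = Id1 ==> a oL adj a = Id1 ==> D (y - (\<pi> a oL y oL \<pi> (adj a))) u = 0"
  using ex_minimiser[OF y0] by blast
 have yc: "y \<in> \<L>" by (rule X_clinear[OF y(1)])
 define P where "P a \<longleftrightarrow> (\<forall>u. ap y (sv V (ap a u)) = ap (\<pi> a) (ap y (sv V u)) &
  ap (adj y) (sv V (ap a u)) = ap (\<pi> a) (ap (adj y) (sv V u)))" for a
 have "P a" if a: "a \<in> Q V" for a
 proof (rule unitaries_span[OF Q_algebra Q_adj Q_scalar _ _ _ a])
  fix a b assume ab: "a \<in> Q V" "b \<in> Q V" "P a" "P b"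
  then show "P (a + b)" by (simp add: P_def pi_add QB blinfun.bilinear_simps sv_add oV)
 next
  fix c a assume a: "a \<in> Q V" "P a"
  then show "P (scalar_op c oL a)"
   by (simp add: P_def pi_compose QB vn_scalar[OF vB] pi_scalar scalar_op_apply sv_scaleC oV clinear_scaleC[OF yc] clinear_scaleC[OF adj_works(2)[OF yc]])
 next
  fix a assume a: "a \<in> Q V" "adj a oL a = Id1" "a oL adj a = Id1"
  have a': "adj a \<in> Q V" "adj (adj a) = a" using Q_adj[OF a(1)] adj_adj[OF Qc[OF a(1)]] by auto
  have adjz: "adj (y - (\<pi> a oL y oL \<pi> (adj a))) = adj y - (\<pi> a oL adj y oL \<pi> (adj a))"
   by (simp add: adj_diff adj_compose clinear_intros pic a a' yc pi_adj QB compose_assoc)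
  have aa: "ap (adj a) (ap a u) = u" for u using a(2) by (metis blinfun_apply_blinfun_compose blinfun_apply_id_blinfun id_apply)
  show "P a" unfolding P_def
  proof
   fix u
   show "ap y (sv V (ap a u)) = ap (\<pi> a) (ap y (sv V u)) &
    ap (adj y) (sv V (ap a u)) = ap (\<pi> a) (ap (adj y) (sv V u))"
    using D_zero[OF Dz[OF a, of "ap a u"]] unfolding adjz by (simp add: blinfun.diff_left pi_V a' aa)
  qed
 qed
 then show ?thesis using y unfolding P_def by blast
qed

end

section \<open>Partitions into right cosets, by inversion\<close>

context td_haar
begin

lemma uminus_compact: "compact A ==> compact (uminus ` A :: 'g set)"
 by (rule compact_continuous_image) (auto intro: cont_grp)
lemma uminus_open: "open A ==> open (uminus ` A :: 'g set)"
proof -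
 assume A: "open A"
 have "uminus ` A = uminus -` A" by force
 then show ?thesis using open_vimage[OF A, of uminus] by (simp add: cont_grp)
qed

lemma compact_open_lstable:
 assumes A: "compact A" "open A" shows "\<exists>V. nsub V & (\<forall>a\<in>A. \<forall>v\<in>V. v + a \<in> A)"
proof -
 obtain V where V: "nsub V" "!!a v. a \<in> uminus ` A ==> v \<in> V ==> a + v \<in> uminus ` A"
  using compact_open_stable[OF uminus_compact[OF A(1)] uminus_open[OF A(2)]] by blast
 have "v + a \<in> A" if "a \<in> A" "v \<in> V" for a v
 proof -
  have "- a + - v \<in> uminus ` A" using V(2)[of "- a" "- v"] that subgroupD(3)[OF nsubD(1)[OF V(1)]] by blast
  then have "- (v + a) \<in> uminus ` A" by (simp add: minus_add)
  then show ?thesis by auto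
 qed
 then show ?thesis using V(1) by blast
qed

lemma rcoset_partition:
 assumes A: "compact A" and V: "nsub V" and AV: "!!a v. a \<in> A ==> v \<in> V ==> v + a \<in> A"
 shows "\<exists>I. finite I & I <= A & A = (\<Union>t\<in>I. rc V t) & (\<forall>s\<in>I. \<forall>t\<in>I. s \<noteq> t --> rc V s \<inter> rc V t = {})"
proof -
 have neg: "uminus ` lc g V = rc V (- g)" for g
 proof -
  have "x \<in> uminus ` lc g V \<longleftrightarrow> - x \<in> lc g V" for x by force
  then show ?thesis using subgroupD(8)[OF nsubD(1)[OF V]] by (auto simp: lc_iff rc_iff) (metis minus_add minus_minus diff_conv_add_uminus)+
 qed
 have stable: "a + v \<in> uminus ` A" if "a \<in> uminus ` A" "v \<in> V" for a v
 proof -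
  have "- v + - a \<in> A" using AV[of "- a" "- v"] that subgroupD(3)[OF nsubD(1)[OF V]] by auto
  then have "- (a + v) \<in> A" by (simp add: minus_add)
  then show ?thesis by force
 qed
 have "\<exists>F. finite F & F <= uminus ` A & uminus ` A = (\<Union>g\<in>F. lc g V) & (\<forall>g\<in>F. \<forall>h\<in>F. g \<noteq> h --> lc g V \<inter> lc h V = {})"
  by (rule coset_partition[OF uminus_compact[OF A] V stable])
 then obtain I where I: "finite I" "I <= uminus ` A" "uminus ` A = (\<Union>g\<in>I. lc g V)" "\<forall>g\<in>I. \<forall>h\<in>I. g \<noteq> h --> lc g V \<inter> lc h V = {}"
  by (elim exE conjE)
 have "A = uminus ` (uminus ` A)" by (simp add: image_image)
 also have "... = (\<Union>g\<in>I. rc V (- g))" unfolding I(3) image_UN neg ..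
 finally have "A = (\<Union>t\<in>uminus ` I. rc V t)" by simp
 moreover have "rc V (- s) \<inter> rc V (- t) = {}" if "s \<in> I" "t \<in> I" "s \<noteq> t" for s t
  using I(4) that unfolding neg[symmetric] by (simp add: image_Int[symmetric] inj_on_def)
 moreover have "uminus ` I <= A" using I(2) by fastforce
 ultimately show ?thesis using I(1) by (intro exI[of _ "uminus ` I"]) simp
qed

end

section \<open>The minimal element fixes step functions\<close>

context bimodule
begin

text \<open>The coefficients of \<open>y 1\<^sub>V\<close> on the cosets \<open>gW\<close> intertwine \<open>\<alpha>\<^bsub>g\<^sup>-\<^sup>1\<^esub>\<close>, so they vanish off \<open>V\<close> by proper
 outerness and the Galois property, and on \<open>V\<close> they are one and the same scalar.\<close>

lemma intertwining_unit_fixes: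
 assumes y: "y \<in> commutant MC" and Fy: "F y = Id1"
  and int: "!!a u. a \<in> Q V ==> ap y (sv V (ap a u)) = ap (\<pi> a) (ap y (sv V u))"
 shows "ap y (sv V u) = sv V u"
proof -
 have yc: "y \<in> \<L>" by (rule M(2)[OF y])
 have Vs: "additive_subgroup V" by (rule nsubD(1)[OF V])
 have coef: "cf y (lc g W) V \<in> B & (\<forall>a\<in>Q V. cf y (lc g W) V oL a = \<alpha> (- g) a oL cf y (lc g W) V)"
  if W: "nsub W" "!!w. w \<in> W ==> g + w - g \<in> V" for g W
 proof -
  have oW: "compact (lc g W)" "open (lc g W)" by (intro compact_lc open_lc nsubD[OF W(1)])+
  note c = cf(2)[OF yc oV oW]
  have "cf y (lc g W) V oL a = \<alpha> (- g) a oL cf y (lc g W) V" if a: "a \<in> Q V" for a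
  proof (rule op_eq_cinnerI)
   fix u p
   have aB: "a \<in> B" "adj a \<in> B" "adj a \<in> Q V" using QB Q_adj a by auto
   \<comment> \<open>Conjugation by \<open>g\<close> carries \<open>W\<close> into \<open>V\<close>,
     whose elements fix \<open>a\<close>; hence \<open>\<pi> (adj a)\<close> is constant on the
     coset.\<close>
   have act_eq: "\<alpha> (- t) (adj a) = \<alpha> (- g) (adj a)" if t: "t \<in> lc g W" for t
   proof -
    define w where "w = - g + t"
    have w: "- w \<in> W" using t subgroupD(3)[OF nsubD(1)[OF W(1)]] by (simp add: w_def lc_iff)
    have "- t = - g + (g + - w - g)" by (simp add: w_def minus_add add.assoc diff_conv_add_uminus del: add_uminus_conv_diff)
    then have "\<alpha> (- t) (adj a) = \<alpha> (- g) (\<alpha> (g + - w - g) (adj a))" using act_add[OF aB(2)] by simp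
    also have "\<alpha> (g + - w - g) (adj a) = adj a" using W(2)[OF w] aB(3) by (simp add: Q_iff)
    finally show ?thesis .
   qed
   have "fm (cf y (lc g W) V oL a) u p = fm (\<pi> a) (ap y (sv V u)) (sv (lc g W) p)"
    by (simp add: c int a)
   also have "... = fm y (sv V u) (ap (\<pi> (adj a)) (sv (lc g W) p))"
    using adj_works(1)[OF pi(1)[OF aB(1)]] by (simp add: pi_adj aB)
   also have "ap (\<pi> (adj a)) (sv (lc g W) p) = sv (lc g W) (ap (adj (\<alpha> (- g) a)) p)"
    using pi_sv[OF aB(2) oW act_eq] by (simp add: act_simps aB)
   also have "fm y (sv V u) (sv (lc g W) (ap (adj (\<alpha> (- g) a)) p)) = fm (\<alpha> (- g) a oL cf y (lc g W) V) u p"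
    using adj_works(1)[OF Balg(2)[OF act_B[OF aB(1)]]] by (simp add: c[symmetric])
   finally show "fm (cf y (lc g W) V oL a) u p = fm (\<alpha> (- g) a oL cf y (lc g W) V) u p" .
  qed
  then show ?thesis using cf_B[OF y oV oW] by blast
 qed
 have scalar: "\<exists>z. cf y (lc g W) V = scalar_op z" if W: "nsub W" "!!w. w \<in> W ==> g + w - g \<in> V" and g: "g \<in> K" for g W
 proof (rule scalarI[OF nsub_K])
  show "cf y (lc g W) V \<in> B" using coef[OF W] by blast
  show "cf y (lc g W) V oL a = a oL cf y (lc g W) V" if a: "a \<in> Q K" for a
   using coef[OF W] Q_antimono[OF nsubD(3)[OF V]] a Q_sub[OF K_sub a g] by auto
 qed
 \<comment> \<open>A nonzero coefficient first forces \<open>g\<close> into \<open>K\<close>. There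
   it commutes with \<open>Q K\<close> and is a scalar, and a nonzero scalar intertwiner makes
   \<open>\<alpha> (- g)\<close> fix \<open>Q V\<close>.\<close>
 have off: "cf y (lc g W) V = 0" if W: "nsub W" "!!w. w \<in> W ==> g + w - g \<in> V" and g: "g \<notin> V" for g W
 proof (rule ccontr)
  let ?c = "cf y (lc g W) V"
  assume c0: "?c \<noteq> 0"
  have cB: "?c \<in> B" and ci: "!!a. a \<in> Q V ==> ?c oL a = \<alpha> (- g) a oL ?c" using coef[OF W] by auto
  have "\<forall>a\<in>fixed_algebra \<alpha> K B. \<alpha> (- g) a oL ?c = ?c oL a" using ci Q_antimono[OF nsubD(3)[OF V]] by auto
  then have "- g \<in> K" using outer cB c0 unfolding properly_outer_relative_def by blast
  then have gK: "g \<in> K" using subgroupD(8)[OF K_sub] by blast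
  obtain z where z: "?c = scalar_op z" using scalar[OF W gK] by blast
  have z0: "z \<noteq> 0" using c0 z by (auto intro!: blinfun_eqI simp: scalar_op_apply scaleC_zero_left)
  have "\<alpha> (- g) a = a" if a: "a \<in> Q V" for a
  proof (rule blinfun_eqI)
   fix u
   have "ap (?c oL a) u = ap (\<alpha> (- g) a oL ?c) u" using ci[OF a] by simp
   then have "z *\<^sub>C ap a u = z *\<^sub>C ap (\<alpha> (- g) a) u"
    by (simp add: z scalar_op_apply clinear_scaleC[OF Balg(2)[OF act_B[OF QB[OF a]]]])
   then have "(1 / z) *\<^sub>C (z *\<^sub>C ap a u) = (1 / z) *\<^sub>C (z *\<^sub>C ap (\<alpha> (- g) a) u)" by simp
   then show "ap (\<alpha> (- g) a) u = ap a u" using z0 by (simp add: scaleC_scaleC scaleC_one)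
  qed
  then have "- g \<in> V" by (rule galois[OF V \<open>- g \<in> K\<close>])
  then show False using g subgroupD(8)[OF Vs] by blast
 qed
 \<comment> \<open>Right translation by \<open>V\<close> carries one coefficient to all cosets of
   \<open>W\<close> in \<open>V\<close>. The normalisation of \<open>F y\<close> makes them add up
   to \<open>m V\<close>, so each equals \<open>m W\<close>.\<close>
 have on: "cf y (lc g W) V = scalar_op (of_real (m W))" if W: "nsub W" "W <= V" and g: "g \<in> V" for g W
 proof -
  have oW: "compact W" "open W" by (rule nsubD[OF W(1)])+
  have W0: "0 + w - 0 \<in> V" if "w \<in> W" for w using W(2) that by auto
  obtain z where z: "cf y W V = scalar_op z" using scalar[OF W(1) W0 subgroupD(1)[OF K_sub]] by (auto simp: lc_0)
  have same: "cf y (lc h W) V = scalar_op z" if h: "h \<in> V" for h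
  proof -
   have hK: "h \<in> K" using h nsubD(3)[OF V] by blast
   show ?thesis using cf_translate[OF y oV oW, of h]
    by (simp add: nsub_rc[OF W(1) hK] rc_subgroup_mem[OF Vs h] \<Delta>_K[OF hK] z act_scalar)
  qed
  have VW: "v + w \<in> V" if "v \<in> V" "w \<in> W" for v w using that W(2) subgroupD(2)[OF Vs] by blast
  obtain I where I: "finite I" "I <= V" "V = (\<Union>h\<in>I. lc h W)" "\<forall>g\<in>I. \<forall>h\<in>I. g \<noteq> h --> lc g W \<inter> lc h W = {}"
   using coset_partition[OF oV(1) W(1) VW] by blast
  have mVI: "m V = real (card I) * m W" by (rule m_partition_lc(1)[OF I(1,3,4) oW(1)])
  obtain p :: 'h where p: "p \<noteq> 0" using ex_nonzero by blast
  have "sv V p = (\<Sum>h\<in>I. sv (lc h W) p)" using sv_UN[OF I(1) compact_lc[OF oW(1)] open_lc[OF oW(2)] I(4)] I(3) by simp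
  then have "fm y (sv V p) (sv V p) = (\<Sum>h\<in>I. fm y (sv V p) (sv (lc h W) p))"
   by (metis cinner_sum_right)
  also have "... = (\<Sum>h\<in>I. z * cinner p p)"
  proof (rule sum.cong[OF refl])
   fix h assume "h \<in> I"
   then have "h \<in> V" using I(2) by blast
   then show "fm y (sv V p) (sv (lc h W) p) = z * cinner p p"
    using cf(2)[OF yc oV compact_lc[OF oW(1)] open_lc[OF oW(2)], of h p p] by (simp add: same scalar_op_apply cinner_scaleC_left)
  qed
  finally have "fm (F y) p p * of_real (m V) = of_nat (card I) * z * cinner p p"
   using mV by (simp add: F_cinner yc)
  then have "of_real (m V) = of_nat (card I) * z" using p by (simp add: Fy cinner_self)
  then have "of_nat (card I) * complex_of_real (m W) = of_nat (card I) * z" by (simp add: mVI)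
  moreover have "card I \<noteq> 0" using mVI mV by (intro notI) simp
  ultimately have "z = of_real (m W)" by simp
  then show ?thesis using same[OF g] by simp
 qed
 have "ap y (sv V u) - sv V u = 0"
 proof (rule step_total)
  fix g
  \<comment> \<open>One subgroup must serve the whole coset \<open>gK\<close>, so that
    \<open>off\<close> applies at each of its points.\<close>
  obtain U where U: "nsub U" "!!x v. x \<in> lc g K ==> v \<in> U ==> x + v - x \<in> V"
   using nsub_conj_compact[OF compact_lc[OF K_compact] oV(2) nsubD(7)[OF V], of g] by blast
  have "cinner (ap y (sv V u) - sv V u) (sv (lc (g + k) W) p) = 0"
   if k: "k \<in> K" and W: "nsub W" "W <= U \<inter> V" for k W p
  proof -
   let ?x = "g + k"
   have oW: "compact (lc ?x W)" "open (lc ?x W)" by (intro compact_lc open_lc nsubD[OF W(1)])+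
   have "?x \<in> lc g K" using k by (simp add: lc_iff)
   then have xW: "?x + w - ?x \<in> V" if "w \<in> W" for w using U(2) that W(2) by blast
   have 1: "fm y (sv V u) (sv (lc ?x W) p) = fm (cf y (lc ?x W) V) u p"
    by (rule cf(2)[OF yc oV oW, symmetric])
   show ?thesis
   proof (cases "?x \<in> V")
    case True
    have "lc ?x W <= V"
    proof
     fix z assume "z \<in> lc ?x W"
     then have "- ?x + z \<in> V" using W(2) by (auto simp: lc_iff)
     then show "z \<in> V" using True subgroupD(2)[OF Vs True, of "- ?x + z"] by (simp add: add.assoc[symmetric])
    qed
    then have "V \<inter> lc ?x W = lc ?x W" by blast
    then show ?thesis using on[OF W(1) _ True] W(2) m_lc[OF borel_haar(3)[OF nsubD(6)[OF W(1)]], of ?x]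
     by (simp add: cinner_diff_left 1 cinner_sv oV oW scalar_op_apply cinner_scaleC_left)
   next
    case False
    have "V \<inter> lc ?x W = {}"
    proof (rule ccontr)
     assume "V \<inter> lc ?x W \<noteq> {}"
     then obtain z where z0: "z \<in> V" "- ?x + z \<in> W" by (auto simp: lc_iff)
     then have z: "z \<in> V" "- ?x + z \<in> V" using W(2) by blast+
     then have "- ?x \<in> V" using subgroupD(7)[OF Vs, of z "- ?x"] by blast
     then show False using False subgroupD(8)[OF Vs] by blast
    qed
    then show ?thesis using off[OF W(1) xW False] by (simp add: cinner_diff_left 1 cinner_sv oV oW m_empty cinner_zero_left)
   qed
  qed
  then show "\<exists>V0. nsub V0 & (\<forall>k\<in>K. \<forall>W. nsub W --> W <= V0 --> (\<forall>p. cinner (ap y (sv V u) - sv V u) (sv (lc (g + k) W) p) = 0))"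
   using nsub_Int[OF U(1) V] by blast
 qed
 then show ?thesis by simp
qed

text \<open>The coefficients of \<open>y\<close> out of \<open>V\<close> are those of the identity.
  Both operators lie in the crossed product, so covariance carries the equality to
  \<open>V t\<close>.\<close>

lemma fixes_translates:
 assumes y: "y \<in> commutant MC" and fx: "!!u. ap y (sv V u) = sv V u"
 shows "ap y (sv (rc V t) u) = sv (rc V t) u"
proof -
 have yc: "y \<in> \<L>" by (rule M(2)[OF y])
 have oVt: "compact (rc V t)" "open (rc V t)" by (intro compact_rc open_rc oV)+
 have "ap y (sv (rc V t) u) - sv (rc V t) u = 0"
 proof (rule sv_orth)
  fix A :: "'g set" and v :: 'h assume A: "compact A" "open A"
  define A' where "A' = rc A (- t)"
  have A': "compact A'" "open A'" "A = rc A' t" unfolding A'_def by (auto intro: compact_rc open_rc A simp: rc_rc rc_0)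
  have idM: "Id1 \<in> commutant MC" by (rule M(3))
  have "cf y A' V = cf Id1 A' V"
   by (rule cf_eqI[OF yc oV A'(1,2)]) (simp add: cf(2)[OF clinear_id oV A'(1,2)] fx)
  then have "cf y A (rc V t) = cf Id1 A (rc V t)"
   using cf_translate[OF y oV A'(1,2), of t] cf_translate[OF idM oV A'(1,2), of t] A'(3) by simp
  then have "fm y (sv (rc V t) u) (sv A v) = cinner (sv (rc V t) u) (sv A v)"
   using cf(2)[OF yc oVt A, of u v] cf(2)[OF clinear_id oVt A, of u v] by simp
  then show "cinner (ap y (sv (rc V t) u) - sv (rc V t) u) (sv A v) = 0" by (simp add: cinner_diff_left)
 qed
 then show ?thesis by simp
qed

text \<open>The minimal element and its adjoint satisfy the same normalisation and the same
  commutation on \<open>1_V\<close>, so both fix the step functions.\<close>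

lemma ex_fixing:
 assumes x: "x \<in> X" and ne: "PA V oL x oL PA V \<noteq> 0"
 shows "\<exists>y\<in>X. \<forall>t u. ap y (sv (rc V t) u) = sv (rc V t) u & ap (adj y) (sv (rc V t) u) = sv (rc V t) u"
proof -
 obtain y0 where y0: "y0 \<in> X" "F y0 = Id1" using ex_unit[OF x ne] by blast
 obtain y where y: "y \<in> X" "F y = Id1"
  and int: "!!a u. a \<in> Q V ==> ap y (sv V (ap a u)) = ap (\<pi> a) (ap y (sv V u))"
   "!!a u. a \<in> Q V ==> ap (adj y) (sv V (ap a u)) = ap (\<pi> a) (ap (adj y) (sv V u))"
  using ex_intertwining_unit[OF y0] by blast
 have yM: "y \<in> commutant MC" using y XM by blast
 have yc: "y \<in> \<L>" by (rule M(2)[OF yM])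
 have Fa: "F (adj y) = Id1"
 proof (rule op_eq_cinnerI)
  fix u v
  have "fm (adj y) (sv V u) (sv V v) = cnj (fm y (sv V v) (sv V u))"
   using adj_works(1)[OF yc, of "sv V v" "sv V u"] cinner_commute[of "ap (adj y) (sv V u)"] by simp
  then have "fm (F (adj y)) u v = cnj (fm (F y) v u)" by (simp add: F_cinner yc adj_works(2))
  also have "... = cinner u v" by (simp add: y(2) cinner_commute[of u])
  finally show "fm (F (adj y)) u v = fm Id1 u v" by simp
 qed
 note fx = intertwining_unit_fixes[OF yM y(2) int(1)] and fxa = intertwining_unit_fixes[OF M_adj[OF yM] Fa int(2)]
 show ?thesis
  using y(1) fixes_translates[OF yM fx] fixes_translates[OF M_adj[OF yM] fxa] by blast
qed

end

section \<open>Which translations belong to an intermediate algebra\<close>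

context crossed_min
begin

text \<open>For \<open>T\<close> in the commutant of \<open>N\<close>, the operators
  \<open>\<Lambda> s oL T\<close> and \<open>T oL \<Lambda> s\<close> are compared on two step
  vectors at a time. For small \<open>V\<close> there is a \<open>y\<close> with
  \<open>\<Lambda> s oL y\<close> in \<open>N\<close> such that \<open>y\<close> and
  \<open>adj y\<close> fix both relevant step vectors; commuting \<open>T\<close> with
  \<open>\<Lambda> s oL y\<close> then gives the equality.\<close>

lemma lam_mem:
 assumes N: "von_neumann_algebra N" "\<pi> ` B <= N" "N <= commutant MC"
  and ne: "!!V. nsub V ==> \<exists>x\<in>N. PA V oL (\<Lambda> (- s) oL x) oL PA V \<noteq> 0"
 shows "\<Lambda> s \<in> N"
proof (rule vn_memI[OF N(1) lam(1)])
 note Nalg = op_algebraD[OF vn_op_algebra[OF N(1)]]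
 define X where "X = {y \<in> \<L>. \<Lambda> s oL y \<in> N}"
 have ss: "\<Lambda> (- s) oL (\<Lambda> s oL y) = y" "\<Lambda> s oL (\<Lambda> (- s) oL y) = y" for y
  by (simp_all add: compose_assoc[symmetric] lam_add[symmetric] lam_zero compose_id_left)
 have bim: "bimodule K \<alpha> B V X" if V: "nsub V" for V
 proof
  show "nsub V" by (rule V)
  show "X <= commutant MC"
  proof
   fix y assume "y \<in> X"
   then have "\<Lambda> (- s) oL (\<Lambda> s oL y) \<in> commutant MC" using N(3) by (intro M(5)[OF lam_M, of "\<Lambda> s oL y"]) (auto simp: X_def)
   then show "y \<in> commutant MC" by (simp only: ss)
  qed
  show "x + y \<in> X" if "x \<in> X" "y \<in> X" for x y using that by (simp add: X_def clinear_add compose_add_right Nalg)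
  show "r *\<^sub>R x \<in> X" if "x \<in> X" for r x using that by (simp add: X_def clinear_scaleR compose_scaleR_right Nalg)
  show "\<pi> a oL x oL \<pi> c \<in> X" if a: "a \<in> B" and c: "c \<in> B" and x: "x \<in> X" for a c x
  proof -
   have "\<Lambda> s oL (\<pi> a oL x oL \<pi> c) = \<pi> (\<alpha> s a) oL ((\<Lambda> s oL x) oL \<pi> c)"
    using lam_pi[OF a, of s] by (metis compose_assoc)
   moreover have "\<pi> (\<alpha> s a) \<in> N" "\<pi> c \<in> N" using N(2) a c act_B by auto
   ultimately have "\<Lambda> s oL (\<pi> a oL x oL \<pi> c) \<in> N" using x by (simp add: X_def Nalg(5))
   then show ?thesis using x a c by (simp add: X_def clinear_compose pi)
  qed
  show "T \<in> X" if S: "S <= X" and T: "T \<in> wot_closure S" "T \<in> \<L>" for S T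
  proof -
   have "\<Lambda> s oL T \<in> wot_closure ((\<lambda>y. \<Lambda> s oL y) ` S)"
    unfolding wot_closure_def
   proof (intro CollectI allI impI)
    fix E :: "(('g, 'h) l2 \<times> ('g, 'h) l2) set" and e :: real assume E: "finite E" "0 < e"
    have fin: "finite ((\<lambda>(u, w). (u, ap (adj (\<Lambda> s)) w)) ` E)" using E(1) by simp
    obtain W where W: "W \<in> S" "\<forall>(u, w)\<in>(\<lambda>(u, w). (u, ap (adj (\<Lambda> s)) w)) ` E. norm (fm W u w - fm T u w) < e"
     using wot_closureD[OF T(1) fin E(2)] by blast
    have "norm (fm (\<Lambda> s oL W) u w - fm (\<Lambda> s oL T) u w) < e" if "(u, w) \<in> E" for u w
     using W(2) that by (auto simp: adj_works(1)[OF lam(1)])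
    then show "\<exists>T'\<in>(\<lambda>y. \<Lambda> s oL y) ` S. \<forall>(u, w)\<in>E. norm (fm T' u w - fm (\<Lambda> s oL T) u w) < e"
     using W(1) by (intro bexI[of _ "\<Lambda> s oL W"]) auto
   qed
   then have "\<Lambda> s oL T \<in> N" by (rule vn_wot_closure[OF N(1), rotated]) (use S T in \<open>auto simp: X_def intro: clinear_compose lam\<close>)
   then show ?thesis using T by (simp add: X_def)
  qed
 qed
 fix T assume T: "T \<in> commutant N"
 have Tc: "T \<in> \<L>" by (rule commutant_clinear[OF T])
 show "\<Lambda> s oL T = T oL \<Lambda> s"
 proof (rule l2_op_eq_stepI)
  fix A :: "'g set" and p :: 'h assume A: "compact A" "open A"
  have "ap (\<Lambda> s oL T) (sv A p) - ap (T oL \<Lambda> s) (sv A p) = 0"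
  proof (rule sv_orth)
   fix C :: "'g set" and q :: 'h assume C: "compact C" "open C"
   \<comment> \<open>The adjoint of \<open>\<Lambda> s\<close> moves the test vector on
     \<open>C\<close> to \<open>C'\<close>. Hence \<open>V\<close> must be so small that
     \<open>A\<close> and \<open>C'\<close> are unions of right cosets of \<open>V\<close>.\<close>
   define C' where "C' = lc (- s) C"
   have C': "compact C'" "open C'" unfolding C'_def by (intro compact_lc open_lc C)+
   obtain V1 where V1: "nsub V1" "!!a v. a \<in> A ==> v \<in> V1 ==> v + a \<in> A" using compact_open_lstable[OF A] by blast
   obtain V2 where V2: "nsub V2" "!!a v. a \<in> C' ==> v \<in> V2 ==> v + a \<in> C'" using compact_open_lstable[OF C'] by blast
   define V where "V = V1 \<inter> V2"
   have V: "nsub V" unfolding V_def by (rule nsub_Int[OF V1(1) V2(1)])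
   interpret bimodule K \<alpha> B V X by (rule bim[OF V])
   obtain x where x: "x \<in> N" "PA V oL (\<Lambda> (- s) oL x) oL PA V \<noteq> 0" using ne[OF V] by blast
   have "\<Lambda> (- s) oL x \<in> X" using x(1) Nalg(2) by (auto simp: X_def ss intro!: clinear_compose lam)
   then obtain y where y: "y \<in> X" "!!t p. ap y (sv (rc V t) p) = sv (rc V t) p" "!!t p. ap (adj y) (sv (rc V t) p) = sv (rc V t) p"
    using ex_fixing[OF _ x(2)] by blast
   have yc: "y \<in> \<L>" by (rule X_clinear[OF y(1)])
   have fixs: "ap z (sv D k) = sv D k"
    if D: "compact D" and DV: "!!a v. a \<in> D ==> v \<in> V ==> v + a \<in> D" and z: "!!t p. ap z (sv (rc V t) p) = sv (rc V t) p" for D z k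
   proof -
    obtain I where I: "finite I" "D = (\<Union>t\<in>I. rc V t)" "\<forall>s\<in>I. \<forall>t\<in>I. s \<noteq> t --> rc V s \<inter> rc V t = {}"
     using rcoset_partition[OF D V DV] by blast
    have "sv D k = (\<Sum>t\<in>I. sv (rc V t) k)" using sv_UN[OF I(1) compact_rc[OF oV(1)] open_rc[OF oV(2)] I(3)] I(2) by simp
    then show ?thesis by (simp add: blinfun.sum_right z)
   qed
   have fA: "ap y (sv A p) = sv A p" by (rule fixs[OF A(1) _ y(2)]) (use V1(2) in \<open>auto simp: V_def\<close>)
   have fC: "ap (adj y) (sv C' q) = sv C' q" by (rule fixs[OF C'(1) _ y(3)]) (use V2(2) in \<open>auto simp: V_def\<close>)
   have lC: "ap (\<Lambda> (- s)) (sv C q) = sv C' q" by (simp add: lam_sv C C'_def)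
   have "ap (T oL \<Lambda> s) (sv A p) = ap (T oL (\<Lambda> s oL y)) (sv A p)" by (simp add: fA)
   also have "T oL (\<Lambda> s oL y) = (\<Lambda> s oL y) oL T" by (rule commutantD[OF T]) (use y(1) in \<open>simp add: X_def\<close>)
   finally have "fm (T oL \<Lambda> s) (sv A p) (sv C q) = fm (\<Lambda> s) (ap y (ap T (sv A p))) (sv C q)" by simp
   also have "... = fm T (sv A p) (ap (adj y) (ap (adj (\<Lambda> s)) (sv C q)))"
    by (simp only: adj_works(1)[OF lam(1)] adj_works(1)[OF yc])
   also have "ap (adj y) (ap (adj (\<Lambda> s)) (sv C q)) = ap (adj (\<Lambda> s)) (sv C q)"
    by (simp add: lam_adj lC fC)
   also have "fm T (sv A p) (ap (adj (\<Lambda> s)) (sv C q)) = fm (\<Lambda> s oL T) (sv A p) (sv C q)"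
    by (simp add: adj_works(1)[OF lam(1)])
   finally show "cinner (ap (\<Lambda> s oL T) (sv A p) - ap (T oL \<Lambda> s) (sv A p)) (sv C q) = 0" by (simp add: cinner_diff_left)
  qed
  then show "ap (\<Lambda> s oL T) (sv A p) = ap (T oL \<Lambda> s) (sv A p)" by simp
 qed (intro clinear_intros lam Tc)+
qed

end

section \<open>Supports of operators\<close>

context td_haar
begin

lemma rc_sub: "A <= C ==> open A ==> closed A ==> open C ==> closed C ==> PA C oL PA A = (PA A :: ('g, 'h::complex_hilbert_space) l2 op)"
 "A <= C ==> open A ==> closed A ==> open C ==> closed C ==> PA A oL PA C = (PA A :: ('g, 'h) l2 op)"
 by (simp_all add: PA_compose Int_absorb1 Int_absorb2)

lemma PA_zero_UN:
 fixes T :: "('g, 'h::complex_hilbert_space) l2 op"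
 assumes "finite I" "!!i. i \<in> I ==> open (A i)" "!!i. i \<in> I ==> closed (A i)" "!!i. i \<in> I ==> T oL PA (A i) = 0"
 shows "T oL PA (\<Union>i\<in>I. A i) = 0"
 using assms
proof (induction I rule: finite_induct)
 case empty
 then show ?case by (simp add: PA_empty compose_zero_right)
next
 case (insert i I)
 define U where "U = (\<Union>i\<in>I. A i)"
 have U: "open U" "closed U" unfolding U_def using insert by (auto intro: open_UN closed_UN)
 have A: "open (A i)" "closed (A i)" using insert by auto
 have T: "T oL PA U = 0" unfolding U_def by (rule insert.IH) (use insert in auto)
 have "PA U oL PA (- A i) = (PA (U \<inter> - A i) :: ('g, 'h) l2 op)" using U A by (intro PA_compose) auto
 then have "T oL PA (U \<inter> - A i) = T oL PA U oL PA (- A i)" by (simp only: compose_assoc)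
 then have z: "T oL PA (U \<inter> - A i) = 0" by (simp add: T compose_zero_left)
 have "A i \<union> U = A i \<union> (U \<inter> - A i)" by blast
 also have "PA ... = PA (A i) + (PA (U \<inter> - A i) :: ('g, 'h) l2 op)"
  by (rule PA_Un) (use U A in \<open>auto intro!: open_Int closed_Int\<close>)
 finally have "T oL PA (A i \<union> U) = (T oL PA (A i)) + (T oL PA (U \<inter> - A i))" by (simp add: compose_add_right)
 also have "... = 0" using insert.prems(3)[of i] z by simp
 finally show ?case by (simp add: U_def)
qed

lemma adj_eq_zero: "T \<in> \<L> ==> adj T = 0 ==> T = 0"
 using adj_adj[of T] by (simp add: adj_zero)

text \<open>Vanishing is a local matter: supports are studied by finding, around each point of a
  compact set, a clopen set on which the operator is zero.\<close>

lemma PA_zero_cover: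
 fixes T :: "('g, 'h::complex_hilbert_space) l2 op"
 assumes C: "compact C" "open C" and A: "!!c. c \<in> C ==> open (A c) & closed (A c) & c \<in> A c & T oL PA (A c) = 0"
 shows "T oL PA C = 0"
proof -
 have op: "open (A c)" if "c \<in> C" for c using A[OF that] by blast
 have cov: "C <= (\<Union>c\<in>C. A c)" using A by blast
 obtain I where I: "I <= C" "finite I" "C <= (\<Union>c\<in>I. A c)" by (rule compactE_image[OF C(1) op cov])
 have oA: "open (A i)" "closed (A i)" "T oL PA (A i) = 0" if "i \<in> I" for i using A I(1) that by blast+
 have U: "open (\<Union>c\<in>I. A c)" "closed (\<Union>c\<in>I. A c)" using oA I(2) by (auto intro: open_UN closed_UN)
 have "T oL PA C = (T oL PA (\<Union>c\<in>I. A c)) oL PA C"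
  by (simp only: compose_assoc rc_sub(1)[OF I(3) C(2) compact_imp_closed[OF C(1)] U])
 then show ?thesis by (simp add: PA_zero_UN[OF I(2) oA] compose_zero_left)
qed

lemma PA_zero_cover_left:
 fixes T :: "('g, 'h::complex_hilbert_space) l2 op"
 assumes C: "compact C" "open C" and T: "T \<in> \<L>"
  and A: "!!c. c \<in> C ==> open (A c) & closed (A c) & c \<in> A c & PA (A c) oL T = 0"
 shows "PA C oL T = 0"
proof (rule adj_eq_zero)
 have cC: "closed C" by (rule compact_imp_closed[OF C(1)])
 show "PA C oL T \<in> \<L>" by (intro clinear_intros PA C cC T)
 have "adj T oL PA C = 0"
 proof (rule PA_zero_cover[OF C])
  fix c assume c: "c \<in> C"
  then have o: "open (A c)" "closed (A c)" and z: "PA (A c) oL T = 0" using A by auto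
  have "adj T oL PA (A c) = adj (PA (A c) oL T)" unfolding adj_compose[OF PA(1)[OF o] T] PA_adj[OF o] ..
  then show "open (A c) & closed (A c) & c \<in> A c & adj T oL PA (A c) = 0" using A[OF c] by (simp add: z adj_zero)
 qed
 then show "adj (PA C oL T) = 0" using C cC T by (simp add: adj_compose PA PA_adj)
qed

lemma clopen_cosets: "compact (A::'g set) ==> open A ==> open (lc g A) & closed (lc g A) & open (rc A t) & closed (rc A t) & open (rc (lc g A) t) & closed (rc (lc g A) t)
 & compact (lc g A) & compact (rc A t) & compact (rc (lc g A) t)"
 by (intro conjI open_lc open_rc compact_imp_closed compact_lc compact_rc)

lemma lam_norm: "norm (ap (lambda_op g) v) = norm (v :: ('g, 'h::complex_hilbert_space) l2)"
 by (rule isometry_norm[OF lam(1)]) (simp add: lam_adj lam_add[symmetric] lam_zero)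

text \<open>The vectors moved little by small subgroups form a closed subspace. It contains the step
  vectors, which a small enough subgroup does not move at all.\<close>

lemma lam_cont: "continuous_on UNIV (\<lambda>g. ap (lambda_op g) (q :: ('g, 'h::complex_hilbert_space) l2))"
proof -
 define S where "S = {q :: ('g, 'h) l2. \<forall>e>0. \<exists>W. nsub W & (\<forall>w\<in>W. norm (ap (lambda_op w) q - q) \<le> e)}"
 have "csubspace S"
  unfolding csubspace_def
 proof (intro conjI ballI allI)
  show "0 \<in> S" unfolding S_def using nsub_K by auto
  fix x y assume xy: "x \<in> S" "y \<in> S"
  show "x + y \<in> S"
   unfolding S_def
  proof (intro CollectI allI impI)
   fix e :: real assume "0 < e"
   then have e: "0 < e / 2" by simp
   obtain W1 where W1: "nsub W1" "\<forall>w\<in>W1. norm (ap (lambda_op w) x - x) \<le> e / 2" using xy(1) e unfolding S_def by blast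
   obtain W2 where W2: "nsub W2" "\<forall>w\<in>W2. norm (ap (lambda_op w) y - y) \<le> e / 2" using xy(2) e unfolding S_def by blast
   have "norm (ap (lambda_op w) (x + y) - (x + y)) \<le> e" if "w \<in> W1 \<inter> W2" for w
   proof -
    have "ap (lambda_op w) (x + y) - (x + y) = (ap (lambda_op w) x - x) + (ap (lambda_op w) y - y)" by (simp add: blinfun.add_right)
    also have "norm ... \<le> e / 2 + e / 2" by (intro norm_triangle_mono) (use W1 W2 that in auto)
    finally show ?thesis by simp
   qed
   then show "\<exists>W. nsub W & (\<forall>w\<in>W. norm (ap (lambda_op w) (x + y) - (x + y)) \<le> e)" using nsub_Int[OF W1(1) W2(1)] by blast
  qed
 next
  fix c and x :: "('g, 'h) l2" assume x: "x \<in> S"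
  show "c *\<^sub>C x \<in> S"
   unfolding S_def
  proof (intro CollectI allI impI)
   fix e :: real assume "0 < e"
   have p: "0 < norm c + 1" by (simp add: add_nonneg_pos)
   then have e: "0 < e / (norm c + 1)" using \<open>0 < e\<close> by simp
   obtain W where W: "nsub W" "\<forall>w\<in>W. norm (ap (lambda_op w) x - x) \<le> e / (norm c + 1)" using x e unfolding S_def by blast
   have "norm (ap (lambda_op w) (c *\<^sub>C x) - c *\<^sub>C x) \<le> e" if "w \<in> W" for w
   proof -
    have "norm (ap (lambda_op w) (c *\<^sub>C x) - c *\<^sub>C x) = norm c * norm (ap (lambda_op w) x - x)"
     by (simp add: clinear_scaleC[OF lam(1)] norm_scaleC flip: scaleC_diff_right)
    also have "... \<le> (norm c + 1) * (e / (norm c + 1))" using W(2) that by (intro mult_mono) auto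
    finally show ?thesis using p by simp
   qed
   then show "\<exists>W. nsub W & (\<forall>w\<in>W. norm (ap (lambda_op w) (c *\<^sub>C x) - c *\<^sub>C x) \<le> e)" using W(1) by blast
  qed
 qed
 moreover have "closed S"
 proof -
  have "closure S <= S"
  proof
   fix x assume x: "x \<in> closure S"
   show "x \<in> S" unfolding S_def
   proof (intro CollectI allI impI)
    fix e :: real assume "0 < e"
    then have e: "0 < e / 3" by simp
    obtain y where y: "y \<in> S" "dist y x < e / 3" using x e unfolding closure_approachable by blast
    obtain W where W: "nsub W" "\<forall>w\<in>W. norm (ap (lambda_op w) y - y) \<le> e / 3" using y(1) e unfolding S_def by blast
    have "norm (ap (lambda_op w) x - x) \<le> e" if "w \<in> W" for w
    proof -
     have "ap (lambda_op w) x - x = ap (lambda_op w) (x - y) + ((ap (lambda_op w) y - y) + (y - x))" by (simp add: blinfun.diff_right)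
     also have "norm ... \<le> e / 3 + (e / 3 + e / 3)"
      by (intro norm_triangle_mono) (use W(2) that y(2) in \<open>auto simp: lam_norm dist_norm norm_minus_commute\<close>)
     finally show ?thesis by simp
    qed
    then show "\<exists>W. nsub W & (\<forall>w\<in>W. norm (ap (lambda_op w) x - x) \<le> e)" using W(1) by blast
   qed
  qed
  then show ?thesis using closure_subset_eq by blast
 qed
 moreover have "{sv A (u::'h) | A u. compact A & open A} <= S"
 proof
  fix x assume "x \<in> {sv A (u::'h) | A u. compact A & open A}"
  then obtain A u where A: "compact A" "open A" "x = sv A u" by blast
  obtain W where W: "nsub W" "!!a w. a \<in> A ==> w \<in> W ==> w + a \<in> A" using compact_open_lstable[OF A(1,2)] by blast
  have "lc w A = A" if w: "w \<in> W" for w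
  proof -
   have w': "- w \<in> W" using w subgroupD(3)[OF nsubD(1)[OF W(1)]] by blast
   have "x \<in> lc w A \<longleftrightarrow> x \<in> A" for x
    using W(2)[OF _ w, of "- w + x"] W(2)[OF _ w', of x] by (auto simp: lc_iff add.assoc[symmetric])
   then show ?thesis by blast
  qed
  then have "\<forall>w\<in>W. ap (lambda_op w) x - x = 0" by (simp add: A lam_sv)
  then show "x \<in> S" unfolding S_def using W(1) by (intro CollectI allI impI exI[of _ W]) auto
 qed
 moreover have "ccspan {sv A (u::'h) | A u. compact A & open A} = UNIV" by (rule ccspan_UNIV) (rule sv_orth, blast)
 ultimately have "S = UNIV" using ccspan_minimal by blast
 then have xi: "\<exists>W. nsub W & (\<forall>w\<in>W. norm (ap (lambda_op w) q - q) \<le> e)" if "0 < e" for e using that unfolding S_def by blast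
 show ?thesis
  unfolding continuous_on_def
 proof (intro ballI tendstoI)
  fix v and e :: real assume e: "0 < e"
  then have e2: "0 < e / 2" by simp
  obtain W where W: "nsub W" "!!w. w \<in> W ==> norm (ap (lambda_op w) q - q) \<le> e / 2" using xi[OF e2] by blast
  have "open (lc v W)" "v \<in> lc v W" using open_lc[OF nsubD(2)[OF W(1)]] lc_subgroup_self[OF nsubD(1)[OF W(1)]] by auto
  moreover have "dist (ap (lambda_op z) q) (ap (lambda_op v) q) < e" if z: "z \<in> lc v W" for z
  proof -
   have "lambda_op z = (lambda_op v :: ('g, 'h) l2 op) oL lambda_op (- v + z)" by (simp add: lam_add[symmetric] add.assoc[symmetric])
   then have "ap (lambda_op z) q - ap (lambda_op v) q = ap (lambda_op v) (ap (lambda_op (- v + z)) q - q)"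
    by (simp add: blinfun.diff_right)
   then have "dist (ap (lambda_op z) q) (ap (lambda_op v) q) \<le> e / 2"
    using W(2)[of "- v + z"] z by (simp add: dist_norm lam_norm lc_iff)
   then show ?thesis using e by simp
  qed
  ultimately have "\<forall>\<^sub>F z in nhds v. dist (ap (lambda_op z) q) (ap (lambda_op v) q) < e"
   unfolding eventually_nhds by blast
  then show "\<forall>\<^sub>F z in at v within UNIV. dist (ap (lambda_op z) q) (ap (lambda_op v) q) < e"
   unfolding eventually_at_filter by (rule eventually_mono) simp
 qed
qed

section \<open>Averages over open subgroups of \<open>K\<close>\<close>

definition avf :: "'g set => ('g, 'h::complex_hilbert_space) l2 op => ('g, 'h) l2 => ('g, 'h) l2 => 'g => complex" where
 "avf V T \<xi> \<zeta> v = (if v \<in> V then fm T (ap (lambda_op v) \<xi>) (ap (lambda_op v) \<zeta>) else 0)"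

text \<open>The mean over \<open>v\<close> in \<open>V\<close> of
  \<open>lambda_op (- v) oL T oL lambda_op v\<close>, given by its sesquilinear form.\<close>

definition ave :: "'g set => ('g, 'h::complex_hilbert_space) l2 op => ('g, 'h) l2 op" where
 "ave V T = (SOME S. S \<in> \<L> & (\<forall>\<xi> \<zeta>. fm S \<xi> \<zeta> = of_real (1 / m V) * (\<integral>v. avf V T \<xi> \<zeta> v \<partial>haar)))"

lemma avf_cont0: "continuous_on UNIV (\<lambda>v. fm T (ap (lambda_op v) w) (ap (lambda_op v) (u :: ('g, 'h::complex_hilbert_space) l2)))"
 by (intro continuous_on_cinner bounded_linear.continuous_on[OF blinfun.bounded_linear_right] lam_cont)

lemma avf:
 assumes V: "nsub V" shows "continuous_on UNIV (avf V T w u)" "v \<notin> V ==> avf V T w u v = 0" "integrable haar (avf V T w u)"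
  "norm (avf V T w u v) \<le> norm T * norm w * norm (u :: ('g, 'h::complex_hilbert_space) l2)"
proof -
 show 1: "continuous_on UNIV (avf V T w u)"
  unfolding avf_def[abs_def] by (rule continuous_on_indicator_clopen[OF avf_cont0 nsubD(2,5)[OF V]])
 show 2: "avf V T w u v = 0" if "v \<notin> V" for v using that by (simp add: avf_def)
 show "integrable haar (avf V T w u)" by (rule integrable_cc[OF 1 nsubD(6)[OF V] 2])
 have "norm (fm T (ap (lambda_op v) w) (ap (lambda_op v) u)) \<le> norm (ap T (ap (lambda_op v) w)) * norm u"
  using norm_cinner_le[of "ap T (ap (lambda_op v) w)" "ap (lambda_op v) u"] by (simp add: lam_norm)
 also have "... \<le> (norm T * norm w) * norm u" using norm_blinfun[of T "ap (lambda_op v) w"] by (intro mult_right_mono) (auto simp: lam_norm)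
 finally show "norm (avf V T w u v) \<le> norm T * norm w * norm u" by (simp add: avf_def)
qed

lemma m_nsub: "nsub V ==> 0 < m V" using m_pos[of V] nsubD(2,6,7)[of V] by blast

lemma ave:
 fixes T :: "('g, 'h::complex_hilbert_space) l2 op"
 assumes T: "T \<in> \<L>" and V: "nsub V"
 shows "ave V T \<in> \<L>" "fm (ave V T) w u = of_real (1 / m V) * (\<integral>v. avf V T w u v \<partial>haar)"
proof -
 have mV: "0 < m V" by (rule m_nsub[OF V])
 have "\<exists>S\<in>\<L>. norm S \<le> norm T & (\<forall>w u. fm S w u = of_real (1 / m V) * (\<integral>v. avf V T w u v \<partial>haar))"
 proof (rule form_op)
  fix x y z :: "('g, 'h) l2" and c
  have "avf V T (x + y) z = (\<lambda>v. avf V T x z v + avf V T y z v)" by (auto simp: avf_def blinfun.add_right cinner_add_left)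
  then show "of_real (1 / m V) * (\<integral>v. avf V T (x + y) z v \<partial>haar) = of_real (1 / m V) * (\<integral>v. avf V T x z v \<partial>haar) + of_real (1 / m V) * (\<integral>v. avf V T y z v \<partial>haar)"
   by (simp add: avf(3)[OF V] distrib_left)
  have "avf V T x (y + z) = (\<lambda>v. avf V T x y v + avf V T x z v)" by (auto simp: avf_def blinfun.add_right cinner_add_right)
  then show "of_real (1 / m V) * (\<integral>v. avf V T x (y + z) v \<partial>haar) = of_real (1 / m V) * (\<integral>v. avf V T x y v \<partial>haar) + of_real (1 / m V) * (\<integral>v. avf V T x z v \<partial>haar)"
   by (simp add: avf(3)[OF V] distrib_left)
  have "avf V T (c *\<^sub>C x) y = (\<lambda>v. c * avf V T x y v)" by (auto simp: avf_def clinear_scaleC[OF lam(1)] clinear_scaleC[OF T] cinner_scaleC_left)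
  then show "of_real (1 / m V) * (\<integral>v. avf V T (c *\<^sub>C x) y v \<partial>haar) = c * (of_real (1 / m V) * (\<integral>v. avf V T x y v \<partial>haar))" by simp
  have "avf V T x (c *\<^sub>C y) = (\<lambda>v. cnj c * avf V T x y v)" by (auto simp: avf_def clinear_scaleC[OF lam(1)] cinner_scaleC_right)
  then show "of_real (1 / m V) * (\<integral>v. avf V T x (c *\<^sub>C y) v \<partial>haar) = cnj c * (of_real (1 / m V) * (\<integral>v. avf V T x y v \<partial>haar))" by simp
  have "norm (\<integral>v. avf V T x y v \<partial>haar) \<le> norm T * norm x * norm y * m V"
   by (rule norm_integral_le[OF avf(1)[OF V] nsubD(6)[OF V] avf(2)[OF V] avf(4)[OF V]]) auto
  then show "norm (of_real (1 / m V) * (\<integral>v. avf V T x y v \<partial>haar)) \<le> norm T * norm x * norm y"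
   using mV by (simp add: norm_divide pos_divide_le_eq)
 qed simp
 then have "\<exists>S. S \<in> \<L> & (\<forall>w u. fm S w u = of_real (1 / m V) * (\<integral>v. avf V T w u v \<partial>haar))" by auto
 from someI_ex[OF this] show "ave V T \<in> \<L>" "fm (ave V T) w u = of_real (1 / m V) * (\<integral>v. avf V T w u v \<partial>haar)"
  unfolding ave_def by auto
qed

text \<open>The integrand is continuous at 0, where its value is the coefficient of
  \<open>T\<close>; no choice of \<open>V\<close> works for all vectors at once.\<close>

lemma ave_approx:
 fixes T :: "('g, 'h::complex_hilbert_space) l2 op"
 assumes T: "T \<in> \<L>" and e: "0 < e"
 shows "\<exists>V0. nsub V0 & (\<forall>V. nsub V --> V <= V0 --> norm (fm (ave V T) w u - fm T w u) \<le> e)"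
proof -
 define f where "f v = fm T (ap (lambda_op v) w) (ap (lambda_op v) u)" for v
 have f: "continuous_on UNIV f" unfolding f_def by (rule avf_cont0)
 have f0: "f 0 = fm T w u" by (simp add: f_def lam_zero)
 obtain V0 where V0: "nsub V0" "!!v. v \<in> V0 ==> dist (f (0 + v)) (f 0) < e" using locally_almost_constant[OF f compact_sing[of 0] e] by blast
 have "norm (fm (ave V T) w u - f 0) \<le> e" if V: "nsub V" "V <= V0" for V
 proof -
  have mV: "0 < m V" by (rule m_nsub[OF V(1)])
  let ?k = "\<lambda>v. if v \<in> V then f 0 else 0"
  have ck: "continuous_on UNIV ?k" by (rule continuous_on_indicator_clopen[OF continuous_on_const nsubD(2,5)[OF V(1)]])
  have ik: "integrable haar ?k" by (rule integrable_cc[OF ck nsubD(6)[OF V(1)]]) simp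
  have "norm (\<integral>v. avf V T w u v - ?k v \<partial>haar) \<le> e * m V"
  proof (rule norm_integral_le[OF continuous_on_diff[OF avf(1)[OF V(1)] ck] nsubD(6)[OF V(1)]])
   show "norm (avf V T w u v - ?k v) \<le> e" for v
    using V0(2)[of v] V(2) e by (auto simp: avf_def f_def dist_norm)
  qed (use e in \<open>auto simp: avf_def\<close>)
  also have "(\<integral>v. avf V T w u v - ?k v \<partial>haar) = (\<integral>v. avf V T w u v \<partial>haar) - f 0 * of_real (m V)"
   by (simp add: avf(3)[OF V(1)] ik integral_indicator_complex[OF nsubD(6)[OF V(1)]])
  finally have le: "norm ((\<integral>v. avf V T w u v \<partial>haar) - f 0 * of_real (m V)) \<le> e * m V" .
  have "fm (ave V T) w u - f 0 = of_real (1 / m V) * ((\<integral>v. avf V T w u v \<partial>haar) - f 0 * of_real (m V))"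
   using mV by (simp add: ave(2)[OF T V(1)] right_diff_distrib)
  also have "norm ... = (1 / m V) * norm ((\<integral>v. avf V T w u v \<partial>haar) - f 0 * of_real (m V))" using mV by (simp add: norm_mult norm_divide)
  also have "... \<le> (1 / m V) * (e * m V)" using mV le by (intro mult_left_mono) auto
  finally show ?thesis using mV by simp
 qed
 then show ?thesis using V0(1) unfolding f0 by blast
qed

text \<open>For \<open>j\<close> in \<open>V\<close> the shift \<open>v \<mapsto> v + j\<close>
  preserves the mean. If \<open>j\<close> in \<open>K\<close> commutes with \<open>T\<close>, then
  \<open>v + j = j + (- j + v + j)\<close>, the outer \<open>j\<close> cancels against its adjoint,
  and conjugation by \<open>j\<close> preserves \<open>V\<close> and its measure.\<close>

lemma ave_lam:
 fixes T :: "('g, 'h::complex_hilbert_space) l2 op"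
 assumes T: "T \<in> \<L>" and V: "nsub V" and j: "j \<in> V \<or> (j \<in> K & T oL lambda_op j = lambda_op j oL T)"
 shows "ave V T oL lambda_op j = lambda_op j oL ave V T"
proof -
 have Vs: "additive_subgroup V" by (rule nsubD(1)[OF V])
 have jK: "j \<in> K" "- j \<in> K" using j nsubD(3)[OF V] subgroupD(8)[OF K_sub] by auto
 have inv: "fm (ave V T) (ap (lambda_op j) y) (ap (lambda_op j) u) = fm (ave V T) y u" for y u
 proof -
  let ?f = "avf V T y u" and ?l = "avf V T (ap (lambda_op j) y) (ap (lambda_op j) u)"
  have ll: "ap (lambda_op v) (ap (lambda_op w) y) = ap (lambda_op (v + w)) y" for v w and y :: "('g, 'h) l2"
   by (simp add: lam_add)
  have right: "(\<integral>v. ?f (v + j) \<partial>haar) = (\<integral>v. ?f v \<partial>haar)"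
   using integral_right[OF avf(1)[OF V] nsubD(6)[OF V] avf(2)[OF V], of T y u "- j"] jK by (simp add: \<Delta>_K)
  have "(\<integral>v. ?l v \<partial>haar) = (\<integral>v. ?f v \<partial>haar)"
   using j
  proof
   assume jV: "j \<in> V"
   have "?l v = ?f (v + j)" for v unfolding avf_def ll using subgroupD(7)[OF Vs jV, of v] by simp
   then show ?thesis using right by simp
  next
   assume jT: "j \<in> K & T oL lambda_op j = lambda_op j oL T"
   define g where "g x = ?f (x + j)" for x
   have "?l v = g (- j + v)" for v
   proof -
    let ?v = "- j + v + j"
    have mem: "?v \<in> V \<longleftrightarrow> v \<in> V"
     using nsub_conj[OF V jK(1), of v] nsubD(4)[OF V jK(1), of ?v] by (auto simp: grp simp del: add_uminus_conv_diff)
    have vj: "v + j = j + ?v" by (simp add: add.assoc[symmetric])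
    have Tj: "ap T (ap (lambda_op j) \<mu>) = ap (lambda_op j) (ap T \<mu>)" for \<mu>
     using jT by (metis blinfun_apply_blinfun_compose)
    have iso: "fm (lambda_op j) \<mu> (ap (lambda_op j) \<nu>) = cinner \<mu> (\<nu> :: ('g, 'h) l2)" for \<mu> \<nu>
     using adj_works_right[OF lam(1), of "ap (lambda_op j) \<mu>" j \<nu>] by (simp add: lam_adj ll lam_zero)
    have "fm T (ap (lambda_op (v + j)) y) (ap (lambda_op (v + j)) u) =
     fm T (ap (lambda_op ?v) y) (ap (lambda_op ?v) u)"
     unfolding vj lam_add[of j] by (simp add: Tj iso)
    then show ?thesis unfolding g_def avf_def ll mem by simp
   qed
   then have "(\<integral>v. ?l v \<partial>haar) = (\<integral>v. g (- j + v) \<partial>haar)" by simp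
   also have "... = (\<integral>v. g v \<partial>haar)"
   proof (rule integral_left)
    show "continuous_on UNIV g" unfolding g_def by (rule continuous_on_compose2[OF avf(1)[OF V]]) (auto intro: cont_grp)
    show "compact (rc V (- j))" by (rule compact_rc[OF nsubD(6)[OF V]])
    show "g x = 0" if "x \<notin> rc V (- j)" for x using that by (simp add: g_def rc_iff avf(2)[OF V])
   qed
   also have "... = (\<integral>v. ?f v \<partial>haar)" unfolding g_def by (rule right)
   finally show ?thesis .
  qed
  then show ?thesis by (simp add: ave(2)[OF T V])
 qed
 show ?thesis
 proof (rule op_eq_cinnerI)
  fix y u :: "('g, 'h) l2"
  have z: "u = ap (lambda_op j) (ap (lambda_op (- j)) u)" by (simp add: lam_zero flip: blinfun_apply_blinfun_compose lam_add)
  have "fm (ave V T) (ap (lambda_op j) y) u = fm (ave V T) y (ap (lambda_op (- j)) u)"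
   by (subst z) (rule inv)
  also have "... = fm (lambda_op j) (ap (ave V T) y) u" by (simp add: adj_works(1)[OF lam(1)] lam_adj)
  finally show "fm (ave V T oL lambda_op j) y u = fm (lambda_op j oL ave V T) y u" by simp
 qed
qed

end

section \<open>Compatibility of averages and blocks with the action\<close>

context crossed
begin

text \<open>\<open>T\<close> commutes with all of \<open>\<pi> b\<close>, so the twist
  \<open>\<alpha> v\<close> produced by moving \<open>\<pi> b\<close> past
  \<open>\<Lambda> v\<close> does no harm.\<close>

lemma ave_pi:
 assumes T: "T \<in> \<L>" and V: "nsub V" and comm: "!!b. b \<in> B ==> T oL \<pi> b = \<pi> b oL T" and b: "b \<in> B"
 shows "ave V T oL \<pi> b = \<pi> b oL ave V T"
proof (rule op_eq_cinnerI)
 fix w u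
 have "avf V T (ap (\<pi> b) w) u v = avf V T w (ap (\<pi> (adj b)) u) v" for v
 proof -
  have vb: "\<alpha> v b \<in> B" "\<alpha> v (adj b) \<in> B" "adj b \<in> B" by (intro act_B b vn_adj[OF vB])+
  have 1: "ap (\<Lambda> v) (ap (\<pi> c) \<mu>) = ap (\<pi> (\<alpha> v c)) (ap (\<Lambda> v) \<mu>)" if "c \<in> B" for c \<mu>
   using lam_pi[OF that, of v] by (metis blinfun_apply_blinfun_compose)
  have 2: "ap T (ap (\<pi> c) \<mu>) = ap (\<pi> c) (ap T \<mu>)" if "c \<in> B" for c \<mu>
   using comm[OF that] by (metis blinfun_apply_blinfun_compose)
  show ?thesis unfolding avf_def 1[OF b] 1[OF vb(3)] 2[OF vb(1)]
   using adj_works(1)[OF pi(1)[OF vb(1)]] by (simp add: pi_adj vb(1) act_simps b)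
 qed
 then have "fm (ave V T) (ap (\<pi> b) w) u = fm (ave V T) w (ap (\<pi> (adj b)) u)"
  by (simp add: ave(2)[OF T V])
 also have "... = fm (\<pi> b) (ap (ave V T) w) u"
  using adj_works(1)[OF pi(1)[OF b]] by (simp add: pi_adj b)
 finally show "fm (ave V T oL \<pi> b) w u = fm (\<pi> b oL ave V T) w u" by simp
qed

text \<open>A block vanishes as soon as the coefficients between all compact open subsets of its
  source and target do, and these are covariant by \<open>cf_translate\<close>.\<close>

lemma PA_translate:
 assumes x: "x \<in> commutant MC" and A: "compact A" "open A" "compact A'" "open A'" and z: "PA A' oL x oL PA A = 0"
 shows "PA (rc A' t) oL x oL PA (rc A t) = 0"
proof (rule l2_op_eq_stepI)
 have xc: "x \<in> \<L>" by (rule M(2)[OF x])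
 have cl: "open (rc A t)" "closed (rc A t)" "open (rc A' t)" "closed (rc A' t)" "closed A" "closed A'"
  by (intro open_rc compact_imp_closed compact_rc A)+
 show "PA (rc A' t) oL x oL PA (rc A t) \<in> \<L>" by (intro clinear_intros PA cl xc)
 fix C :: "'g set" and u :: 'h assume C: "compact C" "open C"
 have "ap (PA (rc A' t) oL x oL PA (rc A t)) (sv C u) = 0"
 proof (rule sv_orth)
  fix C' :: "'g set" and v :: 'h assume C': "compact C'" "open C'"
  define E E' where "E = rc (rc A t \<inter> C) (- t)" and "E' = rc (rc A' t \<inter> C') (- t)"
  have c1: "compact (rc A t \<inter> C)" "compact (rc A' t \<inter> C')" using cl C C' by (auto intro: closed_Int_compact)
  have E: "compact E" "open E" "compact E'" "open E'" unfolding E_def E'_def using cl C C' c1 by (auto intro!: compact_rc open_rc)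
  have Es: "rc E t = rc A t \<inter> C" "rc E' t = rc A' t \<inter> C'" by (simp_all add: E_def E'_def rc_rc rc_0)
  have EA: "A \<inter> E = E" "A' \<inter> E' = E'" by (auto simp: E_def E'_def rc_iff)
  have "cf x E' E = 0"
  proof (rule cf_eqI[OF xc E])
   fix u v
   have "fm x (sv E u) (sv E' v) = fm x (ap (PA A) (sv E u)) (ap (PA A') (sv E' v))"
    by (simp add: PA_sv A E cl EA)
   also have "... = fm (PA A' oL x oL PA A) (sv E u) (sv E' v)"
    using adj_works(1)[OF PA(1)[OF A(4) cl(6)], of "ap x (ap (PA A) (sv E u))" "sv E' v"] by (simp add: PA_adj A cl)
   finally show "fm 0 u v = fm x (sv E u) (sv E' v)" by (simp add: z cinner_zero_left)
  qed
  then have "cf x (rc E' t) (rc E t) = 0" using cf_translate[OF x E, of t] by (simp add: act_simps)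
  then have "fm x (sv (rc A t \<inter> C) u) (sv (rc A' t \<inter> C') v) = 0"
   using cf(2)[OF xc compact_rc[OF E(1), of t] open_rc[OF E(2), of t] compact_rc[OF E(3), of t] open_rc[OF E(4), of t], of u v] by (simp add: Es cinner_zero_left)
  then show "fm (PA (rc A' t) oL x oL PA (rc A t)) (sv C u) (sv C' v) = 0"
   using adj_works(1)[OF PA(1)[OF cl(3,4)], of "ap x (sv (rc A t \<inter> C) u)" "sv C' v"] by (simp add: PA_sv cl C C' PA_adj)
 qed
 then show "ap (PA (rc A' t) oL x oL PA (rc A t)) (sv C u) = ap 0 (sv C u)" by simp
qed (rule clinear_zero)

end

context td_haar
begin

lemma zero_translates:
 fixes S :: "('g, 'h::complex_hilbert_space) l2 op"
 assumes S: "S \<in> \<L>" and D: "compact D" "open D" "D \<noteq> {}" and z: "!!g. S oL PA (lc g D) = 0"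
 shows "S = 0"
proof (rule l2_op_eq_stepI[OF S clinear_zero])
 fix A :: "'g set" and u :: 'h assume A: "compact A" "open A"
 obtain d where d: "d \<in> D" using D(3) by blast
 have "S oL PA A = 0"
  by (rule PA_zero_cover[OF A, of "\<lambda>c. lc (c - d) D"]) (use clopen_cosets[OF D(1,2)] z d in \<open>auto simp: lc_iff grp simp del: add_uminus_conv_diff\<close>)
 then have "ap (S oL PA A) (sv A u) = 0" by simp
 then show "ap S (sv A u) = ap 0 (sv A u)" by (simp add: PA_sv A compact_imp_closed)
qed

lemma PA_UN:
 assumes "finite I" "!!i. i \<in> I ==> open (A i)" "!!i. i \<in> I ==> closed (A i)" "\<forall>i\<in>I. \<forall>j\<in>I. i \<noteq> j --> A i \<inter> A j = {}"
 shows "(PA (\<Union>i\<in>I. A i) :: ('g, 'h::complex_hilbert_space) l2 op) = (\<Sum>i\<in>I. PA (A i))"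
 using assms
proof (induction I rule: finite_induct)
 case (insert i I)
 have "PA (\<Union>j\<in>insert i I. A j) = (PA (A i \<union> (\<Union>j\<in>I. A j)) :: ('g, 'h) l2 op)" by simp
 also have "... = PA (A i) + PA (\<Union>j\<in>I. A j)" by (rule PA_Un) (use insert in \<open>auto intro: open_UN closed_UN\<close>)
 also have "PA (\<Union>j\<in>I. A j) = (\<Sum>j\<in>I. (PA (A j) :: ('g, 'h) l2 op))" by (rule insert.IH) (use insert.prems in auto)
 finally show ?case using insert by simp
qed (simp add: PA_empty)

lemma PA_bessel:
 assumes I: "finite I" "!!i. i \<in> I ==> open (A i)" "!!i. i \<in> I ==> closed (A i)" "\<forall>i\<in>I. \<forall>j\<in>I. i \<noteq> j --> A i \<inter> A j = {}"
 shows "(\<Sum>i\<in>I. (norm (ap (PA (A i)) v))^2) \<le> (norm (v :: ('g, 'h::complex_hilbert_space) l2))^2"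
proof -
 have U: "open (\<Union>i\<in>I. A i)" "closed (\<Union>i\<in>I. A i)" using I by (auto intro: open_UN closed_UN)
 have "(norm (ap (PA (A i)) v))^2 = Re (fm (PA (A i)) v v)" if i: "i \<in> I" for i
 proof -
  have "adj (PA (A i)) oL PA (A i) = (PA (A i) :: ('g, 'h) l2 op)" using I(2,3)[OF i] by (simp add: PA_adj PA_compose)
  then show ?thesis using Re_cinner_adj_comp[OF PA(1)[OF I(2)[OF i] I(3)[OF i]], of v] by simp
 qed
 then have "(\<Sum>i\<in>I. (norm (ap (PA (A i)) v))^2) = Re (fm (PA (\<Union>i\<in>I. A i)) v v)"
  by (simp add: PA_UN[OF I] blinfun.sum_left cinner_sum_left)
 also have "... \<le> norm (PA (\<Union>i\<in>I. A i) :: ('g, 'h) l2 op) * (norm v)^2" by (rule Re_cinner_op_le)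
 also have "... \<le> 1 * (norm v)^2" by (intro mult_right_mono PA(2)[OF U]) simp
 finally show ?thesis by simp
qed

lemma PA_tail:
 fixes v :: "('g, 'h::complex_hilbert_space) l2"
 assumes e: "0 < e"
 shows "\<exists>C. compact C & (\<forall>E. open E --> closed E --> C <= E --> norm (ap (PA E) v - v) \<le> e)"
proof -
 obtain F where F: "ccf F" "norm (vec F - v) < e / 2" using vec_dense[of "e / 2" v] e by auto
 obtain C where C: "compact C" "!!t. t \<notin> C ==> F t = 0" using ccfD(2)[OF F(1)] by blast
 have "norm (ap (PA E) v - v) \<le> e" if E: "open E" "closed E" "C <= E" for E
 proof -
  have "(\<lambda>t. if t \<in> E then F t else 0) = F" using C(2) E(3) by (intro ext) auto
  then have "ap (PA E) (vec F) = vec F" using PA(3)[OF E(1,2) F(1)] by simp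
  then have "ap (PA E) v - v = ap (PA E) (v - vec F) + (vec F - v)" by (simp add: blinfun.diff_right)
  also have "norm ... \<le> 1 * norm (v - vec F) + norm (vec F - v)"
   by (intro norm_triangle_mono norm_blinfun_apply_le PA(2)[OF E(1,2)] order_refl)
  also have "... \<le> e" using F(2) by (simp add: norm_minus_commute)
  finally show ?thesis .
 qed
 then show ?thesis using C(1) by blast
qed

lemma ex_biinvariant:
 assumes C: "compact (C :: 'g set)"
 shows "\<exists>W. compact W & open W & C <= W & (\<forall>w\<in>W. \<forall>k\<in>K. w + k \<in> W & k + w \<in> W)"
proof -
 obtain A where A: "compact A" "open A" "C <= A" "!!a k. a \<in> A ==> k \<in> K ==> a + k \<in> A" using compact_open_hull[OF C] by blast
 define W where "W = (\<lambda>(k, a). k + a) ` (K \<times> A)"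
 have c: "continuous_on (K \<times> A) (\<lambda>p. fst p + snd p)" by (intro cont_add continuous_on_fst continuous_on_snd continuous_on_id)
 have "compact W" unfolding W_def case_prod_beta by (rule compact_continuous_image[OF c compact_Times[OF K_compact A(1)]])
 moreover have "W = (\<Union>k\<in>K. lc k A)" unfolding W_def lc_image by auto
 then have "open W" using open_lc[OF A(2)] by auto
 moreover have "C <= W" using A(3) subgroupD(1)[OF K_sub] unfolding W_def by force
 moreover have "w + k \<in> W & k + w \<in> W" if w: "w \<in> W" and k: "k \<in> K" for w k
 proof -
  obtain j a where ja: "j \<in> K" "a \<in> A" "w = j + a" using w unfolding W_def by auto
  have "w + k = j + (a + k)" "k + w = (k + j) + a" by (simp_all add: ja add.assoc)
  then show ?thesis using A(4)[OF ja(2) k] subgroupD(2)[OF K_sub k ja(1)] ja(1,2) unfolding W_def by force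
 qed
 ultimately show ?thesis by blast
qed

lemma zero_by_cosets:
 fixes S :: "('g, 'h::complex_hilbert_space) l2 op"
 assumes S: "S \<in> \<L>" and z: "!!q r. PA (rc K q) oL S oL PA (rc K r) = 0"
 shows "S = 0"
proof (rule l2_op_eq_stepI[OF S clinear_zero])
 note cl = clopen_cosets[OF K_compact K_open]
 have self: "r \<in> rc K r" for r by (rule rc_subgroup_self[OF K_sub])
 fix A :: "'g set" and u :: 'h assume A: "compact A" "open A"
 have "S oL PA A = 0"
 proof (rule PA_zero_cover[OF A])
  fix r assume "r \<in> A"
  have Sr: "S oL PA (rc K r) \<in> \<L>" using cl by (intro clinear_compose S PA) auto
  have "S oL PA (rc K r) = 0"
  proof (rule l2_op_eq_stepI[OF Sr clinear_zero])
   fix C :: "'g set" and v :: 'h assume "compact C" "open C"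
   have "ap (S oL PA (rc K r)) (sv C v) = 0"
   proof (rule sv_orth)
    fix D :: "'g set" and w :: 'h assume D: "compact D" "open D"
    have cD: "closed D" by (rule compact_imp_closed[OF D(1)])
    have "PA D oL (S oL PA (rc K r)) = 0"
     by (rule PA_zero_cover_left[OF D Sr, of "\<lambda>q. rc K q"]) (use cl self z in \<open>auto simp: compose_assoc\<close>)
    then have "ap (PA D) (ap (S oL PA (rc K r)) (sv C v)) = 0" by (metis blinfun_apply_blinfun_compose zero_blinfun.rep_eq)
    then show "fm (S oL PA (rc K r)) (sv C v) (sv D w) = 0"
     using adj_works(1)[OF PA(1)[OF D(2) cD], of "ap (S oL PA (rc K r)) (sv C v)" "sv D w"] by (simp add: PA_adj PA_sv D cD cinner_zero_left)
   qed
   then show "ap (S oL PA (rc K r)) (sv C v) = ap 0 (sv C v)" by simp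
  qed
  then show "open (rc K r) & closed (rc K r) & r \<in> rc K r & S oL PA (rc K r) = 0" using cl self by auto
 qed
 then have "ap (S oL PA A) (sv A u) = 0" by simp
 then show "ap S (sv A u) = ap 0 (sv A u)" by (simp add: PA_sv A compact_imp_closed)
qed

end

section \<open>Extending corners to the commutant of the crossed product\<close>

context crossed
begin

text \<open>An operator between two right cosets of \<open>L\<close> that commutes with \<open>\<pi>(B)\<close> and \<open>\<lambda>\<^bsub>L\<^esub>\<close> is a corner of an
 element of \<open>MC\<close>, the sum of its left translates.\<close>

lemma extend_MC:
 assumes L: "additive_subgroup L" "compact L" "open L" and Y: "Y \<in> \<L>"
  and Ypi: "!!b. b \<in> B ==> Y oL \<pi> b = \<pi> b oL Y" and Yl: "!!l. l \<in> L ==> Y oL \<Lambda> l = \<Lambda> l oL Y"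
  and YP: "PA (rc L t) oL Y = Y" "Y oL PA (rc L r) = Y"
 shows "\<exists>T\<in>MC. \<forall>g. T oL PA (lc g (rc L r)) = \<Lambda> g oL Y oL \<Lambda> (- g) & PA (lc g (rc L t)) oL T = \<Lambda> g oL Y oL \<Lambda> (- g)"
proof -
 define Z where "Z g = \<Lambda> g oL (Y oL \<Lambda> (- g))" for g
 define Dr Dt where "Dr g = lc g (rc L r)" and "Dt g = lc g (rc L t)" for g
 note cl = clopen_cosets[OF compact_rc[OF L(2)] open_rc[OF L(3)]]
 have oD: "open (Dr g)" "closed (Dr g)" "open (Dt g)" "closed (Dt g)" for g unfolding Dr_def Dt_def using cl by auto
 have opL: "open (rc L s)" "closed (rc L s)" for s using clopen_cosets[OF L(2,3)] by auto
 have Zc: "Z g \<in> \<L>" for g unfolding Z_def by (intro clinear_intros lam Y)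
 have Zr: "Z g oL PA (Dr g) = Z g" for g
 proof -
  have "\<Lambda> (- g) oL PA (Dr g) = PA (rc L r) oL \<Lambda> (- g)" using lam_PA[OF oD(1,2)[of g], of "- g"] by (simp add: Dr_def lc_lc lc_0)
  then have "Z g oL PA (Dr g) = \<Lambda> g oL ((Y oL PA (rc L r)) oL \<Lambda> (- g))" by (simp only: Z_def compose_assoc)
  then show ?thesis by (simp only: YP Z_def)
 qed
 have Zt: "PA (Dt g) oL Z g = Z g" for g
 proof -
  have "PA (Dt g) oL Z g = (PA (Dt g) oL \<Lambda> g) oL (Y oL \<Lambda> (- g))" by (simp only: Z_def compose_assoc)
  also have "PA (Dt g) oL \<Lambda> g = \<Lambda> g oL PA (rc L t)" unfolding Dt_def by (rule lam_PA[OF opL, symmetric])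
  also have "(\<Lambda> g oL PA (rc L t)) oL (Y oL \<Lambda> (- g)) = \<Lambda> g oL ((PA (rc L t) oL Y) oL \<Lambda> (- g))" by (simp only: compose_assoc)
  finally show ?thesis by (simp only: YP Z_def)
 qed
 \<comment> \<open>Commutation of \<open>Y\<close> with translations by \<open>L\<close> makes the
   translate depend on the coset of \<open>g\<close> only, so the sum below runs over
   cosets.\<close>
 have Zeq: "Z g = Z h" if "lc g L = lc h L" for g h
 proof -
  have "h \<in> lc g L" using that lc_subgroup_self[OF L(1), of h] by simp
  then have l: "- g + h \<in> L" by (simp add: lc_iff)
  define l where "l = - g + h"
  have h: "h = g + l" by (simp add: l_def add.assoc[symmetric])
  have "Z h = \<Lambda> g oL ((\<Lambda> l oL Y) oL (\<Lambda> (- l) oL \<Lambda> (- g)))" unfolding Z_def h by (simp only: lam_add minus_add compose_assoc)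
  also have "\<Lambda> l oL Y = Y oL \<Lambda> l" using Yl[of l] l by (simp add: l_def)
  also have "\<Lambda> g oL ((Y oL \<Lambda> l) oL (\<Lambda> (- l) oL \<Lambda> (- g))) = \<Lambda> g oL (Y oL ((\<Lambda> l oL \<Lambda> (- l)) oL \<Lambda> (- g)))" by (simp only: compose_assoc)
  also have "... = Z g" by (simp add: Z_def compose_id_left lam_zero flip: lam_add)
  finally show ?thesis by simp
 qed
 have dis: "Dr g \<inter> Dr h = {}" "Dt g \<inter> Dt h = {}" if "lc g L \<noteq> lc h L" for g h
  using lc_subgroup_disjoint[OF L(1), of g h] that unfolding Dr_def Dt_def lc_rc rc_Int[symmetric] by (auto simp: rc_empty)
 have Zr0: "Z h oL PA (Dr g) = 0" if "lc g L \<noteq> lc h L" for g h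
 proof -
  have "Z h oL PA (Dr g) = Z h oL (PA (Dr h) oL PA (Dr g))" by (metis Zr compose_assoc)
  also have "PA (Dr h) oL PA (Dr g) = (0 :: ('g, 'h) l2 op)" using dis(1)[of h g] that by (intro PA_disjoint oD) auto
  finally show ?thesis by (simp add: compose_zero_right)
 qed
 have Zt0: "PA (Dt g) oL Z h = 0" if "lc g L \<noteq> lc h L" for g h
 proof -
  have "PA (Dt g) oL Z h = (PA (Dt g) oL PA (Dt h)) oL Z h" by (metis Zt compose_assoc)
  also have "PA (Dt g) oL PA (Dt h) = (0 :: ('g, 'h) l2 op)" using dis(2)[of g h] that by (intro PA_disjoint oD) auto
  finally show ?thesis by (simp add: compose_zero_left)
 qed
 define CC where "CC = range (\<lambda>g. lc g L)"
 define rep where "rep c = (SOME g. lc g L = c)" for c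
 have rep: "lc (rep c) L = c" if "c \<in> CC" for c using that someI_ex[of "\<lambda>g. lc g L = c"] unfolding rep_def CC_def by blast
 define S where "S F = (\<Sum>c\<in>F. Z (rep c))" for F
 have Sc: "S F \<in> \<L>" for F unfolding S_def by (intro clinear_sum Zc)
 have S_r: "S F oL PA (Dr g) = Z g" and S_t: "PA (Dt g) oL S F = Z g" if F: "finite F" "F <= CC" "lc g L \<in> F" for F g
 proof -
  have "Z (rep c) oL PA (Dr g) = (if c = lc g L then Z g else 0)" "PA (Dt g) oL Z (rep c) = (if c = lc g L then Z g else 0)" if "c \<in> F" for c
  proof -
   have rc: "lc (rep c) L = c" using rep F(2) that by blast
   show "Z (rep c) oL PA (Dr g) = (if c = lc g L then Z g else 0)" "PA (Dt g) oL Z (rep c) = (if c = lc g L then Z g else 0)"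
    using Zeq[of "rep c" g] Zr0[of g "rep c"] Zt0[of g "rep c"] Zr[of g] Zt[of g] rc by auto
  qed
  then show "S F oL PA (Dr g) = Z g" "PA (Dt g) oL S F = Z g"
   unfolding S_def compose_sum_left compose_sum_right using F by (simp_all cong: sum.cong)
 qed
 \<comment> \<open>Different terms have disjoint sources and disjoint targets, so partial sums are
   bounded by the norm of a single term.\<close>
 have Sn: "norm (S F) \<le> norm Y" if F: "finite F" "F <= CC" for F
 proof (rule norm_blinfun_bound)
  fix v
  have disF: "\<forall>c\<in>F. \<forall>d\<in>F. c \<noteq> d --> Dr (rep c) \<inter> Dr (rep d) = {}" "\<forall>c\<in>F. \<forall>d\<in>F. c \<noteq> d --> Dt (rep c) \<inter> Dt (rep d) = {}"
   using dis rep F(2) by (metis subsetD)+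
  have "(norm (\<Sum>c\<in>F. ap (PA (Dt (rep c))) (ap (Z (rep c)) v)))^2 \<le> (\<Sum>c\<in>F. (norm (ap (Z (rep c)) v))^2)"
   by (rule row_contraction) (use oD PA_bessel[OF F(1) oD(3,4) disF(2)] in \<open>auto simp: PA_adj PA\<close>)
  also have "(\<Sum>c\<in>F. ap (PA (Dt (rep c))) (ap (Z (rep c)) v)) = ap (S F) v"
   unfolding S_def blinfun.sum_left by (intro sum.cong refl) (metis Zt blinfun_apply_blinfun_compose)
  also have "(\<Sum>c\<in>F. (norm (ap (Z (rep c)) v))^2) \<le> (\<Sum>c\<in>F. (norm Y)^2 * (norm (ap (PA (Dr (rep c))) v))^2)"
  proof (rule sum_mono)
   fix c
   have "ap (Z (rep c)) v = ap (Z (rep c)) (ap (PA (Dr (rep c))) v)" by (metis Zr blinfun_apply_blinfun_compose)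
   then have "norm (ap (Z (rep c)) v) \<le> norm Y * norm (ap (PA (Dr (rep c))) v)"
    using norm_blinfun[of Y "ap (\<Lambda> (- rep c)) (ap (PA (Dr (rep c))) v)"] by (simp add: Z_def lam_norm)
   from power_mono[OF this norm_ge_zero, of 2] show "(norm (ap (Z (rep c)) v))^2 \<le> (norm Y)^2 * (norm (ap (PA (Dr (rep c))) v))^2"
    by (simp add: power_mult_distrib)
  qed
  also have "... \<le> (norm Y)^2 * (norm v)^2" unfolding sum_distrib_left[symmetric]
   by (intro mult_left_mono PA_bessel[OF F(1) oD(1,2) disF(1)]) simp
  finally have "(norm (ap (S F) v))^2 \<le> (norm Y * norm v)^2" by (simp add: power_mult_distrib)
  then show "norm (ap (S F) v) \<le> norm Y * norm v" by (rule power2_le_imp_le) simp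
 qed simp
 \<comment> \<open>A weak cluster point of the partial sums replaces the infinite sum. Every block
   becomes constant once its coset occurs, so the blocks of the limit are known.\<close>
 define fam where "fam F = S ` {F'. finite F' & F <= F' & F' <= CC}" for F
 have "\<exists>T\<in>\<L>. norm T \<le> norm Y & (\<forall>A\<in>fam ` {F. finite F & F <= CC}. T \<in> wot_closure A)"
 proof (rule wot_compact)
  show "fam ` {F. finite F & F <= CC} \<noteq> {}" by auto
  show "A \<noteq> {}" if "A \<in> fam ` {F. finite F & F <= CC}" for A using that by (auto simp: fam_def)
  show "T \<in> \<L> & norm T \<le> norm Y" if "A \<in> fam ` {F. finite F & F <= CC}" "T \<in> A" for A T
   using that Sc Sn by (auto simp: fam_def)
  fix A A' assume "A \<in> fam ` {F. finite F & F <= CC}" "A' \<in> fam ` {F. finite F & F <= CC}"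
  then obtain F F' where F: "finite F" "F <= CC" "A = fam F" "finite F'" "F' <= CC" "A' = fam F'" by auto
  then have "fam (F \<union> F') <= A \<inter> A'" by (auto simp: fam_def)
  moreover have "fam (F \<union> F') \<in> fam ` {F. finite F & F <= CC}" using F by auto
  ultimately show "\<exists>A''\<in>fam ` {F. finite F & F <= CC}. A'' <= A \<inter> A'" by blast
 qed
 then obtain T where Tc: "T \<in> \<L>" and TS: "!!F. finite F ==> F <= CC ==> T \<in> wot_closure (fam F)" by auto
 have approx: "\<exists>F. finite F & F <= CC & lc g L \<in> F & norm (fm (S F) v w - fm T v w) < e" if e: "0 < e" for g v w e
 proof -
  have "{lc g L} <= CC" by (auto simp: CC_def)
  from wot_closureD[OF TS[OF _ this] _ e, of "{(v, w)}"] show ?thesis by (auto simp: fam_def)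
 qed
 have T_r: "T oL PA (Dr g) = Z g" for g
 proof (rule op_eq_cinnerI)
  fix v w :: "('g, 'h) l2"
  have "fm (Z g) v w - fm (T oL PA (Dr g)) v w = 0"
  proof (rule norm_le_all_eps[of _ 1])
   fix e :: real assume e: "0 < e"
   from approx[OF e, of g "ap (PA (Dr g)) v" w] obtain F where F: "finite F" "F <= CC" "lc g L \<in> F"
    "norm (fm (S F) (ap (PA (Dr g)) v) w - fm T (ap (PA (Dr g)) v) w) < e" by (elim exE conjE)
   have "ap (S F) (ap (PA (Dr g)) v) = ap (Z g) v" using S_r[OF F(1-3)] by (metis blinfun_apply_blinfun_compose)
   then show "norm (fm (Z g) v w - fm (T oL PA (Dr g)) v w) \<le> 1 * e" using F(4) by simp
  qed
  then show "fm (T oL PA (Dr g)) v w = fm (Z g) v w" by simp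
 qed
 have T_t: "PA (Dt g) oL T = Z g" for g
 proof (rule op_eq_cinnerI)
  fix v w :: "('g, 'h) l2"
  have aw: "fm (PA (Dt g)) u w = cinner u (ap (PA (Dt g)) w)" for u
   using adj_works(1)[OF PA(1)[OF oD(3,4)], of g u w] by (simp add: PA_adj oD)
  have "fm (Z g) v w - fm (PA (Dt g) oL T) v w = 0"
  proof (rule norm_le_all_eps[of _ 1])
   fix e :: real assume e: "0 < e"
   from approx[OF e, of g v "ap (PA (Dt g)) w"] obtain F where F: "finite F" "F <= CC" "lc g L \<in> F"
    "norm (fm (S F) v (ap (PA (Dt g)) w) - fm T v (ap (PA (Dt g)) w)) < e" by (elim exE conjE)
   have "fm (S F) v (ap (PA (Dt g)) w) = fm (Z g) v w"
    unfolding aw[symmetric] using S_t[OF F(1-3)] by (metis blinfun_apply_blinfun_compose)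
   then show "norm (fm (Z g) v w - fm (PA (Dt g) oL T) v w) \<le> 1 * e" using F(4) by (simp add: aw)
  qed
  then show "fm (PA (Dt g) oL T) v w = fm (Z g) v w" by simp
 qed
 have rcL: "compact (rc L r)" "open (rc L r)" "rc L r \<noteq> {}"
  using L subgroupD(1)[OF L(1)] by (auto simp: rc_empty intro: compact_rc open_rc)
 have "T \<in> MC"
  unfolding MC_def
 proof (rule commutantI[OF Tc])
  have pi_case: "T oL \<pi> b = \<pi> b oL T" if b: "b \<in> B" for b
  proof -
   have "(T oL \<pi> b) - (\<pi> b oL T) = 0"
   proof (rule zero_translates[OF _ rcL])
    fix g
    have gb: "\<alpha> (- g) b \<in> B" by (rule act_B[OF b])
    have "(T oL \<pi> b) oL PA (Dr g) = (T oL PA (Dr g)) oL \<pi> b" by (simp only: compose_assoc pi_PA[OF b oD(1,2)])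
    also have "... = \<Lambda> g oL (Y oL (\<Lambda> (- g) oL \<pi> b))" by (simp only: T_r Z_def compose_assoc)
    also have "... = \<Lambda> g oL ((Y oL \<pi> (\<alpha> (- g) b)) oL \<Lambda> (- g))" by (simp only: lam_pi[OF b] compose_assoc)
    also have "... = (\<Lambda> g oL \<pi> (\<alpha> (- g) b)) oL (Y oL \<Lambda> (- g))" by (simp only: Ypi[OF gb] compose_assoc)
    also have "... = \<pi> b oL Z g" by (simp only: lam_pi[OF gb] act_inverse[OF b] Z_def compose_assoc)
    also have "... = (\<pi> b oL T) oL PA (Dr g)" by (simp only: T_r[symmetric] compose_assoc)
    finally show "((T oL \<pi> b) - (\<pi> b oL T)) oL PA (lc g (rc L r)) = 0" unfolding Dr_def by (simp add: compose_diff_left)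
   qed (intro clinear_intros Tc pi b)
   then show ?thesis by simp
  qed
  moreover have "T oL \<Lambda> k = \<Lambda> k oL T" for k
  proof -
   have "(T oL \<Lambda> k) - (\<Lambda> k oL T) = 0"
   proof (rule zero_translates[OF _ rcL])
    fix g
    have lD: "\<Lambda> k oL PA (Dr g) = PA (Dr (k + g)) oL \<Lambda> k"
     unfolding Dr_def lc_lc[symmetric] by (rule lam_PA[OF oD(1,2)[unfolded Dr_def]])
    have "(T oL \<Lambda> k) oL PA (Dr g) = (T oL PA (Dr (k + g))) oL \<Lambda> k"
     by (simp only: compose_assoc lD)
    also have "... = \<Lambda> k oL (\<Lambda> g oL (Y oL (\<Lambda> (- g) oL (\<Lambda> (- k) oL \<Lambda> k))))" by (simp only: T_r Z_def compose_assoc lam_add minus_add)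
    also have "... = \<Lambda> k oL Z g" by (simp add: Z_def lam_zero compose_id_right flip: lam_add)
    also have "... = (\<Lambda> k oL T) oL PA (Dr g)" by (simp only: T_r[symmetric] compose_assoc)
    finally show "((T oL \<Lambda> k) - (\<Lambda> k oL T)) oL PA (lc g (rc L r)) = 0" unfolding Dr_def by (simp add: compose_diff_left)
   qed (intro clinear_intros Tc lam)
   then show ?thesis by simp
  qed
  ultimately show "T oL A = A oL T" if "A \<in> \<pi> ` B \<union> range lambda_op" for A using that by auto
 qed
 then show ?thesis using T_r T_t unfolding Dr_def Dt_def Z_def compose_assoc by blast
qed

end

section \<open>The support of an intermediate algebra\<close>

locale intermediate = crossed_min K \<alpha> B for K :: "'g::{topological_group_add,t2_space} set" and \<alpha> and B :: "'h::complex_hilbert_space op set" +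
 fixes N :: "('g, 'h) l2 op set"
 assumes N: "von_neumann_algebra N" and piN: "\<pi> ` B <= N" and NM: "N <= commutant MC"
begin

definition H :: "'g set" where "H = {s. \<Lambda> s \<in> N}"

lemmas Nalg = op_algebraD[OF vn_op_algebra[OF N]]

lemma H_sub: "additive_subgroup H"
 unfolding additive_subgroup_def H_def
 using Nalg(3,5) vn_adj[OF N] by (auto simp: lam_zero lam_add) (metis lam_adj)

text \<open>By the contrapositive of \<open>lam_mem\<close> one \<open>V\<close> kills the block at
  \<open>s\<close> for all of \<open>N\<close>, and \<open>PA_translate\<close> spreads this to the
  right. The coset \<open>sV\<close> misses \<open>H\<close>, since for \<open>h\<close> in both the
  element \<open>\<Lambda> h\<close> of \<open>N\<close> would have a nonzero block there.\<close>

lemma off_H: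
 assumes s: "s \<notin> H"
 shows "\<exists>V. nsub V & lc s V \<inter> H = {} & (\<forall>x\<in>N. \<forall>t. PA (rc (lc s V) t) oL x oL PA (rc V t) = 0)"
proof -
 obtain V where V: "nsub V" and z: "!!x. x \<in> N ==> PA V oL (\<Lambda> (- s) oL x) oL PA V = 0"
  using lam_mem[OF N piN NM, of s] s unfolding H_def by blast
 note oV = nsubD(2,5,6)[OF V]
 have z1: "PA (lc s V) oL x oL PA V = 0" if x: "x \<in> N" for x
 proof -
  have "PA (lc s V) oL (\<Lambda> s oL \<Lambda> (- s)) = \<Lambda> s oL (PA V oL \<Lambda> (- s))"
   by (simp only: compose_assoc[symmetric] lam_PA[OF oV(1,2)])
  then have "PA (lc s V) = \<Lambda> s oL (PA V oL \<Lambda> (- s))" by (simp add: lam_zero compose_id_right flip: lam_add)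
  then have "PA (lc s V) oL x oL PA V = \<Lambda> s oL (PA V oL (\<Lambda> (- s) oL x) oL PA V)" by (simp only: compose_assoc)
  then show ?thesis by (simp add: z[OF x] compose_zero_right)
 qed
 have "lc s V \<inter> H = {}"
 proof (rule ccontr)
  assume "lc s V \<inter> H \<noteq> {}"
  then obtain h where h: "- s + h \<in> V" "\<Lambda> h \<in> N" by (auto simp: lc_iff H_def)
  obtain u :: 'h where u: "u \<noteq> 0" using ex_nonzero by blast
  have "\<Lambda> (- s + h) oL PA V = PA V oL \<Lambda> (- s + h)" using lam_PA[OF oV(1,2), of "- s + h"] lc_subgroup_mem[OF nsubD(1)[OF V] h(1)] by simp
  then have "PA V oL (\<Lambda> (- s) oL \<Lambda> h) oL PA V = PA V oL (PA V oL \<Lambda> (- s + h))" by (simp only: lam_add[symmetric] compose_assoc)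
  also have "... = PA V oL \<Lambda> (- s + h)" by (simp add: compose_assoc[symmetric] PA_compose oV)
  finally have "ap (PA V oL \<Lambda> (- s + h)) (sv V u) = 0" using z[OF h(2)] by simp
  then have "sv V u = 0" by (simp add: lam_sv oV lc_subgroup_mem[OF nsubD(1)[OF V] h(1)] PA_sv)
  then show False using norm_sv[OF oV(3,1), of u] u m_nsub[OF V] by simp
 qed
 moreover have "PA (rc (lc s V) t) oL x oL PA (rc V t) = 0" if x: "x \<in> N" for x t
  by (rule PA_translate[OF _ oV(3,1) compact_lc[OF oV(3)] open_lc[OF oV(1)] z1[OF x]]) (use x NM in blast)
 ultimately show ?thesis using V by blast
qed

lemma H_closed: "closed H"
proof -
 have "open (- H)"
 proof (subst open_subopen, intro ballI)
  fix s assume "s \<in> - H"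
  then obtain V where V: "nsub V" "lc s V \<inter> H = {}" using off_H by blast
  then show "\<exists>T. open T & s \<in> T & T <= - H"
   using open_lc[OF nsubD(2)[OF V(1)], of s] lc_subgroup_self[OF nsubD(1)[OF V(1)], of s] by (intro exI[of _ "lc s V"]) blast
 qed
 then show ?thesis by (simp add: closed_def)
qed

text \<open>For \<open>q\<close> in \<open>L t\<close> and \<open>p\<close> in \<open>g L t\<close>
  the difference \<open>p - q\<close> lies in \<open>g L\<close>, hence off \<open>H\<close>, and
  \<open>off_H\<close> gives vanishing near the pair. Compactness of \<open>g L\<close> provides one
  subgroup for all pairs.\<close>

lemma support_coset:
 assumes L: "additive_subgroup L" "compact L" "open L" and g: "lc g L \<inter> H = {}" and x: "x \<in> N"
 shows "PA (rc (lc g L) t) oL x oL PA (rc L t) = 0"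
proof -
 have xc: "x \<in> \<L>" by (rule Nalg(2)[OF x])
 define good where "good s V \<longleftrightarrow> (s \<in> lc g L --> nsub V & (\<forall>x\<in>N. \<forall>t. PA (rc (lc s V) t) oL x oL PA (rc V t) = 0))" for s V
 have ex: "\<forall>s. \<exists>V. good s V"
 proof
  fix s
  show "\<exists>V. good s V"
  proof (cases "s \<in> lc g L")
   case True
   then have "s \<notin> H" using g by blast
   from off_H[OF this] obtain V where V: "nsub V" "\<forall>x\<in>N. \<forall>t. PA (rc (lc s V) t) oL x oL PA (rc V t) = 0" by (elim exE conjE)
   show ?thesis unfolding good_def by (intro exI[of _ V] impI conjI V)
  qed (simp add: good_def)
 qed
 from choice[OF ex] obtain Vf where "\<forall>s. good s (Vf s)" by (elim exE)
 then have Vf: "!!s. s \<in> lc g L ==> nsub (Vf s)" "!!s x t. s \<in> lc g L ==> x \<in> N ==> PA (rc (lc s (Vf s)) t) oL x oL PA (rc (Vf s) t) = 0"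
  unfolding good_def by simp_all
 have cgL: "compact (lc g L)" by (rule compact_lc[OF L(2)])
 have "\<exists>F. finite F & F <= lc g L & lc g L <= (\<Union>c\<in>F. lc c (Vf c))" by (rule finite_coset_cover[OF cgL Vf(1)])
 then obtain F where F: "finite F" "F <= lc g L" "lc g L <= (\<Union>c\<in>F. lc c (Vf c))" by (elim exE conjE)
 define V where "V = K \<inter> (\<Inter>s\<in>F. Vf s)"
 have V: "nsub V" unfolding V_def by (rule nsub_INT[OF F(1)]) (use F(2) Vf(1) in blast)
 note oV = nsubD(6,2)[OF V]
 note clV = clopen_cosets[OF oV]
 note clD = clopen_cosets[OF L(2,3)]
 have D: "compact (rc (lc g L) t)" "open (rc (lc g L) t)" "compact (rc L t)" "open (rc L t)" using clD by auto
 show ?thesis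
 proof (rule PA_zero_cover[OF D(3,4)])
  fix q assume q: "q \<in> rc L t"
  have xV: "x oL PA (rc V q) \<in> \<L>" by (intro clinear_compose xc PA) (use clV in auto)
  have ex: "\<exists>U. open U & closed U & p \<in> U & PA U oL (x oL PA (rc V q)) = 0" if p: "p \<in> rc (lc g L) t" for p
  proof -
   have "- g + (p - q) = (- g + (p - t)) - (q - t)" by (simp add: grp del: add_uminus_conv_diff)
   then have "p - q \<in> lc g L" using p q subgroupD(4)[OF L(1)] by (simp add: rc_iff lc_iff)
   then obtain c where c: "c \<in> F" "p - q \<in> lc c (Vf c)" using F(3) by blast
   have cL: "c \<in> lc g L" using c(1) F(2) by blast
   note clc = clopen_cosets[OF nsubD(6,2)[OF Vf(1)[OF cL] ]]
   have "V <= Vf c" using c(1) by (auto simp: V_def)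
   then have "PA (rc (Vf c) q) oL PA (rc V q) = (PA (rc V q) :: ('g, 'h) l2 op)" using clV clc by (intro rc_sub(1) rc_mono) auto
   then have "PA (rc (lc c (Vf c)) q) oL (x oL PA (rc V q)) = (PA (rc (lc c (Vf c)) q) oL x oL PA (rc (Vf c) q)) oL PA (rc V q)"
    by (simp only: compose_assoc)
   then have "PA (rc (lc c (Vf c)) q) oL (x oL PA (rc V q)) = 0" by (simp add: Vf(2)[OF cL x] compose_zero_left)
   then show ?thesis using clc c(2) by (intro exI[of _ "rc (lc c (Vf c)) q"]) (simp add: rc_iff)
  qed
  define U where "U p = (SOME U. open U & closed U & p \<in> U & PA U oL (x oL PA (rc V q)) = 0)" for p
  have "PA (rc (lc g L) t) oL (x oL PA (rc V q)) = 0"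
   by (rule PA_zero_cover_left[OF D(1,2) xV, of U]) (unfold U_def, rule someI_ex, rule ex)
  then show "open (rc V q) & closed (rc V q) & q \<in> rc V q & (PA (rc (lc g L) t) oL x) oL PA (rc V q) = 0"
   using clV rc_subgroup_self[OF nsubD(1)[OF V]] by (simp add: compose_assoc)
 qed
qed

end

section \<open>Commutation with the operators that commute with \<open>B\<close> and the
  translations by \<open>H\<close>\<close>

context intermediate
begin

text \<open>Two elements of \<open>H\<close> in the same coset of \<open>K\<close> differ by an
  element of \<open>H \<inter> K\<close>, which is contained in \<open>L\<close>. So
  \<open>h L\<close> is the only coset of \<open>L\<close> inside \<open>h K\<close> that meets
  \<open>H\<close>, and \<open>support_coset\<close> removes the others.\<close>

lemma coset_support:
 assumes L: "additive_subgroup L" "compact L" "open L" "L <= K" "H \<inter> K <= L" and h: "h \<in> H" and b: "b \<in> rc K r" and x: "x \<in> N"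
 shows "PA (rc (lc h K) r) oL x oL PA (rc L b) = PA (rc (lc h L) b) oL x oL PA (rc L b)"
proof -
 note cK = clopen_cosets[OF K_compact K_open] and cL = clopen_cosets[OF L(2,3)]
 define D where "D = rc (lc h K) r \<inter> - rc (lc h L) b"
 have oD: "open D" "compact D" "closed D"
  unfolding D_def using cK cL by (auto intro!: open_Int compact_Int_closed closed_Int open_Compl closed_Compl)
 have sub: "rc (lc h L) b <= rc (lc h K) r"
 proof
  fix y assume "y \<in> rc (lc h L) b"
  then have "- h + (y - b) \<in> K" using L(4) by (auto simp: rc_iff lc_iff)
  moreover have "b - r \<in> K" using b by (simp add: rc_iff)
  ultimately have "(- h + (y - b)) + (b - r) \<in> K" by (rule subgroupD(2)[OF K_sub])
  then show "y \<in> rc (lc h K) r" by (simp add: rc_iff lc_iff grp del: add_uminus_conv_diff)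
 qed
 have xL: "x oL PA (rc L b) \<in> \<L>" by (intro clinear_compose Nalg(2)[OF x] PA) (use cL in auto)
 have z: "PA D oL (x oL PA (rc L b)) = 0"
 proof (rule PA_zero_cover_left[OF oD(2,1) xL])
  fix p assume p: "p \<in> D"
  have "lc (p - b) L \<inter> H = {}"
  proof (rule ccontr)
   assume "lc (p - b) L \<inter> H \<noteq> {}"
   then obtain h' where h': "- (p - b) + h' \<in> L" "h' \<in> H" by (auto simp: lc_iff)
   have "- h + (p - r) \<in> K" "b - r \<in> K" using p b by (auto simp: D_def rc_iff lc_iff)
   then have "(- h + (p - r)) - (b - r) \<in> K" by (rule subgroupD(4)[OF K_sub])
   moreover have "- (p - b) + h' \<in> K" using h'(1) L(4) by blast
   ultimately have "((- h + (p - r)) - (b - r)) + (- (p - b) + h') \<in> K" by (rule subgroupD(2)[OF K_sub])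
   then have "- h + h' \<in> K" by (simp add: grp del: add_uminus_conv_diff)
   moreover have "- h + h' \<in> H" by (rule subgroupD(5)[OF H_sub h h'(2)])
   ultimately have "- h + h' \<in> L" using L(5) by blast
   then have "(- h + h') - (- (p - b) + h') \<in> L" using h'(1) by (rule subgroupD(4)[OF L(1)])
   then have "p \<in> rc (lc h L) b" by (simp add: rc_iff lc_iff grp del: add_uminus_conv_diff)
   then show False using p by (simp add: D_def)
  qed
  then have "PA (rc (lc (p - b) L) b) oL x oL PA (rc L b) = 0" by (rule support_coset[OF L(1-3) _ x])
  then show "open (rc (lc (p - b) L) b) & closed (rc (lc (p - b) L) b) & p \<in> rc (lc (p - b) L) b & PA (rc (lc (p - b) L) b) oL (x oL PA (rc L b)) = 0"
   using cL lc_subgroup_self[OF L(1), of "p - b"] by (simp add: compose_assoc rc_iff)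
 qed
 have "rc (lc h K) r = rc (lc h L) b \<union> D" using sub by (auto simp: D_def)
 then have "PA (rc (lc h K) r) = PA (rc (lc h L) b) + (PA D :: ('g, 'h) l2 op)"
  using PA_Un[of "rc (lc h L) b" D] cL oD by (auto simp: D_def)
 then show ?thesis using z by (simp add: compose_add_left compose_assoc)
qed

text \<open>The corner of \<open>S\<close> from \<open>L b\<close> to \<open>L a\<close> extends to
  an element of \<open>MC\<close>, with which \<open>x\<close> commutes. Its corner from
  \<open>h L b\<close> to \<open>h L a\<close> is the same corner of the conjugate of
  \<open>S\<close> by \<open>\<Lambda> h\<close>, which yields the right side.\<close>

lemma corner_commute:
 assumes L: "additive_subgroup L" "compact L" "open L" and S: "S \<in> \<L>"
  and Spi: "!!b. b \<in> B ==> S oL \<pi> b = \<pi> b oL S" and Sl: "!!l. l \<in> L ==> S oL \<Lambda> l = \<Lambda> l oL S" and x: "x \<in> N"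
 shows "PA (rc (lc h L) a) oL (x oL (PA (rc L a) oL (S oL PA (rc L b)))) =
  PA (rc (lc h L) a) oL ((\<Lambda> h oL (S oL \<Lambda> (- h))) oL (PA (rc (lc h L) b) oL (x oL PA (rc L b))))"
proof -
 note cL = clopen_cosets[OF L(2,3)]
 have opL: "open (rc L s)" "closed (rc L s)" "open (rc (lc h L) s)" "closed (rc (lc h L) s)" for s using cL by auto
 define Y where "Y = PA (rc L a) oL (S oL PA (rc L b))"
 have Yc: "Y \<in> \<L>" unfolding Y_def by (intro clinear_compose PA opL S)
 have idem: "PA (rc L s) oL PA (rc L s) = (PA (rc L s) :: ('g, 'h) l2 op)" for s by (simp add: PA_compose opL)
 have idem': "PA (rc L s) oL (PA (rc L s) oL X) = PA (rc L s) oL (X :: ('g, 'h) l2 op)" for s X by (simp only: compose_assoc[symmetric] idem)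
 have Ypi: "Y oL \<pi> c = \<pi> c oL Y" if c: "c \<in> B" for c
 proof -
  have "Y oL \<pi> c = PA (rc L a) oL ((S oL \<pi> c) oL PA (rc L b))" by (simp only: Y_def compose_assoc pi_PA[OF c opL(1,2)])
  also have "... = (PA (rc L a) oL \<pi> c) oL (S oL PA (rc L b))" by (simp only: Spi[OF c] compose_assoc)
  also have "PA (rc L a) oL \<pi> c = \<pi> c oL PA (rc L a)" by (rule pi_PA[OF c opL(1,2), symmetric])
  finally show ?thesis by (simp only: Y_def compose_assoc)
 qed
 have lP: "\<Lambda> l oL PA (rc L s) = PA (rc L s) oL \<Lambda> l" if l: "l \<in> L" for l s
 proof -
  have "\<Lambda> l oL PA (rc L s) = PA (lc l (rc L s)) oL \<Lambda> l" by (rule lam_PA[OF opL(1,2)])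
  then show ?thesis by (simp only: lc_rc lc_subgroup_mem[OF L(1) l])
 qed
 have Yl: "Y oL \<Lambda> l = \<Lambda> l oL Y" if l: "l \<in> L" for l
 proof -
  have "Y oL \<Lambda> l = PA (rc L a) oL ((S oL \<Lambda> l) oL PA (rc L b))" by (simp only: Y_def compose_assoc lP[OF l])
  also have "... = (PA (rc L a) oL \<Lambda> l) oL (S oL PA (rc L b))" by (simp only: Sl[OF l] compose_assoc)
  finally show ?thesis by (simp only: Y_def compose_assoc lP[OF l, symmetric])
 qed
 have YP: "PA (rc L a) oL Y = Y" "Y oL PA (rc L b) = Y" unfolding Y_def by (simp_all only: compose_assoc idem idem')
 have "\<exists>T\<in>MC. \<forall>g. T oL PA (lc g (rc L b)) = \<Lambda> g oL Y oL \<Lambda> (- g) & PA (lc g (rc L a)) oL T = \<Lambda> g oL Y oL \<Lambda> (- g)"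
  by (rule extend_MC[OF L Yc Ypi Yl YP])
 then obtain T where T: "T \<in> MC" "!!g. T oL PA (lc g (rc L b)) = \<Lambda> g oL Y oL \<Lambda> (- g)" "!!g. PA (lc g (rc L a)) oL T = \<Lambda> g oL Y oL \<Lambda> (- g)"
  by auto
 have xT: "x oL T = T oL x" by (rule commutantD[OF _ T(1)]) (use x NM in blast)
 have T0: "T oL PA (rc L b) = Y" using T(2)[of 0] by (simp add: lc_0 lam_zero compose_id_left compose_id_right)
 have Th: "PA (rc (lc h L) a) oL T = PA (rc (lc h L) a) oL ((\<Lambda> h oL (S oL \<Lambda> (- h))) oL PA (rc (lc h L) b))"
 proof -
  have 1: "\<Lambda> h oL PA (rc L a) = PA (rc (lc h L) a) oL \<Lambda> h" unfolding lc_rc[symmetric] by (rule lam_PA[OF opL(1,2)])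
  have "\<Lambda> (- h) oL PA (lc h (rc L b)) = PA (lc (- h) (lc h (rc L b))) oL \<Lambda> (- h)" by (rule lam_PA) (simp_all only: lc_rc opL)
  then have 2: "PA (rc L b) oL \<Lambda> (- h) = \<Lambda> (- h) oL PA (rc (lc h L) b)" by (simp add: lc_lc lc_0 lc_rc)
  have "PA (rc (lc h L) a) oL T = (\<Lambda> h oL PA (rc L a)) oL (S oL (PA (rc L b) oL \<Lambda> (- h)))"
   using T(3)[of h] by (simp only: lc_rc Y_def compose_assoc)
  then show ?thesis by (simp only: 1 2 compose_assoc)
 qed
 have "PA (rc (lc h L) a) oL (x oL Y) = PA (rc (lc h L) a) oL ((x oL T) oL PA (rc L b))" by (simp only: T0[symmetric] compose_assoc)
 also have "... = (PA (rc (lc h L) a) oL T) oL (x oL PA (rc L b))" by (simp only: xT compose_assoc)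
 finally show ?thesis by (simp only: Th Y_def compose_assoc)
qed

text \<open>The group \<open>L\<close> generated by \<open>V\<close> and \<open>H \<inter> K\<close> is small enough that \<open>hK\<close> meets \<open>H\<close> only in \<open>hL\<close>.\<close>

lemma key_average:
 assumes V: "nsub V" and T: "T \<in> commutant (\<pi> ` B \<union> lambda_op ` H)" and h: "h \<in> H" and x: "x \<in> N"
 shows "PA (rc (lc h K) t) oL (x oL (PA (rc K t) oL (ave V T oL PA (rc K r)))) =
  PA (rc (lc h K) t) oL ((\<Lambda> h oL (ave V T oL \<Lambda> (- h))) oL (PA (rc (lc h K) r) oL (x oL PA (rc K r))))"
proof -
 have Tc: "T \<in> \<L>" by (rule commutant_clinear[OF T])
 have xc: "x \<in> \<L>" by (rule Nalg(2)[OF x])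
 have Vs: "additive_subgroup V" by (rule nsubD(1)[OF V])
 define J where "J = H \<inter> K"
 have Js: "additive_subgroup J" unfolding J_def by (rule subgroup_Int[OF H_sub K_sub])
 \<comment> \<open>The product of \<open>J\<close> and \<open>V\<close> is a group because
   \<open>J\<close> lies in \<open>K\<close>, which normalises \<open>V\<close>. The average over
   \<open>V\<close> commutes with the translations by both factors.\<close>
 define L where "L = (\<Union>j\<in>J. lc j V)"
 have L_iff: "l \<in> L \<longleftrightarrow> (\<exists>j v. j \<in> J & v \<in> V & l = j + v)" for l
  unfolding L_def lc_image by auto
 have L1: "additive_subgroup L"
  unfolding additive_subgroup_def
 proof (intro conjI ballI)
  show "0 \<in> L" unfolding L_iff using subgroupD(1)[OF Js] subgroupD(1)[OF Vs] by (intro exI[of _ 0]) auto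
  fix l l' assume "l \<in> L" "l' \<in> L"
  then obtain j v j' v' where jv: "j \<in> J" "v \<in> V" "l = j + v" "j' \<in> J" "v' \<in> V" "l' = j' + v'" unfolding L_iff by blast
  have "- j' + v + j' \<in> V" using nsub_conj[OF V _ jv(2)] jv(4) by (simp add: J_def)
  then have "(- j' + v + j') + v' \<in> V" using jv(5) by (rule subgroupD(2)[OF Vs])
  moreover have "l + l' = (j + j') + ((- j' + v + j') + v')" unfolding jv by (simp add: grp del: add_uminus_conv_diff)
  ultimately show "l + l' \<in> L" unfolding L_iff using subgroupD(2)[OF Js jv(1,4)] by blast
 next
  fix l assume "l \<in> L"
  then obtain j v where jv: "j \<in> J" "v \<in> V" "l = j + v" unfolding L_iff by blast
  have "j + - v - j \<in> V" using nsubD(4)[OF V _ subgroupD(3)[OF Vs jv(2)]] jv(1) by (simp add: J_def)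
  moreover have "- l = - j + (j + - v - j)" unfolding jv by (simp add: grp del: add_uminus_conv_diff)
  ultimately show "- l \<in> L" unfolding L_iff using subgroupD(3)[OF Js jv(1)] by blast
 qed
 have L3: "open L" unfolding L_def using open_lc[OF nsubD(2)[OF V]] by auto
 have LK: "L <= K"
 proof
  fix l assume "l \<in> L"
  then obtain j v where "j \<in> J" "v \<in> V" "l = j + v" unfolding L_iff by blast
  then show "l \<in> K" using nsubD(3)[OF V] subgroupD(2)[OF K_sub, of j v] by (auto simp: J_def)
 qed
 have L2: "compact L" using compact_Int_closed[OF K_compact closed_open_subgroup[OF L1 L3]] LK by (simp add: Int_absorb1)
 have JL: "H \<inter> K <= L" using subgroupD(1)[OF Vs] by (auto simp: L_iff J_def) (metis add.right_neutral)
 define S where "S = ave V T"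
 have Sc: "S \<in> \<L>" unfolding S_def by (rule ave(1)[OF Tc V])
 have Spi: "S oL \<pi> b = \<pi> b oL S" if "b \<in> B" for b
  unfolding S_def by (rule ave_pi[OF Tc V _ that]) (rule commutantD[OF T], simp)
 have Sl: "S oL \<Lambda> l = \<Lambda> l oL S" if l: "l \<in> L" for l
 proof -
  obtain j v where jv: "j \<in> J" "v \<in> V" "l = j + v" using l unfolding L_iff by blast
  have 1: "S oL \<Lambda> v = \<Lambda> v oL S" unfolding S_def by (rule ave_lam[OF Tc V]) (use jv in simp)
  have 2: "S oL \<Lambda> j = \<Lambda> j oL S" unfolding S_def
   by (rule ave_lam[OF Tc V]) (use jv commutantD[OF T, of "\<Lambda> j"] in \<open>simp add: J_def\<close>)
  have "S oL \<Lambda> l = (S oL \<Lambda> j) oL \<Lambda> v" by (simp only: jv lam_add compose_assoc)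
  also have "... = \<Lambda> j oL (S oL \<Lambda> v)" by (simp only: 2 compose_assoc)
  finally show ?thesis by (simp only: 1 jv lam_add compose_assoc)
 qed
 define S' where "S' = \<Lambda> h oL (S oL \<Lambda> (- h))"
 have S'c: "S' \<in> \<L>" unfolding S'_def by (intro clinear_compose lam Sc)
 note cK = clopen_cosets[OF K_compact K_open] and cL = clopen_cosets[OF L2 L3]
 have oK: "open (rc K s)" "closed (rc K s)" "open (rc (lc h K) s)" "closed (rc (lc h K) s)" for s using cK by auto
 have opL: "open (rc L s)" "closed (rc L s)" "open (rc (lc h L) s)" "closed (rc (lc h L) s)" for s using cL by auto
 note supp = coset_support[OF L1 L2 L3 LK JL h _ x]
 have hsub: "rc (lc h L) a <= rc (lc h K) t" if a: "a \<in> rc K t" for a t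
 proof -
  have "rc L a <= rc K a" by (rule rc_mono[OF LK])
  then have "lc h (rc L a) <= lc h (rc K t)" using rc_subgroup_eq[OF K_sub a] by (intro lc_mono) simp
  then show ?thesis by (simp only: lc_rc)
 qed
 define U where "U = (x oL (PA (rc K t) oL S)) - (S' oL (PA (rc (lc h K) r) oL x))"
 have Uc: "U \<in> \<L>" unfolding U_def by (intro clinear_intros xc PA oK Sc S'c)
 have "(PA (rc (lc h K) t) oL U) oL PA (rc K r) = 0"
 proof (rule PA_zero_cover[where A = "\<lambda>b. rc L b"])
  show "compact (rc K r)" "open (rc K r)" using cK by auto
  fix b assume b: "b \<in> rc K r"
  have Ub: "U oL PA (rc L b) \<in> \<L>" by (intro clinear_compose Uc PA opL)
  have "PA (rc (lc h K) t) oL (U oL PA (rc L b)) = 0"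
  proof (rule PA_zero_cover_left[OF _ _ Ub, where A = "\<lambda>p. rc (lc h L) (- h + p)"])
   show "compact (rc (lc h K) t)" "open (rc (lc h K) t)" using cK by auto
   fix p assume p: "p \<in> rc (lc h K) t"
   define a where "a = - h + p"
   have a: "a \<in> rc K t" using p by (simp add: a_def rc_iff lc_iff grp del: add_uminus_conv_diff)
   have pa: "p \<in> rc (lc h L) a" using subgroupD(1)[OF L1] by (simp add: a_def rc_iff lc_iff grp del: add_uminus_conv_diff)
   define P where "P = (PA (rc (lc h L) a) :: ('g, 'h) l2 op)"
   have PK: "P oL PA (rc (lc h K) t) = P" unfolding P_def by (rule rc_sub(2)[OF hsub[OF a] opL(3,4) oK(3,4)])
   \<comment> \<open>From the part of \<open>K t\<close> outside \<open>L a\<close> the operator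
     \<open>x\<close> reaches \<open>h K t\<close> only in cosets of the form \<open>h L a'\<close>
     disjoint from \<open>h L a\<close>, so \<open>P\<close> cuts it off.\<close>
   have off: "(P oL x) oL PA (rc K t \<inter> - rc L a) = 0"
   proof (rule PA_zero_cover[where A = "\<lambda>b. rc L b"])
    show "compact (rc K t \<inter> - rc L a)" "open (rc K t \<inter> - rc L a)"
     using cK opL[of a] by (auto intro!: compact_Int_closed open_Int)
    fix a' assume a': "a' \<in> rc K t \<inter> - rc L a"
    have "P oL (PA (rc (lc h K) t) oL x oL PA (rc L a')) = P oL (PA (rc (lc h L) a') oL x oL PA (rc L a'))"
     by (subst supp) (use a' in auto)
    then have "(P oL PA (rc (lc h K) t)) oL (x oL PA (rc L a')) = (P oL PA (rc (lc h L) a')) oL (x oL PA (rc L a'))" by (simp only: compose_assoc)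
    moreover have "P oL PA (rc (lc h L) a') = 0" unfolding P_def
    proof (rule PA_disjoint[OF opL(3,4) opL(3,4)])
     have "rc L a \<inter> rc L a' = {}" using rc_subgroup_disjoint[OF L1, of a a'] rc_subgroup_self[OF L1, of a'] a' by auto
     then show "rc (lc h L) a \<inter> rc (lc h L) a' = {}" unfolding lc_rc[symmetric] lc_Int[symmetric] by (simp add: lc_empty)
    qed
    ultimately have "P oL (x oL PA (rc L a')) = 0" by (simp add: PK compose_zero_left)
    then show "open (rc L a') & closed (rc L a') & a' \<in> rc L a' & (P oL x) oL PA (rc L a') = 0"
     using opL rc_subgroup_self[OF L1] by (simp add: compose_assoc)
   qed
   have "rc K t = rc L a \<union> (rc K t \<inter> - rc L a)" using rc_mono[OF LK, of a] rc_subgroup_eq[OF K_sub a] by auto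
   moreover have "(PA (rc L a \<union> (rc K t \<inter> - rc L a)) :: ('g, 'h) l2 op) = PA (rc L a) + PA (rc K t \<inter> - rc L a)"
    by (rule PA_Un) (use opL[of a] oK in \<open>auto intro!: open_Int closed_Int\<close>)
   ultimately have split: "PA (rc K t) = PA (rc L a) + (PA (rc K t \<inter> - rc L a) :: ('g, 'h) l2 op)" by simp
   have e1: "P oL (x oL (PA (rc K t) oL (S oL PA (rc L b)))) = P oL (x oL (PA (rc L a) oL (S oL PA (rc L b))))"
   proof -
    have "P oL (x oL (PA (rc K t) oL (S oL PA (rc L b)))) =
     (P oL (x oL (PA (rc L a) oL (S oL PA (rc L b))))) + (((P oL x) oL PA (rc K t \<inter> - rc L a)) oL (S oL PA (rc L b)))"
     unfolding split by (simp only: compose_add_left compose_add_right compose_assoc)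
    then show ?thesis by (simp add: off compose_zero_left)
   qed
   have e2: "PA (rc (lc h K) r) oL (x oL PA (rc L b)) = PA (rc (lc h L) b) oL (x oL PA (rc L b))"
    using supp[OF b] by (simp only: compose_assoc)
   have "P oL (U oL PA (rc L b)) = (P oL (x oL (PA (rc K t) oL (S oL PA (rc L b))))) - (P oL (S' oL (PA (rc (lc h K) r) oL (x oL PA (rc L b)))))"
    unfolding U_def by (simp only: compose_diff_left compose_diff_right compose_assoc)
   also have "... = 0" unfolding e1 e2 unfolding P_def S'_def using corner_commute[OF L1 L2 L3 Sc Spi Sl x, of h a b] by simp
   finally show "open (rc (lc h L) (- h + p)) & closed (rc (lc h L) (- h + p)) & p \<in> rc (lc h L) (- h + p) & PA (rc (lc h L) (- h + p)) oL (U oL PA (rc L b)) = 0"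
    using opL pa unfolding a_def P_def by blast
  qed
  then show "open (rc L b) & closed (rc L b) & b \<in> rc L b & (PA (rc (lc h K) t) oL U) oL PA (rc L b) = 0"
   using opL rc_subgroup_self[OF L1] by (simp add: compose_assoc)
 qed
 then have "(PA (rc (lc h K) t) oL (x oL (PA (rc K t) oL (S oL PA (rc K r))))) - (PA (rc (lc h K) t) oL (S' oL (PA (rc (lc h K) r) oL (x oL PA (rc K r))))) = 0"
  unfolding U_def by (simp only: compose_diff_left compose_diff_right compose_assoc)
 then show ?thesis unfolding S_def S'_def by simp
qed

text \<open>If \<open>gK\<close> misses \<open>H\<close>, both sides vanish by
  \<open>support_coset\<close>. Otherwise \<open>g\<close> is replaced by some \<open>h\<close> in
  \<open>H\<close> and \<open>V\<close> shrinks in \<open>key_average\<close>; the conjugation by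
  \<open>\<Lambda> h\<close> disappears because \<open>T\<close> commutes with it.\<close>

lemma key:
 assumes T: "T \<in> commutant (\<pi> ` B \<union> lambda_op ` H)" and x: "x \<in> N"
 shows "PA (rc (lc g K) t) oL (x oL (PA (rc K t) oL (T oL PA (rc K r)))) =
  PA (rc (lc g K) t) oL (T oL (PA (rc (lc g K) r) oL (x oL PA (rc K r))))"
proof (cases "lc g K \<inter> H = {}")
 case True
 have z: "PA (rc (lc g K) s) oL x oL PA (rc K s) = 0" for s by (rule support_coset[OF K_sub K_compact K_open True x])
 have "PA (rc (lc g K) t) oL (x oL (PA (rc K t) oL (T oL PA (rc K r)))) = (PA (rc (lc g K) t) oL x oL PA (rc K t)) oL (T oL PA (rc K r))"
  by (simp only: compose_assoc)
 moreover have "PA (rc (lc g K) r) oL (x oL PA (rc K r)) = 0" using z[of r] by (simp only: compose_assoc)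
 ultimately show ?thesis by (simp add: z compose_zero_left compose_zero_right)
next
 case False
 then obtain h where h: "h \<in> lc g K" "h \<in> H" by blast
 have hg: "lc g K = lc h K" using lc_subgroup_eq[OF K_sub h(1)] by simp
 have Tc: "T \<in> \<L>" by (rule commutant_clinear[OF T])
 have xc: "x \<in> \<L>" by (rule Nalg(2)[OF x])
 note cK = clopen_cosets[OF K_compact K_open]
 have oK: "open (rc K s)" "closed (rc K s)" "open (rc (lc h K) s)" "closed (rc (lc h K) s)" for s using cK by auto
 show ?thesis unfolding hg
 proof (rule op_eq_cinnerI)
  fix y v :: "('g, 'h) l2"
  define \<xi>1 where "\<xi>1 = ap (PA (rc K r)) y"
  define \<zeta>2 where "\<zeta>2 = ap (PA (rc (lc h K) t)) v"
  define \<zeta>1 where "\<zeta>1 = ap (PA (rc K t)) (ap (adj x) \<zeta>2)"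
  define \<xi>2 where "\<xi>2 = ap (\<Lambda> (- h)) (ap (PA (rc (lc h K) r)) (ap x \<xi>1))"
  define \<zeta>3 where "\<zeta>3 = ap (\<Lambda> (- h)) \<zeta>2"
  have aP: "fm (PA A) u w = cinner u (ap (PA A) w)" if "open A" "closed A" for A and u w :: "('g, 'h) l2"
   using adj_works(1)[OF PA(1)[OF that], of u w] by (simp add: PA_adj that)
  have lhs: "fm (PA (rc (lc h K) t) oL (x oL (PA (rc K t) oL (S oL PA (rc K r))))) y v = fm S \<xi>1 \<zeta>1" for S
   by (simp add: aP oK \<xi>1_def \<zeta>1_def \<zeta>2_def adj_works(1)[OF xc])
  have rhs: "fm (PA (rc (lc h K) t) oL ((\<Lambda> h oL (S oL \<Lambda> (- h))) oL (PA (rc (lc h K) r) oL (x oL PA (rc K r))))) y v = fm S \<xi>2 \<zeta>3" for S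
   by (simp add: aP oK \<xi>1_def \<zeta>2_def \<xi>2_def \<zeta>3_def adj_works(1)[OF lam(1)] lam_adj)
  have "T oL \<Lambda> (- h) = \<Lambda> (- h) oL T" by (rule commutantD[OF T]) (use subgroupD(3)[OF H_sub h(2)] in simp)
  then have Th: "\<Lambda> h oL (T oL \<Lambda> (- h)) = T"
   by (simp only: compose_assoc[symmetric] lam_add[symmetric]) (simp add: lam_zero compose_id_left)
  have "fm T \<xi>1 \<zeta>1 - fm T \<xi>2 \<zeta>3 = 0"
  proof (rule norm_le_all_eps[of _ 2])
   fix e :: real assume e: "0 < e"
   obtain V1 where V1: "nsub V1" "!!V. nsub V ==> V <= V1 ==> norm (fm (ave V T) \<xi>1 \<zeta>1 - fm T \<xi>1 \<zeta>1) \<le> e" using ave_approx[OF Tc e] by blast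
   obtain V2 where V2: "nsub V2" "!!V. nsub V ==> V <= V2 ==> norm (fm (ave V T) \<xi>2 \<zeta>3 - fm T \<xi>2 \<zeta>3) \<le> e" using ave_approx[OF Tc e] by blast
   define V where "V = V1 \<inter> V2"
   have V: "nsub V" unfolding V_def by (rule nsub_Int[OF V1(1) V2(1)])
   have eq: "fm (ave V T) \<xi>1 \<zeta>1 = fm (ave V T) \<xi>2 \<zeta>3"
    unfolding lhs[symmetric] rhs[symmetric] key_average[OF V T h(2) x] ..
   have a1: "norm (fm (ave V T) \<xi>1 \<zeta>1 - fm T \<xi>1 \<zeta>1) \<le> e" by (rule V1(2)[OF V]) (simp add: V_def)
   have a2: "norm (fm (ave V T) \<xi>2 \<zeta>3 - fm T \<xi>2 \<zeta>3) \<le> e" by (rule V2(2)[OF V]) (simp add: V_def)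
   have "norm (p - q) \<le> 2 * e" if "norm (s - p) \<le> e" "norm (s - q) \<le> e" for s p q :: complex
    using norm_triangle_ineq4[of "s - q" "s - p"] that by simp
   from this[OF a1[unfolded eq] a2] show "norm (fm T \<xi>1 \<zeta>1 - fm T \<xi>2 \<zeta>3) \<le> 2 * e" .
  qed
  then have "fm T \<xi>1 \<zeta>1 = fm T \<xi>2 \<zeta>3" by simp
  then show "fm (PA (rc (lc h K) t) oL (x oL (PA (rc K t) oL (T oL PA (rc K r))))) y v =
   fm (PA (rc (lc h K) t) oL (T oL (PA (rc (lc h K) r) oL (x oL PA (rc K r))))) y v"
   unfolding lhs rhs[symmetric] Th .
 qed
qed

text \<open>The sum of \<open>key\<close> over the right cosets \<open>K t\<close> that fill the set
  of \<open>e\<close> with \<open>q - e\<close> in \<open>W\<close>. At a row point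
  \<open>q'\<close> take \<open>g = q' - t\<close>: then \<open>q'\<close> lies in
  \<open>g K t\<close>, and the sets \<open>g K r\<close> fill \<open>W r\<close>. Stability of
  \<open>W\<close> under \<open>K\<close> makes this the same for all \<open>q'\<close> in
  \<open>K q\<close>.\<close>

lemma block_commute:
 assumes T: "T \<in> commutant (\<pi> ` B \<union> lambda_op ` H)" and x: "x \<in> N"
  and W: "compact W" "open W" "!!w k. w \<in> W ==> k \<in> K ==> w + k \<in> W" "!!w k. w \<in> W ==> k \<in> K ==> k + w \<in> W"
 shows "ap (PA (rc K q)) (ap x (ap (PA {e. q - e \<in> W}) (ap T (ap (PA (rc K r)) u)))) =
  ap (PA (rc K q)) (ap T (ap (PA (rc W r)) (ap x (ap (PA (rc K r)) u))))"
proof -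
 define E where "E = {e. q - e \<in> W}"
 define p where "p = ap (PA (rc K r)) u"
 note cK = clopen_cosets[OF K_compact K_open]
 have oK: "open (rc K s)" "closed (rc K s)" "open (rc (lc g K) s)" "closed (rc (lc g K) s)" for g s using cK by auto
 have Eimg: "E = rc (uminus ` W) q"
 proof -
  have "e \<in> E \<longleftrightarrow> e \<in> rc (uminus ` W) q" for e
  proof -
   have "x \<in> uminus ` W \<longleftrightarrow> - x \<in> W" for x by force
   from this[of "e - q"] show ?thesis by (simp add: E_def rc_iff)
  qed
  then show ?thesis by blast
 qed
 have E: "compact E" "open E" unfolding Eimg by (intro compact_rc open_rc uminus_compact uminus_open W)+
 have EK: "k + e \<in> E" if "e \<in> E" "k \<in> K" for e k
 proof -
  have "(q - e) + - k \<in> W" by (rule W(3)) (use that subgroupD(3)[OF K_sub] in \<open>simp_all add: E_def\<close>)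
  then show ?thesis by (simp add: E_def grp del: add_uminus_conv_diff)
 qed
 have "\<exists>F. finite F & F <= E & E = (\<Union>t\<in>F. rc K t) & (\<forall>s\<in>F. \<forall>t\<in>F. s \<noteq> t --> rc K s \<inter> rc K t = {})"
  by (rule rcoset_partition[OF E(1) nsub_K EK])
 then obtain F where F: "finite F" "F <= E" "E = (\<Union>t\<in>F. rc K t)" "\<forall>s\<in>F. \<forall>t\<in>F. s \<noteq> t --> rc K s \<inter> rc K t = {}" by (elim exE conjE)
 \<comment> \<open>Small enough that a piece of the row of size \<open>V\<close> around
   \<open>q'\<close> stays inside \<open>(q' - t) K t\<close> for every \<open>t\<close>
   involved.\<close>
 obtain V where V: "nsub V" "!!e v. e \<in> E ==> v \<in> V ==> e + v - e \<in> K"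
  using nsub_conj_compact[OF E(1) K_open subgroupD(1)[OF K_sub]] by blast
 have decomp: "(PA (rc W r) :: ('g, 'h) l2 op) = (\<Sum>t\<in>F. PA (rc (lc (q' - t) K) r))" if q': "q' \<in> rc K q" for q'
 proof -
  have mem: "y \<in> rc (lc (q' - t) K) r \<longleftrightarrow> - (y - r) + q' \<in> rc K t" for y t
  proof -
   have "- (q' - t) + (y - r) = - (- (y - r) + q' - t)" by (simp add: grp del: add_uminus_conv_diff)
   then show ?thesis using subgroupD(8)[OF K_sub] by (simp only: rc_iff lc_iff)
  qed
  have memW: "y \<in> rc W r \<longleftrightarrow> - (y - r) + q' \<in> E" for y
  proof -
   have k: "q - q' \<in> K" "q' - q \<in> K" using q' subgroupD(8)[OF K_sub, of "q' - q"] by (auto simp: rc_iff)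
   have e: "q - (- (y - r) + q') = (q - q') + (y - r)" by (simp add: grp del: add_uminus_conv_diff)
   have "(q' - q) + ((q - q') + (y - r)) = y - r" by (simp add: grp del: add_uminus_conv_diff)
   then have "y - r \<in> W \<longleftrightarrow> (q - q') + (y - r) \<in> W" using W(4)[OF _ k(1), of "y - r"] W(4)[OF _ k(2), of "(q - q') + (y - r)"] by auto
   then show ?thesis by (simp only: E_def rc_iff mem_Collect_eq e)
  qed
  have "rc W r = (\<Union>t\<in>F. rc (lc (q' - t) K) r)"
   by (rule set_eqI) (simp add: memW mem F(3) del: rc_iff)
  moreover have "\<forall>s\<in>F. \<forall>t\<in>F. s \<noteq> t --> rc (lc (q' - s) K) r \<inter> rc (lc (q' - t) K) r = {}"
  proof (intro ballI impI)
   fix s t assume st: "s \<in> F" "t \<in> F" "s \<noteq> t"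
   then have d: "rc K s \<inter> rc K t = {}" using F(4) by blast
   show "rc (lc (q' - s) K) r \<inter> rc (lc (q' - t) K) r = {}"
   proof (rule ccontr)
    assume "rc (lc (q' - s) K) r \<inter> rc (lc (q' - t) K) r \<noteq> {}"
    then obtain y where "y \<in> rc (lc (q' - s) K) r" "y \<in> rc (lc (q' - t) K) r" by blast
    then show False using d unfolding mem by blast
   qed
  qed
  ultimately show ?thesis using PA_UN[OF F(1) oK(3,4)] by simp
 qed
 have PE: "(PA E :: ('g, 'h) l2 op) = (\<Sum>t\<in>F. PA (rc K t))" unfolding F(3) by (rule PA_UN[OF F(1) oK(1,2) F(4)])
 define D where "D = ap x (ap (PA E) (ap T p)) - ap T (ap (PA (rc W r)) (ap x p))"
 have aP: "fm (PA A) u w = cinner u (ap (PA A) w)" if "open A" "closed A" for A and u w :: "('g, 'h) l2"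
  using adj_works(1)[OF PA(1)[OF that], of u w] by (simp add: PA_adj that)
 have PP: "ap (PA (rc K r)) p = p"
  unfolding p_def by (simp add: PA_compose oK flip: blinfun_apply_blinfun_compose)
 have "ap (PA (rc K q)) D = 0"
 proof (rule step_total)
  fix g
  have "fm (PA (rc K q)) D (sv (lc (g + k) V') z) = 0" if V': "nsub V'" "V' <= V" for k V' z
  proof -
   have oV': "compact (lc (g + k) V')" "open (lc (g + k) V')" by (intro compact_lc open_lc nsubD[OF V'(1)])+
   define A where "A = rc K q \<inter> lc (g + k) V'"
   have oA: "compact A" "open A" unfolding A_def using oK[of q] oV' by (auto intro: closed_Int_compact)
   have 1: "fm (PA (rc K q)) D (sv (lc (g + k) V') z) = cinner D (sv A z)"
    by (simp add: aP oK PA_sv oV' A_def)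
   show ?thesis
   proof (cases "A = {}")
    case True
    then show ?thesis unfolding 1 by (simp add: sv_def vec_zero cinner_zero_right)
   next
    case False
    then obtain q' where q': "q' \<in> rc K q" "q' \<in> lc (g + k) V'" unfolding A_def by blast
    have Aq: "- q' + y \<in> V'" if "y \<in> A" for y
    proof -
     have "y \<in> lc (g + k) V'" using that by (simp add: A_def)
     then have "y \<in> lc q' V'" using lc_subgroup_eq[OF nsubD(1)[OF V'(1)] q'(2)] by simp
     then show ?thesis by (simp add: lc_iff)
    qed
    have PAA: "ap (PA (rc (lc (q' - t) K) t)) (sv A z) = sv A z" if t: "t \<in> F" for t
    proof -
     have "A <= rc (lc (q' - t) K) t"
     proof
      fix y assume "y \<in> A"
      then have "- q' + y \<in> V" using Aq V'(2) by blast
      then have "t + (- q' + y) - t \<in> K" using V(2) t F(2) by blast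
      then show "y \<in> rc (lc (q' - t) K) t" by (simp add: rc_iff lc_iff grp del: add_uminus_conv_diff)
     qed
     then have "rc (lc (q' - t) K) t \<inter> A = A" by blast
     then show ?thesis by (simp add: PA_sv oK oA)
    qed
    have each: "fm x (ap (PA (rc K t)) (ap T p)) (sv A z) =
     fm T (ap (PA (rc (lc (q' - t) K) r)) (ap x p)) (sv A z)" if t: "t \<in> F" for t
    proof -
     have "ap (PA (rc (lc (q' - t) K) t)) (ap x (ap (PA (rc K t)) (ap T (ap (PA (rc K r)) p)))) =
      ap (PA (rc (lc (q' - t) K) t)) (ap T (ap (PA (rc (lc (q' - t) K) r)) (ap x (ap (PA (rc K r)) p))))"
      using arg_cong[OF key[OF T x, of "q' - t" t r], of "\<lambda>S. ap S p"] by simp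
     then have "fm (PA (rc (lc (q' - t) K) t)) (ap x (ap (PA (rc K t)) (ap T p))) (sv A z) =
      fm (PA (rc (lc (q' - t) K) t)) (ap T (ap (PA (rc (lc (q' - t) K) r)) (ap x p))) (sv A z)"
      by (simp add: PP)
     then show ?thesis by (simp add: aP oK PAA[OF t])
    qed
    have "fm x (ap (PA E) (ap T p)) (sv A z) = (\<Sum>t\<in>F. fm x (ap (PA (rc K t)) (ap T p)) (sv A z))"
     unfolding PE by (simp add: blinfun.sum_left blinfun.sum_right cinner_sum_left)
    also have "... = (\<Sum>t\<in>F. fm T (ap (PA (rc (lc (q' - t) K) r)) (ap x p)) (sv A z))"
     by (rule sum.cong[OF refl each])
    also have "... = fm T (ap (PA (rc W r)) (ap x p)) (sv A z)"
     unfolding decomp[OF q'(1)] by (simp add: blinfun.sum_left blinfun.sum_right cinner_sum_left)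
    finally show ?thesis unfolding 1 unfolding D_def by (simp add: cinner_diff_left)
   qed
  qed
  then show "\<exists>V0. nsub V0 & (\<forall>k\<in>K. \<forall>V'. nsub V' --> V' <= V0 --> (\<forall>z. fm (PA (rc K q)) D (sv (lc (g + k) V') z) = 0))"
   using V(1) by blast
 qed
 then show ?thesis unfolding D_def E_def p_def by (simp add: blinfun.diff_right)
qed

text \<open>\<open>block_commute\<close> is the commutation relation with two compact cut-offs
  inserted. On fixed vectors these change little once \<open>W\<close> is large.\<close>

lemma commutes:
 assumes T: "T \<in> commutant (\<pi> ` B \<union> lambda_op ` H)" and x: "x \<in> N"
 shows "x oL T = T oL x"
proof -
 have Tc: "T \<in> \<L>" by (rule commutant_clinear[OF T])
 have xc: "x \<in> \<L>" by (rule Nalg(2)[OF x])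
 note cK = clopen_cosets[OF K_compact K_open]
 have oK: "open (rc K s)" "closed (rc K s)" for s using cK by auto
 have "(x oL T) - (T oL x) = 0"
 proof (rule zero_by_cosets)
  show "(x oL T) - (T oL x) \<in> \<L>" by (intro clinear_intros Tc xc)
  fix q r
  show "PA (rc K q) oL ((x oL T) - (T oL x)) oL PA (rc K r) = 0"
  proof (rule blinfun_eqI)
   fix u :: "('g, 'h) l2"
   define v where "v = ap (PA (rc K r)) u"
   let ?D = "ap (PA (rc K q)) (ap x (ap T v) - ap T (ap x v))"
   have "?D = 0"
   proof (rule norm_le_all_eps[of _ "norm x + norm T"])
    fix e :: real assume e: "0 < e"
    from PA_tail[OF e, of "ap T v"] obtain C1 where "compact C1 & (\<forall>E. open E --> closed E --> C1 <= E --> norm (ap (PA E) (ap T v) - ap T v) \<le> e)"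
     by (elim exE)
    then have C1: "compact C1" "!!E. open E ==> closed E ==> C1 <= E ==> norm (ap (PA E) (ap T v) - ap T v) \<le> e" by simp_all
    from PA_tail[OF e, of "ap x v"] obtain C2 where "compact C2 & (\<forall>E. open E --> closed E --> C2 <= E --> norm (ap (PA E) (ap x v) - ap x v) \<le> e)"
     by (elim exE)
    then have C2: "compact C2" "!!E. open E ==> closed E ==> C2 <= E ==> norm (ap (PA E) (ap x v) - ap x v) \<le> e" by simp_all
    have c: "compact ((\<lambda>c. q - c) ` C1)" by (rule compact_continuous_image[OF _ C1(1)]) (intro cont_grp)
    \<comment> \<open>\<open>W\<close> has to contain all \<open>q - c\<close> with \<open>c\<close>
      in \<open>C1\<close> and all \<open>c - r\<close> with \<open>c\<close> in \<open>C2\<close>;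
      then \<open>C1\<close> and \<open>C2\<close> lie inside the two cut-offs.\<close>
    have cc: "compact ((\<lambda>c. q - c) ` C1 \<union> rc C2 (- r))" using c compact_rc[OF C2(1)] by (rule compact_Un)
    from ex_biinvariant[OF cc] obtain W where W: "compact W" "open W" "(\<lambda>c. q - c) ` C1 \<union> rc C2 (- r) <= W" and W4: "\<forall>w\<in>W. \<forall>k\<in>K. w + k \<in> W & k + w \<in> W"
     by (elim exE conjE)
    let ?E = "{e. q - e \<in> W}"
    have oE: "open ?E" "closed ?E"
     using open_vimage[OF W(2), of "\<lambda>e. q - e"] closed_vimage[OF compact_imp_closed[OF W(1)], of "\<lambda>e. q - e"] by (auto simp: vimage_def cont_grp)
    have oW: "open (rc W r)" "closed (rc W r)" by (intro open_rc compact_imp_closed compact_rc W)+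
    have s1: "C1 <= ?E" using W(3) by auto
    have s2: "C2 <= rc W r"
    proof
     fix c assume "c \<in> C2"
     then have "c - r \<in> rc C2 (- r)" by (simp add: rc_iff)
     then show "c \<in> rc W r" using W(3) by (auto simp: rc_iff)
    qed
    have eq: "ap (PA (rc K q)) (ap x (ap (PA ?E) (ap T v))) = ap (PA (rc K q)) (ap T (ap (PA (rc W r)) (ap x v)))"
     unfolding v_def by (rule block_commute[OF T x W(1,2)]) (use W4 in auto)
    let ?a = "ap (PA ?E) (ap T v) - ap T v" and ?b = "ap (PA (rc W r)) (ap x v) - ap x v"
    have "?D = ap (PA (rc K q)) (ap T ?b - ap x ?a)" using eq by (simp add: blinfun.diff_right)
    also have "norm ... \<le> 1 * norm (ap T ?b - ap x ?a)" by (rule norm_blinfun_apply_le[OF PA(2)[OF oK]])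
    also have "... \<le> norm (ap T ?b) + norm (ap x ?a)" using norm_triangle_ineq4 by simp
    also have "... \<le> norm T * e + norm x * e"
     by (intro add_mono order_trans[OF norm_blinfun] mult_left_mono C1(2)[OF oE s1] C2(2)[OF oW s2] norm_ge_zero)
    finally show "norm ?D \<le> (norm x + norm T) * e" by (simp add: algebra_simps)
   qed
   then show "ap (PA (rc K q) oL ((x oL T) - (T oL x)) oL PA (rc K r)) u = ap 0 u"
    by (simp add: v_def blinfun.diff_left)
  qed
 qed
 then show ?thesis by simp
qed

lemma eq_crossed_product: "N = commutant (commutant (\<pi> ` B \<union> lambda_op ` H))"
proof
 show "N <= commutant (commutant (\<pi> ` B \<union> lambda_op ` H))"
  by (intro subsetI commutantI) (auto intro: Nalg(2) commutes)
 have "\<pi> ` B \<union> lambda_op ` H <= N" using piN by (auto simp: H_def)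
 then have "commutant (commutant (\<pi> ` B \<union> lambda_op ` H)) <= commutant (commutant N)" by (intro commutant_antimono)
 then show "commutant (commutant (\<pi> ` B \<union> lambda_op ` H)) <= N" by (simp only: vn_double[OF N])
qed

end

section \<open>Existence of the Haar measure and conclusion\<close>

lemma (in crossed) crossed_product_eq:
 assumes H: "additive_subgroup H"
 shows "crossed_product \<alpha> B H = commutant (commutant (\<pi> ` B \<union> lambda_op ` H))"
proof -
 have "adj ` (\<pi> ` B \<union> lambda_op ` H) <= \<pi> ` B \<union> lambda_op ` H"
  using vn_adj[OF vB] subgroupD(3)[OF H] by (auto simp: pi_adj lam_adj)
 then show ?thesis unfolding crossed_product_def vn_generated_def by (simp add: Un_absorb2)
qed

text \<open>Without a Haar measure \<open>haar\<close> would be the null measure and the space of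
  square-integrable functions would be zero, which leaves no room for a nonzero operator.\<close>

lemma left_haar_measure_haar:
 fixes T :: "('g::{topological_group_add,t2_space}, 'h::complex_hilbert_space) l2 op"
 assumes "T \<noteq> 0" shows "left_haar_measure (haar :: 'g measure)"
proof (cases "\<exists>\<mu>::'g measure. left_haar_measure \<mu>")
 case True
 then show ?thesis unfolding haar_def by (simp add: someI_ex)
next
 case False
 then have h: "haar = (null_measure borel :: 'g measure)" unfolding haar_def by (rule if_not_P)
 have v: "v = 0" for v :: "('g, 'h) l2"
 proof (rule vec_orth)
  fix F :: "'g => 'h" assume F: "ccf F"
  have "cinner (vec F) (vec F) = 0" unfolding cinner_vec[OF F F] h by simp
  then have "vec F = 0" by (simp add: cinner_self)
  then show "cinner v (vec F) = 0" by (simp add: cinner_zero_right)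
 qed
 have "T = 0" by (rule blinfun_eqI) (metis v)
 then show ?thesis using assms by simp
qed

theorem theoremF:
  fixes \<alpha> :: "'g::{topological_group_add,t2_space}
      \<Rightarrow> ('h::complex_hilbert_space \<Rightarrow>\<^sub>L 'h) \<Rightarrow> ('h \<Rightarrow>\<^sub>L 'h)"
    and B :: "('h \<Rightarrow>\<^sub>L 'h) set"
    and K\<^sub>0 :: "'g set"
    and N :: "(('g, 'h) l2 \<Rightarrow>\<^sub>L ('g, 'h) l2) set"
  assumes "locally compact (UNIV :: 'g set)"
    and "totally_disconnected (UNIV :: 'g set)"
    and "vn_factor B" and "vn_sigma_finite B" and "vn_diffuse B"
    and "continuous_action \<alpha> B"
    and "additive_subgroup K\<^sub>0" and "compact K\<^sub>0" and "open K\<^sub>0"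
    and "properly_outer_relative \<alpha> B K\<^sub>0"
    and "minimal_action \<alpha> B K\<^sub>0"
    and "vn_factor N" and "pi_op \<alpha> ` B \<subseteq> N" and "N \<subseteq> crossed_product \<alpha> B UNIV"
  shows "\<exists>H. additive_subgroup H \<and> closed H \<and> N = crossed_product \<alpha> B H"
proof -
 have vN: "von_neumann_algebra N" "N \<noteq> {0}" using assms(12) by (auto simp: vn_factor_def)
 have "0 \<in> N" by (rule op_algebraD(8)[OF vn_op_algebra[OF vN(1)]])
 then obtain T where "T \<in> N" "T \<noteq> 0" using vN(2) by blast
 then have haar: "left_haar_measure (haar :: 'g measure)" by (intro left_haar_measure_haar)
 interpret crossed_min K\<^sub>0 \<alpha> B by unfold_locales (use assms haar in auto)
 have "additive_subgroup (UNIV :: 'g set)" by (simp add: additive_subgroup_def)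
 then have "N <= commutant MC" using assms(14) crossed_product_eq by (simp add: MC_def)
 then interpret intermediate K\<^sub>0 \<alpha> B N by unfold_locales (use assms vN in auto)
 show ?thesis using H_sub H_closed eq_crossed_product crossed_product_eq[OF H_sub] by (intro exI[of _ H]) simp
qed

end
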